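(* Let $\varepsilon>0$, $\alpha_0>0$, $\alpha_1>0$. Assume that for $u=P,N$: $m_u^0,k_u^0,m_u^1,k_u^1>0$; $a_u^0,b_u^0,a_u^1,b_u^1\in[0,1]$ (with $a_P^0,a_N^0,b_P^1,b_N^1>0$); $0\le u^0\le u^{max}$ a.e. on $(0,1)$. Assume that the constant $\rho_{hl}$ satisfies $3P^{max}-N^{max}+\rho_{hl}=0$, and that $$-\frac{1}{3a_P^0}\bigl(1+\log(\alpha_0a_P^0k_P^0)\bigr)\le\Delta\Psi_0^{pzc}\le\frac{1}{a_N^0}\bigl(1+\log(\alpha_0a_N^0k_N^0)\bigr),$$ $$-\frac{1}{b_N^1}\bigl(1+\log(\alpha_1b_N^1m_N^1)\bigr)\le\Delta\Psi_1^{pzc}\le\frac{1}{3b_P^1}\bigl(1+\log(\alpha_1b_P^1m_P^1)\bigr).$$ Let $(\mathcal T_m,\Delta t_m)_m$ be a sequence of meshes of $[0,1]$ and time steps ($T/\Delta t_m\in\mathbb N$) with mesh sizes $h_m\to0$ and $\Delta t_m\to0$ as $m\to+\infty$, and let $(P_m,N_m,\Psi_m)_m$ be the corresponding sequence of approximate solutions given by the scheme $(\mathcal S)$. Then there exist $P,N,\Psi\in L^2(0,T;H^1(0,1))$ such that, up to a subsequence, as $m\to+\infty$, $$P_m\to P,\qquad N_m\to N,\qquad \Psi_m\to\Psi\qquad\text{strongly in }L^2(0,T;L^2(0,1)),$$ and $(P,N,\Psi)$ is a weak solution of the corrosion model $(\mathcal P)$.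
   Context: **Data.** $T>0$, $\lambda>0$, $V,\rho_{hl},\Delta\Psi_0^{pzc},\Delta\Psi_1^{pzc}\in\mathbb R$, $P^{max},N^{max}>0$; constants $\alpha_0,\alpha_1,\varepsilon$ and $m_u^i,k_u^i,a_u^i,b_u^i$ ($u=P,N$, $i=0,1$); initial data $P^0,N^0\in L^\infty(0,1)$ (the generic notation is $u^0$, $u^{max}$ for $u=P,N$). Set $z_P=3$, $z_N=-1$, $\varepsilon_P=1$, $\varepsilon_N=\varepsilon$ and, for $u=P,N$, $$\beta_u^i(x)=m_u^ie^{-z_ub_u^ix}+k_u^ie^{z_ua_u^ix}\ (i=0,1),\quad \gamma_u^0(x)=m_u^0u^{max}e^{-z_ub_u^0x},\quad \gamma_u^1(x)=k_u^1u^{max}e^{z_ua_u^1x}.$$ **Corrosion model $(\mathcal P)$.** On $(0,1)\times(0,T)$: $\varepsilon_u\partial_tu+\partial_xJ_u=0$, $J_u=-\partial_xu-z_uu\,\partial_x\Psi$ for $u=P,N$, and $-\lambda^2\partial_{xx}^2\Psi=3P-N+\rho_{hl}$; with boundary conditions $-J_u=\beta_u^0(\Psi)u-\gamma_u^0(\Psi)$ at $x=0$, $J_u=\beta_u^1(V-\Psi)u-\gamma_u^1(V-\Psi)$ at $x=1$, $\Psi-\alpha_0\partial_x\Psi=\Delta\Psi_0^{pzc}$ at $x=0$, $\Psi+\alpha_1\partial_x\Psi=V-\Delta\Psi_1^{pzc}$ at $x=1$; and initial conditions $u(x,0)=u^0(x)$. **Weak solution.** $(P,N,\Psi)$, each component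 in $L^2(0,T;H^1(0,1))\cap L^\infty((0,1)\times(0,T))$, is a weak solution of $(\mathcal P)$ if (functions written as functions of $(x,t)$, values at $x=0,1$ being traces), for $u=P,N$ and all smooth $\varphi$ with compact support in $[0,1]\times[0,T)$, $$-\varepsilon_u\int_0^T\!\!\int_0^1u\,\partial_t\varphi\,dx\,dt-\varepsilon_u\int_0^1u^0(x)\varphi(x,0)\,dx-\int_0^T\!\!\int_0^1(-\partial_xu-z_uu\,\partial_x\Psi)\,\partial_x\varphi\,dx\,dt$$ $$+\int_0^T\Bigl[\bigl(\beta_u^1(V-\Psi(1,t))u(1,t)-\gamma_u^1(V-\Psi(1,t))\bigr)\varphi(1,t)+\bigl(\beta_u^0(\Psi(0,t))u(0,t)-\gamma_u^0(\Psi(0,t))\bigr)\varphi(0,t)\Bigr]dt=0,$$ and, for all $\varphi\in L^2(0,T;H^1(0,1))$, $$\lambda^2\int_0^T\!\!\int_0^1\partial_x\Psi\,\partial_x\varphi\,dx\,dt-\int_0^T\frac{\lambda^2}{\alpha_1}(V-\Psi(1,t)-\Delta\Psi_1^{pzc})\varphi(1,t)\,dt+\int_0^T\frac{\lambda^2}{\alpha_0}(\Psi(0,t)-\Delta\Psi_0^{pzc})\varphi(0,t)\,dt=\int_0^T\!\!\int_0^1(3P-N+\rho_{hl})\varphi\,dx\,dt.$$ **Mesh.** A mesh $\mathcal T$ of $[0,1]$ is given by $0=x_{1/2}<x_{3/2}<\dots<x_{I+1/2}=1$; $x_i=(x_{i-1/2}+x_{i+1/2})/2$ for $1\le i\le I$,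 $x_0=0$, $x_{I+1}=1$; $h_i=x_{i+1/2}-x_{i-1/2}$ ($1\le i\le I$), $h_{i+1/2}=x_{i+1}-x_i$ ($0\le i\le I$); size $h=\max_ih_i$. Time step $\Delta t=T/K$, $K\in\mathbb N$, $K\ge1$, $t^k=k\Delta t$. **Scheme $(\mathcal S)$.** Initial values $u_i^0=\frac1{h_i}\int_{x_{i-1/2}}^{x_{i+1/2}}u^0(x)\,dx$ ($1\le i\le I$, $u=P,N$). For $0\le k\le K-1$ the unknowns $(P_i^{k+1},N_i^{k+1},\Psi_i^{k+1})_{0\le i\le I+1}$ satisfy, for $1\le i\le I$, $$-\lambda^2(d\Psi_{i+1/2}^{k+1}-d\Psi_{i-1/2}^{k+1})=h_i(3P_i^{k+1}-N_i^{k+1}+\rho_{hl}),\qquad \varepsilon_uh_i\frac{u_i^{k+1}-u_i^k}{\Delta t}+\mathcal F_{u,i+1/2}^{k+1}-\mathcal F_{u,i-1/2}^{k+1}=0\ (u=P,N),$$ where for $0\le i\le I$, $d\Psi_{i+1/2}^{k+1}=(\Psi_{i+1}^{k+1}-\Psi_i^{k+1})/h_{i+1/2}$ and $$\mathcal F_{u,i+1/2}^{k+1}=\frac{B(z_uh_{i+1/2}d\Psi_{i+1/2}^{k+1})u_i^{k+1}-B(-z_uh_{i+1/2}d\Psi_{i+1/2}^{k+1})u_{i+1}^{k+1}}{h_{i+1/2}},\quad B(x)=\frac{x}{e^x-1}\ (x\ne0),\ B(0)=1,$$ together with $\Psi_0^{k+1}-\alpha_0d\Psi_{1/2}^{k+1}=\Delta\Psi_0^{pzc}$,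 $\Psi_{I+1}^{k+1}+\alpha_1d\Psi_{I+1/2}^{k+1}=V-\Delta\Psi_1^{pzc}$, $-\mathcal F_{u,1/2}^{k+1}=\beta_u^0(\Psi_0^{k+1})u_0^{k+1}-\gamma_u^0(\Psi_0^{k+1})$, $\mathcal F_{u,I+1/2}^{k+1}=\beta_u^1(V-\Psi_{I+1}^{k+1})u_{I+1}^{k+1}-\gamma_u^1(V-\Psi_{I+1}^{k+1})$ ($u=P,N$). **Approximate solutions.** Given a solution of $(\mathcal S)$ satisfying $0\le P_i^k\le P^{max}$ and $0\le N_i^k\le N^{max}$ for all $0\le i\le I+1$, $1\le k\le K$ (such solutions exist under the stated hypotheses), define for $w=P,N,\Psi$ the function $w_{h,\Delta t}$ on $[0,1]\times[0,T)$ by $w_{h,\Delta t}(x,t)=w_i^{k+1}$ for $x\in(x_{i-1/2},x_{i+1/2})$, $1\le i\le I$, $t\in[t^k,t^{k+1})$, and $w_{h,\Delta t}(0,t)=w_0^{k+1}$, $w_{h,\Delta t}(1,t)=w_{I+1}^{k+1}$. For the mesh $\mathcal T_m$ and time step $\Delta t_m$, put $w_m=w_{h_m,\Delta t_m}$. *)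

theory Defs
  imports "HOL-Analysis.Analysis"
begin

datatype species = SpP | SpN

text \<open>In the fields \<open>m_c\<close>, \<open>k_c\<close>, \<open>a_c\<close>, \<open>b_c\<close> the second argument is the
  boundary index \<open>i\<close>; only the values at \<open>i = 0\<close> and \<open>i = 1\<close> are used.\<close>

record corrosion_data =
  t_end :: real
  lam :: real
  V_pot :: real
  rho_hl :: real
  dPsi_pzc0 :: real
  dPsi_pzc1 :: real
  alpha0 :: real
  alpha1 :: real
  eps :: real
  u_max :: "species \<Rightarrow> real"
  m_c :: "species \<Rightarrow> nat \<Rightarrow> real"
  k_c :: "species \<Rightarrow> nat \<Rightarrow> real"
  a_c :: "species \<Rightarrow> nat \<Rightarrow> real"
  b_c :: "species \<Rightarrow> nat \<Rightarrow> real"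
  u_init :: "species \<Rightarrow> real \<Rightarrow> real"

primrec z_of :: "species \<Rightarrow> real" where
  "z_of SpP = 3"
| "z_of SpN = -1"

primrec eps_of :: "corrosion_data \<Rightarrow> species \<Rightarrow> real" where
  "eps_of d SpP = 1"
| "eps_of d SpN = eps d"

definition beta :: "corrosion_data \<Rightarrow> species \<Rightarrow> nat \<Rightarrow> real \<Rightarrow> real" where
  "beta d s i x = m_c d s i * exp (- z_of s * b_c d s i * x) + k_c d s i * exp (z_of s * a_c d s i * x)"

definition gamma0 :: "corrosion_data \<Rightarrow> species \<Rightarrow> real \<Rightarrow> real" where
  "gamma0 d s x = m_c d s 0 * u_max d s * exp (- z_of s * b_c d s 0 * x)"

definition gamma1 :: "corrosion_data \<Rightarrow> species \<Rightarrow> real \<Rightarrow> real" where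
  "gamma1 d s x = k_c d s 1 * u_max d s * exp (z_of s * a_c d s 1 * x)"

primrec Ck :: "nat \<Rightarrow> ('a::euclidean_space \<Rightarrow> real) \<Rightarrow> bool" where
  "Ck 0 f \<longleftrightarrow> continuous_on UNIV f"
| "Ck (Suc k) f \<longleftrightarrow> (\<forall>x. f differentiable at x) \<and>
     (\<forall>b\<in>Basis. Ck k (\<lambda>x. frechet_derivative f (at x) b))"

definition smooth_fun :: "('a::euclidean_space \<Rightarrow> real) \<Rightarrow> bool" where
  "smooth_fun f \<longleftrightarrow> (\<forall>k. Ck k f)"

definition L2_on :: "'a::euclidean_space set \<Rightarrow> ('a \<Rightarrow> real) \<Rightarrow> bool" where
  "L2_on S f \<longleftrightarrow> set_borel_measurable lebesgue S f \<and> set_integrable lebesgue S (\<lambda>x. (f x)\<^sup>2)"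

definition Linf_on :: "'a::euclidean_space set \<Rightarrow> ('a \<Rightarrow> real) \<Rightarrow> bool" where
  "Linf_on S f \<longleftrightarrow> set_borel_measurable lebesgue S f \<and>
     (\<exists>C. AE x in lebesgue. x \<in> S \<longrightarrow> \<bar>f x\<bar> \<le> C)"

definition test_fun01 :: "(real \<Rightarrow> real) \<Rightarrow> bool" where
  "test_fun01 \<phi> \<longleftrightarrow> smooth_fun \<phi> \<and> compact (closure {x. \<phi> x \<noteq> 0}) \<and>
     closure {x. \<phi> x \<noteq> 0} \<subseteq> {0<..<1}"

definition weak_deriv01 :: "(real \<Rightarrow> real) \<Rightarrow> (real \<Rightarrow> real) \<Rightarrow> bool" where
  "weak_deriv01 f g \<longleftrightarrow> (\<forall>\<phi>. test_fun01 \<phi> \<longrightarrow>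
     (LINT x:{0<..<1}|lebesgue. f x * deriv \<phi> x) = - (LINT x:{0<..<1}|lebesgue. g x * \<phi> x))"

text \<open>\<open>f\<close> belongs to \<open>H\<^sup>1(0,1)\<close> and \<open>g\<close> is (a representative of) its weak derivative.\<close>

definition H1_deriv :: "(real \<Rightarrow> real) \<Rightarrow> (real \<Rightarrow> real) \<Rightarrow> bool" where
  "H1_deriv f g \<longleftrightarrow> L2_on {0<..<1} f \<and> L2_on {0<..<1} g \<and> weak_deriv01 f g"

definition QT :: "real \<Rightarrow> (real \<times> real) set" where
  "QT T = {0<..<1} \<times> {0<..<T}"

text \<open>Elements of \<open>L\<^sup>2(0,T;H\<^sup>1(0,1))\<close> are represented by measurable functions of \<open>(x,t)\<close>.
  \<open>L2H1_deriv T u v\<close> says that \<open>u\<close> lies in this space and that \<open>v\<close> represents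
  its weak derivative in \<open>x\<close>. The two \<open>L2_on (QT T)\<close> conditions express that the integral over
  \<open>(0,T)\<close> of the squared \<open>H\<^sup>1(0,1)\<close> norm of \<open>u(\<sqdot>,t)\<close> is finite.\<close>

definition L2H1_deriv :: "real \<Rightarrow> (real \<times> real \<Rightarrow> real) \<Rightarrow> (real \<times> real \<Rightarrow> real) \<Rightarrow> bool" where
  "L2H1_deriv T u v \<longleftrightarrow> L2_on (QT T) u \<and> L2_on (QT T) v \<and>
     (AE t in lebesgue. t \<in> {0<..<T} \<longrightarrow> H1_deriv (\<lambda>x. u (x, t)) (\<lambda>x. v (x, t)))"

definition L2H1 :: "real \<Rightarrow> (real \<times> real \<Rightarrow> real) \<Rightarrow> bool" where
  "L2H1 T u \<longleftrightarrow> (\<exists>v. L2H1_deriv T u v)"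

text \<open>The trace of \<open>f\<close> at an end point \<open>p\<close> of \<open>[0,1]\<close>, for \<open>f\<close> in \<open>H\<^sup>1(0,1)\<close>, is the value at
  \<open>p\<close> of the continuous representative of \<open>f\<close>.\<close>

definition trace01 :: "(real \<Rightarrow> real) \<Rightarrow> real \<Rightarrow> real" where
  "trace01 f p = (THE c. \<exists>g. continuous_on {0..1} g \<and>
     (AE x in lebesgue. x \<in> {0<..<1} \<longrightarrow> g x = f x) \<and> g p = c)"

abbreviation tr :: "(real \<times> real \<Rightarrow> real) \<Rightarrow> real \<Rightarrow> real \<Rightarrow> real" where
  "tr u p t \<equiv> trace01 (\<lambda>x. u (x, t)) p"

definition tendsto_L2 :: "real \<Rightarrow> (nat \<Rightarrow> real \<times> real \<Rightarrow> real) \<Rightarrow> (real \<times> real \<Rightarrow> real) \<Rightarrow> bool" where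
  "tendsto_L2 T f g \<longleftrightarrow> (\<forall>m. L2_on (QT T) (f m)) \<and> L2_on (QT T) g \<and>
     (\<lambda>m. sqrt (LINT z:QT T|lebesgue. (f m z - g z)\<^sup>2)) \<longlonglongrightarrow> 0"

text \<open>Functions that are smooth up to the boundary of \<open>[0,1] \<times> [0,T)\<close> are represented by smooth
  extensions to the plane; the support condition concerns the restriction to that set.\<close>

definition test_fun_QT :: "real \<Rightarrow> (real \<times> real \<Rightarrow> real) \<Rightarrow> bool" where
  "test_fun_QT T \<phi> \<longleftrightarrow> smooth_fun \<phi> \<and>
     (let S = closure {z \<in> {0..1} \<times> {0..<T}. \<phi> z \<noteq> 0} in compact S \<and> S \<subseteq> {0..1} \<times> {0..<T})"

definition weak_solution ::
  "corrosion_data \<Rightarrow> (species \<Rightarrow> real \<times> real \<Rightarrow> real) \<Rightarrow> (real \<times> real \<Rightarrow> real) \<Rightarrow> bool" where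
  "weak_solution d u \<Psi> \<longleftrightarrow> (\<exists>u' \<Psi>'.
     (\<forall>s. L2H1_deriv (t_end d) (u s) (u' s) \<and> Linf_on (QT (t_end d)) (u s)) \<and>
     L2H1_deriv (t_end d) \<Psi> \<Psi>' \<and> Linf_on (QT (t_end d)) \<Psi> \<and>
     (\<forall>s \<phi>. test_fun_QT (t_end d) \<phi> \<longrightarrow>
        - eps_of d s * (LINT z:QT (t_end d)|lebesgue. u s z * frechet_derivative \<phi> (at z) (0, 1))
        - eps_of d s * (LINT x:{0<..<1}|lebesgue. u_init d s x * \<phi> (x, 0))
        - (LINT z:QT (t_end d)|lebesgue.
             (- u' s z - z_of s * u s z * \<Psi>' z) * frechet_derivative \<phi> (at z) (1, 0))
        + (LINT t:{0<..<t_end d}|lebesgue.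
             (beta d s 1 (V_pot d - tr \<Psi> 1 t) * tr (u s) 1 t - gamma1 d s (V_pot d - tr \<Psi> 1 t)) * \<phi> (1, t)
           + (beta d s 0 (tr \<Psi> 0 t) * tr (u s) 0 t - gamma0 d s (tr \<Psi> 0 t)) * \<phi> (0, t)) = 0) \<and>
     (\<forall>\<phi> \<phi>'. L2H1_deriv (t_end d) \<phi> \<phi>' \<longrightarrow>
        (lam d)\<^sup>2 * (LINT z:QT (t_end d)|lebesgue. \<Psi>' z * \<phi>' z)
        - (LINT t:{0<..<t_end d}|lebesgue.
             (lam d)\<^sup>2 / alpha1 d * (V_pot d - tr \<Psi> 1 t - dPsi_pzc1 d) * tr \<phi> 1 t)
        + (LINT t:{0<..<t_end d}|lebesgue.
             (lam d)\<^sup>2 / alpha0 d * (tr \<Psi> 0 t - dPsi_pzc0 d) * tr \<phi> 0 t)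
        = (LINT z:QT (t_end d)|lebesgue. (3 * u SpP z - u SpN z + rho_hl d) * \<phi> z)))"

text \<open>\<open>face M i\<close> is the point \<open>x\<close> with index \<open>i + 1/2\<close>, for \<open>0 \<le> i \<le> n_cells M\<close>.
  Likewise the argument \<open>i\<close> of \<open>dual_h\<close>, \<open>dPsi\<close> and \<open>flux\<close> below stands for \<open>i + 1/2\<close>.\<close>

record mesh =
  n_cells :: nat
  face :: "nat \<Rightarrow> real"

definition is_mesh :: "mesh \<Rightarrow> bool" where
  "is_mesh M \<longleftrightarrow> face M 0 = 0 \<and> face M (n_cells M) = 1 \<and> (\<forall>i<n_cells M. face M i < face M (i + 1))"

definition node :: "mesh \<Rightarrow> nat \<Rightarrow> real" where
  "node M i = (if i = 0 then 0 else if i = n_cells M + 1 then 1 else (face M (i - 1) + face M i) / 2)"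

definition cell_h :: "mesh \<Rightarrow> nat \<Rightarrow> real" where
  "cell_h M i = face M i - face M (i - 1)"

definition dual_h :: "mesh \<Rightarrow> nat \<Rightarrow> real" where
  "dual_h M i = node M (i + 1) - node M i"

definition mesh_size :: "mesh \<Rightarrow> real" where
  "mesh_size M = Max (cell_h M ` {1..n_cells M})"

definition Bern :: "real \<Rightarrow> real" where
  "Bern x = (if x = 0 then 1 else x / (exp x - 1))"

definition dPsi :: "mesh \<Rightarrow> (nat \<Rightarrow> nat \<Rightarrow> real) \<Rightarrow> nat \<Rightarrow> nat \<Rightarrow> real" where
  "dPsi M \<Psi> k i = (\<Psi> k (i + 1) - \<Psi> k i) / dual_h M i"

definition flux ::
  "mesh \<Rightarrow> (species \<Rightarrow> nat \<Rightarrow> nat \<Rightarrow> real) \<Rightarrow> (nat \<Rightarrow> nat \<Rightarrow> real) \<Rightarrow> species \<Rightarrow> nat \<Rightarrow> nat \<Rightarrow> real" where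
  "flux M u \<Psi> s k i =
     (Bern (z_of s * dual_h M i * dPsi M \<Psi> k i) * u s k i
      - Bern (- z_of s * dual_h M i * dPsi M \<Psi> k i) * u s k (i + 1)) / dual_h M i"

text \<open>In discrete unknowns the time index precedes the space index.\<close>

definition scheme_solution ::
  "corrosion_data \<Rightarrow> mesh \<Rightarrow> nat \<Rightarrow> (species \<Rightarrow> nat \<Rightarrow> nat \<Rightarrow> real) \<Rightarrow> (nat \<Rightarrow> nat \<Rightarrow> real) \<Rightarrow> bool" where
  "scheme_solution d M K u \<Psi> \<longleftrightarrow>
     (\<forall>s. \<forall>i\<in>{1..n_cells M}.
        u s 0 i = (LINT x:{face M (i - 1)<..<face M i}|lebesgue. u_init d s x) / cell_h M i) \<and>
     (\<forall>k<K.
        (\<forall>i\<in>{1..n_cells M}.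
           - (lam d)\<^sup>2 * (dPsi M \<Psi> (k + 1) i - dPsi M \<Psi> (k + 1) (i - 1))
             = cell_h M i * (3 * u SpP (k + 1) i - u SpN (k + 1) i + rho_hl d) \<and>
           (\<forall>s. eps_of d s * cell_h M i * ((u s (k + 1) i - u s k i) / (t_end d / real K))
                + flux M u \<Psi> s (k + 1) i - flux M u \<Psi> s (k + 1) (i - 1) = 0)) \<and>
        \<Psi> (k + 1) 0 - alpha0 d * dPsi M \<Psi> (k + 1) 0 = dPsi_pzc0 d \<and>
        \<Psi> (k + 1) (n_cells M + 1) + alpha1 d * dPsi M \<Psi> (k + 1) (n_cells M)
          = V_pot d - dPsi_pzc1 d \<and>
        (\<forall>s. - flux M u \<Psi> s (k + 1) 0
             = beta d s 0 (\<Psi> (k + 1) 0) * u s (k + 1) 0 - gamma0 d s (\<Psi> (k + 1) 0)) \<and>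
        (\<forall>s. flux M u \<Psi> s (k + 1) (n_cells M)
             = beta d s 1 (V_pot d - \<Psi> (k + 1) (n_cells M + 1)) * u s (k + 1) (n_cells M + 1)
               - gamma1 d s (V_pot d - \<Psi> (k + 1) (n_cells M + 1))))"

definition bounded_unknowns ::
  "corrosion_data \<Rightarrow> mesh \<Rightarrow> nat \<Rightarrow> (species \<Rightarrow> nat \<Rightarrow> nat \<Rightarrow> real) \<Rightarrow> bool" where
  "bounded_unknowns d M K u \<longleftrightarrow>
     (\<forall>s. \<forall>k\<in>{1..K}. \<forall>i\<in>{0..n_cells M + 1}. 0 \<le> u s k i \<and> u s k i \<le> u_max d s)"

text \<open>The piecewise constant reconstruction on \<open>[0,1] \<times> [0,T)\<close>. It is set to \<open>0\<close> on the interior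
  cell faces, a null set where no value is prescribed, and outside its domain.\<close>

definition approx ::
  "real \<Rightarrow> mesh \<Rightarrow> nat \<Rightarrow> (nat \<Rightarrow> nat \<Rightarrow> real) \<Rightarrow> real \<times> real \<Rightarrow> real" where
  "approx T M K w = (\<lambda>(x, t). \<Sum>k<K. indicator {real k * (T / real K)..<real (k + 1) * (T / real K)} t *
     (w (k + 1) 0 * indicator {0} x
      + (\<Sum>i\<in>{1..n_cells M}. w (k + 1) i * indicator {face M (i - 1)<..<face M i} x)
      + w (k + 1) (n_cells M + 1) * indicator {1} x))"

end

theory Submission
  imports Defs "HOL-Complex_Analysis.Great_Picard"
begin

text \<open>In one space dimension the discrete Poisson equation can be integrated explicitly, so the
  bounds on the densities bound the potential and its slope, uniformly in the mesh. Testing the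
  discrete conservation laws with the densities then bounds the gradients of the piecewise affine
  reconstructions in \<open>L\<^sup>2\<close>. Integrating the conservation laws twice in space, the time derivative
  of the second primitive of the densities is bounded; by interpolation the first primitives are
  approximately equicontinuous in space and time, hence converge uniformly along a subsequence by
  the Arzela-Ascoli argument. Combined with the gradient bound this gives strong convergence of the
  densities, uniformly in space for almost every time, including the traces. The potential is
  an explicit integral of the primitives and converges as well. The limit gradient is found as the
  element of minimal norm among convex combinations of the approximate gradients, and
  the weak formulation follows by partial integration from the twice integrated conservation law.\<close>

section \<open>Integration on an interval and on the cylinder\<close>

text \<open>The gradients are only square integrable, so the conservation law bounds the time
  derivative of the densities merely in a negative norm. One space integration would still leave the
  gradient in the equation; after two it has become a difference of density values, every term is
  bounded pointwise, and Lipschitz continuity in time follows up to a small defect. Strong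
  convergence comes from pairing the difference of two piecewise constant densities, whose primitive
  is uniformly small, with the difference of the affine ones, whose gradient is bounded. The
  boundary terms multiply traces of the densities by exponentials of traces of the potential, and
  convergence in \<open>L2\<close> of the cylinder says nothing about traces; the one-dimensional
  bound of a supremum by function and gradient supplies them at almost every time. The analysis uses
  Borel functions on the finite measures \<open>lm T\<close> and their products, where Fubini needs
  no completion; the Lebesgue formulation is entered and left by modification on null sets.\<close>

definition lm :: "real \<Rightarrow> real measure" where
  "lm T = density lborel (indicator {0<..<T})"

text \<open>Truncation by \<open>{..x}\<close> instead of an interval starting at 0 makes the
  primitive of an integrable function continuous on the whole line: it is 0 for x \<le> 0 and keeps
  the full integral beyond T, because \<open>lm T\<close> has no mass outside
  \<open>(0,T)\<close>.\<close>

definition prim :: "real \<Rightarrow> (real \<Rightarrow> real) \<Rightarrow> real \<Rightarrow> real" where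
  "prim T f x = (\<integral>y. indicator {..x} y * f y \<partial>lm T)"

abbreviation mq :: "real \<Rightarrow> (real \<times> real) measure" where
  "mq T \<equiv> lm 1 \<Otimes>\<^sub>M lm T"

lemma sets_lm [measurable_cong, simp]: "sets (lm T) = sets borel"
  by (simp add: lm_def)

lemma space_lm [simp]: "space (lm T) = UNIV"
  by (simp add: lm_def)

lemma emeasure_lm: "A \<in> sets borel \<Longrightarrow> emeasure (lm T) A = emeasure lborel ({0<..<T} \<inter> A)"
  unfolding lm_def by (subst emeasure_density) (auto simp: nn_integral_indicator[symmetric] indicator_inter_arith simp del: nn_integral_indicator)

lemma finite_measure_lm: "finite_measure (lm T)"
proof
  show "emeasure (lm T) (space (lm T)) \<noteq> \<infinity>"
    by (cases "0 \<le> T") (auto simp: emeasure_lm)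
qed

interpretation lm: finite_measure "lm T" for T
  by (rule finite_measure_lm)

interpretation lmp: pair_sigma_finite "lm S" "lm T" for S T
  by (simp add: pair_sigma_finite_def lm.sigma_finite_measure_axioms)

lemma measure_lm: "0 \<le> T \<Longrightarrow> measure (lm T) UNIV = T"
  by (simp add: measure_def emeasure_lm)

lemma sets_mq [measurable_cong, simp]: "sets (lm S \<Otimes>\<^sub>M lm T) = sets borel"
  by (metis borel_prod sets_lm sets_pair_measure_cong)

lemma space_mq [simp]: "space (lm S \<Otimes>\<^sub>M lm T) = UNIV"
  by (simp add: space_pair_measure)

lemma finite_measure_mq: "finite_measure (lm S \<Otimes>\<^sub>M lm T)"
  by (simp add: finite_measure_pair_measure finite_measure_lm)

interpretation mq: finite_measure "lm S \<Otimes>\<^sub>M lm T" for S T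
  by (rule finite_measure_mq)

lemma AE_lm: "(AE x in lm T. P x) \<longleftrightarrow> (AE x in lborel. x \<in> {0<..<T} \<longrightarrow> P x)"
  unfolding lm_def by (subst AE_density) (auto simp: indicator_def)

lemma AE_lm_I: "(\<And>x. 0 < x \<Longrightarrow> x < T \<Longrightarrow> P x) \<Longrightarrow> AE x in lm T. P x"
  unfolding AE_lm by auto

lemma AE_lm_lebesgue: "(AE x in lm T. P x) \<longleftrightarrow> (AE x in lebesgue. x \<in> {0<..<T} \<longrightarrow> P x)"
  unfolding AE_lm AE_completion_iff ..

text \<open>Fubini is available for the product, whereas \<open>weak_solution\<close> speaks of
  Lebesgue measure on \<open>QT T\<close>; the passage between the two rests on this
  identity.\<close>

lemma mq_eq: "lm S \<Otimes>\<^sub>M lm T = density lborel (indicator ({0<..<S} \<times> {0<..<T}))"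
proof -
  have "lm S \<Otimes>\<^sub>M lm T = density (lborel \<Otimes>\<^sub>M lborel) (\<lambda>(x,y). indicator {0<..<S} x * indicator {0<..<T} y)"
    unfolding lm_def
    by (rule pair_measure_density) (auto simp: lm_def[symmetric] lborel.sigma_finite_measure_axioms lm.sigma_finite_measure_axioms)
  also have "(\<lambda>(x,y). indicator {0<..<S} x * indicator {0<..<T} y :: ennreal) = indicator ({0<..<S} \<times> {0<..<T})"
    by (auto simp: fun_eq_iff indicator_def)
  finally show ?thesis by (simp add: lborel_prod)
qed

lemma QT_borel [measurable]: "QT T \<in> sets borel"
  unfolding QT_def by (auto intro!: borel_open open_Times)

lemma AE_mq: "(AE z in lm 1 \<Otimes>\<^sub>M lm T. P z) \<longleftrightarrow> (AE z in lborel. z \<in> QT T \<longrightarrow> P z)"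
  unfolding mq_eq by (subst AE_density) (auto simp: indicator_def QT_def intro!: borel_measurable_indicator borel_open open_Times)

lemma AE_mq_lebesgue: "(AE z in lm 1 \<Otimes>\<^sub>M lm T. P z) \<longleftrightarrow> (AE z in lebesgue. z \<in> QT T \<longrightarrow> P z)"
  unfolding AE_mq AE_completion_iff ..

lemma integral_lm:
  fixes f :: "real \<Rightarrow> real"
  assumes [measurable]: "f \<in> borel_measurable borel"
  shows "(LINT x:{0<..<T}|lebesgue. f x) = integral\<^sup>L (lm T) f"
    "set_integrable lebesgue {0<..<T} f \<longleftrightarrow> integrable (lm T) f"
proof -
  have "indicator {0<..<T} = (\<lambda>x. ennreal (indicator {0<..<T} x))"
    by (auto simp: fun_eq_iff indicator_def)
  then have e: "lm T = density lborel (\<lambda>x. ennreal (indicator {0<..<T} x))"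
    unfolding lm_def by simp
  show "(LINT x:{0<..<T}|lebesgue. f x) = integral\<^sup>L (lm T) f"
    unfolding e set_lebesgue_integral_def by (subst integral_density) (auto simp: integral_completion)
  show "set_integrable lebesgue {0<..<T} f \<longleftrightarrow> integrable (lm T) f"
    unfolding e set_integrable_def by (subst integrable_density) (auto simp: integrable_completion)
qed

lemma integral_mq:
  fixes f :: "real \<times> real \<Rightarrow> real"
  assumes [measurable]: "f \<in> borel_measurable borel"
  shows "(LINT z:QT T|lebesgue. f z) = integral\<^sup>L (mq T) f"
    "set_integrable lebesgue (QT T) f \<longleftrightarrow> integrable (mq T) f"
proof -
  have "indicator ({0<..<1} \<times> {0<..<T}) = (\<lambda>x. ennreal (indicator (QT T) x))"
    by (auto simp: fun_eq_iff indicator_def QT_def)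
  then have e: "mq T = density lborel (\<lambda>x. ennreal (indicator (QT T) x))"
    unfolding mq_eq by simp
  show "(LINT x:QT T|lebesgue. f x) = integral\<^sup>L (mq T) f"
    unfolding e set_lebesgue_integral_def by (subst integral_density) (auto simp: integral_completion)
  show "set_integrable lebesgue (QT T) f \<longleftrightarrow> integrable (mq T) f"
    unfolding e set_integrable_def by (subst integrable_density) (auto simp: integrable_completion)
qed

lemma slice_borel:
  fixes f :: "real \<times> real \<Rightarrow> real"
  assumes "f \<in> borel_measurable borel"
  shows "(\<lambda>x. f (x, t)) \<in> borel_measurable borel" "(\<lambda>t. f (x, t)) \<in> borel_measurable borel"
proof -
  have "(\<lambda>x::real. (x, t::real)) \<in> borel \<rightarrow>\<^sub>M borel \<Otimes>\<^sub>M (borel :: real measure)" "(\<lambda>t::real. (x::real, t)) \<in> borel \<rightarrow>\<^sub>M (borel :: real measure) \<Otimes>\<^sub>M borel"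
    by measurable
  then show "(\<lambda>x. f (x, t)) \<in> borel_measurable borel" "(\<lambda>t. f (x, t)) \<in> borel_measurable borel"
    using assms measurable_compose unfolding borel_prod by blast+
qed

text \<open>\<open>AE_pair\<close> slices with the first coordinate outermost. Time is the second
  coordinate, so the factors are exchanged through the image measure of the flip.\<close>

lemma AE_mq_slice:
  assumes "AE z in lm S \<Otimes>\<^sub>M lm T. P z"
  shows "AE t in lm T. AE x in lm S. P (x, t)"
proof -
  interpret Q: pair_sigma_finite "lm T" "lm S" ..
  have "AE z in distr (lm T \<Otimes>\<^sub>M lm S) (lm S \<Otimes>\<^sub>M lm T) (\<lambda>(x, y). (y, x)). P z"
    using assms unfolding lmp.distr_pair_swap[symmetric] .
  then have "AE z in lm T \<Otimes>\<^sub>M lm S. P (case z of (x, y) \<Rightarrow> (y, x))"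
    by (rule AE_distrD[rotated]) measurable
  from lmp.AE_pair[OF this] show ?thesis by simp
qed

text \<open>Converse of the slicing rule. Here measurability of the set is essential: null slices
  alone do not make a set null.\<close>

lemma AE_mq_I:
  assumes "{z. P z} \<in> sets borel" "AE t in lm T. AE x in lm S. P (x, t)"
  shows "AE z in lm S \<Otimes>\<^sub>M lm T. P z"
proof -
  have "(AE t in lm T. AE x in lm S. P (x, t)) \<longleftrightarrow> (AE x in lm S. AE t in lm T. P (x, t))"
    by (rule lmp.AE_commute[symmetric]) (use assms in \<open>simp only: sets_mq space_mq UNIV_I simp_thms prod.collapse\<close>)
  then show ?thesis using assms
    by (intro lmp.AE_pair_measure) (simp_all only: sets_mq space_mq UNIV_I simp_thms)
qed

lemma integrable_bounded_finite:
  fixes f :: "'a \<Rightarrow> real"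
  assumes "finite_measure M" "f \<in> borel_measurable M" "AE x in M. \<bar>f x\<bar> \<le> B"
  shows "integrable M f"
  using finite_measure.integrable_const_bound[of M f B] assms by simp

text \<open>Space is the first coordinate, so the versions with time outermost come from the product
  with exchanged factors.\<close>

lemma mq_integral_iterated:
  assumes "integrable (lm S \<Otimes>\<^sub>M lm T) (f :: real \<times> real \<Rightarrow> real)"
  shows "integral\<^sup>L (lm S \<Otimes>\<^sub>M lm T) f = (\<integral>t. (\<integral>x. f (x, t) \<partial>lm S) \<partial>lm T)"
    "integral\<^sup>L (lm S \<Otimes>\<^sub>M lm T) f = (\<integral>x. (\<integral>t. f (x, t) \<partial>lm T) \<partial>lm S)"
    "integrable (lm T) (\<lambda>t. \<integral>x. f (x, t) \<partial>lm S)"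
    "integrable (lm S) (\<lambda>x. \<integral>t. f (x, t) \<partial>lm T)"
    "AE t in lm T. integrable (lm S) (\<lambda>x. f (x, t))"
    "AE x in lm S. integrable (lm T) (\<lambda>t. f (x, t))"
proof -
  interpret Q: pair_sigma_finite "lm T" "lm S" ..
  have sw: "integrable (lm T \<Otimes>\<^sub>M lm S) (\<lambda>(t, x). f (x, t))"
    using lmp.integrable_product_swap[OF assms] by (simp add: case_prod_beta)
  have m: "f \<in> borel_measurable (lm S \<Otimes>\<^sub>M lm T)" using assms by (rule borel_measurable_integrable)
  show "integral\<^sup>L (lm S \<Otimes>\<^sub>M lm T) f = (\<integral>x. (\<integral>t. f (x, t) \<partial>lm T) \<partial>lm S)"
    using lmp.integral_fst'[OF assms] by simp
  show "integral\<^sup>L (lm S \<Otimes>\<^sub>M lm T) f = (\<integral>t. (\<integral>x. f (x, t) \<partial>lm S) \<partial>lm T)"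
    using lmp.integral_fst'[OF sw] lmp.integral_product_swap[OF m] by simp
  show "integrable (lm T) (\<lambda>t. \<integral>x. f (x, t) \<partial>lm S)"
    using lmp.integrable_fst'[OF sw] by simp
  show "integrable (lm S) (\<lambda>x. \<integral>t. f (x, t) \<partial>lm T)"
    using lmp.integrable_fst'[OF assms] by simp
  show "AE t in lm T. integrable (lm S) (\<lambda>x. f (x, t))"
    using lmp.AE_integrable_fst'[OF sw] by simp
  show "AE x in lm S. integrable (lm T) (\<lambda>t. f (x, t))"
    using lmp.AE_integrable_fst'[OF assms] by simp
qed

section \<open>Primitives and integration by parts on an interval\<close>

lemma integrable_trunc:
  assumes "integrable (lm T) f"
  shows "integrable (lm T) (\<lambda>y. indicator {..x} y * f y :: real)"
  using integrable_real_mult_indicator[of "{..x}" "lm T" f] assms by (simp add: mult.commute)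

lemma prim_add: "integrable (lm T) f \<Longrightarrow> integrable (lm T) g \<Longrightarrow> prim T (\<lambda>y. f y + g y) x = prim T f x + prim T g x"
  by (simp add: prim_def distrib_left integrable_trunc)

lemma prim_diff: "integrable (lm T) f \<Longrightarrow> integrable (lm T) g \<Longrightarrow> prim T (\<lambda>y. f y - g y) x = prim T f x - prim T g x"
  by (simp add: prim_def right_diff_distrib integrable_trunc)

lemma prim_cmult: "prim T (\<lambda>y. c * f y) x = c * prim T f x"
  by (simp add: prim_def mult.left_commute)

lemma prim_0: "x \<le> 0 \<Longrightarrow> prim T f x = 0"
proof -
  assume "x \<le> 0"
  show ?thesis unfolding prim_def
    by (intro integral_eq_zero_AE AE_lm_I) (use \<open>x \<le> 0\<close> in \<open>auto simp: indicator_def\<close>)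
qed

lemma prim_end: "f \<in> borel_measurable borel \<Longrightarrow> prim T f T = integral\<^sup>L (lm T) f"
  unfolding prim_def by (intro Bochner_Integration.integral_cong_AE AE_lm_I) auto

lemma prim_cong_AE:
  "f \<in> borel_measurable borel \<Longrightarrow> g \<in> borel_measurable borel \<Longrightarrow> AE x in lm T. f x = g x \<Longrightarrow> prim T f x = prim T g x"
  unfolding prim_def by (intro Bochner_Integration.integral_cong_AE) auto

lemma prim_le_integral:
  assumes "integrable (lm T) f"
  shows "\<bar>prim T f x\<bar> \<le> (\<integral>y. \<bar>f y\<bar> \<partial>lm T)"
proof -
  have "\<bar>prim T f x\<bar> \<le> (\<integral>y. \<bar>indicator {..x} y * f y\<bar> \<partial>lm T)"
    unfolding prim_def by (rule integral_abs_bound)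
  also have "\<dots> \<le> (\<integral>y. \<bar>f y\<bar> \<partial>lm T)"
    using assms integrable_trunc[OF assms] by (intro integral_mono) (auto simp: indicator_def)
  finally show ?thesis .
qed

lemma measure_lm_Ioc: "0 \<le> x \<Longrightarrow> x \<le> y \<Longrightarrow> y \<le> T \<Longrightarrow> measure (lm T) {x<..y} = y - x"
proof -
  assume a: "0 \<le> x" "x \<le> y" "y \<le> T"
  have "emeasure lborel ({0<..<T} \<inter> {x<..y}) = ennreal (y - x)"
  proof (cases "y = T")
    \<comment> \<open>At \<open>y = T\<close> the end point itself lies outside the open support, so
      the intersection is an open interval.\<close>
    case True
    then have "{0<..<T} \<inter> {x<..y} = {x<..<y}" using a by auto
    then show ?thesis using a by simp
  next
    case False
    then have "{0<..<T} \<inter> {x<..y} = {x<..y}" using a by auto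
    then show ?thesis using a by simp
  qed
  then show ?thesis using a by (simp add: measure_def emeasure_lm)
qed

lemma integral_lm_Ioc: "0 \<le> x \<Longrightarrow> x \<le> y \<Longrightarrow> y \<le> T \<Longrightarrow> (\<integral>z. indicator {x<..y} z \<partial>lm T) = y - x"
  using measure_lm_Ioc by simp

lemma prim_diff_Ioc:
  assumes "integrable (lm T) f" "x \<le> y"
  shows "prim T f y - prim T f x = (\<integral>z. indicator {x<..y} z * f z \<partial>lm T)"
proof -
  have "prim T f y - prim T f x = (\<integral>z. indicator {..y} z * f z - indicator {..x} z * f z \<partial>lm T)"
    unfolding prim_def by (simp add: integrable_trunc assms)
  also have "\<dots> = (\<integral>z. indicator {x<..y} z * f z \<partial>lm T)"
    by (rule Bochner_Integration.integral_cong) (use assms(2) in \<open>auto simp: indicator_def\<close>)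
  finally show ?thesis .
qed

lemma prim_lipschitz:
  assumes [measurable]: "f \<in> borel_measurable borel" and B: "AE z in lm T. \<bar>f z\<bar> \<le> B"
    and "0 \<le> x" "x \<le> y" "y \<le> T"
  shows "\<bar>prim T f y - prim T f x\<bar> \<le> B * (y - x)"
proof -
  have i: "integrable (lm T) f" by (rule integrable_bounded_finite[OF finite_measure_lm _ B]) simp
  have i2: "integrable (lm T) (indicator {x<..y} :: real \<Rightarrow> real)"
    by (rule integrable_bounded_finite[OF finite_measure_lm, where B=1]) (auto simp: indicator_def)
  have "\<bar>prim T f y - prim T f x\<bar> = \<bar>\<integral>z. indicator {x<..y} z * f z \<partial>lm T\<bar>"
    using prim_diff_Ioc[OF i] assms by simp
  also have "\<dots> \<le> (\<integral>z. \<bar>indicator {x<..y} z * f z\<bar> \<partial>lm T)" by (rule integral_abs_bound)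
  also have "\<dots> \<le> (\<integral>z. B * indicator {x<..y} z \<partial>lm T)"
  proof (rule integral_mono_AE)
    show "integrable (lm T) (\<lambda>z. \<bar>indicator {x<..y} z * f z\<bar>)"
      using integrable_real_mult_indicator[OF _ i, of "{x<..y}"] by (simp add: mult.commute)
    show "integrable (lm T) (\<lambda>z. B * indicator {x<..y} z)" using i2 by simp
    show "AE z in lm T. \<bar>indicator {x<..y} z * f z\<bar> \<le> B * indicator {x<..y} z"
      using B by eventually_elim (auto simp: indicator_def)
  qed
  also have "\<dots> = B * (y - x)" using integral_lm_Ioc assms by simp
  finally show ?thesis .
qed

lemma prim_bound:
  assumes "f \<in> borel_measurable borel" "AE z in lm T. \<bar>f z\<bar> \<le> B" "0 \<le> x" "x \<le> T"
  shows "\<bar>prim T f x\<bar> \<le> B * x"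
  using prim_lipschitz[OF assms(1,2), of 0 x] assms prim_0[of 0 T f] by simp

lemma prim_const: "0 \<le> x \<Longrightarrow> x \<le> T \<Longrightarrow> prim T (\<lambda>_. c) x = c * x"
proof -
  assume a: "0 \<le> x" "x \<le> T"
  have "prim T (\<lambda>_. c) x - prim T (\<lambda>_. c) 0 = (\<integral>z. indicator {0<..x} z * c \<partial>lm T)"
    using a by (intro prim_diff_Ioc) auto
  then show ?thesis using integral_lm_Ioc[of 0 x T] a by (simp add: prim_0)
qed

lemma lm_point_null: "AE z in lm T. z \<noteq> x"
  unfolding AE_lm using AE_lborel_singleton[of x] by eventually_elim auto

lemma lm_finite_null: "finite A \<Longrightarrow> AE z in lm T. z \<notin> A"
proof (induct rule: finite_induct)
  case (insert a A)
  then show ?case using lm_point_null[of a T] by auto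
qed simp

text \<open>Dominated convergence with majorant \<open>\<bar>f\<bar>\<close>: as the end points tend
  to \<open>x\<close>, the truncations converge at every point except possibly \<open>x\<close>
  itself.\<close>

lemma prim_continuous:
  assumes "integrable (lm T) f"
  shows "continuous_on UNIV (prim T f)"
proof (unfold continuous_on_eq_continuous_at[OF open_UNIV], intro ballI, unfold continuous_at_sequentially, intro allI impI)
  fix x :: real and s assume s: "s \<longlonglongrightarrow> x"
  have [measurable]: "f \<in> borel_measurable borel" using borel_measurable_integrable[OF assms] by simp
  show "((prim T f) \<circ> s) \<longlonglongrightarrow> prim T f x"
    unfolding prim_def o_def
  proof (rule integral_dominated_convergence[where w="\<lambda>y. \<bar>f y\<bar>"])
    show "AE z in lm T. (\<lambda>n. indicator {..s n} z * f z) \<longlonglongrightarrow> indicator {..x} z * f z"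
      using lm_point_null[of x T]
    proof eventually_elim
      fix z assume "z \<noteq> x"
      have "eventually (\<lambda>n. indicator {..s n} z = (indicator {..x} z :: real)) sequentially"
      proof (cases "z < x")
        case True
        from order_tendstoD(1)[OF s this] show ?thesis by eventually_elim (use True in auto)
      next
        case False
        then have "x < z" using \<open>z \<noteq> x\<close> by simp
        from order_tendstoD(2)[OF s this] show ?thesis by eventually_elim (use \<open>x < z\<close> in auto)
      qed
      then show "(\<lambda>n. indicator {..s n} z * f z) \<longlonglongrightarrow> indicator {..x} z * f z"
        by (intro tendsto_mult tendsto_const tendsto_eventually)
    qed
    show "AE z in lm T. norm (indicator {..s n} z * f z) \<le> \<bar>f z\<bar>" for n
      by (auto simp: indicator_def)
  qed (use assms in auto)
qed

lemma borel_measurable_lm [simp]: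
  "borel_measurable (lm T) = borel_measurable borel"
  "borel_measurable (M \<Otimes>\<^sub>M lm T) = borel_measurable (M \<Otimes>\<^sub>M borel)"
  "borel_measurable (lm S \<Otimes>\<^sub>M lm T) = borel_measurable borel"
  by (rule measurable_cong_sets[OF sets_lm refl] measurable_cong_sets[OF sets_pair_measure_cong[OF refl sets_lm] refl]
    measurable_cong_sets[OF sets_mq refl])+

text \<open>Written as a condition on the pair, the truncation is jointly measurable, and
  integrating out one variable keeps measurability. End point and parameter vary together because
  both occur in functions of \<open>(x,t)\<close> later on.\<close>

lemma prim_borel_gen:
  assumes [measurable]: "g \<in> borel_measurable (M \<Otimes>\<^sub>M borel)" "h \<in> borel_measurable M"
  shows "(\<lambda>z. prim T (\<lambda>y. g (z, y)) (h z)) \<in> borel_measurable M"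
proof -
  have "(\<lambda>(z, y). (if y \<le> h z then 1 else 0) * g (z, y)) \<in> borel_measurable (M \<Otimes>\<^sub>M lm T)"
    by (simp only: borel_measurable_lm) measurable
  then have "(\<lambda>z. \<integral>y. (if y \<le> h z then 1 else 0) * g (z, y) \<partial>lm T) \<in> borel_measurable M"
    by (rule lm.borel_measurable_lebesgue_integral)
  also have "(\<lambda>z. \<integral>y. (if y \<le> h z then 1 else 0) * g (z, y) \<partial>lm T) = (\<lambda>z. prim T (\<lambda>y. g (z, y)) (h z))"
    unfolding prim_def by (intro ext Bochner_Integration.integral_cong) (auto simp: indicator_def)
  finally show ?thesis .
qed

lemma prim_borel [measurable (raw)]:
  assumes [measurable]: "f \<in> borel_measurable borel"
  shows "prim T f \<in> borel_measurable borel"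
proof -
  have "(\<lambda>z. f (snd z)) \<in> borel_measurable (borel \<Otimes>\<^sub>M (borel :: real measure))" by measurable
  from prim_borel_gen[OF this, of "\<lambda>x. x" T] show ?thesis by simp
qed

lemma prim_borel2:
  assumes [measurable]: "f \<in> borel_measurable borel"
  shows "(\<lambda>z. prim T (\<lambda>y. f (y, snd z)) (fst z)) \<in> borel_measurable (borel :: (real\<times>real) measure)"
    "(\<lambda>z. prim T (\<lambda>y. f (fst z, y)) (snd z)) \<in> borel_measurable (borel :: (real\<times>real) measure)"
proof -
  have [measurable]: "f \<in> borel_measurable (borel \<Otimes>\<^sub>M borel)" using assms by (simp add: borel_prod)
  have "(\<lambda>z. f (snd z, snd (fst z))) \<in> borel_measurable ((borel \<Otimes>\<^sub>M borel) \<Otimes>\<^sub>M borel)"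
     "(\<lambda>z. f (fst (fst z), snd z)) \<in> borel_measurable ((borel \<Otimes>\<^sub>M borel) \<Otimes>\<^sub>M borel)"
    by measurable
  from prim_borel_gen[OF this(1), of fst T] prim_borel_gen[OF this(2), of snd T]
  show "(\<lambda>z. prim T (\<lambda>y. f (y, snd z)) (fst z)) \<in> borel_measurable (borel :: (real\<times>real) measure)"
    "(\<lambda>z. prim T (\<lambda>y. f (fst z, y)) (snd z)) \<in> borel_measurable (borel :: (real\<times>real) measure)"
    by (simp_all add: borel_prod[symmetric])
qed

text \<open>Fubini on the two triangles of the square; the diagonal is a null set.\<close>

lemma prim_by_parts:
  assumes f: "integrable (lm T) f" and g: "integrable (lm T) g"
  shows "(\<integral>x. f x * prim T g x \<partial>lm T) + (\<integral>x. prim T f x * g x \<partial>lm T) = integral\<^sup>L (lm T) f * integral\<^sup>L (lm T) g"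
    "integrable (lm T) (\<lambda>x. f x * prim T g x)"
proof -
  have [measurable]: "f \<in> borel_measurable borel" "g \<in> borel_measurable borel"
    using borel_measurable_integrable[OF f] borel_measurable_integrable[OF g] by simp_all
  have fg: "integrable (lm T \<Otimes>\<^sub>M lm T) (\<lambda>z. f (fst z) * g (snd z))"
    using lmp.Fubini_integrable[of "\<lambda>z. f (fst z) * g (snd z)" T T] f g
    by (simp add: abs_mult)
  have [measurable]: "fst \<in> borel_measurable (lm T \<Otimes>\<^sub>M lm T)" "snd \<in> borel_measurable (lm T \<Otimes>\<^sub>M lm T)"
    by (simp_all add: borel_prod[symmetric])
  let ?A = "\<lambda>z. (if snd z \<le> fst z then 1 else 0) * (f (fst z) * g (snd z))"
  let ?B = "\<lambda>z. (if fst z \<le> snd z then 1 else 0) * (f (fst z) * g (snd z))"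
  have iA: "integrable (lm T \<Otimes>\<^sub>M lm T) ?A" 
    by (rule Bochner_Integration.integrable_bound[OF fg]) (auto intro!: AE_I2)
  have iB: "integrable (lm T \<Otimes>\<^sub>M lm T) ?B"
    by (rule Bochner_Integration.integrable_bound[OF fg]) (auto intro!: AE_I2)
  have A: "(\<integral>y. ?A (x, y) \<partial>lm T) = f x * prim T g x" for x
  proof -
    have "(\<integral>y. ?A (x, y) \<partial>lm T) = (\<integral>y. f x * (indicator {..x} y * g y) \<partial>lm T)"
      by (rule Bochner_Integration.integral_cong) (auto simp: indicator_def)
    then show ?thesis by (simp add: prim_def)
  qed
  have B: "(\<integral>x. ?B (x, y) \<partial>lm T) = prim T f y * g y" for y
  proof -
    have "(\<integral>x. ?B (x, y) \<partial>lm T) = (\<integral>x. g y * (indicator {..y} x * f x) \<partial>lm T)"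
      by (rule Bochner_Integration.integral_cong) (auto simp: indicator_def)
    then show ?thesis by (simp add: prim_def mult.commute)
  qed
  show "integrable (lm T) (\<lambda>x. f x * prim T g x)"
    using mq_integral_iterated(4)[OF iA] unfolding A .
  have "integral\<^sup>L (lm T \<Otimes>\<^sub>M lm T) ?A + integral\<^sup>L (lm T \<Otimes>\<^sub>M lm T) ?B = integral\<^sup>L (lm T \<Otimes>\<^sub>M lm T) (\<lambda>z. ?A z + ?B z)"
    using iA iB by simp
  also have "\<dots> = integral\<^sup>L (lm T \<Otimes>\<^sub>M lm T) (\<lambda>z. f (fst z) * g (snd z))"
  proof (rule Bochner_Integration.integral_cong_AE)
    have "AE z in lm T \<Otimes>\<^sub>M lm T. fst z \<noteq> snd z"
    proof (rule AE_mq_I)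
      have "{z :: real\<times>real. fst z \<noteq> snd z} = {z \<in> space (borel \<Otimes>\<^sub>M borel). fst z \<noteq> snd z}" by (simp add: space_pair_measure)
      also have "\<dots> \<in> sets (borel \<Otimes>\<^sub>M borel)" by measurable
      finally show "{z :: real\<times>real. fst z \<noteq> snd z} \<in> sets borel" by (simp add: borel_prod)
      show "AE t in lm T. AE x in lm T. fst (x, t) \<noteq> snd (x, t)"
        using lm_point_null by simp
    qed
    then show "AE z in lm T \<Otimes>\<^sub>M lm T. ?A z + ?B z = f (fst z) * g (snd z)"
      by eventually_elim auto
  qed measurable
  also have "\<dots> = integral\<^sup>L (lm T) f * integral\<^sup>L (lm T) g"
    using mq_integral_iterated(2)[OF fg] by simp
  finally show "(\<integral>x. f x * prim T g x \<partial>lm T) + (\<integral>x. prim T f x * g x \<partial>lm T) = integral\<^sup>L (lm T) f * integral\<^sup>L (lm T) g"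
    unfolding mq_integral_iterated(2)[OF iA] mq_integral_iterated(1)[OF iB] A B .
qed

text \<open>The factors are absolutely continuous only up to null sets. Their boundary values are
  therefore not read off from \<open>F\<close> and \<open>G\<close> but from the constants
  \<open>a\<close>, \<open>b\<close> at 0 and from \<open>a + \<integral>f\<close>,
  \<open>b + \<integral>g\<close> at T.\<close>

lemma ibp:
  assumes f: "integrable (lm T) f" and g: "integrable (lm T) g"
    and F: "AE x in lm T. F x = a + prim T f x" and G: "AE x in lm T. G x = b + prim T g x"
    and [measurable]: "F \<in> borel_measurable borel" "G \<in> borel_measurable borel"
  shows "(\<integral>x. f x * G x \<partial>lm T) = (a + integral\<^sup>L (lm T) f) * (b + integral\<^sup>L (lm T) g) - a * b - (\<integral>x. F x * g x \<partial>lm T)"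
    "integrable (lm T) (\<lambda>x. f x * G x)" "integrable (lm T) (\<lambda>x. F x * g x)"
proof -
  have [measurable]: "f \<in> borel_measurable borel" "g \<in> borel_measurable borel"
    using borel_measurable_integrable[OF f] borel_measurable_integrable[OF g] by simp_all
  have e1: "AE x in lm T. b * f x + f x * prim T g x = f x * G x"
    using G by eventually_elim (simp add: algebra_simps)
  have e2: "AE x in lm T. a * g x + g x * prim T f x = F x * g x"
    using F by eventually_elim (simp add: algebra_simps)
  have i1: "integrable (lm T) (\<lambda>x. b * f x + f x * prim T g x)"
    using f prim_by_parts(2)[OF f g] by simp
  have i2: "integrable (lm T) (\<lambda>x. a * g x + g x * prim T f x)"
    using g prim_by_parts(2)[OF g f] by simp
  show "integrable (lm T) (\<lambda>x. f x * G x)"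
    by (rule iffD1[OF integrable_cong_AE i1]) (use e1 in auto)
  show "integrable (lm T) (\<lambda>x. F x * g x)"
    by (rule iffD1[OF integrable_cong_AE i2]) (use e2 in auto)
  have "(\<integral>x. f x * G x \<partial>lm T) = (\<integral>x. b * f x + f x * prim T g x \<partial>lm T)"
    by (rule Bochner_Integration.integral_cong_AE) (use e1 in auto)
  also have "\<dots> = b * integral\<^sup>L (lm T) f + (\<integral>x. f x * prim T g x \<partial>lm T)"
    using f prim_by_parts(2)[OF f g] by simp
  finally have 1: "(\<integral>x. f x * G x \<partial>lm T) = b * integral\<^sup>L (lm T) f + (\<integral>x. f x * prim T g x \<partial>lm T)" .
  have "(\<integral>x. F x * g x \<partial>lm T) = (\<integral>x. a * g x + g x * prim T f x \<partial>lm T)"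
    by (rule Bochner_Integration.integral_cong_AE) (use e2 in auto)
  also have "\<dots> = a * integral\<^sup>L (lm T) g + (\<integral>x. g x * prim T f x \<partial>lm T)"
    using g prim_by_parts(2)[OF g f] by simp
  finally have 2: "(\<integral>x. F x * g x \<partial>lm T) = a * integral\<^sup>L (lm T) g + (\<integral>x. prim T f x * g x \<partial>lm T)"
    by (simp add: mult.commute)
  show "(\<integral>x. f x * G x \<partial>lm T) = (a + integral\<^sup>L (lm T) f) * (b + integral\<^sup>L (lm T) g) - a * b - (\<integral>x. F x * g x \<partial>lm T)"
    unfolding 1 2 using prim_by_parts(1)[OF f g] by (simp add: algebra_simps)
qed

text \<open>Dynkin argument: the sets over which \<open>f\<close> has zero integral contain the half
  lines \<open>{..a}\<close>, which are stable under intersection and generate the Borel sets, and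
  they are closed under complements and disjoint unions. Zero integral over every Borel set means
  zero almost everywhere.\<close>

lemma prim_zero_imp_AE_zero:
  assumes f: "integrable (lm T) f" and z: "\<And>x. 0 < x \<Longrightarrow> x \<le> T \<Longrightarrow> prim T f x = 0"
  shows "AE x in lm T. f x = 0"
proof -
  have [measurable]: "f \<in> borel_measurable borel"
    using borel_measurable_integrable[OF f] by simp
  \<comment> \<open>Outside \<open>(0,T]\<close> the primitive is 0 or repeats its value at T, so
    half lines with arbitrary end point are covered.\<close>
  have 0: "prim T f x = 0" for x
  proof (cases "x \<le> 0")
    case True then show ?thesis by (rule prim_0)
  next
    case False
    show ?thesis
    proof (cases "x \<le> T")
      case True then show ?thesis using False z by simp
    next
      case b: False
      show ?thesis
      proof (cases "0 < T")
        case True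
        have "prim T f x = prim T f T" unfolding prim_def
          by (intro Bochner_Integration.integral_cong_AE AE_lm_I) (use b in auto)
        then show ?thesis using z[of T] True by simp
      next
        case False
        show ?thesis unfolding prim_def
          by (intro integral_eq_zero_AE AE_lm_I) (use False in auto)
      qed
    qed
  qed
  have T0: "integral\<^sup>L (lm T) f = 0" using 0[of T] prim_end[of f T] by simp
  have main: "(\<integral>x. indicator A x * f x \<partial>lm T) = 0" if "A \<in> sets borel" for A
  proof -
    have sb: "sets (borel::real measure) = sigma_sets UNIV (range (\<lambda>a. {..a}))"
      by (simp add: borel_eq_atMost)
    have st: "Int_stable (range (\<lambda>a::real. {..a}))"
      by (auto simp: Int_stable_def)
    show ?thesis
    proof (rule sigma_sets_induct_disjoint[OF st _ that[unfolded sb]])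
      fix A :: "real set" assume "A \<in> range (\<lambda>a. {..a})"
      then show "(\<integral>x. indicator A x * f x \<partial>lm T) = 0" using 0 by (auto simp: prim_def)
    next
      fix A :: "real set" assume A: "A \<in> sigma_sets UNIV (range (\<lambda>a. {..a}))" and h: "(\<integral>x. indicator A x * f x \<partial>lm T) = 0"
      have [measurable]: "A \<in> sets borel" using A sb by simp
      have iA: "integrable (lm T) (\<lambda>x. indicator A x * f x)"
        using integrable_real_mult_indicator[OF _ f, of A] by (simp add: mult.commute)
      have "(\<integral>x. indicator (UNIV - A) x * f x \<partial>lm T) = (\<integral>x. f x - indicator A x * f x \<partial>lm T)"
        by (rule Bochner_Integration.integral_cong) (auto simp: indicator_def)
      then show "(\<integral>x. indicator (UNIV - A) x * f x \<partial>lm T) = 0" using h T0 f iA by simp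
    next
      fix A :: "nat \<Rightarrow> real set"
      assume d: "disjoint_family A" and A: "range A \<subseteq> sigma_sets UNIV (range (\<lambda>a. {..a}))"
        and h: "\<And>i. (\<integral>x. indicator (A i) x * f x \<partial>lm T) = 0"
      have [measurable]: "A i \<in> sets borel" for i using A sb by auto
      have "(\<lambda>n. \<integral>x. indicator (\<Union>i<n. A i) x * f x \<partial>lm T) \<longlonglongrightarrow> (\<integral>x. indicator (\<Union>i. A i) x * f x \<partial>lm T)"
      proof (rule integral_dominated_convergence[where w="\<lambda>x. \<bar>f x\<bar>"])
        show "AE x in lm T. (\<lambda>n. indicator (\<Union>i<n. A i) x * f x) \<longlonglongrightarrow> indicator (\<Union>i. A i) x * f x"
          by (intro AE_I2 tendsto_mult tendsto_const LIMSEQ_indicator_UN)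
      qed (use f in \<open>auto simp: indicator_def\<close>)
      moreover have "(\<integral>x. indicator (\<Union>i<n. A i) x * f x \<partial>lm T) = 0" for n
      proof -
        have "indicator (\<Union>i<n. A i) x = (\<Sum>i<n. indicator (A i) x :: real)" for x
          using d by (intro indicator_UN_disjoint) (auto simp: disjoint_family_on_def)
        then have "(\<integral>x. indicator (\<Union>i<n. A i) x * f x \<partial>lm T) = (\<integral>x. (\<Sum>i<n. indicator (A i) x * f x) \<partial>lm T)"
          by (simp add: sum_distrib_right)
        also have "\<dots> = (\<Sum>i<n. \<integral>x. indicator (A i) x * f x \<partial>lm T)"
          by (rule Bochner_Integration.integral_sum)
             (use integrable_real_mult_indicator[OF _ f] in \<open>auto simp: mult.commute\<close>)
        finally show ?thesis using h by simp
      qed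
      ultimately show "(\<integral>x. indicator (\<Union>i. A i) x * f x \<partial>lm T) = 0"
        by (simp add: LIMSEQ_const_iff)
    qed auto
  qed
  show ?thesis
    by (rule density_unique_real[where f'="\<lambda>_. 0"]) (use f main in \<open>auto simp: set_lebesgue_integral_def\<close>)
qed

section \<open>Compactness\<close>

text \<open>The rate \<open>(1/4)^j\<close> is chosen so that Young's inequality can spend a factor
  \<open>2^j\<close> on it and still leave the summable \<open>(1/2)^j\<close>.\<close>

lemma fast_subsequence:
  fixes c :: "nat \<Rightarrow> nat \<Rightarrow> real"
  assumes "\<And>e. 0 < e \<Longrightarrow> \<exists>N. \<forall>m\<ge>N. \<forall>n\<ge>N. c m n \<le> e"
  shows "\<exists>r. strict_mono r \<and> (\<forall>j. \<forall>m\<ge>r j. \<forall>n\<ge>r j. c m n \<le> (1/4)^j)"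
proof -
  have "\<exists>N. \<forall>m\<ge>N. \<forall>n\<ge>N. c m n \<le> (1/4)^j" for j :: nat
    by (rule assms) simp
  then obtain N where N: "\<And>j m n. N j \<le> m \<Longrightarrow> N j \<le> n \<Longrightarrow> c m n \<le> (1/4)^j" by metis
  have "\<exists>r. \<forall>j. N j \<le> r j \<and> r j < r (Suc j)"
  proof (rule dependent_nat_choice)
    show "\<exists>x. N 0 \<le> x" by blast
    show "\<exists>y. N (Suc n) \<le> y \<and> x < y" for x n
      by (rule exI[of _ "max (N (Suc n)) (Suc x)"]) auto
  qed
  then obtain r where r: "\<And>j. N j \<le> r j" "\<And>j. r j < r (Suc j)" by blast
  have "strict_mono r" using r(2) by (simp add: strict_mono_Suc_iff)
  then show ?thesis using N r(1) by (meson order_trans)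
qed

text \<open>Beppo Levi: the integrals have a finite sum, hence the sum of the functions is finite
  almost everywhere.\<close>

lemma AE_summable:
  fixes f :: "nat \<Rightarrow> 'a \<Rightarrow> real"
  assumes int: "\<And>n. integrable M (f n)" and nn: "\<And>n x. 0 \<le> f n x" and C: "\<And>n. integral\<^sup>L M (f n) \<le> C * (1/2)^n"
  shows "AE x in M. summable (\<lambda>n. f n x)"
proof -
  have [measurable]: "\<And>n. f n \<in> borel_measurable M" using int by auto
  have C0: "0 \<le> C" 
  proof -
    have "0 \<le> integral\<^sup>L M (f 0)" using nn by simp
    then show ?thesis using C[of 0] by simp
  qed
  have "(\<integral>\<^sup>+x. (\<Sum>n. ennreal (f n x)) \<partial>M) = (\<Sum>n. \<integral>\<^sup>+x. ennreal (f n x) \<partial>M)"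
    by (rule nn_integral_suminf) simp
  also have "\<dots> \<le> (\<Sum>n. ennreal (C * (1/2)^n))"
  proof (rule suminf_le)
    show "(\<integral>\<^sup>+x. ennreal (f n x) \<partial>M) \<le> ennreal (C * (1/2)^n)" for n
      by (subst nn_integral_eq_integral) (use int nn C in \<open>auto intro!: ennreal_leI\<close>)
  qed auto
  also have "\<dots> < \<infinity>"
    by (subst suminf_ennreal2) (use C0 in \<open>auto intro!: summable_mult summable_geometric\<close>)
  finally have "(\<integral>\<^sup>+x. (\<Sum>n. ennreal (f n x)) \<partial>M) \<noteq> \<infinity>" by simp
  then have "AE x in M. (\<Sum>n. ennreal (f n x)) \<noteq> \<infinity>"
    by (intro nn_integral_PInf_AE) auto
  then show ?thesis
  proof eventually_elim
    fix x assume "(\<Sum>n. ennreal (f n x)) \<noteq> \<infinity>"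
    then show "summable (\<lambda>n. f n x)"
      using summable_suminf_not_top[of "\<lambda>n. f n x"] nn by simp
  qed
qed

lemma sq_integrable_mult:
  fixes f g :: "'a \<Rightarrow> real"
  assumes [measurable]: "f \<in> borel_measurable M" "g \<in> borel_measurable M"
    and "integrable M (\<lambda>z. (f z)\<^sup>2)" "integrable M (\<lambda>z. (g z)\<^sup>2)"
  shows "integrable M (\<lambda>z. f z * g z)"
proof (rule Bochner_Integration.integrable_bound[of M "\<lambda>z. (f z)\<^sup>2 + (g z)\<^sup>2"])
  show "AE z in M. norm (f z * g z) \<le> norm ((f z)\<^sup>2 + (g z)\<^sup>2)"
  proof (rule AE_I2)
    fix z
    have "0 \<le> (\<bar>f z\<bar> - \<bar>g z\<bar>)\<^sup>2" by simp
    then have "2 * (\<bar>f z\<bar> * \<bar>g z\<bar>) \<le> (f z)\<^sup>2 + (g z)\<^sup>2" by (simp add: power2_diff)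
    moreover have "0 \<le> \<bar>f z\<bar> * \<bar>g z\<bar>" by simp
    moreover have "norm (f z * g z) = \<bar>f z\<bar> * \<bar>g z\<bar>" "norm ((f z)\<^sup>2 + (g z)\<^sup>2) = (f z)\<^sup>2 + (g z)\<^sup>2"
      by (simp_all add: abs_mult)
    ultimately show "norm (f z * g z) \<le> norm ((f z)\<^sup>2 + (g z)\<^sup>2)" by linarith
  qed
qed (use assms in auto)

lemma sq_integrable_diff:
  fixes f g :: "'a \<Rightarrow> real"
  assumes "f \<in> borel_measurable M" "g \<in> borel_measurable M"
    and "integrable M (\<lambda>z. (f z)\<^sup>2)" "integrable M (\<lambda>z. (g z)\<^sup>2)"
  shows "integrable M (\<lambda>z. (f z - g z)\<^sup>2)" "integrable M (\<lambda>z. (f z + g z)\<^sup>2)"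
  unfolding power2_diff power2_sum
  using sq_integrable_mult[OF assms] assms(3,4) by (auto simp: mult.assoc)

lemma sq_integrable_imp_integrable:
  fixes f :: "'a \<Rightarrow> real"
  assumes "finite_measure M" "f \<in> borel_measurable M" "integrable M (\<lambda>z. (f z)\<^sup>2)"
  shows "integrable M f"
  using sq_integrable_mult[of f M "\<lambda>_. 1"] assms
  by (simp add: finite_measure.integrable_const)

lemma young_sq: "0 < \<eta> \<Longrightarrow> 2 * (\<bar>a\<bar> * \<bar>b\<bar>) \<le> a\<^sup>2 / \<eta> + \<eta> * b\<^sup>2" for a b \<eta> :: real
proof -
  assume h: "0 < \<eta>"
  have "0 \<le> (\<bar>a\<bar> - \<eta> * \<bar>b\<bar>)\<^sup>2 / \<eta>" using h by simp
  also have "\<dots> = a\<^sup>2 / \<eta> - 2 * (\<bar>a\<bar> * \<bar>b\<bar>) + \<eta> * b\<^sup>2"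
    using h by (simp add: power2_eq_square field_simps)
  finally show ?thesis by simp
qed

text \<open>Riesz-Fischer. A fast subsequence has summable increments almost everywhere and provides
  the limit; Fatou along it carries the Cauchy estimate over to the full sequence.\<close>

lemma L2_complete:
  fixes f :: "nat \<Rightarrow> 'a \<Rightarrow> real"
  assumes fin: "finite_measure M" and [measurable]: "\<And>n. f n \<in> borel_measurable M"
    and sq: "\<And>n. integrable M (\<lambda>z. (f n z)\<^sup>2)"
    and Cauchy: "\<And>e. 0 < e \<Longrightarrow> \<exists>N. \<forall>m\<ge>N. \<forall>n\<ge>N. (\<integral>z. (f m z - f n z)\<^sup>2 \<partial>M) \<le> e"
  shows "\<exists>g r. g \<in> borel_measurable M \<and> integrable M (\<lambda>z. (g z)\<^sup>2) \<and> strict_mono r \<and>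
    (AE z in M. (\<lambda>j. f (r j) z) \<longlonglongrightarrow> g z) \<and> (\<lambda>n. \<integral>z. (f n z - g z)\<^sup>2 \<partial>M) \<longlonglongrightarrow> 0"
proof -
  interpret finite_measure M by fact
  obtain r where r: "strict_mono r" and c: "\<And>j m n. r j \<le> m \<Longrightarrow> r j \<le> n \<Longrightarrow> (\<integral>z. (f m z - f n z)\<^sup>2 \<partial>M) \<le> (1/4)^j"
    using fast_subsequence[of "\<lambda>m n. \<integral>z. (f m z - f n z)\<^sup>2 \<partial>M"] Cauchy by blast
  have isd: "integrable M (\<lambda>z. (f m z - f n z)\<^sup>2)" for m n by (rule sq_integrable_diff) (auto simp: sq)
  let ?d = "\<lambda>j z. \<bar>f (r (Suc j)) z - f (r j) z\<bar>"
  have id: "integrable M (?d j)" for j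
    using sq_integrable_imp_integrable[OF fin, of "\<lambda>z. f (r (Suc j)) z - f (r j) z"] isd by auto
  have "AE z in M. summable (\<lambda>j. ?d j z)"
  proof (rule AE_summable[where C="1 + measure M (space M)"])
    fix j
    \<comment> \<open>Young with weight \<open>(1/2)^j\<close> bounds the increment by its square,
      so that integrals of squares control an \<open>L1\<close> sum on a finite measure
      space.\<close>
    have "?d j z \<le> (f (r (Suc j)) z - f (r j) z)\<^sup>2 * 2^j + (1/2)^j" for z
    proof -
      have "?d j z \<le> 2 * ?d j z" by simp
      moreover have "2 * ?d j z \<le> (f (r (Suc j)) z - f (r j) z)\<^sup>2 * 2^j + (1/2)^j"
        using young_sq[of "(1/2)^j" "f (r (Suc j)) z - f (r j) z" 1]
        by (simp add: power_one_over)
      ultimately show ?thesis by (rule order_trans)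
    qed
    then have "integral\<^sup>L M (?d j) \<le> (\<integral>z. (f (r (Suc j)) z - f (r j) z)\<^sup>2 * 2^j + (1/2)^j \<partial>M)"
      by (intro integral_mono id) (use isd in auto)
    also have "\<dots> = (\<integral>z. (f (r (Suc j)) z - f (r j) z)\<^sup>2 \<partial>M) * 2^j + (1/2)^j * measure M (space M)"
      using isd by simp
    also have "\<dots> \<le> (1/4)^j * 2^j + (1/2)^j * measure M (space M)"
      using c[of j "r (Suc j)" "r j"] strict_mono_less_eq[OF r, of j "Suc j"] by (simp add: mult_right_mono)
    also have "(1/4)^j * 2^j = (1/2::real)^j" by (simp add: power_mult_distrib[symmetric])
    finally show "integral\<^sup>L M (?d j) \<le> (1 + measure M (space M)) * (1/2)^j" by (simp add: algebra_simps)
  qed (use id in auto)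
  then have conv: "AE z in M. convergent (\<lambda>j. f (r j) z)"
  proof eventually_elim
    fix z assume "summable (\<lambda>j. ?d j z)"
    then have "summable (\<lambda>j. f (r (Suc j)) z - f (r j) z)" by (rule summable_rabs_cancel)
    then have "convergent (\<lambda>n. \<Sum>j<n. f (r (Suc j)) z - f (r j) z)" by (simp add: summable_iff_convergent)
    moreover have "(\<Sum>j<n. f (r (Suc j)) z - f (r j) z) = f (r n) z - f (r 0) z" for n
      by (rule sum_lessThan_telescope)
    ultimately have "convergent (\<lambda>n. f (r n) z - f (r 0) z)" by simp
    then show "convergent (\<lambda>j. f (r j) z)"
      using convergent_diff_const_right_iff by blast
  qed
  define g where "g z = lim (\<lambda>j. f (r j) z)" for z
  have gm [measurable]: "g \<in> borel_measurable M" unfolding g_def by measurable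
  have lim: "AE z in M. (\<lambda>j. f (r j) z) \<longlonglongrightarrow> g z"
    using conv by eventually_elim (simp add: g_def convergent_LIMSEQ_iff)
  have fatou: "(\<integral>\<^sup>+z. ennreal ((f n z - g z)\<^sup>2) \<partial>M) \<le> ennreal e"
    if "\<And>m. N \<le> m \<Longrightarrow> (\<integral>z. (f n z - f m z)\<^sup>2 \<partial>M) \<le> e" for n N e
  proof -
    have "(\<integral>\<^sup>+z. ennreal ((f n z - g z)\<^sup>2) \<partial>M) \<le> (\<integral>\<^sup>+z. liminf (\<lambda>j. ennreal ((f n z - f (r j) z)\<^sup>2)) \<partial>M)"
    proof (rule nn_integral_mono_AE)
      show "AE z in M. ennreal ((f n z - g z)\<^sup>2) \<le> liminf (\<lambda>j. ennreal ((f n z - f (r j) z)\<^sup>2))"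
        using lim
      proof eventually_elim
        fix z assume "(\<lambda>j. f (r j) z) \<longlonglongrightarrow> g z"
        then have "(\<lambda>j. ennreal ((f n z - f (r j) z)\<^sup>2)) \<longlonglongrightarrow> ennreal ((f n z - g z)\<^sup>2)"
          by (intro tendsto_intros)
        then show "ennreal ((f n z - g z)\<^sup>2) \<le> liminf (\<lambda>j. ennreal ((f n z - f (r j) z)\<^sup>2))"
          by (metis lim_imp_Liminf[OF trivial_limit_sequentially] order_refl)
      qed
    qed
    also have "\<dots> \<le> liminf (\<lambda>j. \<integral>\<^sup>+z. ennreal ((f n z - f (r j) z)\<^sup>2) \<partial>M)"
      by (rule nn_integral_liminf) simp
    also have "\<dots> \<le> ennreal e"
    proof (rule Liminf_le)
      show "\<forall>\<^sub>F j in sequentially. (\<integral>\<^sup>+z. ennreal ((f n z - f (r j) z)\<^sup>2) \<partial>M) \<le> ennreal e"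
        using eventually_ge_at_top[of N]
      proof eventually_elim
        fix j assume "N \<le> j"
        then have "N \<le> r j" using strict_mono_imp_increasing[OF r, of j] by simp
        then show "(\<integral>\<^sup>+z. ennreal ((f n z - f (r j) z)\<^sup>2) \<partial>M) \<le> ennreal e"
          using that isd[of n "r j"] by (subst nn_integral_eq_integral) (auto intro!: ennreal_leI)
      qed
    qed simp
    finally show ?thesis .
  qed
  \<comment> \<open>The limit is square integrable because it differs from the single member
    \<open>f N\<close> by a square integrable function.\<close>
  obtain N where N: "\<And>m n. N \<le> m \<Longrightarrow> N \<le> n \<Longrightarrow> (\<integral>z. (f m z - f n z)\<^sup>2 \<partial>M) \<le> 1"
    using Cauchy[of 1] by auto
  have "integrable M (\<lambda>z. (f N z - g z)\<^sup>2)"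
  proof (rule integrableI_bounded)
    have "(\<integral>\<^sup>+z. ennreal (norm ((f N z - g z)\<^sup>2)) \<partial>M) \<le> ennreal 1"
      using fatou[of N N 1] N by simp
    then show "(\<integral>\<^sup>+z. ennreal (norm ((f N z - g z)\<^sup>2)) \<partial>M) < \<infinity>"
      by (rule order_le_less_trans) simp
  qed simp
  then have sg: "integrable M (\<lambda>z. (g z)\<^sup>2)"
    using sq_integrable_diff(1)[of "f N" M "\<lambda>z. f N z - g z"] sq by simp
  have "(\<lambda>n. \<integral>z. (f n z - g z)\<^sup>2 \<partial>M) \<longlonglongrightarrow> 0"
  proof (rule LIMSEQ_I)
    fix e :: real assume "0 < e"
    then obtain N where N: "\<And>m n. N \<le> m \<Longrightarrow> N \<le> n \<Longrightarrow> (\<integral>z. (f m z - f n z)\<^sup>2 \<partial>M) \<le> e/2"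
      using Cauchy[of "e/2"] by auto
    have "norm ((\<integral>z. (f n z - g z)\<^sup>2 \<partial>M) - 0) < e" if "N \<le> n" for n
    proof -
      have i: "integrable M (\<lambda>z. (f n z - g z)\<^sup>2)" by (rule sq_integrable_diff) (auto simp: sq sg)
      have "ennreal (\<integral>z. (f n z - g z)\<^sup>2 \<partial>M) \<le> ennreal (e/2)"
        by (subst nn_integral_eq_integral[OF i, symmetric], simp, rule fatou[of N]) (rule N[OF that])
      then have "(\<integral>z. (f n z - g z)\<^sup>2 \<partial>M) \<le> e/2"
        using \<open>0 < e\<close> ennreal_le_iff[of "e/2" "\<integral>z. (f n z - g z)\<^sup>2 \<partial>M"] by linarith
      moreover have "0 \<le> (\<integral>z. (f n z - g z)\<^sup>2 \<partial>M)" by (rule Bochner_Integration.integral_nonneg) simp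
      ultimately show ?thesis using \<open>0 < e\<close> by simp
    qed
    then show "\<exists>no. \<forall>n\<ge>no. norm ((\<integral>z. (f n z - g z)\<^sup>2 \<partial>M) - 0) < e" by blast
  qed
  then show ?thesis using r lim sg gm by (intro exI[of _ g] exI[of _ r] conjI)
qed

text \<open>Near-minimisers of the norm over a decreasing sequence of midpoint-convex sets form a
  Cauchy sequence by the parallelogram law. This replaces weak compactness in \<open>L\<^sup>2\<close>.\<close>

lemma midpoint_convex_Cauchy:
  fixes P :: "nat \<Rightarrow> ('a \<Rightarrow> real) \<Rightarrow> bool"
  assumes meas: "\<And>n f. P n f \<Longrightarrow> f \<in> borel_measurable M"
    and sq: "\<And>n f. P n f \<Longrightarrow> integrable M (\<lambda>z. (f z)\<^sup>2)"
    and C: "\<And>n f. P n f \<Longrightarrow> (\<integral>z. (f z)\<^sup>2 \<partial>M) \<le> C"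
    and mid: "\<And>n f g. P n f \<Longrightarrow> P n g \<Longrightarrow> P n (\<lambda>z. (f z + g z) / 2)"
    and anti: "\<And>n m f. n \<le> m \<Longrightarrow> P m f \<Longrightarrow> P n f"
    and ne: "\<And>n. \<exists>f. P n f"
  shows "\<exists>f. (\<forall>n. P n (f n)) \<and> (\<forall>e>0. \<exists>N. \<forall>m\<ge>N. \<forall>n\<ge>N. (\<integral>z. (f m z - f n z)\<^sup>2 \<partial>M) \<le> e)"
proof -
  define q where "q f = (\<integral>z. (f z)\<^sup>2 \<partial>M)" for f :: "'a \<Rightarrow> real"
  define c where "c n = Inf (q ` {f. P n f})" for n
  have q0: "0 \<le> q f" for f unfolding q_def by simp
  have bdd: "bdd_below (q ` {f. P n f})" for n using q0 by (auto intro!: bdd_belowI[where m=0])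
  have cle: "c n \<le> q f" if "P n f" for n f
    unfolding c_def using that bdd by (intro cInf_lower) auto
  have cmono: "c n \<le> c m" if "n \<le> m" for n m
    unfolding c_def by (rule cInf_superset_mono) (use ne anti that bdd in auto)
  have cC: "c n \<le> C" for n
  proof -
    obtain f where "P n f" using ne by blast
    then show ?thesis using cle[of n f] C[of n f] by (simp add: q_def)
  qed
  \<comment> \<open>The infima increase, since the classes shrink as the index grows, and they are
    at most \<open>C\<close>.\<close>
  have "convergent c"
  proof (rule Bseq_mono_convergent)
    have "norm (c n) \<le> \<bar>c 0\<bar> + \<bar>C\<bar>" for n using cC[of n] cmono[of 0 n] by auto
    then show "Bseq c" by (rule BseqI')
  qed (use cmono in auto)
  then have cau: "Cauchy c" by (simp add: Cauchy_convergent_iff)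
  have "\<exists>f. P n f \<and> q f < c n + 1 / real (Suc n)" for n
  proof -
    have "Inf (q ` {f. P n f}) < c n + 1 / real (Suc n)" unfolding c_def by simp
    then show ?thesis using ne bdd by (subst (asm) cInf_less_iff) auto
  qed
  then obtain f where f: "\<And>n. P n (f n)" "\<And>n. q (f n) < c n + 1 / real (Suc n)" by metis
  have key: "(\<integral>z. (f m z - f n z)\<^sup>2 \<partial>M) \<le> 2 * (c m - c n) + 4 / real (Suc n)" if "n \<le> m" for m n
  proof -
    have Pm: "P n (f m)" using anti[OF that f(1)] .
    have fm: "f m \<in> borel_measurable M" "f n \<in> borel_measurable M" using meas f(1) by auto
    have i: "integrable M (\<lambda>z. (f m z)\<^sup>2)" "integrable M (\<lambda>z. (f n z)\<^sup>2)" using sq f(1) by auto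
    note id = sq_integrable_diff[OF fm i]
    \<comment> \<open>The midpoint of \<open>f m\<close> and \<open>f n\<close> competes for the
      infimum \<open>c n\<close>, so its norm cannot drop far below theirs. The parallelogram law
      then leaves only \<open>2 * (c m - c n)\<close> and the slack of the near-minimisers.\<close>
    have "4 * q (\<lambda>z. (f m z + f n z) / 2) = (\<integral>z. (f m z + f n z)\<^sup>2 \<partial>M)"
      unfolding q_def by (simp add: power_divide)
    moreover have "c n \<le> q (\<lambda>z. (f m z + f n z) / 2)" by (rule cle[OF mid[OF Pm f(1)]])
    moreover have "(\<integral>z. (f m z - f n z)\<^sup>2 \<partial>M) + (\<integral>z. (f m z + f n z)\<^sup>2 \<partial>M) = 2 * q (f m) + 2 * q (f n)"
    proof -
      have "(\<integral>z. (f m z - f n z)\<^sup>2 \<partial>M) + (\<integral>z. (f m z + f n z)\<^sup>2 \<partial>M) = (\<integral>z. (f m z - f n z)\<^sup>2 + (f m z + f n z)\<^sup>2 \<partial>M)"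
        using id by simp
      also have "\<dots> = (\<integral>z. 2 * (f m z)\<^sup>2 + 2 * (f n z)\<^sup>2 \<partial>M)"
        by (simp add: power2_diff power2_sum algebra_simps)
      finally show ?thesis using i by (simp add: q_def)
    qed
    moreover have "1 / real (Suc m) \<le> 1 / real (Suc n)" using that by (simp add: frac_le)
    ultimately show ?thesis using f(2)[of m] f(2)[of n] by simp
  qed
  have "\<exists>N. \<forall>m\<ge>N. \<forall>n\<ge>N. (\<integral>z. (f m z - f n z)\<^sup>2 \<partial>M) \<le> e" if "0 < e" for e
  proof -
    have "\<exists>N1. \<forall>m\<ge>N1. \<forall>n\<ge>N1. dist (c m) (c n) < e/4"
      by (rule metric_CauchyD[OF cau]) (use that in simp)
    then obtain N1 where N1: "\<And>m n. N1 \<le> m \<Longrightarrow> N1 \<le> n \<Longrightarrow> \<bar>c m - c n\<bar> < e/4"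
      unfolding dist_real_def by blast
    obtain N2 :: nat where N2: "8 / e < real N2" using reals_Archimedean2 by blast
    have N2': "4 / real (Suc n) \<le> e/2" if "N2 \<le> n" for n
    proof -
      have "8 / e < real (Suc n)" using N2 that by simp
      then show ?thesis using \<open>0 < e\<close> by (simp add: field_simps)
    qed
    have "(\<integral>z. (f m z - f n z)\<^sup>2 \<partial>M) \<le> e" if "max N1 N2 \<le> m" "max N1 N2 \<le> n" for m n
    proof (cases "n \<le> m")
      case True
      have "\<bar>c m - c n\<bar> < e/4" "4 / real (Suc n) \<le> e/2" using N1[of m n] N2'[of n] that by auto
      then show ?thesis using key[OF True] by argo
    next
      case False
      have "\<bar>c m - c n\<bar> < e/4" "4 / real (Suc m) \<le> e/2" using N1[of m n] N2'[of m] that by auto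
      then have "(\<integral>z. (f n z - f m z)\<^sup>2 \<partial>M) \<le> e" using key[of m n, OF less_imp_le] False unfolding not_le by argo
      then show ?thesis by (simp add: power2_commute)
    qed
    then show ?thesis by blast
  qed
  then show ?thesis using f(1) by blast
qed

text \<open>The functions may be discontinuous: equicontinuity is required only up to
  \<open>e\<close> and only for large indices, as discrete reconstructions provide it. The usual
  proof survives, with a diagonal subsequence on a countable dense set and a finite cover of the
  compact closure of \<open>S\<close>, because the modulus is used only beyond
  \<open>N\<close>.\<close>

lemma approximate_Arzela_Ascoli:
  fixes f :: "nat \<Rightarrow> 'a::euclidean_space \<Rightarrow> 'b::{real_normed_vector,heine_borel}"
  assumes bd: "bounded S" and B: "\<And>n x. x \<in> S \<Longrightarrow> norm (f n x) \<le> B"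
    and eq: "\<And>e. 0 < e \<Longrightarrow> \<exists>d>0. \<exists>N. \<forall>n\<ge>N. \<forall>x\<in>S. \<forall>y\<in>S. dist x y < d \<longrightarrow> norm (f n x - f n y) < e"
  shows "\<exists>r::nat\<Rightarrow>nat. strict_mono r \<and> (\<forall>e>0. \<exists>N. \<forall>m\<ge>N. \<forall>n\<ge>N. \<forall>x\<in>S. norm (f (r m) x - f (r n) x) < e)"
proof -
  obtain A where A: "countable A" "A \<subseteq> S" "S \<subseteq> closure A" using separable by metis
  obtain r where r: "strict_mono r" "\<And>x. x \<in> A \<Longrightarrow> \<exists>l. (\<lambda>n. f (r n) x) \<longlonglongrightarrow> l"
    using function_convergent_subsequence[OF A(1), of f B] B A(2) by blast
  have main: "\<exists>N. \<forall>m\<ge>N. \<forall>n\<ge>N. \<forall>x\<in>S. norm (f (r m) x - f (r n) x) < e" if "0 < e" for e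
  proof -
    obtain d N where d: "0 < d" and N: "\<And>n x y. N \<le> n \<Longrightarrow> x \<in> S \<Longrightarrow> y \<in> S \<Longrightarrow> dist x y < d \<Longrightarrow> norm (f n x - f n y) < e/3"
    proof -
      have "0 < e/3" using \<open>0 < e\<close> by simp
      from eq[OF this] show ?thesis using that by blast
    qed
    have "closure S \<subseteq> (\<Union>a\<in>A. ball a d)"
    proof
      fix x assume "x \<in> closure S"
      then have "x \<in> closure A" using A(3) closure_minimal closed_closure by blast
      then show "x \<in> (\<Union>a\<in>A. ball a d)" using d by (auto simp: closure_approachable)
    qed
    moreover have "compact (closure S)" using bd by simp
    ultimately obtain A' where A': "A' \<subseteq> A" "finite A'" "closure S \<subseteq> (\<Union>a\<in>A'. ball a d)"
      using compactE_image[of "closure S" A "\<lambda>a. ball a d"] by (metis open_ball)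
    have "\<exists>n0. \<forall>m\<ge>n0. \<forall>n\<ge>n0. norm (f (r m) a - f (r n) a) < e/3" if "a \<in> A" for a
    proof -
      have "Cauchy (\<lambda>n. f (r n) a)" using r(2)[OF that] LIMSEQ_imp_Cauchy by blast
      then show ?thesis unfolding dist_norm[symmetric] by (rule metric_CauchyD) (use \<open>0 < e\<close> in simp)
    qed
    then obtain n0 where n0: "\<And>a m n. a \<in> A \<Longrightarrow> n0 a \<le> m \<Longrightarrow> n0 a \<le> n \<Longrightarrow> norm (f (r m) a - f (r n) a) < e/3" by metis
    define N' where "N' = Max (insert N (n0 ` A'))"
    have N': "N \<le> N'" "\<And>a. a \<in> A' \<Longrightarrow> n0 a \<le> N'" unfolding N'_def using A'(2) by auto
    have "norm (f (r m) x - f (r n) x) < e" if mn: "N' \<le> m" "N' \<le> n" and x: "x \<in> S" for m n x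
    proof -
      have "x \<in> closure S" using x closure_subset by (rule subsetD[rotated])
      then have "x \<in> (\<Union>a\<in>A'. ball a d)" by (rule subsetD[OF A'(3)])
      then obtain a where a: "a \<in> A'" "dist a x < d" by auto
      then have aS: "a \<in> S" "a \<in> A" using A'(1) A(2) by auto
      have "N \<le> r m" "N \<le> r n" using strict_mono_imp_increasing[OF r(1)] mn N'(1) by (meson order_trans)+
      then have "norm (f (r m) x - f (r m) a) < e/3" "norm (f (r n) a - f (r n) x) < e/3"
        using N a(2) x aS by (auto simp: dist_commute)
      moreover have "norm (f (r m) a - f (r n) a) < e/3"
        using n0[OF aS(2)] N'(2)[OF a(1)] mn by auto
      moreover have "norm (f (r m) x - f (r n) x) = norm ((f (r m) x - f (r m) a) + (f (r m) a - f (r n) a) + (f (r n) a - f (r n) x))" by simp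
      ultimately show ?thesis using norm_triangle_ineq[of "(f (r m) x - f (r m) a) + (f (r m) a - f (r n) a)" "f (r n) a - f (r n) x"]
          norm_triangle_ineq[of "f (r m) x - f (r m) a" "f (r m) a - f (r n) a"] by linarith
    qed
    then show ?thesis by blast
  qed
  show ?thesis by (intro exI[of _ r] conjI allI impI r(1) main)
qed

section \<open>Test functions on the unit interval\<close>

text \<open>On the real line the only basis vector is 1, so the directional Frechet derivatives in
  \<open>Ck\<close> reduce to the ordinary derivative and smoothness becomes a matter of induction
  over \<open>k\<close>.\<close>

lemma Ck_SucI:
  fixes f :: "real \<Rightarrow> real"
  assumes "\<And>x. (f has_real_derivative f' x) (at x)" "Ck k f'"
  shows "Ck (Suc k) f"
proof -
  have "frechet_derivative f (at x) 1 = f' x" for x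
  proof -
    have "(*) (f' x) = frechet_derivative f (at x)"
      using assms(1)[of x] by (intro frechet_derivative_at) (simp add: has_field_derivative_def)
    from fun_cong[OF this, of 1] show ?thesis by simp
  qed
  then have "(\<lambda>x. frechet_derivative f (at x) 1) = f'" by auto
  then show ?thesis using assms
    by (auto simp: real_differentiable_def)
qed

lemma Ck_SucD:
  fixes f :: "real \<Rightarrow> real"
  assumes "Ck (Suc k) f"
  shows "(f has_real_derivative deriv f x) (at x)" "Ck k (deriv f)"
proof -
  have d: "f differentiable at x" for x using assms by simp
  then show *: "(f has_real_derivative deriv f x) (at x)" for x
    using DERIV_deriv_iff_real_differentiable by blast
  have "frechet_derivative f (at x) 1 = deriv f x" for x
  proof -
    have "(*) (deriv f x) = frechet_derivative f (at x)"
      using *[of x] by (intro frechet_derivative_at) (simp add: has_field_derivative_def)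
    from fun_cong[OF this, of 1] show ?thesis by simp
  qed
  then have "(\<lambda>x. frechet_derivative f (at x) 1) = deriv f" by auto
  then show "Ck k (deriv f)" using assms by simp
qed

lemma Ck_continuous: "Ck k f \<Longrightarrow> continuous_on UNIV f"
  by (cases k) (auto intro!: continuous_at_imp_continuous_on differentiable_imp_continuous_within)

text \<open>Not immediate from the recursion, which asks for continuity only of the highest
  derivatives; differentiability supplies it at the bottom of the induction.\<close>

lemma Ck_mono_Suc: "Ck (Suc k) (f :: real \<Rightarrow> real) \<Longrightarrow> Ck k f"
proof (induct k arbitrary: f)
  case 0 
  show ?case unfolding Ck.simps(1) by (rule Ck_continuous[OF 0])
next
  case (Suc k)
  show ?case by (rule Ck_SucI[OF Ck_SucD(1)[OF Suc.prems] Suc.hyps[OF Ck_SucD(2)[OF Suc.prems]]])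
qed

lemma Ck_cmult: "Ck k (f :: real \<Rightarrow> real) \<Longrightarrow> Ck k (\<lambda>x. c * f x)"
proof (induct k arbitrary: f)
  case 0 then show ?case by (auto intro!: continuous_intros)
next
  case (Suc k)
  show ?case
    by (rule Ck_SucI[of _ "\<lambda>x. c * deriv f x"])
       (use Ck_SucD[OF Suc.prems] Suc.hyps in \<open>auto intro!: derivative_eq_intros\<close>)
qed

lemma Ck_add: "Ck k (f :: real \<Rightarrow> real) \<Longrightarrow> Ck k g \<Longrightarrow> Ck k (\<lambda>x. f x + g x)"
proof (induct k arbitrary: f g)
  case 0 then show ?case by (auto intro!: continuous_intros)
next
  case (Suc k)
  show ?case
    by (rule Ck_SucI[of _ "\<lambda>x. deriv f x + deriv g x"])
       (use Ck_SucD[OF Suc.prems(1)] Ck_SucD[OF Suc.prems(2)] Suc.hyps in \<open>auto intro!: derivative_eq_intros\<close>)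
qed

lemma Ck_mult: "Ck k (f :: real \<Rightarrow> real) \<Longrightarrow> Ck k g \<Longrightarrow> Ck k (\<lambda>x. f x * g x)"
proof (induct k arbitrary: f g)
  case 0 then show ?case by (auto intro!: continuous_intros)
next
  case (Suc k)
  note f = Ck_SucD[OF Suc.prems(1)] note g = Ck_SucD[OF Suc.prems(2)]
  note lower = Ck_mono_Suc[OF Suc.prems(1)] Ck_mono_Suc[OF Suc.prems(2)]
  show ?case
  proof (rule Ck_SucI[of _ "\<lambda>x. deriv f x * g x + f x * deriv g x"])
    show "((\<lambda>x. f x * g x) has_real_derivative deriv f x * g x + f x * deriv g x) (at x)" for x
      using DERIV_mult[OF f(1)[of x] g(1)[of x]] by (simp add: algebra_simps)
    show "Ck k (\<lambda>x. deriv f x * g x + f x * deriv g x)"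
      by (intro Ck_add Suc.hyps f(2) g(2) lower)
  qed
qed

lemma Ck_affine: "Ck k (f :: real \<Rightarrow> real) \<Longrightarrow> Ck k (\<lambda>x. f (a * x + b))"
proof (induct k arbitrary: f)
  case 0
  then have "continuous_on UNIV f" by simp
  then show ?case by (auto intro!: continuous_on_compose2[of UNIV f] continuous_intros)
next
  case (Suc k)
  note f = Ck_SucD[OF Suc.prems]
  show ?case
  proof (rule Ck_SucI[of _ "\<lambda>x. a * deriv f (a * x + b)"])
    show "((\<lambda>x. f (a * x + b)) has_real_derivative a * deriv f (a * x + b)) (at x)" for x
    proof -
      have "((\<lambda>x. a * x + b) has_real_derivative a) (at x)" by (auto intro!: derivative_eq_intros)
      from DERIV_chain2[OF f(1) this] show ?thesis by (simp add: mult.commute)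
    qed
    show "Ck k (\<lambda>x. a * deriv f (a * x + b))" by (intro Ck_cmult Suc.hyps f(2))
  qed
qed

text \<open>The functions \<open>x^(-n) * exp (-1/x)\<close>, extended by 0, form a family closed
  under differentiation up to linear combinations. Keeping the power as a parameter makes smoothness
  a plain induction.\<close>

definition flat :: "nat \<Rightarrow> real \<Rightarrow> real" where
  "flat n x = (if x \<le> 0 then 0 else (1/x)^n * exp (- (1/x)))"

lemma flat_tendsto_0: "((\<lambda>x. flat n x) \<longlongrightarrow> 0) (at 0)"
proof -
  have "((\<lambda>y::real. y^n / exp y) \<longlongrightarrow> 0) at_top" by (rule tendsto_power_div_exp_0)
  then have "((\<lambda>x. (inverse x)^n / exp (inverse x)) \<longlongrightarrow> (0::real)) (at_right 0)"
    by (rule filterlim_compose) (rule filterlim_inverse_at_top_right)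
  then have r: "((\<lambda>x. flat n x) \<longlongrightarrow> 0) (at_right 0)"
    by (rule Lim_transform_eventually)
       (auto simp: eventually_at_right_field flat_def exp_minus field_simps intro!: exI[of _ 1])
  have l: "((\<lambda>x. flat n x) \<longlongrightarrow> 0) (at_left 0)"
    by (rule Lim_transform_eventually[OF tendsto_const])
       (auto simp: eventually_at_left_field flat_def intro!: exI[of _ "-1"])
  show ?thesis using l r by (simp add: filterlim_split_at)
qed

lemma flat_deriv: "(flat n has_real_derivative (- real n) * flat (Suc n) x + flat (n + 2) x) (at x)"
proof -
  consider "x < 0" | "x = 0" | "0 < x" by linarith
  then show ?thesis
  proof cases
    case 1
    have "((\<lambda>_. 0) has_real_derivative 0) (at x)" by simp
    moreover have "eventually (\<lambda>y. flat n y = 0) (nhds x)"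
      using eventually_nhds_in_open[of "{..<0}" x] 1 by (auto elim!: eventually_mono simp: flat_def)
    ultimately have "(flat n has_real_derivative 0) (at x)"
      by (subst DERIV_cong_ev[OF refl _ refl]) auto
    then show ?thesis using 1 by (simp add: flat_def)
  next
    \<comment> \<open>At 0 the difference quotient of \<open>flat n\<close> is
      \<open>flat (Suc n)\<close>, which tends to 0.\<close>
    case 2
    have "((\<lambda>y. flat (Suc n) y) \<longlongrightarrow> 0) (at 0)" by (rule flat_tendsto_0)
    then have "((\<lambda>y. (flat n y - flat n 0) / (y - 0)) \<longlongrightarrow> 0) (at 0)"
      by (rule Lim_transform_eventually) (auto simp: flat_def eventually_at_filter)
    then have "(flat n has_real_derivative 0) (at 0)" by (simp add: has_field_derivative_iff)
    then show ?thesis using 2 by (simp add: flat_def)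
  next
    case 3
    have d: "((\<lambda>x. (1/x)^n * exp (- (1/x))) has_real_derivative 
        (- real n) * ((1/x)^(Suc n) * exp (- (1/x))) + (1/x)^(n+2) * exp (- (1/x))) (at x)"
    proof -
      have i: "((\<lambda>x. 1/x) has_real_derivative - ((1/x)^2)) (at x)"
        using 3 by (auto intro!: derivative_eq_intros simp: power2_eq_square)
      have e: "((\<lambda>x. exp (- (1/x))) has_real_derivative exp (- (1/x)) * - (- ((1/x)^2))) (at x)"
        by (rule DERIV_fun_exp[OF DERIV_minus[OF i]])
      have "real n * (- (y^2) * y^(n - Suc 0)) * E + E * - (- (y^2)) * y^n = (- real n) * (y^(Suc n) * E) + y^(n+2) * E" for y E :: real
        by (cases n) (auto simp: power_add power2_eq_square algebra_simps)
      from DERIV_cong[OF DERIV_mult[OF DERIV_power[OF i, of n] e] this] show ?thesis .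
    qed
    have "eventually (\<lambda>y. flat n y = (1/y)^n * exp (- (1/y))) (nhds x)"
      using eventually_nhds_in_open[of "{0<..}" x] 3 by (auto elim!: eventually_mono simp: flat_def)
    then have "(flat n has_real_derivative (- real n) * ((1/x)^(Suc n) * exp (- (1/x))) + (1/x)^(n+2) * exp (- (1/x))) (at x)"
      using d by (subst DERIV_cong_ev[OF refl _ refl])
    then show ?thesis using 3 by (simp add: flat_def)
  qed
qed

lemma Ck_flat: "Ck k (flat n)"
proof (induct k arbitrary: n)
  case 0
  have "continuous_on UNIV (flat n)"
    using flat_deriv DERIV_isCont by (blast intro: continuous_at_imp_continuous_on)
  then show ?case by simp
next
  case (Suc k)
  show ?case by (rule Ck_SucI[OF flat_deriv]) (intro Ck_add Ck_cmult Suc)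
qed

text \<open>A bump that is positive exactly on \<open>(a,b)\<close>. Dilating both factors by
  \<open>Suc n\<close> makes it tend to the indicator of that interval; the arguments have the form
  expected by \<open>Ck_affine\<close>.\<close>

definition hat :: "real \<Rightarrow> real \<Rightarrow> nat \<Rightarrow> real \<Rightarrow> real" where
  "hat a b n x = flat 0 (real (Suc n) * x + - real (Suc n) * a) * flat 0 (- real (Suc n) * x + real (Suc n) * b)"

lemma hat_smooth: "smooth_fun (hat a b n)"
  unfolding smooth_fun_def hat_def by (intro allI Ck_mult Ck_affine Ck_flat)

lemma hat_outside: "x \<le> a \<or> b \<le> x \<Longrightarrow> hat a b n x = 0"
proof -
  assume "x \<le> a \<or> b \<le> x"
  then have "real (Suc n) * x \<le> real (Suc n) * a \<or> real (Suc n) * b \<le> real (Suc n) * x"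
    using mult_left_mono[of x a "real (Suc n)"] mult_left_mono[of b x "real (Suc n)"] by simp
  then have "real (Suc n) * x + - real (Suc n) * a \<le> 0 \<or> - real (Suc n) * x + real (Suc n) * b \<le> 0"
    unfolding mult_minus_left by linarith
  then show ?thesis unfolding hat_def flat_def by auto
qed

lemma hat_formula: "a < x \<Longrightarrow> x < b \<Longrightarrow> hat a b n x = exp (- (1 / (x - a) / real (Suc n))) * exp (- (1 / (b - x) / real (Suc n)))"
proof -
  assume h: "a < x" "x < b"
  have e: "real (Suc n) * x + - real (Suc n) * a = real (Suc n) * (x - a)"
    "- real (Suc n) * x + real (Suc n) * b = real (Suc n) * (b - x)" by (simp_all add: algebra_simps)
  have "0 < real (Suc n) * (x - a)" "0 < real (Suc n) * (b - x)" using h by simp_all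
  then show ?thesis unfolding hat_def e flat_def by (simp add: field_simps)
qed

lemma hat_bounds: "0 \<le> hat a b n x" "hat a b n x \<le> 1"
proof -
  have "0 \<le> flat 0 y" "flat 0 y \<le> 1" for y by (auto simp: flat_def)
  then show "0 \<le> hat a b n x" "hat a b n x \<le> 1" unfolding hat_def
    by (auto intro: mult_le_one)
qed

lemma hat_pos: "a < x \<Longrightarrow> x < b \<Longrightarrow> 0 < hat a b n x"
  by (simp add: hat_formula)

lemma hat_tendsto: "(\<lambda>n. hat a b n x) \<longlonglongrightarrow> indicator {a<..<b} x"
proof (cases "a < x \<and> x < b")
  case True
  have "(\<lambda>n. exp (- (1 / (x - a) / real (Suc n))) * exp (- (1 / (b - x) / real (Suc n)))) \<longlonglongrightarrow> exp (- 0) * exp (- 0)"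
    by (intro tendsto_mult tendsto_exp tendsto_minus LIMSEQ_Suc[OF lim_const_over_n])
  then show ?thesis using True by (simp add: hat_formula)
next
  case False
  then show ?thesis by (auto simp: hat_outside not_less)
qed

lemma smooth_continuous: "smooth_fun f \<Longrightarrow> continuous_on UNIV f"
  unfolding smooth_fun_def by (rule Ck_continuous[of 0]) (erule spec)

lemma smooth_borel: "smooth_fun f \<Longrightarrow> f \<in> borel_measurable borel"
  by (rule borel_measurable_continuous_onI) (rule smooth_continuous)

lemma test_fun01I:
  assumes "smooth_fun f" "0 < a" "b < 1" "\<And>x. x \<le> a \<or> b \<le> x \<Longrightarrow> f x = 0"
  shows "test_fun01 f"
proof -
  have "{x. f x \<noteq> 0} \<subseteq> {a..b}"
  proof
    fix x assume "x \<in> {x. f x \<noteq> 0}"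
    then have "\<not> (x \<le> a \<or> b \<le> x)" using assms(4)[of x] by blast
    then show "x \<in> {a..b}" by simp
  qed
  then have c: "closure {x. f x \<noteq> 0} \<subseteq> {a..b}" by (rule closure_minimal) simp
  moreover have "compact (closure {x. f x \<noteq> 0})"
    using c by (meson bounded_closed_interval bounded_subset closed_closure compact_eq_bounded_closed)
  ultimately show ?thesis using assms(1-3) by (auto simp: test_fun01_def)
qed

section \<open>Fundamental theorem of calculus and primitives of test functions\<close>

lemma integral_lm_lborel:
  fixes f :: "real \<Rightarrow> real"
  assumes [measurable]: "f \<in> borel_measurable borel"
  shows "integral\<^sup>L (lm T) f = (\<integral>x. indicator {0<..<T} x * f x \<partial>lborel)"
  using integral_lm(1)[OF assms, of T] by (simp add: set_lebesgue_integral_def integral_completion)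

lemma prim_lborel:
  assumes [measurable]: "f \<in> borel_measurable borel" and x: "0 \<le> x" "x \<le> T"
  shows "prim T f x = (\<integral>y. indicator {0..x} y * f y \<partial>lborel)"
  unfolding prim_def
proof (subst integral_lm_lborel)
  have "AE y in lborel. y \<noteq> 0 \<and> y \<noteq> T" using AE_lborel_singleton[of 0] AE_lborel_singleton[of T] by eventually_elim auto
  then show "(\<integral>y. indicator {0<..<T} y * (indicator {..x} y * f y) \<partial>lborel) = (\<integral>y. indicator {0..x} y * f y \<partial>lborel)"
    by (intro Bochner_Integration.integral_cong_AE; measurable?; eventually_elim) (use x in \<open>auto simp: indicator_def\<close>)
qed measurable

lemma prim_FTC:
  assumes [measurable]: "f' \<in> borel_measurable borel"
    and d: "\<And>y. y \<in> {0..T} \<Longrightarrow> (f has_real_derivative f' y) (at y)" and c: "continuous_on {0..T} f'"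
    and x: "0 \<le> x" "x \<le> T"
  shows "f x = f 0 + prim T f' x"
proof -
  have c': "continuous_on {0..x} f'" using c by (rule continuous_on_subset) (use x in auto)
  have v: "(f has_vector_derivative f' y) (at y within {0..x})" if "0 \<le> y" "y \<le> x" for y
  proof -
    have "(f has_real_derivative f' y) (at y within {0..x})"
      by (rule has_field_derivative_at_within[OF d]) (use x that in simp)
    then show ?thesis by (simp add: has_real_derivative_iff_has_vector_derivative)
  qed
  have "f x - f 0 = prim T f' x"
    unfolding prim_lborel[OF assms(1) x] using integral_FTC_Icc[OF x(1) v c'] by simp
  then show ?thesis by simp
qed

lemma prim_eq_integral:
  assumes "continuous_on UNIV f" and x: "0 \<le> x" "x \<le> T"
  shows "prim T f x = integral {0..x} f"
proof -
  have b: "f \<in> borel_measurable borel" using assms(1) by (rule borel_measurable_continuous_onI)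
  have "set_integrable lborel {0..x} f"
    using borel_integrable_compact[OF compact_Icc continuous_on_subset[OF assms(1)], of 0 x]
    by (simp add: set_integrable_def indicator_scaleR_eq_if)
  then have "(LBINT y:{0..x}. f y) = integral {0..x} f" by (rule set_borel_integral_eq_integral(2))
  then show ?thesis unfolding prim_lborel[OF b x] by (simp add: set_lebesgue_integral_def)
qed

text \<open>Zero mean is what makes the primitive vanish again beyond \<open>b\<close>, so that it
  has compact support.\<close>

lemma test_fun01_primitive:
  assumes sm: "smooth_fun \<psi>" and ab: "0 < a" "a < b" "b < 1" and out: "\<And>x. x \<le> a \<or> b \<le> x \<Longrightarrow> \<psi> x = 0"
    and z: "integral\<^sup>L (lm 1) \<psi> = 0"
  obtains \<phi> where "test_fun01 \<phi>" "\<And>x. (\<phi> has_real_derivative \<psi> x) (at x)"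
proof -
  note c = smooth_continuous[OF sm]
  have ci: "\<psi> integrable_on {u..v}" for u v using continuous_on_subset[OF c] by (intro integrable_continuous_interval) auto
  \<comment> \<open>The value 0 outside \<open>(0,1)\<close> agrees with the integral, which
    vanishes near both ends; it spares intervals reaching beyond 1.\<close>
  define \<phi> where "\<phi> x = (if x \<in> {0<..<1} then integral {0..x} \<psi> else 0)" for x
  have all: "integral {0..1} \<psi> = 0"
    using prim_eq_integral[OF c, of 1 1] prim_end[of \<psi> 1] smooth_borel[OF sm] z by simp
  have low: "integral {0..x} \<psi> = 0" if "x \<le> a" for x
    using integral_cong[of "{0..x}" \<psi> "\<lambda>_. 0"] out that by simp
  have up: "integral {0..x} \<psi> = 0" if "b \<le> x" "x \<le> 1" for x
  proof -
    have "integral {0..x} \<psi> + integral {x..1} \<psi> = integral {0..1} \<psi>"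
      by (rule Henstock_Kurzweil_Integration.integral_combine) (use ab that ci in auto)
    moreover have "integral {x..1} \<psi> = 0" using integral_cong[of "{x..1}" \<psi> "\<lambda>_. 0"] out that by simp
    ultimately show ?thesis using all by simp
  qed
  have out\<phi>: "\<phi> x = 0" if "x \<le> a \<or> b \<le> x" for x
    using that low up by (auto simp: \<phi>_def)
  have d: "(\<phi> has_real_derivative \<psi> x) (at x)" for x
  proof -
    consider "x < a" | "b < x" | "0 < x" "x < 1" using ab by linarith
    then show ?thesis
    proof cases
      case 1
      have "eventually (\<lambda>y. \<phi> y = 0) (nhds x)"
        using eventually_nhds_in_open[of "{..<a}" x] 1 by (auto elim!: eventually_mono simp: out\<phi>)
      then show ?thesis using 1 out by (subst DERIV_cong_ev[OF refl _ refl]) auto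
    next
      case 2
      have "eventually (\<lambda>y. \<phi> y = 0) (nhds x)"
        using eventually_nhds_in_open[of "{b<..}" x] 2 by (auto elim!: eventually_mono simp: out\<phi>)
      then show ?thesis using 2 out by (subst DERIV_cong_ev[OF refl _ refl]) auto
    next
      case 3
      have "((\<lambda>u. integral {0..u} \<psi>) has_vector_derivative \<psi> x) (at x within {0..1})"
        by (rule integral_has_vector_derivative) (use 3 continuous_on_subset[OF c] in auto)
      then have "((\<lambda>u. integral {0..u} \<psi>) has_vector_derivative \<psi> x) (at x within {0<..<1})"
        by (rule has_vector_derivative_within_subset) auto
      then have "((\<lambda>u. integral {0..u} \<psi>) has_vector_derivative \<psi> x) (at x)"
        using 3 by (subst (asm) at_within_open) auto
      then have h: "((\<lambda>u. integral {0..u} \<psi>) has_real_derivative \<psi> x) (at x)"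
        by (simp add: has_real_derivative_iff_has_vector_derivative)
      have "eventually (\<lambda>y. \<phi> y = integral {0..y} \<psi>) (nhds x)"
        using eventually_nhds_in_open[of "{0<..<1}" x] 3 by (auto elim!: eventually_mono simp: \<phi>_def)
      then show ?thesis using h by (subst DERIV_cong_ev[OF refl _ refl])
    qed
  qed
  have "smooth_fun \<phi>" unfolding smooth_fun_def
  proof
    fix k show "Ck k \<phi>"
      by (rule Ck_mono_Suc, rule Ck_SucI[OF d]) (use sm in \<open>simp add: smooth_fun_def\<close>)
  qed
  then have "test_fun01 \<phi>" by (rule test_fun01I[OF _ ab(1) ab(3)]) (rule out\<phi>)
  then show thesis using d that by blast
qed

lemma test_fun01_props:
  assumes "test_fun01 \<phi>"
  shows "deriv \<phi> \<in> borel_measurable borel" "continuous_on UNIV (deriv \<phi>)" "\<phi> 0 = 0" "\<phi> 1 = 0"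
    "\<And>x. (\<phi> has_real_derivative deriv \<phi> x) (at x)"
    "\<And>x. 0 \<le> x \<Longrightarrow> x \<le> 1 \<Longrightarrow> \<phi> x = prim 1 (deriv \<phi>) x"
    "integrable (lm 1) (deriv \<phi>)" "\<phi> \<in> borel_measurable borel" "integral\<^sup>L (lm 1) (deriv \<phi>) = 0"
    "\<exists>B. \<forall>x\<in>{0..1}. \<bar>\<phi> x\<bar> \<le> B" "\<exists>B. \<forall>x\<in>{0..1}. \<bar>deriv \<phi> x\<bar> \<le> B"
proof -
  have sm: "Ck (Suc 0) \<phi>" using assms by (simp add: test_fun01_def smooth_fun_def)
  show d: "(\<phi> has_real_derivative deriv \<phi> x) (at x)" for x by (rule Ck_SucD(1)[OF sm])
  show c: "continuous_on UNIV (deriv \<phi>)" using Ck_SucD(2)[OF sm] by simp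
  then show b: "deriv \<phi> \<in> borel_measurable borel" by (rule borel_measurable_continuous_onI)
  have c2: "continuous_on UNIV \<phi>" using d DERIV_isCont by (blast intro: continuous_at_imp_continuous_on)
  then show "\<phi> \<in> borel_measurable borel" by (rule borel_measurable_continuous_onI)
  have "closure {x. \<phi> x \<noteq> 0} \<subseteq> {0<..<1}" using assms by (simp add: test_fun01_def)
  then have s: "{x. \<phi> x \<noteq> 0} \<subseteq> {0<..<1}" by (rule subset_trans[OF closure_subset])
  show 0: "\<phi> 0 = 0" using subsetD[OF s, of 0] by auto
  show 1: "\<phi> 1 = 0" using subsetD[OF s, of 1] by auto
  show p: "\<phi> x = prim 1 (deriv \<phi>) x" if "0 \<le> x" "x \<le> 1" for x
    using prim_FTC[OF b d continuous_on_subset[OF c] that] 0 by simp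
  have bd: "\<exists>B. \<forall>x\<in>{0..1}. \<bar>h x\<bar> \<le> B" if "continuous_on UNIV h" for h :: "real \<Rightarrow> real"
    using compact_imp_bounded[OF compact_continuous_image[OF continuous_on_subset[OF that] compact_Icc, of 0 1]]
    by (auto simp: bounded_iff)
  show "\<exists>B. \<forall>x\<in>{0..1}. \<bar>\<phi> x\<bar> \<le> B" by (rule bd[OF c2])
  show ex: "\<exists>B. \<forall>x\<in>{0..1}. \<bar>deriv \<phi> x\<bar> \<le> B" by (rule bd[OF c])
  then obtain B where "\<forall>x\<in>{0..1}. \<bar>deriv \<phi> x\<bar> \<le> B" by blast
  then show "integrable (lm 1) (deriv \<phi>)"
    by (intro integrable_bounded_finite[OF finite_measure_lm, of _ _ B] AE_lm_I) (use b in auto)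
  show "integral\<^sup>L (lm 1) (deriv \<phi>) = 0" using p[of 1] 1 prim_end[OF b] by simp
qed

text \<open>With \<open>F = f - prim 1 g\<close>, integration by parts shows that \<open>F\<close>
  annihilates the derivatives of all test functions, that is, smooth functions of zero mean
  supported inside \<open>(0,1)\<close>. A multiple of the fixed bump \<open>h0\<close> corrects the
  mean of any other bump, so \<open>F - c\<close> annihilates every \<open>hat a b n\<close> and,
  letting \<open>n\<close> grow, every interval.\<close>

lemma du_Bois_Reymond:
  assumes f: "integrable (lm 1) f" and g: "integrable (lm 1) g"
    and weak: "\<And>\<phi>. test_fun01 \<phi> \<Longrightarrow> (\<integral>x. f x * deriv \<phi> x \<partial>lm 1) = - (\<integral>x. g x * \<phi> x \<partial>lm 1)"
  shows "\<exists>c. AE x in lm 1. f x = c + prim 1 g x"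
proof -
  have [measurable]: "f \<in> borel_measurable borel" "g \<in> borel_measurable borel"
    using borel_measurable_integrable[OF f] borel_measurable_integrable[OF g] by simp_all
  have ipg: "integrable (lm 1) (prim 1 g)"
    by (rule integrable_bounded_finite[OF finite_measure_lm, where B="\<integral>y. \<bar>g y\<bar> \<partial>lm 1"])
       (use prim_le_integral[OF g] in auto)
  define F where "F x = f x - prim 1 g x" for x
  have [measurable]: "F \<in> borel_measurable borel" unfolding F_def by measurable
  have F: "integrable (lm 1) F" unfolding F_def using f ipg by simp
  have bdi: "integrable (lm 1) (\<lambda>x. h x * k x)" if "integrable (lm 1) h" "k \<in> borel_measurable borel" "\<And>x. x \<in> {0..1} \<Longrightarrow> \<bar>k x\<bar> \<le> B" for h k :: "real \<Rightarrow> real" and B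
  proof (rule Bochner_Integration.integrable_bound[of _ "\<lambda>x. B * h x"])
    have [measurable]: "h \<in> borel_measurable borel" "k \<in> borel_measurable borel" using borel_measurable_integrable[OF that(1)] that(2) by simp_all
    show "(\<lambda>x. h x * k x) \<in> borel_measurable (lm 1)" by measurable
    show "AE x in lm 1. norm (h x * k x) \<le> norm (B * h x)"
    proof (rule AE_lm_I)
      fix x :: real assume "0 < x" "x < 1"
      then have "\<bar>k x\<bar> \<le> \<bar>B\<bar>" using that(3)[of x] by auto
      then show "norm (h x * k x) \<le> norm (B * h x)" 
        using mult_right_mono[of "\<bar>k x\<bar>" "\<bar>B\<bar>" "\<bar>h x\<bar>"] by (simp add: abs_mult mult.commute)
    qed
  qed (use that in simp)
  have Fz: "(\<integral>x. F x * deriv \<phi> x \<partial>lm 1) = 0" if t: "test_fun01 \<phi>" for \<phi>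
  proof -
    note p = test_fun01_props[OF t]
    have "(\<integral>x. deriv \<phi> x * prim 1 g x \<partial>lm 1) = (0 + integral\<^sup>L (lm 1) (deriv \<phi>)) * (0 + integral\<^sup>L (lm 1) g) - 0 * 0 - (\<integral>x. \<phi> x * g x \<partial>lm 1)"
      by (rule ibp[OF p(7) g]) (use p in \<open>auto intro!: AE_lm_I\<close>)
    then have e: "(\<integral>x. prim 1 g x * deriv \<phi> x \<partial>lm 1) = - (\<integral>x. g x * \<phi> x \<partial>lm 1)"
      using p(9) by (simp add: mult.commute)
    obtain B where "\<forall>x\<in>{0..1}. \<bar>deriv \<phi> x\<bar> \<le> B" using p(11) by blast
    then have "integrable (lm 1) (\<lambda>x. f x * deriv \<phi> x)" "integrable (lm 1) (\<lambda>x. prim 1 g x * deriv \<phi> x)"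
      using bdi[OF f p(1)] bdi[OF ipg p(1)] by blast+
    then show ?thesis unfolding F_def left_diff_distrib using weak[OF t] e by simp
  qed
  define h0 where "h0 = hat (1/4) (3/4) 0"
  have h0: "smooth_fun h0" "\<And>x. 0 \<le> h0 x" "\<And>x. h0 x \<le> 1" "\<And>x. x \<le> 1/4 \<or> 3/4 \<le> x \<Longrightarrow> h0 x = 0"
    unfolding h0_def using hat_smooth hat_bounds hat_outside by blast+
  have [measurable]: "h0 \<in> borel_measurable borel" using smooth_borel[OF h0(1)] .
  have ih0: "integrable (lm 1) h0"
    by (rule integrable_bounded_finite[OF finite_measure_lm, where B=1]) (use h0(2,3) in auto)
  define J where "J = integral\<^sup>L (lm 1) h0"
  have J: "J \<noteq> 0"
  proof
    assume "J = 0"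
    then have "AE x in lm 1. h0 x = 0" using integral_nonneg_eq_0_iff_AE[OF ih0] h0(2) by (simp add: J_def)
    then have "AE x in lborel. x \<in> {0<..<1} \<longrightarrow> h0 x = 0" unfolding AE_lm .
    then have "AE x in lborel. x \<notin> {1/4<..<3/4::real}"
      by eventually_elim (use hat_pos[of "1/4" _ "3/4" 0] in \<open>fastforce simp: h0_def\<close>)
    then have "emeasure lborel {1/4<..<3/4::real} = 0"
      by (subst (asm) AE_iff_measurable[of "{1/4<..<3/4}"]) auto
    then show False by simp
  qed
  \<comment> \<open>Forced by testing with \<open>h0\<close>: this value makes \<open>F - c\<close>
    orthogonal to \<open>h0\<close>.\<close>
  define c where "c = (\<integral>x. F x * h0 x \<partial>lm 1) / J"
  have key: "(\<integral>x. (F x - c) * \<psi> x \<partial>lm 1) = 0" if \<psi>: "\<psi> = hat a b n" and ab: "0 < a" "a < b" "b < 1" for \<psi> a b n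
  proof -
    have p: "smooth_fun \<psi>" "\<And>x. 0 \<le> \<psi> x" "\<And>x. \<psi> x \<le> 1" "\<And>x. x \<le> a \<or> b \<le> x \<Longrightarrow> \<psi> x = 0"
      unfolding \<psi> using hat_smooth hat_bounds hat_outside by blast+
    have [measurable]: "\<psi> \<in> borel_measurable borel" using smooth_borel[OF p(1)] .
    have i\<psi>: "integrable (lm 1) \<psi>"
      by (rule integrable_bounded_finite[OF finite_measure_lm, where B=1]) (use p(2,3) in auto)
    define I where "I = integral\<^sup>L (lm 1) \<psi>"
    let ?\<chi> = "\<lambda>x. \<psi> x + (- I / J) * h0 x"
    have "smooth_fun ?\<chi>" using p(1) h0(1) unfolding smooth_fun_def by (intro allI Ck_add Ck_cmult) auto
    moreover have "?\<chi> x = 0" if "x \<le> min a (1/4) \<or> max b (3/4) \<le> x" for x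
      using that p(4) h0(4) by auto
    moreover have "integral\<^sup>L (lm 1) ?\<chi> = 0" using i\<psi> ih0 J by (simp add: I_def J_def)
    moreover have "0 < min a (1/4)" "min a (1/4) < max b (3/4)" "max b (3/4) < 1" using ab by (auto simp: min_def max_def)
    ultimately obtain \<phi> where t: "test_fun01 \<phi>" and d: "\<And>x. (\<phi> has_real_derivative ?\<chi> x) (at x)"
      using test_fun01_primitive[of ?\<chi> "min a (1/4)" "max b (3/4)"] by metis
    have "deriv \<phi> = ?\<chi>" using d DERIV_imp_deriv by blast
    then have z: "(\<integral>x. F x * (\<psi> x + (- I / J) * h0 x) \<partial>lm 1) = 0" using Fz[OF t] by simp
    have iF: "integrable (lm 1) (\<lambda>x. F x * \<psi> x)" "integrable (lm 1) (\<lambda>x. F x * h0 x)"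
      using bdi[OF F, of _ 1] p(2,3) h0(2,3) by auto
    have "(\<integral>x. F x * (\<psi> x + (- I / J) * h0 x) \<partial>lm 1) = (\<integral>x. F x * \<psi> x + (- I / J) * (F x * h0 x) \<partial>lm 1)"
      by (rule Bochner_Integration.integral_cong) (auto simp: algebra_simps)
    also have "\<dots> = (\<integral>x. F x * \<psi> x \<partial>lm 1) - c * I"
      using iF J by (simp add: c_def)
    finally have "(\<integral>x. F x * \<psi> x \<partial>lm 1) = c * I" using z by simp
    then show ?thesis unfolding left_diff_distrib using iF i\<psi> by (simp add: I_def)
  qed
  have iFc: "integrable (lm 1) (\<lambda>x. F x - c)" using F by simp
  have ab: "(\<integral>x. indicator {a<..<b} x * (F x - c) \<partial>lm 1) = 0" if "0 < a" "a < b" "b < 1" for a b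
  proof -
    have "(\<lambda>n. \<integral>x. (F x - c) * hat a b n x \<partial>lm 1) \<longlonglongrightarrow> (\<integral>x. (F x - c) * indicator {a<..<b} x \<partial>lm 1)"
    proof (rule integral_dominated_convergence[where w="\<lambda>x. \<bar>F x - c\<bar>"])
      show "AE x in lm 1. (\<lambda>n. (F x - c) * hat a b n x) \<longlonglongrightarrow> (F x - c) * indicator {a<..<b} x"
        by (intro AE_I2 tendsto_mult tendsto_const hat_tendsto)
      show "AE x in lm 1. norm ((F x - c) * hat a b n x) \<le> \<bar>F x - c\<bar>" for n
        using hat_bounds[of a b n] by (auto simp: abs_mult mult_left_le)
      show "(\<lambda>x. (F x - c) * hat a b n x) \<in> borel_measurable (lm 1)" for n
        using smooth_borel[OF hat_smooth[of a b n]] by auto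
    qed (use iFc in auto)
    then show ?thesis using key[OF refl that] by (simp add: LIMSEQ_const_iff mult.commute)
  qed
  have pz: "prim 1 (\<lambda>x. F x - c) x = 0" if x: "0 < x" "x < 1" for x
  proof -
    \<comment> \<open>Intervals must stay away from 0 to carry test functions; the left end
      \<open>x / (n + 2)\<close> tends to 0 and remains below \<open>x\<close>.\<close>
    have "(\<lambda>n. \<integral>y. indicator {x / real (Suc (Suc n))<..<x} y * (F y - c) \<partial>lm 1) \<longlonglongrightarrow> prim 1 (\<lambda>x. F x - c) x"
      unfolding prim_def
    proof (rule integral_dominated_convergence[where w="\<lambda>x. \<bar>F x - c\<bar>"])
      have "AE y in lm 1. y \<noteq> x \<and> 0 < y" using lm_point_null[of x 1] AE_lm_I[of 1 "\<lambda>y. 0 < y"] by auto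
      then show "AE y in lm 1. (\<lambda>n. indicator {x / real (Suc (Suc n))<..<x} y * (F y - c)) \<longlonglongrightarrow> indicator {..x} y * (F y - c)"
      proof eventually_elim
        fix y assume y: "y \<noteq> x \<and> 0 < y"
        have "(\<lambda>n. x / real (Suc (Suc n))) \<longlonglongrightarrow> 0" by (intro LIMSEQ_Suc[OF LIMSEQ_Suc[OF lim_const_over_n]])
        then have "eventually (\<lambda>n. x / real (Suc (Suc n)) < y) sequentially" using y by (auto intro: order_tendstoD(2))
        then have "eventually (\<lambda>n. indicator {x / real (Suc (Suc n))<..<x} y = (indicator {..x} y :: real)) sequentially"
          by eventually_elim (use y in \<open>auto simp: indicator_def\<close>)
        then show "(\<lambda>n. indicator {x / real (Suc (Suc n))<..<x} y * (F y - c)) \<longlonglongrightarrow> indicator {..x} y * (F y - c)"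
          by (intro tendsto_mult tendsto_const tendsto_eventually)
      qed
    qed (use iFc in \<open>auto simp: indicator_def\<close>)
    moreover have "(\<integral>y. indicator {x / real (Suc (Suc n))<..<x} y * (F y - c) \<partial>lm 1) = 0" for n
      by (rule ab) (use x in \<open>auto simp: field_simps add_pos_nonneg\<close>)
    ultimately show ?thesis by (simp add: LIMSEQ_const_iff)
  qed
  have "AE x in lm 1. F x - c = 0"
  proof (rule prim_zero_imp_AE_zero[OF iFc])
    fix x :: real assume x: "0 < x" "x \<le> 1"
    show "prim 1 (\<lambda>x. F x - c) x = 0"
    proof (cases "x = 1")
      case False then show ?thesis using pz x by simp
    next
      \<comment> \<open>The end point 1 is not covered by \<open>pz\<close> and is reached by
        continuity of the primitive.\<close>
      case True
      have "isCont (prim 1 (\<lambda>x. F x - c)) 1"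
        using prim_continuous[OF iFc] by (simp add: continuous_on_eq_continuous_at)
      then have "(prim 1 (\<lambda>x. F x - c) \<longlongrightarrow> prim 1 (\<lambda>x. F x - c) 1) (at_left 1)"
        by (simp add: isCont_def filterlim_at_split)
      moreover have "(prim 1 (\<lambda>x. F x - c) \<longlongrightarrow> 0) (at_left 1)"
        by (rule Lim_transform_eventually[OF tendsto_const])
           (use pz in \<open>auto simp: eventually_at_left_field intro!: exI[of _ 0]\<close>)
      ultimately show ?thesis using True tendsto_unique[of "at_left (1::real)"] by auto
    qed
  qed
  then have "AE x in lm 1. f x = c + prim 1 g x" by eventually_elim (simp add: F_def)
  then show ?thesis by blast
qed

section \<open>Bernoulli function and meshes\<close>

lemma Bern_diff: "Bern x - Bern (- x) = - x"
proof (cases "x = 0")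
  case False
  define E where "E = exp x"
  have E: "0 < E" "E \<noteq> 1" "1 / E - 1 \<noteq> 0" "E - 1 \<noteq> 0" using False by (auto simp: E_def)
  have "- x / (1 / E - 1) = x * E / (E - 1)"
    using E by (subst frac_eq_eq) (auto simp: algebra_simps)
  moreover have "Bern (- x) = - x / (1 / E - 1)" using False by (simp add: Bern_def E_def exp_minus inverse_eq_divide)
  ultimately have "Bern x - Bern (- x) = (x - x * E) / (E - 1)"
    using False by (simp add: Bern_def E_def diff_divide_distrib)
  also have "\<dots> = - x" using E by (simp add: divide_eq_eq algebra_simps)
  finally show ?thesis .
qed (simp add: Bern_def)

text \<open>For nonzero \<open>x\<close> the sum is \<open>x * coth (x/2)\<close>. Half of it is the
  effective diffusion of the flux: the lower bound gives coercivity, the upper one says that the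
  excess over 1 is of the order of the mesh size.\<close>

lemma Bern_sum_bounds: "2 \<le> Bern x + Bern (- x)" "Bern x + Bern (- x) \<le> 2 + \<bar>x\<bar>"
proof -
  have pos: "2 \<le> Bern x + Bern (- x) \<and> Bern x + Bern (- x) \<le> 2 + x" if x: "0 < x" for x
  proof -
    have e: "1 < exp x" using x by simp
    have "Bern (- x) = Bern x + x" using Bern_diff[of x] by simp
    then have s: "Bern x + Bern (- x) = x * (exp x + 1) / (exp x - 1)"
    proof -
      have "Bern x = x / (exp x - 1)" using x by (simp add: Bern_def)
      then show ?thesis unfolding \<open>Bern (- x) = Bern x + x\<close> using e by (simp add: divide_simps) (simp add: algebra_simps)
    qed
    \<comment> \<open>Clearing denominators, the lower bound reads \<open>0 \<le> f x\<close>. This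
      \<open>f\<close> vanishes at 0 and is nondecreasing because
      \<open>(1 - y) * exp y \<le> 1\<close>.\<close>
    define f where "f y = y * (exp y + 1) - 2 * (exp y - 1)" for y :: real
    have "f 0 \<le> f x"
    proof (rule DERIV_nonneg_imp_nondecreasing[of 0 x f])
      fix y :: real assume y: "0 \<le> y" "y \<le> x"
      have "(f has_real_derivative (y * exp y + (exp y + 1) - 2 * exp y)) (at y)"
        unfolding f_def by (auto intro!: derivative_eq_intros)
      moreover have "0 \<le> y * exp y + (exp y + 1) - 2 * exp y"
      proof -
        have "(1 + - y) * exp y \<le> exp (- y) * exp y" by (intro mult_right_mono exp_ge_add_one_self) simp
        then show ?thesis by (simp add: exp_minus algebra_simps)
      qed
      ultimately show "\<exists>z. (f has_real_derivative z) (at y) \<and> 0 \<le> z" by blast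
    qed (use x in simp)
    then have "2 * (exp x - 1) \<le> x * (exp x + 1)" by (simp add: f_def)
    moreover have "x * (exp x + 1) \<le> (2 + x) * (exp x - 1)"
    proof -
      have "1 + x \<le> exp x" by (rule exp_ge_add_one_self)
      moreover have "(2 + x) * (exp x - 1) - x * (exp x + 1) = 2 * exp x - 2 - 2 * x" by (simp add: algebra_simps)
      ultimately show ?thesis by linarith
    qed
    ultimately show ?thesis unfolding s using e by (simp add: le_divide_eq divide_le_eq)
  qed
  consider "x = 0" | "0 < x" | "0 < - x" by linarith
  then have "2 \<le> Bern x + Bern (- x) \<and> Bern x + Bern (- x) \<le> 2 + \<bar>x\<bar>"
  proof cases
    case 1 then show ?thesis by (simp add: Bern_def)
  next
    case 2 then show ?thesis using pos[of x] by simp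
  next
    case 3 then show ?thesis using pos[of "- x"] by (simp add: add.commute)
  qed
  then show "2 \<le> Bern x + Bern (- x)" "Bern x + Bern (- x) \<le> 2 + \<bar>x\<bar>" by auto
qed

section \<open>Step functions and affine interpolation on a mesh\<close>

lemma prim_indicator:
  assumes "0 \<le> a" "a \<le> b" "b \<le> T" "0 \<le> x" "x \<le> T"
  shows "prim T (indicator {a<..<b}) x = max 0 (min x b - a)"
proof -
  have "prim T (indicator {a<..<b}) x = (\<integral>y. indicator {a<..max a (min x b)} y \<partial>lm T)"
    unfolding prim_def
  proof (rule Bochner_Integration.integral_cong_AE)
    show "AE y in lm T. indicator {..x} y * indicator {a<..<b} y = (indicator {a<..max a (min x b)} y :: real)"
      using lm_point_null[of b T]
    proof eventually_elim
      fix y assume "y \<noteq> b"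
      then show "indicator {..x} y * indicator {a<..<b} y = (indicator {a<..max a (min x b)} y :: real)"
        using assms(2) by (auto simp: indicator_def max_def min_def split: if_splits)
    qed
  qed auto
  also have "\<dots> = max a (min x b) - a"
    by (rule integral_lm_Ioc) (use assms in \<open>auto simp: max_def min_def\<close>)
  finally show ?thesis by (simp add: max_def)
qed

lemma integrable_indicator_lm: "integrable (lm T) (\<lambda>x. c * indicator {a<..<b} x :: real)"
  by (rule integrable_bounded_finite[OF finite_measure_lm, where B="\<bar>c\<bar>"]) (auto simp: indicator_def)

lemma prim_sum:
  "finite A \<Longrightarrow> (\<And>i. i \<in> A \<Longrightarrow> integrable (lm T) (f i)) \<Longrightarrow> prim T (\<lambda>y. \<Sum>i\<in>A. f i y) x = (\<Sum>i\<in>A. prim T (f i) x)"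
  unfolding prim_def sum_distrib_left by (rule Bochner_Integration.integral_sum) (rule integrable_trunc)

text \<open>Constant on the dual cells between consecutive nodes, where slopes and fluxes live,
  while \<open>cstep\<close> is constant on the control volumes. The two partitions interlace, which
  is one source of the errors of order h.\<close>

definition dstep :: "mesh \<Rightarrow> (nat \<Rightarrow> real) \<Rightarrow> real \<Rightarrow> real" where
  "dstep M c x = (\<Sum>i\<le>n_cells M. c i * indicator {node M i<..<node M (i + 1)} x)"

definition cstep :: "mesh \<Rightarrow> (nat \<Rightarrow> real) \<Rightarrow> real \<Rightarrow> real" where
  "cstep M v x = v 0 * indicator {0} x
      + (\<Sum>i\<in>{1..n_cells M}. v i * indicator {face M (i - 1)<..<face M i} x)
      + v (n_cells M + 1) * indicator {1} x"

definition grad :: "mesh \<Rightarrow> (nat \<Rightarrow> real) \<Rightarrow> nat \<Rightarrow> real" where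
  "grad M v i = (v (i + 1) - v i) / dual_h M i"

text \<open>Linear interpolation of the nodal values. Defined as a primitive, it comes with its
  derivative \<open>dstep M (grad M v)\<close> and needs no case distinction over cells.\<close>

definition pwaff :: "mesh \<Rightarrow> (nat \<Rightarrow> real) \<Rightarrow> real \<Rightarrow> real" where
  "pwaff M v x = v 0 + prim 1 (dstep M (grad M v)) x"

locale fv_mesh =
  fixes M :: mesh
  assumes mesh: "is_mesh M"
begin

abbreviation "I \<equiv> n_cells M"

lemma face_0: "face M 0 = 0" and face_I: "face M I = 1"
  and face_step: "i < I \<Longrightarrow> face M i < face M (i + 1)"
  using mesh by (auto simp: is_mesh_def)

lemma I_pos: "1 \<le> I"
  using face_0 face_I by (cases "I = 0") auto

lemma face_mono: "i \<le> j \<Longrightarrow> j \<le> I \<Longrightarrow> face M i \<le> face M j"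
proof (induct j)
  case (Suc j)
  show ?case
  proof (cases "i = Suc j")
    case False
    then have "face M i \<le> face M j" using Suc by auto
    then show ?thesis using face_step[of j] Suc.prems by simp
  qed simp
qed simp

lemma face_range: "i \<le> I \<Longrightarrow> 0 \<le> face M i \<and> face M i \<le> 1"
  using face_mono[of 0 i] face_mono[of i I] face_0 face_I by auto

lemma cell_pos: "1 \<le> i \<Longrightarrow> i \<le> I \<Longrightarrow> 0 < cell_h M i"
  using face_step[of "i - 1"] by (auto simp: cell_h_def)

lemma cell_le: "1 \<le> i \<Longrightarrow> i \<le> I \<Longrightarrow> cell_h M i \<le> mesh_size M"
  unfolding mesh_size_def by (rule Max_ge) auto

lemma size_pos: "0 < mesh_size M"
  using cell_pos[of 1] cell_le[of 1] I_pos by auto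

lemma node_0: "node M 0 = 0" and node_end: "node M (I + 1) = 1"
  by (auto simp: node_def)

lemma node_cell: "1 \<le> i \<Longrightarrow> i \<le> I \<Longrightarrow> node M i = (face M (i - 1) + face M i) / 2"
  by (simp add: node_def)

text \<open>A dual cell consists of two half control volumes that meet at the face of the same
  index, each at most h/2 long. For \<open>j = 0\<close> and \<open>j = I\<close> one half is empty,
  since node and face coincide there.\<close>

lemma dual_props:
  assumes "j \<le> I"
  shows "0 < dual_h M j" "dual_h M j \<le> mesh_size M" "node M j \<le> face M j" "face M j \<le> node M (j + 1)"
    "j < I \<Longrightarrow> node M (j + 1) < face M (j + 1)" "0 < j \<Longrightarrow> face M (j - 1) < node M j"
proof -
  have a: "node M j \<le> face M j \<and> face M j - node M j \<le> mesh_size M / 2 \<and> (0 < j \<longrightarrow> node M j < face M j \<and> face M (j - 1) < node M j)"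
  proof (cases "j = 0")
    case True then show ?thesis using face_0 node_0 size_pos by simp
  next
    case False
    then have "node M j = (face M (j - 1) + face M j) / 2" "0 < cell_h M j" "cell_h M j \<le> mesh_size M"
      using node_cell[of j] cell_pos[of j] cell_le[of j] assms by auto
    then show ?thesis by (auto simp: cell_h_def field_simps)
  qed
  have b: "face M j \<le> node M (j + 1) \<and> node M (j + 1) - face M j \<le> mesh_size M / 2 \<and> (j < I \<longrightarrow> node M (j + 1) < face M (j + 1) \<and> face M j < node M (j + 1))"
  proof (cases "j = I")
    case True then show ?thesis using face_I node_end size_pos by simp
  next
    case False
    then have "node M (j + 1) = (face M j + face M (j + 1)) / 2" "0 < cell_h M (j + 1)" "cell_h M (j + 1) \<le> mesh_size M"
      using node_cell[of "j + 1"] cell_pos[of "j + 1"] cell_le[of "j + 1"] assms by auto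
    then show ?thesis by (auto simp: cell_h_def field_simps)
  qed
  have "0 < j \<or> j < I" using I_pos assms by linarith
  then show "0 < dual_h M j" using a b by (auto simp: dual_h_def)
  show "dual_h M j \<le> mesh_size M" using a b by (simp add: dual_h_def)
  show "node M j \<le> face M j" "face M j \<le> node M (j + 1)"
    "j < I \<Longrightarrow> node M (j + 1) < face M (j + 1)" "0 < j \<Longrightarrow> face M (j - 1) < node M j" using a b by auto
qed

lemma node_step: "j \<le> I \<Longrightarrow> node M j < node M (j + 1)"
  using dual_props(1)[of j] by (simp add: dual_h_def)

lemma node_mono: "i \<le> j \<Longrightarrow> j \<le> I + 1 \<Longrightarrow> node M i \<le> node M j"
proof (induct j)
  case (Suc j)
  show ?case
  proof (cases "i = Suc j")
    case False
    then have "node M i \<le> node M j" using Suc by auto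
    then show ?thesis using node_step[of j] Suc.prems by simp
  qed simp
qed simp

lemma node_range: "i \<le> I + 1 \<Longrightarrow> 0 \<le> node M i \<and> node M i \<le> 1"
  using node_mono[of 0 i] node_mono[of i "I + 1"] node_0 node_end by auto

lemma sum_dual: "(\<Sum>i\<le>I. dual_h M i) = 1"
proof -
  have "(\<Sum>i\<le>I. dual_h M i) = (\<Sum>i<I+1. node M (Suc i) - node M i)"
    by (simp add: dual_h_def lessThan_Suc_atMost[symmetric])
  also have "\<dots> = node M (I + 1) - node M 0" by (rule sum_lessThan_telescope)
  finally show ?thesis using node_0 node_end by simp
qed

lemma sum_cell: "j \<le> I \<Longrightarrow> (\<Sum>i=1..j. cell_h M i) = face M j"
  by (induct j) (auto simp: cell_h_def face_0)

lemma dual_interval: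
  assumes "0 \<le> x" "x \<le> 1"
  shows "\<exists>j\<le>I. node M j \<le> x \<and> x \<le> node M (j + 1)"
proof -
  define j where "j = (GREATEST j. j \<le> I \<and> node M j \<le> x)"
  have e: "0 \<le> I \<and> node M 0 \<le> x" using assms node_0 by simp
  have j: "j \<le> I \<and> node M j \<le> x" unfolding j_def by (rule GreatestI_nat[of "\<lambda>j. j \<le> I \<and> node M j \<le> x" 0 I, OF e]) auto
  have "x \<le> node M (j + 1)"
  proof (cases "j = I")
    case True then show ?thesis using node_end assms by simp
  next
    case False
    show ?thesis
    proof (rule ccontr)
      assume "\<not> x \<le> node M (j + 1)"
      then have "j + 1 \<le> j"
        by (intro Greatest_le_nat[of "\<lambda>j. j \<le> I \<and> node M j \<le> x" "j + 1" I, folded j_def]) (use False j in auto)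
      then show False by simp
    qed
  qed
  then show ?thesis using j by blast
qed

definition skel :: "real set" where "skel = node M ` {..I+1} \<union> face M ` {..I}"

lemma finite_skel: "finite skel" by (simp add: skel_def)

lemma AE_skel: "AE x in lm T. x \<notin> skel" by (rule lm_finite_null[OF finite_skel])

text \<open>The left half of dual cell \<open>j\<close> belongs to control volume \<open>j\<close>,
  the right half to control volume \<open>j + 1\<close>; the disjunction records which value
  \<open>cstep\<close> takes.\<close>

lemma locate:
  assumes "0 < x" "x < 1" "x \<notin> skel"
  shows "\<exists>j\<le>I. node M j < x \<and> x < node M (j + 1) \<and> 
    ((x < face M j \<and> 1 \<le> j \<and> face M (j - 1) < x) \<or> (face M j < x \<and> j < I \<and> x < face M (j + 1)))"
proof -
  obtain j where j: "j \<le> I" "node M j \<le> x" "x \<le> node M (j + 1)" using dual_interval[of x] assms by auto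
  have ne: "x \<noteq> node M j" "x \<noteq> node M (j + 1)" "x \<noteq> face M j" using assms(3) j(1) by (auto simp: skel_def)
  have "(x < face M j \<and> 1 \<le> j \<and> face M (j - 1) < x) \<or> (face M j < x \<and> j < I \<and> x < face M (j + 1))"
  proof (cases "x < face M j")
    case True
    then have "0 < j" using face_0 assms(1) by (cases j) auto
    then show ?thesis using True dual_props(6)[OF j(1)] j(2) by auto
  next
    case False
    then have f: "face M j < x" using ne by simp
    then have "j \<noteq> I" using face_I assms(2) by auto
    then show ?thesis using f dual_props(5)[OF j(1)] j by auto
  qed
  then show ?thesis using j ne by (intro exI[of _ j]) auto
qed

lemma dstep_at:
  assumes "j \<le> I" "node M j < x" "x < node M (j + 1)"
  shows "dstep M c x = c j"
proof -
  have "c i * indicator {node M i<..<node M (i + 1)} x = (if i = j then c j else 0)" if "i \<le> I" for i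
  proof (cases "i = j")
    case True then show ?thesis using assms by simp
  next
    case False
    then have "i + 1 \<le> j \<or> j + 1 \<le> i" by linarith
    then have "x \<notin> {node M i<..<node M (i + 1)}"
      using node_mono[of "i + 1" j] node_mono[of "j + 1" i] assms that by auto
    then show ?thesis using False by simp
  qed
  then have "dstep M c x = (\<Sum>i\<le>I. if i = j then c j else 0)" unfolding dstep_def by (intro sum.cong) auto
  then show ?thesis using assms(1) by simp
qed

lemma cstep_at:
  assumes "1 \<le> j" "j \<le> I" "face M (j - 1) < x" "x < face M j"
  shows "cstep M v x = v j"
proof -
  have j1: "j - 1 \<le> I" using assms(2) by (rule le_trans[OF diff_le_self])
  then have x: "x \<noteq> 0" "x \<noteq> 1" using face_range[of "j - 1"] face_range[of j] assms by auto
  have "v i * indicator {face M (i - 1)<..<face M i} x = (if i = j then v j else 0)" if "i \<in> {1..I}" for i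
  proof (cases "i = j")
    case True then show ?thesis using assms by simp
  next
    case False
    have "i \<le> j - 1 \<or> j \<le> i - 1" using that False by auto
    moreover have "i - 1 \<le> I" using that by auto
    ultimately have "face M i \<le> face M (j - 1) \<or> face M j \<le> face M (i - 1)"
      using face_mono[OF _ j1, of i] face_mono[of j "i - 1"] by blast
    then have "x \<notin> {face M (i - 1)<..<face M i}"
      using assms by auto
    then show ?thesis using False by simp
  qed
  then have "(\<Sum>i\<in>{1..I}. v i * indicator {face M (i - 1)<..<face M i} x) = (\<Sum>i\<in>{1..I}. if i = j then v j else 0)"
    by (intro sum.cong) auto
  then show ?thesis using assms x by (simp add: cstep_def)
qed

lemma dstep_borel [measurable]: "dstep M c \<in> borel_measurable borel"
  unfolding dstep_def by measurable

lemma cstep_borel [measurable]: "cstep M c \<in> borel_measurable borel"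
  unfolding cstep_def by measurable

text \<open>All pointwise comparisons between the two partitions are made in this form; the mesh
  points are a null set.\<close>

lemma AE_dual_cell:
  assumes "\<And>j x. j \<le> I \<Longrightarrow> node M j < x \<Longrightarrow> x < node M (j + 1) \<Longrightarrow> 0 < x \<Longrightarrow> x < 1 \<Longrightarrow>
    (x < face M j \<and> 1 \<le> j \<and> face M (j - 1) < x) \<or> (face M j < x \<and> j < I \<and> x < face M (j + 1)) \<Longrightarrow> P x"
  shows "AE x in lm 1. P x"
proof -
  have "AE x in lm 1. 0 < x \<and> x < 1" by (rule AE_lm_I) simp
  with AE_skel[of 1] show ?thesis
proof eventually_elim
  fix x assume "x \<notin> skel" and x: "0 < x \<and> x < 1"
  then obtain j where "j \<le> I" "node M j < x" "x < node M (j + 1)" 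
    "(x < face M j \<and> 1 \<le> j \<and> face M (j - 1) < x) \<or> (face M j < x \<and> j < I \<and> x < face M (j + 1))"
    using locate[of x] by blast
  then show "P x" using assms[of j x] x by blast
qed
qed

lemma dstep_bound: "(\<And>j. j \<le> I \<Longrightarrow> \<bar>c j\<bar> \<le> B) \<Longrightarrow> AE x in lm 1. \<bar>dstep M c x\<bar> \<le> B"
  by (rule AE_dual_cell) (simp add: dstep_at)

lemma dstep_integrable: "integrable (lm 1) (dstep M c)"
  unfolding dstep_def by (intro Bochner_Integration.integrable_sum integrable_indicator_lm)

lemma cstep_bound: "(\<And>j. 1 \<le> j \<Longrightarrow> j \<le> I \<Longrightarrow> \<bar>v j\<bar> \<le> B) \<Longrightarrow> AE x in lm 1. \<bar>cstep M v x\<bar> \<le> B"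
proof (rule AE_dual_cell)
  fix j x assume b: "\<And>j. 1 \<le> j \<Longrightarrow> j \<le> I \<Longrightarrow> \<bar>v j\<bar> \<le> B" and j: "j \<le> I" 
    and c: "(x < face M j \<and> 1 \<le> j \<and> face M (j - 1) < x) \<or> (face M j < x \<and> j < I \<and> x < face M (j + 1))"
  from c show "\<bar>cstep M v x\<bar> \<le> B"
  proof
    assume "x < face M j \<and> 1 \<le> j \<and> face M (j - 1) < x" then show ?thesis using cstep_at[of j x v] b[of j] j by simp
  next
    assume "face M j < x \<and> j < I \<and> x < face M (j + 1)" then show ?thesis using cstep_at[of "j + 1" x v] b[of "j + 1"] j by simp
  qed
qed

lemma cstep_eq_AE: "AE x in lm 1. cstep M v x = (\<Sum>i\<in>{1..I}. v i * indicator {face M (i - 1)<..<face M i} x)"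
  by (rule AE_lm_I) (auto simp: cstep_def)

lemma cstep_integrable: "integrable (lm 1) (cstep M v)"
proof -
  have m: "cstep M v \<in> borel_measurable (lm 1)"
    "(\<lambda>x. \<Sum>i\<in>{1..I}. v i * indicator {face M (i - 1)<..<face M i} x) \<in> borel_measurable (lm 1)"
    by measurable
  show ?thesis unfolding integrable_cong_AE[OF m cstep_eq_AE]
    by (intro Bochner_Integration.integrable_sum integrable_indicator_lm)
qed

lemma prim_dstep:
  assumes "j \<le> I" "node M j \<le> x" "x \<le> node M (j + 1)"
  shows "prim 1 (dstep M c) x = (\<Sum>i<j. c i * dual_h M i) + c j * (x - node M j)"
proof -
  have x: "0 \<le> x" "x \<le> 1" using node_range[of j] node_range[of "j+1"] assms by auto
  have t: "c i * prim 1 (indicator {node M i<..<node M (i + 1)}) x =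
      (if i < j then c i * dual_h M i else if i = j then c j * (x - node M j) else 0)" if "i \<le> I" for i
  proof -
    have "prim 1 (indicator {node M i<..<node M (i + 1)}) x = max 0 (min x (node M (i + 1)) - node M i)"
      by (rule prim_indicator) (use node_range[of i] node_range[of "i+1"] node_step[of i] that x in auto)
    moreover have "i < j \<Longrightarrow> node M (i + 1) \<le> x" using node_mono[of "i+1" j] assms by auto
    moreover have "j < i \<Longrightarrow> x \<le> node M i" using node_mono[of "j+1" i] assms that by auto
    ultimately show ?thesis using node_step[of i] that assms by (auto simp: dual_h_def max_def min_def)
  qed
  have "prim 1 (dstep M c) x = (\<Sum>i\<le>I. prim 1 (\<lambda>x. c i * indicator {node M i<..<node M (i + 1)} x) x)"
    unfolding dstep_def by (rule prim_sum) (rule finite_atMost, rule integrable_indicator_lm)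
  also have "\<dots> = (\<Sum>i\<le>I. if i < j then c i * dual_h M i else if i = j then c j * (x - node M j) else 0)"
    unfolding prim_cmult by (rule sum.cong) (use t in auto)
  also have "\<dots> = (\<Sum>i\<in>{..<j} \<union> {j}. if i < j then c i * dual_h M i else if i = j then c j * (x - node M j) else 0)"
    by (rule sum.mono_neutral_right) (use assms in auto)
  also have "\<dots> = (\<Sum>i<j. c i * dual_h M i) + c j * (x - node M j)"
    by (subst sum.union_disjoint) auto
  finally show ?thesis .
qed

lemma prim_cstep_face:
  assumes "j \<le> I"
  shows "prim 1 (cstep M v) (face M j) = (\<Sum>i=1..j. cell_h M i * v i)"
proof -
  note fj = face_range[OF assms]
  have t: "v i * prim 1 (indicator {face M (i - 1)<..<face M i}) (face M j) = (if i \<le> j then cell_h M i * v i else 0)" if "i \<in> {1..I}" for i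
  proof -
    have "prim 1 (indicator {face M (i - 1)<..<face M i}) (face M j) = max 0 (min (face M j) (face M i) - face M (i - 1))"
      by (rule prim_indicator) (use face_range[of i] face_range[of "i-1"] face_mono[of "i-1" i] that fj in auto)
    moreover have "i \<le> j \<Longrightarrow> face M i \<le> face M j" using face_mono[of i j] assms by auto
    moreover have "j < i \<Longrightarrow> face M j \<le> face M (i - 1)" using face_mono[of j "i - 1"] that by auto
    ultimately show ?thesis using cell_pos[of i] that by (auto simp: cell_h_def max_def min_def)
  qed
  have "prim 1 (cstep M v) (face M j) = prim 1 (\<lambda>x. \<Sum>i\<in>{1..I}. v i * indicator {face M (i - 1)<..<face M i} x) (face M j)"
    by (rule prim_cong_AE[OF _ _ cstep_eq_AE]) measurable
  also have "\<dots> = (\<Sum>i\<in>{1..I}. prim 1 (\<lambda>x. v i * indicator {face M (i - 1)<..<face M i} x) (face M j))"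
    by (rule prim_sum) (rule finite_atLeastAtMost, rule integrable_indicator_lm)
  also have "\<dots> = (\<Sum>i\<in>{1..I}. if i \<le> j then cell_h M i * v i else 0)"
    unfolding prim_cmult by (rule sum.cong) (use t in auto)
  also have "\<dots> = (\<Sum>i\<in>{1..j}. if i \<le> j then cell_h M i * v i else 0)"
    by (rule sum.mono_neutral_right) (use assms in auto)
  finally show ?thesis by simp
qed

lemma dstep_integral: "integral\<^sup>L (lm 1) (dstep M c) = (\<Sum>i\<le>I. c i * dual_h M i)"
proof -
  have "integral\<^sup>L (lm 1) (dstep M c) = prim 1 (dstep M c) 1" by (rule prim_end[symmetric]) measurable
  also have "\<dots> = (\<Sum>i<I. c i * dual_h M i) + c I * (1 - node M I)"
    by (rule prim_dstep) (use node_range[of I] node_end in auto)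
  also have "\<dots> = (\<Sum>i\<le>I. c i * dual_h M i)"
    using node_end by (simp add: lessThan_Suc_atMost[symmetric] dual_h_def)
  finally show ?thesis .
qed

lemma dstep_comp_AE: "AE x in lm 1. f (dstep M c x) = dstep M (\<lambda>i. f (c i)) x"
  by (rule AE_dual_cell) (simp add: dstep_at)

lemma dstep_comp_integral:
  assumes "f \<in> borel_measurable borel"
  shows "(\<integral>x. f (dstep M c x) \<partial>lm 1) = (\<Sum>i\<le>I. f (c i) * dual_h M i)"
proof -
  note assms [measurable]
  have "(\<integral>x. f (dstep M c x) \<partial>lm 1) = integral\<^sup>L (lm 1) (dstep M (\<lambda>i. f (c i)))"
    by (rule Bochner_Integration.integral_cong_AE) (use dstep_comp_AE in auto)
  then show ?thesis by (simp add: dstep_integral)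
qed

lemma grad_telescope: "j \<le> I + 1 \<Longrightarrow> v 0 + (\<Sum>i<j. grad M v i * dual_h M i) = v j"
proof (induct j)
  case (Suc j)
  then have "dual_h M j \<noteq> 0" using dual_props(1)[of j] by simp
  then show ?case using Suc by (simp add: grad_def)
qed simp

lemma pwaff_at:
  assumes "j \<le> I" "node M j \<le> x" "x \<le> node M (j + 1)"
  shows "pwaff M v x = v j + grad M v j * (x - node M j)"
    "pwaff M v x = v (j + 1) - grad M v j * (node M (j + 1) - x)"
proof -
  show 1: "pwaff M v x = v j + grad M v j * (x - node M j)"
    unfolding pwaff_def prim_dstep[OF assms] using grad_telescope[of j v] assms(1) by simp
  have "v (j + 1) - v j = grad M v j * (node M (j + 1) - node M j)"
    using dual_props(1)[OF assms(1)] by (simp add: grad_def dual_h_def)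
  then show "pwaff M v x = v (j + 1) - grad M v j * (node M (j + 1) - x)"
    unfolding 1 by (simp add: algebra_simps)
qed

lemma pwaff_0: "pwaff M v 0 = v 0"
  by (simp add: pwaff_def prim_0)

lemma pwaff_1: "pwaff M v 1 = v (I + 1)"
  using pwaff_at(2)[of I 1 v] node_range[of I] node_end by simp

lemma pwaff_bounds:
  assumes "\<And>i. i \<le> I + 1 \<Longrightarrow> a \<le> v i \<and> v i \<le> b" "0 \<le> x" "x \<le> 1"
  shows "a \<le> pwaff M v x" "pwaff M v x \<le> b"
proof -
  obtain j where j: "j \<le> I" "node M j \<le> x" "x \<le> node M (j + 1)" using dual_interval[of x] assms by auto
  define s where "s = (x - node M j) / dual_h M j"
  have d: "0 < dual_h M j" using dual_props(1)[OF j(1)] .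
  have s: "0 \<le> s" "s \<le> 1" using j d by (auto simp: s_def dual_h_def)
  have e: "pwaff M v x = (1 - s) * v j + s * v (j + 1)"
    unfolding pwaff_at(1)[OF j] grad_def s_def using d by (simp add: field_simps)
  have "(1 - s) * a + s * a \<le> (1 - s) * v j + s * v (j + 1)"
    using assms(1)[of j] assms(1)[of "j + 1"] j s by (intro add_mono mult_left_mono) auto
  then show "a \<le> pwaff M v x" unfolding e by (simp add: algebra_simps)
  have "(1 - s) * v j + s * v (j + 1) \<le> (1 - s) * b + s * b"
    using assms(1)[of j] assms(1)[of "j + 1"] j s by (intro add_mono mult_left_mono) auto
  then show "pwaff M v x \<le> b" unfolding e by (simp add: algebra_simps)
qed

text \<open>On each half of a dual cell both functions take the value of the adjacent node there,
  and the affine one leaves it with slope \<open>grad\<close>.\<close>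

lemma pwaff_cstep_AE:
  "AE x in lm 1. \<bar>pwaff M v x - cstep M v x\<bar> \<le> mesh_size M * \<bar>dstep M (grad M v) x\<bar>"
proof (rule AE_dual_cell)
  fix j x assume j: "j \<le> I" "node M j < x" "x < node M (j + 1)"
    and c: "(x < face M j \<and> 1 \<le> j \<and> face M (j - 1) < x) \<or> (face M j < x \<and> j < I \<and> x < face M (j + 1))"
  have g: "dstep M (grad M v) x = grad M v j" by (rule dstep_at[OF j])
  have h: "x - node M j \<le> mesh_size M" "node M (j + 1) - x \<le> mesh_size M"
    using dual_props(2)[OF j(1)] j by (auto simp: dual_h_def)
  from c show "\<bar>pwaff M v x - cstep M v x\<bar> \<le> mesh_size M * \<bar>dstep M (grad M v) x\<bar>"
  proof
    assume "x < face M j \<and> 1 \<le> j \<and> face M (j - 1) < x"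
    then have "cstep M v x = v j" using cstep_at[of j x v] j by simp
    then show ?thesis using pwaff_at(1)[of j x v] j mult_right_mono[OF h(1), of "\<bar>grad M v j\<bar>"]
      by (simp add: g abs_mult mult.commute[of "\<bar>grad M v j\<bar>"])
  next
    assume "face M j < x \<and> j < I \<and> x < face M (j + 1)"
    then have "cstep M v x = v (j + 1)" using cstep_at[of "j + 1" x v] j by simp
    then show ?thesis using pwaff_at(2)[of j x v] j mult_right_mono[OF h(2), of "\<bar>grad M v j\<bar>"]
      by (simp add: g abs_mult mult.commute[of "\<bar>grad M v j\<bar>"])
  qed
qed

text \<open>The flux contains the mean of two neighbouring values where the limit equation has the
  density itself; mean and cell value differ by half a jump.\<close>

lemma avg_cstep:
  assumes j: "j \<le> I" "(x < face M j \<and> 1 \<le> j \<and> face M (j - 1) < x) \<or> (face M j < x \<and> j < I \<and> x < face M (j + 1))"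
  shows "\<bar>(v j + v (j + 1)) / 2 - cstep M v x\<bar> \<le> mesh_size M / 2 * \<bar>grad M v j\<bar>"
proof -
  have "cstep M v x = v j \<or> cstep M v x = v (j + 1)"
    using j cstep_at[of j x v] cstep_at[of "j + 1" x v] by auto
  then have "\<bar>(v j + v (j + 1)) / 2 - cstep M v x\<bar> = \<bar>v (j + 1) - v j\<bar> / 2"
    by (auto simp: abs_if field_simps)
  also have "\<dots> = dual_h M j / 2 * \<bar>grad M v j\<bar>"
    using dual_props(1)[OF j(1)] by (simp add: grad_def abs_divide)
  also have "\<dots> \<le> mesh_size M / 2 * \<bar>grad M v j\<bar>"
    using dual_props(2)[OF j(1)] by (intro mult_right_mono) auto
  finally show ?thesis .
qed

lemma summation_by_parts:
  fixes F v :: "nat \<Rightarrow> real"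
  shows "(\<Sum>i=1..n. (F i - F (i - 1)) * v i) = F n * v (n + 1) - F 0 * v 0 - (\<Sum>j\<le>n. F j * (v (j + 1) - v j))"
  by (induct n) (auto simp: algebra_simps)

end

section \<open>A priori estimates for the scheme\<close>

locale corrosion_setting =
  fixes d :: corrosion_data
  assumes T_pos: "t_end d > 0" and lam_pos: "lam d > 0" and eps_pos: "eps d > 0"
    and alpha0_pos: "alpha0 d > 0" and alpha1_pos: "alpha1 d > 0"
    and umax_pos: "\<And>s. u_max d s > 0"
    and mk_pos: "\<And>s i. i \<in> {0, 1} \<Longrightarrow> m_c d s i > 0 \<and> k_c d s i > 0"
    and ab_range: "\<And>s i. i \<in> {0, 1} \<Longrightarrow> a_c d s i \<in> {0..1} \<and> b_c d s i \<in> {0..1}"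
    and init_Linf: "\<And>s. Linf_on {0<..<1} (u_init d s)"
    and init_range: "\<And>s. AE x in lebesgue. x \<in> {0<..<1} \<longrightarrow> 0 \<le> u_init d s x \<and> u_init d s x \<le> u_max d s"
begin

abbreviation "T \<equiv> t_end d"

text \<open>Bounds for, in this order, the densities, the charge, the curvature and the slope of the
  potential, the potential, the exponentials at the boundary, the boundary fluxes and the squared
  gradient norms of the densities.\<close>

definition "Cu = u_max d SpP + u_max d SpN"
definition "Crho = 4 * Cu + \<bar>rho_hl d\<bar>"
definition "Cj = Crho / (lam d)\<^sup>2"
definition "CQ = \<bar>V_pot d - dPsi_pzc1 d - dPsi_pzc0 d\<bar> + Cj * (2 + alpha1 d)"
definition "CP = alpha0 d * CQ + \<bar>dPsi_pzc0 d\<bar> + CQ"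
definition "Cexp = exp (3 * (CP + \<bar>V_pot d\<bar>))"
definition "CF = 2 * Cu * Cexp * (\<Sum>s\<in>{SpP, SpN}. \<Sum>i\<in>{0,1}. m_c d s i + k_c d s i)"
definition "CE = 2 * T * ((3 * CQ * Cu)\<^sup>2 / 2 + 2 * CF * Cu) + (1 + eps d) * Cu\<^sup>2"

lemma umax_le: "u_max d s \<le> Cu"
  using umax_pos[of SpP] umax_pos[of SpN] by (cases s) (auto simp: Cu_def)

lemma Cu_pos: "0 < Cu" using umax_pos[of SpP] umax_pos[of SpN] by (simp add: Cu_def)
lemma Crho_pos: "0 < Crho" using Cu_pos by (simp add: Crho_def add_pos_nonneg)
lemma Cj_pos: "0 < Cj" using Crho_pos lam_pos by (simp add: Cj_def)
lemma CQ_pos: "0 < CQ" using Cj_pos alpha1_pos by (simp add: CQ_def add_nonneg_pos)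
lemma CP_pos: "0 < CP" using CQ_pos alpha0_pos by (simp add: CP_def add_nonneg_pos)
lemma Cexp_pos: "0 < Cexp" by (simp add: Cexp_def)

lemma z_bound: "\<bar>z_of s\<bar> \<le> 3" by (cases s) auto

lemma eps_of_range: "0 < eps_of d s" "eps_of d s \<le> 1 + eps d"
  using eps_pos by (cases s; simp)+

text \<open>The factor 3 in \<open>Cexp\<close> is the larger valence in absolute value, and the
  allowance \<open>\<bar>V_pot d\<bar>\<close> covers the argument \<open>V - \<Psi>\<close> at the
  right end.\<close>

lemma exp_le_Cexp:
  assumes "c \<in> {0..1}" "\<bar>p\<bar> \<le> CP + \<bar>V_pot d\<bar>"
  shows "exp (z_of s * c * p) \<le> Cexp" "exp (- z_of s * c * p) \<le> Cexp"
proof -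
  have "\<bar>z_of s * c * p\<bar> = \<bar>z_of s\<bar> * c * \<bar>p\<bar>" using assms by (simp add: abs_mult)
  also have "\<dots> \<le> 3 * 1 * (CP + \<bar>V_pot d\<bar>)"
    using z_bound[of s] assms CP_pos by (intro mult_mono) auto
  finally have "\<bar>z_of s * c * p\<bar> \<le> 3 * (CP + \<bar>V_pot d\<bar>)" by simp
  then show "exp (z_of s * c * p) \<le> Cexp" "exp (- z_of s * c * p) \<le> Cexp"
    by (auto simp: Cexp_def abs_le_iff)
qed

text \<open>Each of the two terms is at most the sum of its rate constants times
  \<open>Cu * Cexp\<close>, which accounts for the factor 2 in \<open>CF\<close>; summing the
  constants over species and ends makes one bound serve all four fluxes.\<close>

lemma boundary_bound:
  assumes v: "0 \<le> v" "v \<le> Cu"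
  shows "\<bar>p\<bar> \<le> CP \<Longrightarrow> \<bar>beta d s 0 p * v - gamma0 d s p\<bar> \<le> CF"
    "\<bar>p\<bar> \<le> CP \<Longrightarrow> \<bar>beta d s 1 (V_pot d - p) * v - gamma1 d s (V_pot d - p)\<bar> \<le> CF"
    "0 < CF"
proof -
  have mk: "0 < m_c d s i" "0 < k_c d s i" if "i \<in> {0,1}" for s i using mk_pos that by auto
  have mkp: "0 \<le> m_c d s i + k_c d s i" if "i \<in> {0,1}" for s i using mk[OF that, of s] by auto
  show "0 < CF" unfolding CF_def using mk[of 0] mk[of 1] Cu_pos Cexp_pos
    by (intro mult_pos_pos) (auto intro!: add_pos_pos)
  have part: "m_c d s i + k_c d s i \<le> (\<Sum>s\<in>{SpP, SpN}. \<Sum>i\<in>{0,1}. m_c d s i + k_c d s i)" if "i \<in> {0,1}" for i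
    using that mkp[of 0 SpP] mkp[of 0 SpN] mkp[of 1 SpP] mkp[of 1 SpN] by (cases s) auto
  have main: "\<bar>beta d s i q * v - c * u_max d s * e\<bar> \<le> CF"
    if i: "i \<in> {0,1}" and q: "\<bar>q\<bar> \<le> CP + \<bar>V_pot d\<bar>" and c: "0 \<le> c" "c \<le> m_c d s i + k_c d s i" and e: "0 \<le> e" "e \<le> Cexp" for i q c e
  proof -
    let ?S = "m_c d s i + k_c d s i"
    have b: "0 \<le> beta d s i q" unfolding beta_def using mk[OF i, of s] by (intro add_nonneg_nonneg mult_nonneg_nonneg) auto
    have "beta d s i q \<le> m_c d s i * Cexp + k_c d s i * Cexp"
      unfolding beta_def using mk[OF i, of s] exp_le_Cexp[OF _ q] ab_range[OF i, of s]
      by (intro add_mono mult_left_mono) auto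
    then have "beta d s i q * v \<le> (?S * Cexp) * Cu"
      using b v mkp[OF i, of s] Cexp_pos by (intro mult_mono) (auto simp: algebra_simps)
    moreover have "0 \<le> beta d s i q * v" using b v by simp
    moreover have "c * u_max d s * e \<le> ?S * Cu * Cexp"
      using c e umax_le[of s] umax_pos[of s] Cu_pos by (intro mult_mono) auto
    moreover have "0 \<le> c * u_max d s * e" using c e umax_pos[of s] by simp
    ultimately have "\<bar>beta d s i q * v - c * u_max d s * e\<bar> \<le> 2 * Cu * Cexp * ?S"
      by (auto simp: abs_le_iff algebra_simps)
    also have "\<dots> \<le> CF" unfolding CF_def using part[OF i] Cu_pos Cexp_pos by (intro mult_left_mono) auto
    finally show ?thesis .
  qed
  show "\<bar>p\<bar> \<le> CP \<Longrightarrow> \<bar>beta d s 0 p * v - gamma0 d s p\<bar> \<le> CF"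
    unfolding gamma0_def using mk[of 0 s] ab_range[of 0 s] exp_le_Cexp(2)[of "b_c d s 0" p s]
    by (intro main) auto
  show "\<bar>p\<bar> \<le> CP \<Longrightarrow> \<bar>beta d s 1 (V_pot d - p) * v - gamma1 d s (V_pot d - p)\<bar> \<le> CF"
    unfolding gamma1_def using mk[of 1 s] ab_range[of 1 s] exp_le_Cexp(1)[of "a_c d s 1" "V_pot d - p" s]
    by (intro main) auto
qed

text \<open>The datum is only Lebesgue measurable; a Borel version is fixed so that it can enter the
  primitives.\<close>

definition u0 :: "species \<Rightarrow> real \<Rightarrow> real" where
  "u0 s = (SOME g. g \<in> borel_measurable borel \<and> (AE x in lborel. x \<in> {0<..<1} \<longrightarrow> u_init d s x = g x))"

lemma u0: "u0 s \<in> borel_measurable borel" "AE x in lborel. x \<in> {0<..<1} \<longrightarrow> u_init d s x = u0 s x"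
proof -
  have m: "(\<lambda>x. indicator {0<..<1} x *\<^sub>R u_init d s x) \<in> borel_measurable (completion lborel)"
    using init_Linf[of s] by (simp add: Linf_on_def set_borel_measurable_def)
  from completion_ex_borel_measurable_real[OF m] obtain g where g: "g \<in> borel_measurable lborel"
    "AE x in lborel. indicator {0<..<1} x *\<^sub>R u_init d s x = g x" by blast
  have "AE x in lborel. x \<in> {0<..<1} \<longrightarrow> u_init d s x = g x" using g(2) by eventually_elim auto
  then have "\<exists>g. g \<in> borel_measurable borel \<and> (AE x in lborel. x \<in> {0<..<1} \<longrightarrow> u_init d s x = g x)"
    using g(1) by (intro exI[of _ g]) simp
  from someI_ex[OF this] show "u0 s \<in> borel_measurable borel" "AE x in lborel. x \<in> {0<..<1} \<longrightarrow> u_init d s x = u0 s x"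
    unfolding u0_def by auto
qed

lemma u0_borel [measurable]: "u0 s \<in> borel_measurable borel" by (rule u0)

lemma u0_bound: "AE x in lm 1. \<bar>u0 s x\<bar> \<le> Cu"
proof -
  have "AE x in lborel. x \<in> {0<..<1} \<longrightarrow> 0 \<le> u_init d s x \<and> u_init d s x \<le> u_max d s"
    using init_range[of s] unfolding AE_completion_iff .
  then show ?thesis unfolding AE_lm using u0(2)[of s]
    by eventually_elim (use umax_le[of s] in auto)
qed

lemma u0_integrable: "integrable (lm 1) (u0 s)"
  by (rule integrable_bounded_finite[OF finite_measure_lm _ u0_bound]) simp

text \<open>Turns the cell means of the scheme into increments of one primitive, which
  telescope.\<close>

lemma u_init_integral:
  assumes "0 \<le> a" "a \<le> b" "b \<le> 1"
  shows "(LINT x:{a<..<b}|lebesgue. u_init d s x) = prim 1 (u0 s) b - prim 1 (u0 s) a"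
proof -
  have m: "(\<lambda>x. indicator {0<..<1} x *\<^sub>R u_init d s x) \<in> borel_measurable lebesgue"
    using init_Linf[of s] by (simp add: Linf_on_def set_borel_measurable_def)
  have "(\<lambda>x. indicator {a<..<b} x *\<^sub>R u_init d s x) = (\<lambda>x. indicator {a<..<b} x * (indicator {0<..<1} x *\<^sub>R u_init d s x))"
    using assms by (auto simp: indicator_def fun_eq_iff)
  moreover have "(\<lambda>x. indicator {a<..<b} x * (indicator {0<..<1} x *\<^sub>R u_init d s x)) \<in> borel_measurable lebesgue"
    by (rule borel_measurable_times[OF measurable_completion m]) simp
  ultimately have m2: "(\<lambda>x. indicator {a<..<b} x *\<^sub>R u_init d s x) \<in> borel_measurable lebesgue" by simp
  have m3: "(\<lambda>x. indicator {a<..<b} x * u0 s x) \<in> borel_measurable lborel" by measurable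
  have "(LINT x:{a<..<b}|lebesgue. u_init d s x) = (\<integral>x. indicator {a<..<b} x * u0 s x \<partial>lebesgue)"
    unfolding set_lebesgue_integral_def
  proof (rule Bochner_Integration.integral_cong_AE[OF m2])
    show "(\<lambda>x. indicator {a<..<b} x * u0 s x) \<in> borel_measurable lebesgue" using measurable_completion[OF m3] .
    show "AE x in lebesgue. indicator {a<..<b} x *\<^sub>R u_init d s x = indicator {a<..<b} x * u0 s x"
      unfolding AE_completion_iff using u0(2)[of s] by eventually_elim (use assms in \<open>auto simp: indicator_def\<close>)
  qed
  also have "\<dots> = (\<integral>x. indicator {a<..<b} x * u0 s x \<partial>lborel)" by (rule integral_completion[OF m3])
  also have "\<dots> = (\<integral>x. indicator {0<..<1} x * (indicator {a<..b} x * u0 s x) \<partial>lborel)"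
  proof (rule Bochner_Integration.integral_cong_AE)
    show "AE x in lborel. indicator {a<..<b} x * u0 s x = indicator {0<..<1} x * (indicator {a<..b} x * u0 s x)"
      using AE_lborel_singleton[of b] AE_lborel_singleton[of 1]
      by eventually_elim (use assms in \<open>auto simp: indicator_def\<close>)
  qed measurable
  also have "\<dots> = (\<integral>x. indicator {a<..b} x * u0 s x \<partial>lm 1)" by (rule integral_lm_lborel[symmetric]) measurable
  finally show ?thesis using prim_diff_Ioc[OF u0_integrable assms(2)] by simp
qed

end

locale corrosion_scheme = corrosion_setting d + fv_mesh M for d M +
  fixes K :: nat and u :: "species \<Rightarrow> nat \<Rightarrow> nat \<Rightarrow> real" and \<Psi> :: "nat \<Rightarrow> nat \<Rightarrow> real"
  assumes K1: "1 \<le> K" and scheme: "scheme_solution d M K u \<Psi>" and bounded: "bounded_unknowns d M K u"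
begin

abbreviation "h \<equiv> mesh_size M"
definition "dt = t_end d / real K"

lemma dt_pos: "0 < dt" using T_pos K1 by (simp add: dt_def)
lemma K_dt: "real K * dt = T" using K1 by (simp add: dt_def)

lemma u_range: "1 \<le> k \<Longrightarrow> k \<le> K \<Longrightarrow> i \<le> I + 1 \<Longrightarrow> 0 \<le> u s k i \<and> u s k i \<le> Cu"
proof -
  assume "1 \<le> k" "k \<le> K" "i \<le> I + 1"
  then have "0 \<le> u s k i \<and> u s k i \<le> u_max d s"
    by (intro bounded[unfolded bounded_unknowns_def, THEN spec, THEN bspec, THEN bspec]) auto
  then show ?thesis using umax_le[of s] by linarith
qed

text \<open>Here \<open>k\<close> is the new time level; \<open>scheme_solution\<close> counts from
  the old one, so its \<open>k + 1\<close> is \<open>k\<close> now.\<close>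

lemma
  assumes "1 \<le> k" "k \<le> K"
  shows poisson: "1 \<le> i \<Longrightarrow> i \<le> I \<Longrightarrow> - (lam d)\<^sup>2 * (dPsi M \<Psi> k i - dPsi M \<Psi> k (i - 1))
             = cell_h M i * (3 * u SpP k i - u SpN k i + rho_hl d)"
    and cons: "1 \<le> i \<Longrightarrow> i \<le> I \<Longrightarrow> eps_of d s * cell_h M i * ((u s k i - u s (k - 1) i) / dt)
                + flux M u \<Psi> s k i - flux M u \<Psi> s k (i - 1) = 0"
    and robin0: "\<Psi> k 0 - alpha0 d * dPsi M \<Psi> k 0 = dPsi_pzc0 d"
    and robin1: "\<Psi> k (I + 1) + alpha1 d * dPsi M \<Psi> k I = V_pot d - dPsi_pzc1 d"
    and bc0: "- flux M u \<Psi> s k 0 = beta d s 0 (\<Psi> k 0) * u s k 0 - gamma0 d s (\<Psi> k 0)"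
    and bc1: "flux M u \<Psi> s k I = beta d s 1 (V_pot d - \<Psi> k (I + 1)) * u s k (I + 1) - gamma1 d s (V_pot d - \<Psi> k (I + 1))"
proof -
  have k: "k - 1 < K" "k - 1 + 1 = k" using assms by auto
  note S = scheme[unfolded scheme_solution_def, THEN conjunct2, rule_format, OF k(1), unfolded k(2)]
  show "1 \<le> i \<Longrightarrow> i \<le> I \<Longrightarrow> - (lam d)\<^sup>2 * (dPsi M \<Psi> k i - dPsi M \<Psi> k (i - 1))
             = cell_h M i * (3 * u SpP k i - u SpN k i + rho_hl d)" using S by simp
  show "1 \<le> i \<Longrightarrow> i \<le> I \<Longrightarrow> eps_of d s * cell_h M i * ((u s k i - u s (k - 1) i) / dt)
                + flux M u \<Psi> s k i - flux M u \<Psi> s k (i - 1) = 0" using S unfolding dt_def by auto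
  show "\<Psi> k 0 - alpha0 d * dPsi M \<Psi> k 0 = dPsi_pzc0 d" "\<Psi> k (I + 1) + alpha1 d * dPsi M \<Psi> k I = V_pot d - dPsi_pzc1 d"
    "- flux M u \<Psi> s k 0 = beta d s 0 (\<Psi> k 0) * u s k 0 - gamma0 d s (\<Psi> k 0)"
    "flux M u \<Psi> s k I = beta d s 1 (V_pot d - \<Psi> k (I + 1)) * u s k (I + 1) - gamma1 d s (V_pot d - \<Psi> k (I + 1))"
    using S by auto
qed

section \<open>Uniform bounds for the discrete potential\<close>

lemma dPsi_grad: "dPsi M \<Psi> k = grad M (\<Psi> k)"
  by (auto simp: dPsi_def grad_def)

definition "charge k i = 3 * u SpP k i - u SpN k i + rho_hl d"

lemma charge_bound: "1 \<le> k \<Longrightarrow> k \<le> K \<Longrightarrow> i \<le> I + 1 \<Longrightarrow> \<bar>charge k i\<bar> \<le> Crho"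
  using u_range[of k i SpP] u_range[of k i SpN] unfolding charge_def Crho_def by (auto simp: abs_le_iff)

lemma charge_bound': "1 \<le> k \<Longrightarrow> k \<le> K \<Longrightarrow> AE x in lm 1. \<bar>cstep M (charge k) x\<bar> \<le> Crho"
  by (rule cstep_bound) (simp add: charge_bound)

lemma charge_cstep: "AE x in lm 1. cstep M (charge k) x = 3 * cstep M (u SpP k) x - cstep M (u SpN k) x + rho_hl d"
proof (rule AE_dual_cell)
  fix j x assume "j \<le> I" and c: "(x < face M j \<and> 1 \<le> j \<and> face M (j - 1) < x) \<or> (face M j < x \<and> j < I \<and> x < face M (j + 1))"
  from c show "cstep M (charge k) x = 3 * cstep M (u SpP k) x - cstep M (u SpN k) x + rho_hl d"
    using \<open>j \<le> I\<close> cstep_at[of j x] cstep_at[of "j + 1" x] by (auto simp: charge_def)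
qed

text \<open>The discrete Poisson equation summed over the cells up to face \<open>j\<close>. At a
  face the primitive of a step function is exactly the weighted sum, so no quadrature error
  arises.\<close>

lemma dPsi_formula:
  assumes k: "1 \<le> k" "k \<le> K"
  shows "j \<le> I \<Longrightarrow> dPsi M \<Psi> k j = dPsi M \<Psi> k 0 - prim 1 (cstep M (charge k)) (face M j) / (lam d)\<^sup>2"
proof -
  assume "j \<le> I"
  then have "dPsi M \<Psi> k j = dPsi M \<Psi> k 0 - (\<Sum>i=1..j. cell_h M i * charge k i) / (lam d)\<^sup>2"
  proof (induct j)
    case (Suc j)
    have "dPsi M \<Psi> k (Suc j) - dPsi M \<Psi> k j = - (cell_h M (Suc j) * charge k (Suc j)) / (lam d)\<^sup>2"
      using poisson[OF k, of "Suc j"] Suc.prems lam_pos by (simp add: charge_def field_simps)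
    then show ?case using Suc by (simp add: add_divide_distrib)
  qed simp
  then show ?thesis using prim_cstep_face[OF \<open>j \<le> I\<close>, of "charge k"] by simp
qed

lemma Psi_sum: "i \<le> I + 1 \<Longrightarrow> \<Psi> k i = \<Psi> k 0 + (\<Sum>j<i. dPsi M \<Psi> k j * dual_h M j)"
  using grad_telescope[of i "\<Psi> k"] by (simp add: dPsi_grad)

lemma weighted_dual:
  assumes "i \<le> I + 1" "\<And>j. j < i \<Longrightarrow> \<bar>c j\<bar> \<le> B" "0 \<le> B"
  shows "\<bar>\<Sum>j<i. c j * dual_h M j\<bar> \<le> B"
proof -
  have "\<bar>\<Sum>j<i. c j * dual_h M j\<bar> \<le> (\<Sum>j<i. \<bar>c j * dual_h M j\<bar>)" by (rule sum_abs)
  also have "\<dots> \<le> (\<Sum>j<i. B * dual_h M j)"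
    using assms dual_props(1) by (intro sum_mono) (auto simp: abs_mult less_imp_le intro!: mult_mono)
  also have "\<dots> \<le> (\<Sum>j\<le>I. B * dual_h M j)"
    by (rule sum_mono2) (use assms dual_props(1) in \<open>auto simp: less_imp_le\<close>)
  also have "\<dots> = B" using sum_dual by (simp add: sum_distrib_left[symmetric])
  finally show ?thesis .
qed

text \<open>All slopes differ from the left one by at most \<open>Cj\<close>, which leaves one
  unknown; the two Robin conditions determine it.\<close>

lemma dPsi_bound:
  assumes k: "1 \<le> k" "k \<le> K"
  shows "j \<le> I \<Longrightarrow> \<bar>dPsi M \<Psi> k j - dPsi M \<Psi> k 0\<bar> \<le> Cj" "j \<le> I \<Longrightarrow> \<bar>dPsi M \<Psi> k j\<bar> \<le> CQ" "i \<le> I + 1 \<Longrightarrow> \<bar>\<Psi> k i\<bar> \<le> CP"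
proof -
  show *: "\<bar>dPsi M \<Psi> k j - dPsi M \<Psi> k 0\<bar> \<le> Cj" if "j \<le> I" for j
  proof -
    have "\<bar>prim 1 (cstep M (charge k)) (face M j)\<bar> \<le> Crho * face M j"
      by (rule prim_bound[OF _ charge_bound'[OF k]]) (use face_range[OF that] in auto)
    also have "\<dots> \<le> Crho * 1" using face_range[OF that] Crho_pos by (intro mult_left_mono) auto
    finally show ?thesis unfolding dPsi_formula[OF k that] Cj_def by (simp add: divide_right_mono)
  qed
  let ?q = "dPsi M \<Psi> k 0"
  have "\<Psi> k (I + 1) = \<Psi> k 0 + (\<Sum>j<I+1. dPsi M \<Psi> k j * dual_h M j)" by (rule Psi_sum) simp
  moreover have "(\<Sum>j<I+1. dPsi M \<Psi> k j * dual_h M j) = ?q + (\<Sum>j<I+1. (dPsi M \<Psi> k j - ?q) * dual_h M j)"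
  proof -
    have "(\<Sum>j<I+1. ?q * dual_h M j) = ?q" using sum_dual by (simp add: sum_distrib_left[symmetric] lessThan_Suc_atMost)
    then show ?thesis by (simp add: left_diff_distrib sum_subtractf)
  qed
  moreover have "\<bar>\<Sum>j<I+1. (dPsi M \<Psi> k j - ?q) * dual_h M j\<bar> \<le> Cj"
    by (rule weighted_dual) (use * Cj_pos in auto)
  ultimately have 1: "\<bar>\<Psi> k (I + 1) - \<Psi> k 0 - ?q\<bar> \<le> Cj" by simp
  have 2: "\<bar>alpha1 d * dPsi M \<Psi> k I - alpha1 d * ?q\<bar> \<le> alpha1 d * Cj"
    using *[of I] alpha1_pos by (simp add: right_diff_distrib[symmetric] abs_mult)
  \<comment> \<open>Difference of the two Robin conditions: the potential drop across the interval
    contributes the coefficient 1 up to \<open>Cj\<close>, the slopes at the ends contribute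
    \<open>alpha0\<close> and, up to \<open>alpha1 * Cj\<close>, \<open>alpha1\<close>.\<close>
  have "(1 + alpha0 d + alpha1 d) * ?q = (V_pot d - dPsi_pzc1 d - dPsi_pzc0 d) 
     - (\<Psi> k (I + 1) - \<Psi> k 0 - ?q) - (alpha1 d * dPsi M \<Psi> k I - alpha1 d * ?q)"
    using robin0[OF k] robin1[OF k] by (simp add: algebra_simps)
  then have 3: "\<bar>(1 + alpha0 d + alpha1 d) * ?q\<bar> \<le> \<bar>V_pot d - dPsi_pzc1 d - dPsi_pzc0 d\<bar> + Cj + alpha1 d * Cj"
    using 1 2 by argo
  have "\<bar>?q\<bar> \<le> (1 + alpha0 d + alpha1 d) * \<bar>?q\<bar>"
    using alpha0_pos alpha1_pos mult_right_mono[of 1 "1 + alpha0 d + alpha1 d" "\<bar>?q\<bar>"] by simp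
  also have "\<dots> = \<bar>(1 + alpha0 d + alpha1 d) * ?q\<bar>" using alpha0_pos alpha1_pos by (simp add: abs_mult)
  finally have q: "\<bar>?q\<bar> \<le> CQ - Cj" using 3 by (simp add: CQ_def algebra_simps)
  show b: "\<bar>dPsi M \<Psi> k j\<bar> \<le> CQ" if "j \<le> I" for j using *[OF that] q by argo
  show "\<bar>\<Psi> k i\<bar> \<le> CP" if "i \<le> I + 1"
  proof -
    have "\<bar>\<Sum>j<i. dPsi M \<Psi> k j * dual_h M j\<bar> \<le> CQ" by (rule weighted_dual[OF that]) (use b that CQ_pos in auto)
    moreover have "\<Psi> k 0 = dPsi_pzc0 d + alpha0 d * ?q" using robin0[OF k] by simp
    moreover have "\<bar>alpha0 d * ?q\<bar> \<le> alpha0 d * CQ" using b[of 0] alpha0_pos by (simp add: abs_mult)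
    ultimately show ?thesis unfolding Psi_sum[OF that, of k] CP_def by argo
  qed
qed

lemma flux_bound:
  assumes k: "1 \<le> k" "k \<le> K"
  shows "\<bar>flux M u \<Psi> s k 0\<bar> \<le> CF" "\<bar>flux M u \<Psi> s k I\<bar> \<le> CF"
proof -
  show "\<bar>flux M u \<Psi> s k 0\<bar> \<le> CF"
    using boundary_bound(1)[of "u s k 0" "\<Psi> k 0" s] u_range[OF k, of 0 s] dPsi_bound(3)[OF k, of 0] bc0[OF k, of s] by simp
  show "\<bar>flux M u \<Psi> s k I\<bar> \<le> CF"
    using boundary_bound(2)[of "u s k (I + 1)" "\<Psi> k (I + 1)" s] u_range[OF k, of "I + 1" s] dPsi_bound(3)[OF k, of "I + 1"] bc1[OF k, of s] by simp
qed

text \<open>The Bernoulli weights are split into even and odd parts. The odd part is exactly half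
  the argument up to sign and yields a centred drift term; the even part \<open>b\<close> acts as
  diffusion coefficient. The scheme is thus a centred one whose diffusion exceeds 1 by
  \<open>O(h)\<close>.\<close>

lemma flux_formula:
  assumes k: "1 \<le> k" "k \<le> K" and j: "j \<le> I"
  shows "\<exists>b. 1 \<le> b \<and> b \<le> 1 + 3 / 2 * CQ * h \<and>
    flux M u \<Psi> s k j = - b * grad M (u s k) j - z_of s * dPsi M \<Psi> k j * ((u s k j + u s k (j + 1)) / 2)"
proof -
  have D: "0 < dual_h M j" "dual_h M j \<le> h" using dual_props[OF j] by auto
  define y where "y = z_of s * dual_h M j * dPsi M \<Psi> k j"
  define b where "b = (Bern y + Bern (- y)) / 2"
  have my: "- z_of s * dual_h M j * dPsi M \<Psi> k j = - y" by (simp add: y_def)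
  have "\<bar>y\<bar> = \<bar>z_of s\<bar> * dual_h M j * \<bar>dPsi M \<Psi> k j\<bar>" using D by (simp add: y_def abs_mult)
  also have "\<dots> \<le> 3 * h * CQ" using z_bound[of s] D dPsi_bound(2)[OF k j] by (intro mult_mono) auto
  finally have y: "\<bar>y\<bar> \<le> 3 * h * CQ" .
  have e: "1 + 3 / 2 * CQ * h = (2 + 3 * h * CQ) / 2" by (simp add: field_simps)
  have "1 \<le> b" using Bern_sum_bounds(1)[of y] by (simp add: b_def)
  moreover have "b \<le> 1 + 3 / 2 * CQ * h" unfolding e b_def
    by (rule divide_right_mono[OF order_trans[OF Bern_sum_bounds(2) add_left_mono[OF y]]]) simp
  ultimately have b: "1 \<le> b" "b \<le> 1 + 3 / 2 * CQ * h" by auto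
  have B: "Bern y = b - y / 2" "Bern (- y) = b + y / 2" using Bern_diff[of y] by (auto simp: b_def field_simps)
  have al: "(b - y / 2) * p - (b + y / 2) * q = b * (p - q) - y * ((p + q) / 2)" for p q :: real
    by (simp add: algebra_simps add_divide_distrib)
  have "flux M u \<Psi> s k j = (b * (u s k j - u s k (j + 1)) - y * ((u s k j + u s k (j + 1)) / 2)) / dual_h M j"
    unfolding flux_def y_def[symmetric] my B al ..
  also have "\<dots> = - b * grad M (u s k) j - z_of s * dPsi M \<Psi> k j * ((u s k j + u s k (j + 1)) / 2)"
    using D by (simp add: grad_def y_def field_simps)
  finally show ?thesis using b by blast
qed

section \<open>Energy estimate and mass balance\<close>

definition "energy s k = (\<Sum>i=1..I. cell_h M i * (u s k i)\<^sup>2)"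
definition "dissipation s k = (\<Sum>j\<le>I. dual_h M j * (grad M (u s k) j)\<^sup>2)"

text \<open>The scheme is tested with its own solution. The drift is controlled by the sup bounds of
  densities and slopes, so Young's inequality absorbs it into half of the diffusion, and implicit
  time stepping contributes the decrease of the energy.\<close>

lemma level_energy:
  assumes k: "1 \<le> k" "k \<le> K"
  shows "dt * dissipation s k \<le> 2 * dt * ((3 * CQ * Cu)\<^sup>2 / 2 + 2 * CF * Cu) + eps_of d s * (energy s (k - 1) - energy s k)"
proof -
  let ?F = "flux M u \<Psi> s k" and ?g = "grad M (u s k)" and ?v = "u s k" and ?w = "u s (k - 1)"
  let ?c = "3 * CQ * Cu"
  \<comment> \<open>Coercivity on one dual cell: the diffusion \<open>b \<ge> 1\<close> yields the
    squared slope, half of which pays for the drift, itself bounded by \<open>?c\<close>.\<close>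
  have low: "dual_h M j * ((?g j)\<^sup>2 / 2 - ?c\<^sup>2 / 2) \<le> - ?F j * (?v (j + 1) - ?v j)" if j: "j \<le> I" for j
  proof -
    obtain b where b: "1 \<le> b" "?F j = - b * ?g j - z_of s * dPsi M \<Psi> k j * ((?v j + ?v (j + 1)) / 2)"
      using flux_formula[OF k j] by blast
    have D: "0 < dual_h M j" using dual_props[OF j] by auto
    have dv: "?v (j + 1) - ?v j = dual_h M j * ?g j" using D by (simp add: grad_def)
    let ?a = "z_of s * dPsi M \<Psi> k j * ((?v j + ?v (j + 1)) / 2)"
    have "\<bar>?a\<bar> = \<bar>z_of s\<bar> * \<bar>dPsi M \<Psi> k j\<bar> * ((?v j + ?v (j + 1)) / 2)"
      using u_range[OF k, of j s] u_range[OF k, of "j + 1" s] j by (simp add: abs_mult)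
    also have "\<dots> \<le> 3 * CQ * Cu"
      using z_bound[of s] dPsi_bound(2)[OF k j] u_range[OF k, of j s] u_range[OF k, of "j + 1" s] j CQ_pos by (intro mult_mono) auto
    finally have a: "\<bar>?a\<bar> \<le> ?c" .
    have "2 * (\<bar>?a\<bar> * \<bar>?g j\<bar>) \<le> ?a\<^sup>2 + (?g j)\<^sup>2" using young_sq[of 1 ?a "?g j"] by simp
    moreover have "?a\<^sup>2 \<le> ?c\<^sup>2" using a by (rule abs_le_square_iff[THEN iffD1, of ?a ?c, OF order_trans]) simp
    moreover have "- (\<bar>?a\<bar> * \<bar>?g j\<bar>) \<le> ?a * ?g j" by (metis abs_mult abs_ge_minus_self minus_le_iff)
    moreover have "(?g j)\<^sup>2 \<le> b * (?g j)\<^sup>2" using b(1) mult_right_mono[of 1 b "(?g j)\<^sup>2"] by simp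
    ultimately have "(?g j)\<^sup>2 / 2 - ?c\<^sup>2 / 2 \<le> b * (?g j)\<^sup>2 + ?a * ?g j" by linarith
    then have "dual_h M j * ((?g j)\<^sup>2 / 2 - ?c\<^sup>2 / 2) \<le> dual_h M j * (b * (?g j)\<^sup>2 + ?a * ?g j)"
      using D by (intro mult_left_mono) auto
    also have "\<dots> = - ?F j * (?v (j + 1) - ?v j)" unfolding dv b(2) by (simp add: power2_eq_square algebra_simps)
    finally show ?thesis .
  qed
  have "(\<Sum>j\<le>I. dual_h M j * ((?g j)\<^sup>2 / 2 - ?c\<^sup>2 / 2)) \<le> (\<Sum>j\<le>I. - ?F j * (?v (j + 1) - ?v j))"
    using low by (intro sum_mono) auto
  moreover have "(\<Sum>j\<le>I. dual_h M j * ((?g j)\<^sup>2 / 2 - ?c\<^sup>2 / 2)) = dissipation s k / 2 - ?c\<^sup>2 / 2"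
  proof -
    have "(\<Sum>j\<le>I. dual_h M j * ((?g j)\<^sup>2 / 2 - ?c\<^sup>2 / 2)) = (\<Sum>j\<le>I. dual_h M j * (?g j)\<^sup>2) / 2 - (\<Sum>j\<le>I. dual_h M j) * (?c\<^sup>2 / 2)"
      by (simp add: right_diff_distrib sum_subtractf sum_divide_distrib sum_distrib_right)
    then show ?thesis unfolding sum_dual dissipation_def by simp
  qed
  ultimately have 1: "dissipation s k / 2 - ?c\<^sup>2 / 2 \<le> (\<Sum>j\<le>I. - ?F j * (?v (j + 1) - ?v j))" by simp
  have 2: "(\<Sum>j\<le>I. - ?F j * (?v (j + 1) - ?v j)) = (\<Sum>i=1..I. (?F i - ?F (i - 1)) * ?v i) - ?F I * ?v (I + 1) + ?F 0 * ?v 0"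
    unfolding summation_by_parts by (simp add: sum_negf)
  have 3: "(?F i - ?F (i - 1)) * ?v i \<le> eps_of d s / (2 * dt) * (cell_h M i * (?w i)\<^sup>2 - cell_h M i * (?v i)\<^sup>2)" if i: "i \<in> {1..I}" for i
  proof -
    have e: "?F i - ?F (i - 1) = - (eps_of d s / dt * cell_h M i * (?v i - ?w i))"
    proof -
      have "eps_of d s / dt * cell_h M i * (?v i - ?w i) = eps_of d s * cell_h M i * ((?v i - ?w i) / dt)" by simp
      then show ?thesis using cons[OF k, of i s] i by simp
    qed
    \<comment> \<open>Convexity of the square; the discarded term \<open>(?v i - ?w i)^2 / 2\<close>
      is the numerical dissipation in time.\<close>
    have sq: "- ((?v i - ?w i) * ?v i) \<le> ((?w i)\<^sup>2 - (?v i)\<^sup>2) / 2"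
      using zero_le_power2[of "?v i - ?w i"] by (simp add: power2_eq_square algebra_simps)
    have "(?F i - ?F (i - 1)) * ?v i = (eps_of d s / dt * cell_h M i) * - ((?v i - ?w i) * ?v i)"
      unfolding e by (simp add: algebra_simps)
    also have "\<dots> \<le> (eps_of d s / dt * cell_h M i) * (((?w i)\<^sup>2 - (?v i)\<^sup>2) / 2)"
      using sq eps_of_range[of s] dt_pos cell_pos[of i] i by (intro mult_left_mono) auto
    also have "\<dots> = eps_of d s / (2 * dt) * (cell_h M i * (?w i)\<^sup>2 - cell_h M i * (?v i)\<^sup>2)"
      by (simp add: field_simps)
    finally show ?thesis .
  qed
  have 4: "(\<Sum>i=1..I. (?F i - ?F (i - 1)) * ?v i) \<le> eps_of d s / (2 * dt) * (energy s (k - 1) - energy s k)"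
  proof -
    have "(\<Sum>i=1..I. (?F i - ?F (i - 1)) * ?v i) \<le> (\<Sum>i=1..I. eps_of d s / (2 * dt) * (cell_h M i * (?w i)\<^sup>2 - cell_h M i * (?v i)\<^sup>2))"
      using 3 by (intro sum_mono) auto
    also have "\<dots> = eps_of d s / (2 * dt) * (energy s (k - 1) - energy s k)"
      unfolding energy_def sum_subtractf[symmetric] sum_distrib_left ..
    finally show ?thesis .
  qed
  have "\<bar>?F I * ?v (I + 1)\<bar> \<le> CF * Cu" "\<bar>?F 0 * ?v 0\<bar> \<le> CF * Cu"
    unfolding abs_mult using flux_bound[OF k, of s] u_range[OF k, of 0 s] u_range[OF k, of "I + 1" s] by (auto intro!: mult_mono)
  then have "- (?F I * ?v (I + 1)) \<le> CF * Cu" "?F 0 * ?v 0 \<le> CF * Cu" by (simp_all only: abs_le_iff)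
  then have "dissipation s k / 2 - ?c\<^sup>2 / 2 \<le> eps_of d s / (2 * dt) * (energy s (k - 1) - energy s k) + 2 * (CF * Cu)"
    using 1 4 unfolding 2 by linarith
  then have "dt * 2 * (dissipation s k / 2 - ?c\<^sup>2 / 2) \<le> dt * 2 * (eps_of d s / (2 * dt) * (energy s (k - 1) - energy s k) + 2 * (CF * Cu))"
    using dt_pos by (intro mult_left_mono) auto
  moreover have "dt * 2 * (eps_of d s / (2 * dt) * (energy s (k - 1) - energy s k)) = eps_of d s * (energy s (k - 1) - energy s k)"
    using dt_pos by simp
  ultimately show ?thesis by (simp add: algebra_simps)
qed

text \<open>\<open>bounded_unknowns\<close> starts at level 1; at level 0 the bound comes from the
  datum.\<close>

lemma initial_mean:
  assumes "1 \<le> i" "i \<le> I"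
  shows "cell_h M i * u s 0 i = prim 1 (u0 s) (face M i) - prim 1 (u0 s) (face M (i - 1))" "\<bar>u s 0 i\<bar> \<le> Cu"
proof -
  have i1: "i - 1 \<le> I" using assms by (intro le_trans[OF diff_le_self])
  have f: "0 \<le> face M (i - 1)" "face M (i - 1) \<le> face M i" "face M i \<le> 1"
    using face_range[OF i1] face_range[OF assms(2)] face_mono[of "i - 1" i] assms by auto
  have c: "0 < cell_h M i" by (rule cell_pos[OF assms])
  have "u s 0 i = (LINT x:{face M (i - 1)<..<face M i}|lebesgue. u_init d s x) / cell_h M i"
    using scheme assms unfolding scheme_solution_def by auto
  then show *: "cell_h M i * u s 0 i = prim 1 (u0 s) (face M i) - prim 1 (u0 s) (face M (i - 1))"
    using c unfolding u_init_integral[OF f] by simp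
  have "\<bar>cell_h M i * u s 0 i\<bar> = \<bar>prim 1 (u0 s) (face M i) - prim 1 (u0 s) (face M (i - 1))\<bar>" by (simp only: *)
  also have "\<dots> \<le> Cu * (face M i - face M (i - 1))" by (rule prim_lipschitz[OF _ u0_bound]) (use f in auto)
  also have "\<dots> = Cu * cell_h M i" by (simp add: cell_h_def)
  finally have "\<bar>cell_h M i * u s 0 i\<bar> \<le> Cu * cell_h M i" .
  then show "\<bar>u s 0 i\<bar> \<le> Cu" using c by (simp add: abs_mult)
qed

lemma energy_0: "energy s 0 \<le> Cu\<^sup>2" "0 \<le> energy s k"
proof -
  have "energy s 0 \<le> (\<Sum>i=1..I. cell_h M i * Cu\<^sup>2)" unfolding energy_def
    using cell_pos initial_mean(2)[of _ s] Cu_pos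
    by (intro sum_mono mult_left_mono) (auto simp: abs_le_square_iff[symmetric] less_imp_le)
  also have "\<dots> = Cu\<^sup>2" using sum_cell[of I] face_I by (simp add: sum_distrib_right[symmetric])
  finally show "energy s 0 \<le> Cu\<^sup>2" .
  show "0 \<le> energy s k" unfolding energy_def using cell_pos by (intro sum_nonneg mult_nonneg_nonneg) (auto simp: less_imp_le)
qed

text \<open>The energies telescope and the initial one is at most \<open>Cu^2\<close>, which
  explains the two summands of \<open>CE\<close>.\<close>

lemma total_dissipation: "(\<Sum>k=1..K. dt * dissipation s k) \<le> CE"
proof -
  let ?c = "(3 * CQ * Cu)\<^sup>2 / 2 + 2 * CF * Cu"
  have "(\<Sum>k=1..n. dt * dissipation s k) \<le> real n * (2 * dt * ?c) + eps_of d s * (energy s 0 - energy s n)" if "n \<le> K" for n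
    using that
  proof (induct n)
    case (Suc n)
    have "dt * dissipation s (Suc n) \<le> 2 * dt * ?c + eps_of d s * (energy s n - energy s (Suc n))"
      using level_energy[of "Suc n" s] Suc.prems by simp
    then show ?case using Suc by (simp add: algebra_simps)
  qed simp
  from this[of K] have 1: "(\<Sum>k=1..K. dt * dissipation s k) \<le> real K * (2 * dt * ?c) + eps_of d s * (energy s 0 - energy s K)" by simp
  have "eps_of d s * (energy s 0 - energy s K) \<le> (1 + eps d) * Cu\<^sup>2"
  proof -
    have "energy s 0 - energy s K \<le> Cu\<^sup>2" using energy_0(1)[of s] energy_0(2)[of s K] by linarith
    then have "eps_of d s * (energy s 0 - energy s K) \<le> eps_of d s * Cu\<^sup>2"
      using eps_of_range(1)[of s] by (intro mult_left_mono) auto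
    also have "\<dots> \<le> (1 + eps d) * Cu\<^sup>2" by (rule mult_right_mono[OF eps_of_range(2)]) simp
    finally show ?thesis .
  qed
  moreover have "real K * (2 * dt * ?c) = 2 * T * ?c" by (simp only: K_dt[symmetric] mult_ac)
  ultimately show ?thesis using 1 unfolding CE_def by linarith
qed

text \<open>Conservation summed over cells and time levels is an exact identity at the faces,
  because the cell means at level 0 reproduce the primitive of the datum there.\<close>

lemma mass_balance:
  assumes "j \<le> I" "k \<le> K"
  shows "eps_of d s * ((\<Sum>i=1..j. cell_h M i * u s k i) - prim 1 (u0 s) (face M j))
    + dt * (\<Sum>l=1..k. flux M u \<Psi> s l j - flux M u \<Psi> s l 0) = 0"
  using assms(2)
proof (induct k)
  case 0
  have "(\<Sum>i=1..j. cell_h M i * u s 0 i) = prim 1 (u0 s) (face M j)"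
    using assms(1)
  proof (induct j)
    case 0 then show ?case by (simp add: face_0 prim_0)
  next
    case (Suc j) then show ?case using initial_mean(1)[of "Suc j" s] by simp
  qed
  then show ?case by simp
next
  case (Suc k)
  have k: "1 \<le> Suc k" "Suc k \<le> K" using Suc.prems by auto
  have "eps_of d s * ((\<Sum>i=1..j. cell_h M i * u s (Suc k) i) - (\<Sum>i=1..j. cell_h M i * u s k i)) + dt * (flux M u \<Psi> s (Suc k) j - flux M u \<Psi> s (Suc k) 0) = 0"
    using assms(1)
  proof (induct j)
    case (Suc j)
    have "eps_of d s * cell_h M (Suc j) * ((u s (Suc k) (Suc j) - u s k (Suc j)) / dt) + flux M u \<Psi> s (Suc k) (Suc j) - flux M u \<Psi> s (Suc k) j = 0"
      using cons[OF k, of "Suc j" s] Suc.prems by simp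
    then have X: "dt * (eps_of d s * cell_h M (Suc j) * ((u s (Suc k) (Suc j) - u s k (Suc j)) / dt) + flux M u \<Psi> s (Suc k) (Suc j) - flux M u \<Psi> s (Suc k) j) = 0" by simp
    have sc: "dt * (e * c * ((a - b) / dt) + f - g) = e * (c * a - c * b) + dt * (f - g)" for e c a b f g
      using dt_pos by (simp add: field_simps)
    have "eps_of d s * (cell_h M (Suc j) * u s (Suc k) (Suc j) - cell_h M (Suc j) * u s k (Suc j)) + dt * (flux M u \<Psi> s (Suc k) (Suc j) - flux M u \<Psi> s (Suc k) j) = 0"
      using X unfolding sc .
    moreover have "eps_of d s * ((\<Sum>i=1..j. cell_h M i * u s (Suc k) i) - (\<Sum>i=1..j. cell_h M i * u s k i)) + dt * (flux M u \<Psi> s (Suc k) j - flux M u \<Psi> s (Suc k) 0) = 0"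
      using Suc by simp
    ultimately show ?case by (simp add: algebra_simps)
  qed simp
  moreover have "eps_of d s * ((\<Sum>i=1..j. cell_h M i * u s k i) - prim 1 (u0 s) (face M j))
    + dt * (\<Sum>l=1..k. flux M u \<Psi> s l j - flux M u \<Psi> s l 0) = 0" using Suc by simp
  ultimately show ?case by (simp add: algebra_simps)
qed

end

section \<open>Space-time form of the scheme\<close>

lemma integrable_prim: "integrable (lm T) f \<Longrightarrow> integrable (lm T) (prim T f)"
proof -
  assume f: "integrable (lm T) f"
  then have "f \<in> borel_measurable borel" using borel_measurable_integrable[OF f] by simp
  then show ?thesis
    by (intro integrable_bounded_finite[OF finite_measure_lm, where B="\<integral>y. \<bar>f y\<bar> \<partial>lm T"])
       (use prim_le_integral[OF f] in auto)
qed

text \<open>\<open>uh\<close>, \<open>ub\<close> and \<open>gh\<close> are the piecewise affine reconstruction, the piecewise constant one and the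
  derivative of the former; \<open>Ph\<close>, \<open>Pb\<close>, \<open>Qh\<close> play the same roles for the potential,
  whose slopes at the two ends are \<open>q0\<close> and \<open>q1\<close>. The finite volume equations enter only through
  their space-time integrals \<open>moment\<close> and \<open>mass\<close>.\<close>

locale approximate_solution = corrosion_setting +
  fixes C \<delta> :: real
    and uh gh ub :: "species \<Rightarrow> real \<times> real \<Rightarrow> real" and Ph Qh Pb :: "real \<times> real \<Rightarrow> real" and q0 q1 :: "real \<Rightarrow> real"
  assumes borel: "uh s \<in> borel_measurable borel" "gh s \<in> borel_measurable borel" "ub s \<in> borel_measurable borel"
      "Ph \<in> borel_measurable borel" "Qh \<in> borel_measurable borel" "Pb \<in> borel_measurable borel"
    and delta_nonneg: "0 \<le> \<delta>"
    and uh_bound: "0 < t \<Longrightarrow> t < T \<Longrightarrow> 0 \<le> x \<Longrightarrow> x \<le> 1 \<Longrightarrow> 0 \<le> uh s (x, t) \<and> uh s (x, t) \<le> Cu"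
    and ub_bound: "0 < t \<Longrightarrow> t < T \<Longrightarrow> AE x in lm 1. \<bar>ub s (x, t)\<bar> \<le> C"
    and Ph_bound: "0 < t \<Longrightarrow> t < T \<Longrightarrow> 0 \<le> x \<Longrightarrow> x \<le> 1 \<Longrightarrow> \<bar>Ph (x, t)\<bar> \<le> CP"
    and Qh_bound: "0 < t \<Longrightarrow> t < T \<Longrightarrow> AE x in lm 1. \<bar>Qh (x, t)\<bar> \<le> C"
    and uh_prim: "0 < t \<Longrightarrow> t < T \<Longrightarrow> 0 \<le> x \<Longrightarrow> x \<le> 1 \<Longrightarrow> uh s (x, t) = uh s (0, t) + prim 1 (\<lambda>y. gh s (y, t)) x"
    and gh_sq: "integrable (mq T) (\<lambda>z. (gh s z)\<^sup>2)" "(\<integral>z. (gh s z)\<^sup>2 \<partial>mq T) \<le> C"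
      "0 < t \<Longrightarrow> t < T \<Longrightarrow> integrable (lm 1) (\<lambda>x. (gh s (x, t))\<^sup>2)"
    and uh_ub: "0 < t \<Longrightarrow> t < T \<Longrightarrow> AE x in lm 1. \<bar>uh s (x, t) - ub s (x, t)\<bar> \<le> \<delta> * \<bar>gh s (x, t)\<bar>"
    and Ph_prim: "0 < t \<Longrightarrow> t < T \<Longrightarrow> 0 \<le> x \<Longrightarrow> x \<le> 1 \<Longrightarrow> Ph (x, t) = Ph (0, t) + prim 1 (\<lambda>y. Qh (y, t)) x"
    and Qh_q0: "0 < t \<Longrightarrow> t < T \<Longrightarrow> AE x in lm 1.
      \<bar>Qh (x, t) - q0 t + prim 1 (\<lambda>y. 3 * ub SpP (y, t) - ub SpN (y, t) + rho_hl d) x / (lam d)\<^sup>2\<bar> \<le> \<delta>"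
    and q1_q0: "0 < t \<Longrightarrow> t < T \<Longrightarrow> q1 t = q0 t - prim 1 (\<lambda>y. 3 * ub SpP (y, t) - ub SpN (y, t) + rho_hl d) 1 / (lam d)\<^sup>2"
    and Ph_0: "0 < t \<Longrightarrow> t < T \<Longrightarrow> Ph (0, t) - alpha0 d * q0 t = dPsi_pzc0 d"
    and Ph_1: "0 < t \<Longrightarrow> t < T \<Longrightarrow> Ph (1, t) + alpha1 d * q1 t = V_pot d - dPsi_pzc1 d"
    and Ph_Pb: "0 < t \<Longrightarrow> t < T \<Longrightarrow> AE x in lm 1. \<bar>Ph (x, t) - Pb (x, t)\<bar> \<le> \<delta>"
    and moment: "0 < t \<Longrightarrow> t < T \<Longrightarrow> 0 \<le> x \<Longrightarrow> x \<le> 1 \<Longrightarrow>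
      \<bar>eps_of d s * (prim 1 (prim 1 (\<lambda>y. ub s (y, t))) x - prim 1 (prim 1 (u0 s)) x)
        - prim T (\<lambda>\<tau>. uh s (x, \<tau>) - uh s (0, \<tau>) + z_of s * prim 1 (\<lambda>y. Qh (y, \<tau>) * ub s (y, \<tau>)) x
            - x * (beta d s 0 (Ph (0, \<tau>)) * uh s (0, \<tau>) - gamma0 d s (Ph (0, \<tau>)))) t\<bar> \<le> \<delta>"
    and mass: "0 < t \<Longrightarrow> t < T \<Longrightarrow>
      \<bar>eps_of d s * (prim 1 (\<lambda>y. ub s (y, t)) 1 - prim 1 (u0 s) 1)
        + prim T (\<lambda>\<tau>. (beta d s 1 (V_pot d - Ph (1, \<tau>)) * uh s (1, \<tau>) - gamma1 d s (V_pot d - Ph (1, \<tau>)))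
            + (beta d s 0 (Ph (0, \<tau>)) * uh s (0, \<tau>) - gamma0 d s (Ph (0, \<tau>)))) t\<bar> \<le> \<delta>"

context corrosion_setting
begin
text \<open>\<open>CG\<close> bounds the integrand \<open>G\<close> of the twice integrated law,
  \<open>Ctot\<close> becomes the constant \<open>C\<close> of \<open>approximate_solution\<close>,
  and every error of the discrete equations is bounded by summands of \<open>Cdel\<close> times the
  mesh size or the time step.\<close>

definition "CG = Cu + 3 * CQ * Cu + CF"
definition "Ctot = Cu + CQ + CE"
definition "Cdel = 1 + Cj + CQ + 2 * (1 + eps d) * Cu + 3 * CQ * (T + CE) + CG + 2 * CF"

lemma CF_pos: "0 < CF" using boundary_bound(3)[of 0] Cu_pos by simp

lemma CE_pos: "0 < CE" unfolding CE_def using T_pos CF_pos Cu_pos eps_pos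
  by (intro add_nonneg_pos mult_nonneg_nonneg add_nonneg_nonneg mult_pos_pos) auto

lemma CG_pos: "0 < CG" unfolding CG_def using CF_pos Cu_pos CQ_pos by (intro add_pos_pos mult_pos_pos) auto

lemma Cdel_parts: "1 \<le> Cdel" "Cj \<le> Cdel" "CQ \<le> Cdel" "2 * (1 + eps d) * Cu + 3 * CQ * (T + CE) \<le> Cdel" "CG \<le> Cdel" "2 * CF \<le> Cdel"
proof -
  have "0 \<le> 2 * (1 + eps d) * Cu" "0 \<le> 3 * CQ * (T + CE)" using eps_pos Cu_pos CQ_pos T_pos CE_pos by auto
  then show "1 \<le> Cdel" "Cj \<le> Cdel" "CQ \<le> Cdel" "2 * (1 + eps d) * Cu + 3 * CQ * (T + CE) \<le> Cdel" "CG \<le> Cdel" "2 * CF \<le> Cdel"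
    unfolding Cdel_def using Cj_pos CQ_pos CG_pos CF_pos by linarith+
qed
end

context corrosion_scheme
begin

text \<open>Up to a consistency error this is minus the space primitive of the flux relative to its
  left boundary value, at level \<open>l\<close>, with the left flux replaced by its boundary law.
  \<open>B01\<close> is the net outflow through both ends.\<close>

definition "G s l x = pwaff M (u s l) x - pwaff M (u s l) 0 
  + z_of s * prim 1 (\<lambda>y. dstep M (dPsi M \<Psi> l) y * cstep M (u s l) y) x
  - x * (beta d s 0 (pwaff M (\<Psi> l) 0) * pwaff M (u s l) 0 - gamma0 d s (pwaff M (\<Psi> l) 0))"

definition "B01 s l = (beta d s 1 (V_pot d - pwaff M (\<Psi> l) 1) * pwaff M (u s l) 1 - gamma1 d s (V_pot d - pwaff M (\<Psi> l) 1))
  + (beta d s 0 (pwaff M (\<Psi> l) 0) * pwaff M (u s l) 0 - gamma0 d s (pwaff M (\<Psi> l) 0))"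

lemma B01_eq: "1 \<le> l \<Longrightarrow> l \<le> K \<Longrightarrow> B01 s l = flux M u \<Psi> s l I - flux M u \<Psi> s l 0"
  unfolding B01_def pwaff_0 pwaff_1 using bc0[of l s] bc1[of l s] by simp

lemma product_bound:
  assumes "1 \<le> l" "l \<le> K"
  shows "AE x in lm 1. \<bar>dstep M (dPsi M \<Psi> l) x * cstep M (u s l) x\<bar> \<le> CQ * Cu"
proof -
  have "AE x in lm 1. \<bar>dstep M (dPsi M \<Psi> l) x\<bar> \<le> CQ" by (rule dstep_bound) (rule dPsi_bound(2)[OF assms])
  moreover have "AE x in lm 1. \<bar>cstep M (u s l) x\<bar> \<le> Cu" by (rule cstep_bound) (use u_range[OF assms, of _ s] in auto)
  ultimately show ?thesis
    by eventually_elim (auto simp: abs_mult intro!: mult_mono less_imp_le[OF CQ_pos])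
qed

lemma product_integrable: "1 \<le> l \<Longrightarrow> l \<le> K \<Longrightarrow> integrable (lm 1) (\<lambda>y. dstep M (dPsi M \<Psi> l) y * cstep M (u s l) y)"
  by (rule integrable_bounded_finite[OF finite_measure_lm _ product_bound]) auto

lemma G_eq:
  assumes "1 \<le> l" "l \<le> K"
  shows "G s l x = prim 1 (dstep M (grad M (u s l))) x + z_of s * prim 1 (\<lambda>y. dstep M (dPsi M \<Psi> l) y * cstep M (u s l) y) x
    + x * flux M u \<Psi> s l 0"
  unfolding G_def pwaff_0 using bc0[OF assms, of s] by (simp add: pwaff_def algebra_simps)

lemma G_bound:
  assumes l: "1 \<le> l" "l \<le> K" and x: "0 \<le> x" "x \<le> 1"
  shows "\<bar>G s l x\<bar> \<le> CG"
proof -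
  have b: "0 \<le> pwaff M (u s l) y \<and> pwaff M (u s l) y \<le> Cu" if "0 \<le> y" "y \<le> 1" for y
    using pwaff_bounds[of 0 "u s l" Cu y] u_range[OF l, of _ s] that by auto
  have 1: "\<bar>pwaff M (u s l) x - pwaff M (u s l) 0\<bar> \<le> Cu" using b[of x] b[of 0] x by (auto simp: abs_le_iff)
  have "\<bar>prim 1 (\<lambda>y. dstep M (dPsi M \<Psi> l) y * cstep M (u s l) y) x\<bar> \<le> CQ * Cu * x"
    by (rule prim_bound[OF _ product_bound[OF l]]) (use x in auto)
  also have "\<dots> \<le> CQ * Cu * 1" using x CQ_pos Cu_pos by (intro mult_left_mono) auto
  finally have "\<bar>z_of s\<bar> * \<bar>prim 1 (\<lambda>y. dstep M (dPsi M \<Psi> l) y * cstep M (u s l) y) x\<bar> \<le> 3 * (CQ * Cu)"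
    using z_bound[of s] by (intro mult_mono) auto
  then have 2: "\<bar>z_of s * prim 1 (\<lambda>y. dstep M (dPsi M \<Psi> l) y * cstep M (u s l) y) x\<bar> \<le> 3 * (CQ * Cu)" by (simp add: abs_mult)
  have "\<bar>x * flux M u \<Psi> s l 0\<bar> \<le> 1 * CF" unfolding abs_mult
    using flux_bound(1)[OF l, of s] x by (intro mult_mono) auto
  moreover have "G s l x = (pwaff M (u s l) x - pwaff M (u s l) 0) + z_of s * prim 1 (\<lambda>y. dstep M (dPsi M \<Psi> l) y * cstep M (u s l) y) x + x * flux M u \<Psi> s l 0"
    unfolding G_eq[OF l] pwaff_0 by (simp add: pwaff_def)
  ultimately show ?thesis using 1 2 unfolding CG_def by linarith
qed

lemma grad_sq:
  "(\<integral>x. (dstep M (grad M (u s k)) x)\<^sup>2 \<partial>lm 1) = dissipation s k"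
  "integrable (lm 1) (\<lambda>x. (dstep M (grad M (u s k)) x)\<^sup>2)"
proof -
  show "(\<integral>x. (dstep M (grad M (u s k)) x)\<^sup>2 \<partial>lm 1) = dissipation s k"
    using dstep_comp_integral[of "\<lambda>a. a\<^sup>2" "grad M (u s k)"] by (simp add: dissipation_def mult.commute)
  have "AE x in lm 1. \<bar>dstep M (grad M (u s k)) x\<bar> \<le> (\<Sum>j\<le>I. \<bar>grad M (u s k) j\<bar>)"
    by (rule dstep_bound) (auto intro: member_le_sum)
  then have "AE x in lm 1. \<bar>(dstep M (grad M (u s k)) x)\<^sup>2\<bar> \<le> (\<Sum>j\<le>I. \<bar>grad M (u s k) j\<bar>)\<^sup>2"
    by eventually_elim (metis abs_power2 abs_ge_zero power2_abs power_mono)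
  then show "integrable (lm 1) (\<lambda>x. (dstep M (grad M (u s k)) x)\<^sup>2)"
    by (intro integrable_bounded_finite[OF finite_measure_lm]) auto
qed

text \<open>Two errors of size \<open>3/2 * CQ * h\<close> times the slope arise: one from the
  excess diffusion \<open>b - 1\<close>, one from replacing the mean of neighbours by the cell
  value. Bounding the slope by 1 plus its square lets the dissipation control their sum over
  time.\<close>

lemma flux_primitive:
  assumes k: "1 \<le> k" "k \<le> K"
  shows "\<bar>prim 1 (dstep M (flux M u \<Psi> s k)) x + prim 1 (dstep M (grad M (u s k))) x
    + z_of s * prim 1 (\<lambda>y. dstep M (dPsi M \<Psi> k) y * cstep M (u s k) y) x\<bar> \<le> 3 * CQ * h * (1 + dissipation s k)"
proof -
  let ?f = "dstep M (flux M u \<Psi> s k)" and ?g = "dstep M (grad M (u s k))" 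
  let ?p = "\<lambda>y. dstep M (dPsi M \<Psi> k) y * cstep M (u s k) y"
  let ?R = "\<lambda>y. ?f y + ?g y + z_of s * ?p y"
  have iR: "integrable (lm 1) ?R" using dstep_integrable product_integrable[OF k] by auto
  have R: "AE y in lm 1. \<bar>?R y\<bar> \<le> 3 * CQ * h * \<bar>?g y\<bar>"
  proof (rule AE_dual_cell)
    fix j y assume j: "j \<le> I" "node M j < y" "y < node M (j + 1)"
      and c: "(y < face M j \<and> 1 \<le> j \<and> face M (j - 1) < y) \<or> (face M j < y \<and> j < I \<and> y < face M (j + 1))"
    obtain b where b: "1 \<le> b" "b \<le> 1 + 3 / 2 * CQ * h"
      "flux M u \<Psi> s k j = - b * grad M (u s k) j - z_of s * dPsi M \<Psi> k j * ((u s k j + u s k (j + 1)) / 2)"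
      using flux_formula[OF k j(1)] by blast
    let ?gj = "grad M (u s k) j" and ?m = "(u s k j + u s k (j + 1)) / 2 - cstep M (u s k) y"
    have e: "?R y = - ((b - 1) * ?gj) - z_of s * dPsi M \<Psi> k j * ?m"
      unfolding dstep_at[OF j] b(3) by (simp add: algebra_simps)
    have "\<bar>z_of s * dPsi M \<Psi> k j * ?m\<bar> \<le> 3 * CQ * (h / 2 * \<bar>?gj\<bar>)"
      unfolding abs_mult using z_bound[of s] dPsi_bound(2)[OF k j(1)] avg_cstep[OF j(1) c, of "u s k"] CQ_pos
      by (intro mult_mono) auto
    moreover have "\<bar>(b - 1) * ?gj\<bar> \<le> 3 / 2 * CQ * h * \<bar>?gj\<bar>"
      unfolding abs_mult using b by (intro mult_right_mono) auto
    ultimately show "\<bar>?R y\<bar> \<le> 3 * CQ * h * \<bar>?g y\<bar>" unfolding e unfolding dstep_at[OF j] by (auto simp: abs_le_iff)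
  qed
  have "prim 1 ?f x + prim 1 ?g x + z_of s * prim 1 ?p x = prim 1 ?R x"
    using dstep_integrable product_integrable[OF k, of s] by (simp add: prim_add prim_cmult)
  then have "\<bar>prim 1 ?f x + prim 1 ?g x + z_of s * prim 1 ?p x\<bar> \<le> (\<integral>y. \<bar>?R y\<bar> \<partial>lm 1)"
    using prim_le_integral[OF iR, of x] by simp
  also have "\<dots> \<le> (\<integral>y. 3 * CQ * h * (1 + (?g y)\<^sup>2) \<partial>lm 1)"
  proof (rule integral_mono_AE)
    show "integrable (lm 1) (\<lambda>y. \<bar>?R y\<bar>)" using iR by (rule integrable_abs)
    show "integrable (lm 1) (\<lambda>y. 3 * CQ * h * (1 + (?g y)\<^sup>2))" using grad_sq(2) by simp
    show "AE y in lm 1. \<bar>?R y\<bar> \<le> 3 * CQ * h * (1 + (?g y)\<^sup>2)"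
      using R
    proof eventually_elim
      fix y assume r: "\<bar>?R y\<bar> \<le> 3 * CQ * h * \<bar>?g y\<bar>"
      have "\<bar>?g y\<bar> \<le> 1 + (?g y)\<^sup>2" using young_sq[of 1 "?g y" 1] by simp
      then have "3 * CQ * h * \<bar>?g y\<bar> \<le> 3 * CQ * h * (1 + (?g y)\<^sup>2)"
        using CQ_pos size_pos by (intro mult_left_mono) auto
      then show "\<bar>?R y\<bar> \<le> 3 * CQ * h * (1 + (?g y)\<^sup>2)" using r by (rule order_trans[rotated])
    qed
  qed
  also have "\<dots> = 3 * CQ * h * (1 + dissipation s k)"
    using grad_sq[of s k] measure_lm[of 1] by simp
  finally show ?thesis .
qed

text \<open>The exact balance at faces is extended to all points and integrated once more in space;
  thereby the gradients in the flux become values of the density.\<close>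

lemma level_identity:
  assumes k: "1 \<le> k" "k \<le> K" and x: "0 \<le> x" "x \<le> 1"
  shows "\<bar>eps_of d s * (prim 1 (prim 1 (cstep M (u s k))) x - prim 1 (prim 1 (u0 s)) x) - dt * (\<Sum>l=1..k. G s l x)\<bar>
    \<le> (2 * (1 + eps d) * Cu + 3 * CQ * (T + CE)) * h"
proof -
  let ?w = "prim 1 (cstep M (u s k))" and ?iv = "prim 1 (u0 s)"
  let ?F = "\<lambda>l. flux M u \<Psi> s l"
  let ?S = "\<lambda>y. eps_of d s * (?w y - ?iv y) + dt * (\<Sum>l=1..k. dstep M (?F l) y - ?F l 0)"
  have cb: "AE y in lm 1. \<bar>cstep M (u s k) y\<bar> \<le> Cu" by (rule cstep_bound) (use u_range[OF k, of _ s] in auto)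
  have iw: "integrable (lm 1) ?w" "integrable (lm 1) ?iv"
    using integrable_prim cstep_integrable u0_integrable by auto
  \<comment> \<open>Inside a dual cell the flux is constant and the balance holds at its face, at
    distance at most \<open>h\<close>; moving from there to \<open>y\<close> costs only the
    Lipschitz constant \<open>Cu\<close> of the two primitives.\<close>
  have S: "AE y in lm 1. \<bar>?S y\<bar> \<le> 2 * (1 + eps d) * Cu * h"
  proof (rule AE_dual_cell)
    fix j y assume j: "j \<le> I" "node M j < y" "y < node M (j + 1)" and y: "0 < y" "y < 1"
    note D = dual_props[OF j(1)]
    have close: "\<bar>prim 1 f y - prim 1 f (face M j)\<bar> \<le> Cu * h"
      if f: "f \<in> borel_measurable borel" "AE y in lm 1. \<bar>f y\<bar> \<le> Cu" for f
    proof -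
      have "\<bar>y - face M j\<bar> \<le> h" using D j by (auto simp: dual_h_def abs_le_iff)
      then have h: "Cu * \<bar>y - face M j\<bar> \<le> Cu * h" using Cu_pos by (intro mult_left_mono) auto
      show ?thesis
      proof (cases "y \<le> face M j")
        case True
        have "\<bar>prim 1 f (face M j) - prim 1 f y\<bar> \<le> Cu * (face M j - y)"
          by (rule prim_lipschitz[OF f]) (use y True face_range[OF j(1)] in auto)
        then show ?thesis using True h by (simp add: abs_minus_commute)
      next
        case False
        have "\<bar>prim 1 f y - prim 1 f (face M j)\<bar> \<le> Cu * (y - face M j)"
          by (rule prim_lipschitz[OF f]) (use y False face_range[OF j(1)] in auto)
        then show ?thesis using False h by simp
      qed
    qed
    have 1: "\<bar>?w y - ?w (face M j)\<bar> \<le> Cu * h" by (rule close[OF _ cb]) measurable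
    have 2: "\<bar>?iv y - ?iv (face M j)\<bar> \<le> Cu * h" using close[OF u0_borel[of s] u0_bound[of s]] by simp
    have z: "eps_of d s * (?w (face M j) - ?iv (face M j)) + dt * (\<Sum>l=1..k. ?F l j - ?F l 0) = 0"
      using mass_balance[OF j(1) k(2), of s] unfolding prim_cstep_face[OF j(1)] .
    have "?S y = eps_of d s * ((?w y - ?w (face M j)) - (?iv y - ?iv (face M j)))"
      using z unfolding dstep_at[OF j] by (simp add: algebra_simps)
    then have "\<bar>?S y\<bar> = eps_of d s * \<bar>(?w y - ?w (face M j)) - (?iv y - ?iv (face M j))\<bar>"
      using eps_of_range[of s] by (simp add: abs_mult)
    also have "\<dots> \<le> (1 + eps d) * (2 * Cu * h)"
      using eps_of_range[of s] 1 2 eps_pos by (intro mult_mono) auto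
    finally show "\<bar>?S y\<bar> \<le> 2 * (1 + eps d) * Cu * h" by (simp add: mult_ac)
  qed
  have iS2: "integrable (lm 1) (\<lambda>y. \<Sum>l=1..k. dstep M (?F l) y - ?F l 0)"
    by (intro Bochner_Integration.integrable_sum Bochner_Integration.integrable_diff dstep_integrable) simp
  have pS2: "prim 1 (\<lambda>y. \<Sum>l=1..k. dstep M (?F l) y - ?F l 0) x = (\<Sum>l=1..k. prim 1 (dstep M (?F l)) x - ?F l 0 * x)"
  proof -
    have "prim 1 (\<lambda>y. \<Sum>l=1..k. dstep M (?F l) y - ?F l 0) x = (\<Sum>l=1..k. prim 1 (\<lambda>y. dstep M (?F l) y - ?F l 0) x)"
      by (rule prim_sum) (auto intro!: Bochner_Integration.integrable_diff dstep_integrable)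
    also have "\<dots> = (\<Sum>l=1..k. prim 1 (dstep M (?F l)) x - ?F l 0 * x)"
      using prim_diff[OF dstep_integrable, of "\<lambda>_. ?F l 0" for l] prim_const[OF x] by simp
    finally show ?thesis .
  qed
  have "prim 1 ?S x = eps_of d s * (prim 1 ?w x - prim 1 ?iv x) + dt * (\<Sum>l=1..k. prim 1 (dstep M (?F l)) x - ?F l 0 * x)"
  proof -
    have "prim 1 ?S x = prim 1 (\<lambda>y. eps_of d s * (?w y - ?iv y)) x + prim 1 (\<lambda>y. dt * (\<Sum>l=1..k. dstep M (?F l) y - ?F l 0)) x"
      by (rule prim_add) (use iw iS2 in auto)
    then show ?thesis using iw unfolding prim_cmult pS2 by (simp add: prim_diff)
  qed
  moreover have "\<bar>prim 1 ?S x\<bar> \<le> 2 * (1 + eps d) * Cu * h * 1"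
  proof -
    have "\<bar>prim 1 ?S x\<bar> \<le> 2 * (1 + eps d) * Cu * h * x"
      by (rule prim_bound[OF _ S]) (use x in auto)
    also have "\<dots> \<le> 2 * (1 + eps d) * Cu * h * 1" using x eps_pos Cu_pos size_pos by (intro mult_left_mono) auto
    finally show ?thesis .
  qed
  moreover have "\<bar>(\<Sum>l=1..k. prim 1 (dstep M (?F l)) x - ?F l 0 * x) + (\<Sum>l=1..k. G s l x)\<bar> \<le> (\<Sum>l=1..k. 3 * CQ * h * (1 + dissipation s l))"
  proof -
    have "\<bar>(\<Sum>l=1..k. prim 1 (dstep M (?F l)) x - ?F l 0 * x) + (\<Sum>l=1..k. G s l x)\<bar>
      = \<bar>\<Sum>l=1..k. prim 1 (dstep M (?F l)) x + prim 1 (dstep M (grad M (u s l))) x + z_of s * prim 1 (\<lambda>y. dstep M (dPsi M \<Psi> l) y * cstep M (u s l) y) x\<bar>"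
      unfolding sum.distrib[symmetric]
      by (intro arg_cong[where f=abs] sum.cong) (use k in \<open>auto simp: G_eq\<close>)
    also have "\<dots> \<le> (\<Sum>l=1..k. 3 * CQ * h * (1 + dissipation s l))"
      by (rule order_trans[OF sum_abs sum_mono]) (use k in \<open>auto intro!: flux_primitive\<close>)
    finally show ?thesis .
  qed
  \<comment> \<open>Uniform in the number of steps: the level errors carry the dissipation, whose
    total is at most \<open>CE\<close>.\<close>
  moreover have "dt * (\<Sum>l=1..k. 3 * CQ * h * (1 + dissipation s l)) \<le> 3 * CQ * (T + CE) * h"
  proof -
    have dnn: "0 \<le> dissipation s l" for l unfolding dissipation_def using dual_props(1) by (intro sum_nonneg mult_nonneg_nonneg) (auto simp: less_imp_le)
    have "dt * (\<Sum>l=1..k. 3 * CQ * h * (1 + dissipation s l)) = 3 * CQ * h * (real k * dt + (\<Sum>l=1..k. dt * dissipation s l))"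
      by (simp add: sum_distrib_left[symmetric] sum.distrib algebra_simps)
    also have "\<dots> \<le> 3 * CQ * h * (T + CE)"
    proof (intro mult_left_mono add_mono)
      show "real k * dt \<le> T" unfolding K_dt[symmetric] using k dt_pos by (intro mult_right_mono) auto
      have "(\<Sum>l=1..k. dt * dissipation s l) \<le> (\<Sum>l=1..K. dt * dissipation s l)"
        by (rule sum_mono2) (use k dt_pos dnn in auto)
      then show "(\<Sum>l=1..k. dt * dissipation s l) \<le> CE" using total_dissipation[of s] by simp
    qed (use CQ_pos size_pos in auto)
    finally show ?thesis by (simp add: mult_ac)
  qed
  ultimately show ?thesis
  proof -
    assume a: "prim 1 ?S x = eps_of d s * (prim 1 ?w x - prim 1 ?iv x) + dt * (\<Sum>l=1..k. prim 1 (dstep M (?F l)) x - ?F l 0 * x)"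
      and b: "\<bar>prim 1 ?S x\<bar> \<le> 2 * (1 + eps d) * Cu * h * 1"
      and c: "\<bar>(\<Sum>l=1..k. prim 1 (dstep M (?F l)) x - ?F l 0 * x) + (\<Sum>l=1..k. G s l x)\<bar> \<le> (\<Sum>l=1..k. 3 * CQ * h * (1 + dissipation s l))"
      and e: "dt * (\<Sum>l=1..k. 3 * CQ * h * (1 + dissipation s l)) \<le> 3 * CQ * (T + CE) * h"
    let ?A = "\<Sum>l=1..k. prim 1 (dstep M (?F l)) x - ?F l 0 * x" and ?B = "\<Sum>l=1..k. G s l x"
    have "\<bar>dt * (?A + ?B)\<bar> \<le> 3 * CQ * (T + CE) * h"
      using order_trans[OF mult_left_mono[OF c less_imp_le[OF dt_pos]] e] dt_pos by (simp only: abs_mult abs_of_pos)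
    moreover have "eps_of d s * (prim 1 ?w x - prim 1 ?iv x) - dt * ?B = prim 1 ?S x - dt * (?A + ?B)"
      unfolding a by (simp add: algebra_simps)
    moreover have "(2 * (1 + eps d) * Cu + 3 * CQ * (T + CE)) * h = 2 * (1 + eps d) * Cu * h * 1 + 3 * CQ * (T + CE) * h"
      by (simp add: algebra_simps)
    ultimately show ?thesis using b by linarith
  qed
qed

text \<open>The scheme is implicit: on \<open>[t^k, t^(k+1))\<close> the reconstruction takes the
  values of level \<open>k + 1\<close>, hence the shift by one.\<close>

definition "lvl t = nat \<lfloor>t / dt\<rfloor> + 1"

lemma lvl_at: "real k * dt \<le> t \<Longrightarrow> t < real (k + 1) * dt \<Longrightarrow> lvl t = k + 1"
proof -
  assume "real k * dt \<le> t" "t < real (k + 1) * dt"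
  then have "real k \<le> t / dt" "t / dt < real (k + 1)" using dt_pos by (simp_all add: pos_le_divide_eq pos_divide_less_eq)
  then have "\<lfloor>t / dt\<rfloor> = int k" by (intro floor_unique) auto
  then show ?thesis by (simp add: lvl_def)
qed

lemma lvl_range:
  assumes "0 < t" "t < T"
  shows "\<exists>k<K. lvl t = k + 1 \<and> real k * dt \<le> t \<and> t < real (k + 1) * dt"
proof -
  define k where "k = nat \<lfloor>t / dt\<rfloor>"
  have p: "0 \<le> t / dt" using assms dt_pos by simp
  then have r: "real k = of_int \<lfloor>t / dt\<rfloor>" by (simp add: k_def)
  have "real k \<le> t / dt" "t / dt < real k + 1" unfolding r by linarith+
  then have kt: "real k * dt \<le> t" "t < real (k + 1) * dt" using dt_pos by (simp_all add: pos_le_divide_eq pos_divide_less_eq add.commute)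
  have "real k * dt < real K * dt" using kt assms K_dt by linarith
  then have "k < K" using dt_pos by simp
  then show ?thesis using kt by (auto simp: lvl_def k_def)
qed

lemma lvl_le: "0 < t \<Longrightarrow> t < T \<Longrightarrow> 1 \<le> lvl t \<and> lvl t \<le> K"
  using lvl_range[of t] by auto

lemma lvl_measurable [measurable]: "lvl \<in> borel \<rightarrow>\<^sub>M count_space UNIV"
  unfolding lvl_def by measurable

lemma step_borel: "(\<And>k. f k \<in> borel_measurable borel) \<Longrightarrow> (\<lambda>z. f (lvl (snd z)) (fst z)) \<in> borel_measurable (borel :: (real \<times> real) measure)"
proof -
  assume [measurable]: "\<And>k. f k \<in> borel_measurable borel"
  have "(\<lambda>z. f (lvl (snd z)) (fst z)) \<in> borel_measurable (borel \<Otimes>\<^sub>M borel)"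
    by (rule measurable_compose_countable[where f="\<lambda>k z. f k (fst z)"]) measurable
  then show ?thesis by (simp add: borel_prod)
qed

lemma step_time:
  fixes g :: "nat \<Rightarrow> real"
  shows "integrable (lm T) (\<lambda>\<tau>. g (lvl \<tau>))" "n \<le> K \<Longrightarrow> prim T (\<lambda>\<tau>. g (lvl \<tau>)) (real n * dt) = dt * (\<Sum>l=1..n. g l)"
proof -
  have m: "(\<lambda>\<tau>. g (lvl \<tau>)) \<in> borel_measurable borel"
    by (rule measurable_compose[OF lvl_measurable]) simp
  have "AE \<tau> in lm T. \<bar>g (lvl \<tau>)\<bar> \<le> (\<Sum>l=1..K. \<bar>g l\<bar>)"
  proof (rule AE_lm_I)
    fix \<tau> assume "0 < \<tau>" "\<tau> < T"
    from lvl_le[OF this] show "\<bar>g (lvl \<tau>)\<bar> \<le> (\<Sum>l=1..K. \<bar>g l\<bar>)"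
      by (intro member_le_sum[of "lvl \<tau>" "{1..K}" "\<lambda>l. \<bar>g l\<bar>"]) auto
  qed
  then show i: "integrable (lm T) (\<lambda>\<tau>. g (lvl \<tau>))"
    by (rule integrable_bounded_finite[OF finite_measure_lm, rotated]) (simp add: m)
  show "n \<le> K \<Longrightarrow> prim T (\<lambda>\<tau>. g (lvl \<tau>)) (real n * dt) = dt * (\<Sum>l=1..n. g l)"
  proof (induct n)
    case 0 then show ?case by (simp add: prim_0)
  next
    case (Suc n)
    let ?a = "real n * dt" and ?b = "real (Suc n) * dt"
    have ab: "0 \<le> ?a" "?a \<le> ?b" "?b \<le> T"
      unfolding K_dt[symmetric] using dt_pos Suc.prems by (auto intro!: mult_right_mono)
    have "prim T (\<lambda>\<tau>. g (lvl \<tau>)) ?b - prim T (\<lambda>\<tau>. g (lvl \<tau>)) ?a = (\<integral>\<tau>. indicator {?a<..?b} \<tau> * g (lvl \<tau>) \<partial>lm T)"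
      by (rule prim_diff_Ioc[OF i ab(2)])
    also have "\<dots> = (\<integral>\<tau>. indicator {?a<..?b} \<tau> * g (Suc n) \<partial>lm T)"
    proof (rule Bochner_Integration.integral_cong_AE)
      show "AE \<tau> in lm T. indicator {?a<..?b} \<tau> * g (lvl \<tau>) = indicator {?a<..?b} \<tau> * g (Suc n)"
        using lm_point_null[of ?b T]
        by eventually_elim (use lvl_at[of n] in \<open>auto simp: indicator_def\<close>)
    qed (use m in auto)
    also have "\<dots> = dt * g (Suc n)" using integral_lm_Ioc[OF ab] by (simp add: algebra_simps)
    finally show ?case using Suc by (simp add: algebra_simps)
  qed
qed

text \<open>The sum runs to the right end of the step containing \<open>t\<close>, so it differs
  from the integral up to \<open>t\<close> by a part of one step.\<close>

lemma step_time_near: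
  fixes g :: "nat \<Rightarrow> real"
  assumes t: "0 < t" "t < T" and B: "\<And>l. 1 \<le> l \<Longrightarrow> l \<le> K \<Longrightarrow> \<bar>g l\<bar> \<le> B"
  shows "\<bar>prim T (\<lambda>\<tau>. g (lvl \<tau>)) t - dt * (\<Sum>l=1..lvl t. g l)\<bar> \<le> B * dt"
proof -
  obtain k where k: "k < K" "lvl t = k + 1" "real k * dt \<le> t" "t < real (k + 1) * dt" using lvl_range[OF t] by blast
  have m: "(\<lambda>\<tau>. g (lvl \<tau>)) \<in> borel_measurable borel"
    by (rule measurable_compose[OF lvl_measurable]) simp
  have b: "AE \<tau> in lm T. \<bar>g (lvl \<tau>)\<bar> \<le> B" by (rule AE_lm_I) (use lvl_le B in blast)
  have e: "real (k + 1) * dt \<le> T" unfolding K_dt[symmetric] using k dt_pos by (intro mult_right_mono) auto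
  have "\<bar>prim T (\<lambda>\<tau>. g (lvl \<tau>)) (real (k + 1) * dt) - prim T (\<lambda>\<tau>. g (lvl \<tau>)) t\<bar> \<le> B * (real (k + 1) * dt - t)"
    by (rule prim_lipschitz[OF m b]) (use t k e in auto)
  also have "\<dots> \<le> B * dt"
    using k B[of 1] K1 by (intro mult_left_mono) (auto simp: algebra_simps)
  finally show ?thesis using step_time(2)[of "k + 1" g] k by (simp add: abs_minus_commute)
qed

lemma approx_eq:
  assumes "0 < t" "t < T"
  shows "approx T M K w (x, t) = cstep M (w (lvl t)) x"
proof -
  obtain k where k: "k < K" "lvl t = k + 1" "real k * dt \<le> t" "t < real (k + 1) * dt" using lvl_range[OF assms] by blast
  have ind: "indicator {real i * (T / real K)..<real (i + 1) * (T / real K)} t = (if i = k then 1 else 0 :: real)" for i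
  proof (cases "i = k")
    case True then show ?thesis using k by (simp add: dt_def)
  next
    case False
    have "\<not> (real i * dt \<le> t \<and> t < real (i + 1) * dt)"
      using lvl_at[of i t] k(2) False by auto
    then show ?thesis using False by (auto simp: dt_def indicator_def)
  qed
  have "approx T M K w (x, t) = (\<Sum>i<K. (if i = k then 1 else 0) * cstep M (w (i + 1)) x)"
    unfolding approx_def cstep_def prod.case ind ..
  also have "\<dots> = (\<Sum>i<K. if i = k then cstep M (w (k + 1)) x else 0)" by (rule sum.cong) auto
  also have "\<dots> = cstep M (w (lvl t)) x" using k by simp
  finally show ?thesis .
qed

definition "uh s z = pwaff M (u s (lvl (snd z))) (fst z)"
definition "gh s z = dstep M (grad M (u s (lvl (snd z)))) (fst z)"
definition "ub s z = cstep M (u s (lvl (snd z))) (fst z)"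
definition "Ph z = pwaff M (\<Psi> (lvl (snd z))) (fst z)"
definition "Qh z = dstep M (dPsi M \<Psi> (lvl (snd z))) (fst z)"
definition "Pb z = cstep M (\<Psi> (lvl (snd z))) (fst z)"

lemma pwaff_borel [measurable]: "pwaff M v \<in> borel_measurable borel"
  unfolding pwaff_def[abs_def] by measurable

text \<open>The limit analysis refers only to \<open>approximate_solution\<close>; all dependence on
  mesh and time step is condensed into the single error \<open>Cdel * (h + dt)\<close>.\<close>

theorem scheme_approximate_solution:
  "approximate_solution d Ctot (Cdel * (h + dt)) uh gh ub Ph Qh Pb (\<lambda>t. dPsi M \<Psi> (lvl t) 0) (\<lambda>t. dPsi M \<Psi> (lvl t) I)"
proof
  fix s
  show "uh s \<in> borel_measurable borel" "gh s \<in> borel_measurable borel" "ub s \<in> borel_measurable borel"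
    "Ph \<in> borel_measurable borel" "Qh \<in> borel_measurable borel" "Pb \<in> borel_measurable borel"
    unfolding uh_def[abs_def] gh_def[abs_def] ub_def[abs_def] Ph_def[abs_def] Qh_def[abs_def] Pb_def[abs_def]
    by (rule step_borel; measurable)+
  have nn: "0 \<le> h" "0 \<le> dt" "1 \<le> Cdel" using size_pos dt_pos Cdel_parts by auto
  then show "0 \<le> Cdel * (h + dt)" by simp
  have hle: "c * h \<le> Cdel * (h + dt)" if "c \<le> Cdel" for c
    using mult_right_mono[OF that nn(1)] nn by (simp add: distrib_left add_increasing2)
  have dtle: "c * dt \<le> Cdel * (h + dt)" if "c \<le> Cdel" for c
    using mult_right_mono[OF that nn(2)] nn by (simp add: distrib_left add_increasing)
  have Cu_le: "Cu \<le> Ctot" "CQ \<le> Ctot" "CE \<le> Ctot" unfolding Ctot_def using Cu_pos CQ_pos CE_pos by auto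
  \<comment> \<open>The bound used here depends on the mesh and serves integrability only; the
    uniform bound follows from the dissipation.\<close>
  show gi: "integrable (mq T) (\<lambda>z. (gh s z)\<^sup>2)"
  proof (rule integrable_bounded_finite[OF finite_measure_mq, where B="(\<Sum>l=1..K. \<Sum>i\<le>I. \<bar>grad M (u s l) i\<bar>)\<^sup>2"])
    show "(\<lambda>z. (gh s z)\<^sup>2) \<in> borel_measurable (mq T)"
      unfolding borel_measurable_lm(3) using \<open>gh s \<in> borel_measurable borel\<close> by measurable
    show "AE z in mq T. \<bar>(gh s z)\<^sup>2\<bar> \<le> (\<Sum>l=1..K. \<Sum>i\<le>I. \<bar>grad M (u s l) i\<bar>)\<^sup>2"
      unfolding AE_mq
    proof (rule AE_I2, rule impI)
      fix z assume "z \<in> QT T"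
      then have "0 < snd z" "snd z < T" by (auto simp: QT_def)
      from lvl_le[OF this] have l: "lvl (snd z) \<in> {1..K}" by auto
      let ?c = "grad M (u s (lvl (snd z)))"
      have "\<bar>gh s z\<bar> \<le> (\<Sum>i\<le>I. \<bar>?c i * indicator {node M i<..<node M (i + 1)} (fst z)\<bar>)"
        unfolding gh_def dstep_def by (rule sum_abs)
      also have "\<dots> \<le> (\<Sum>i\<le>I. \<bar>?c i\<bar>)" by (rule sum_mono) (auto simp: indicator_def)
      also have "\<dots> \<le> (\<Sum>l=1..K. \<Sum>i\<le>I. \<bar>grad M (u s l) i\<bar>)"
        using l by (intro member_le_sum[of "lvl (snd z)" "{1..K}" "\<lambda>l. \<Sum>i\<le>I. \<bar>grad M (u s l) i\<bar>"] sum_nonneg) auto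
      finally have "\<bar>gh s z\<bar>\<^sup>2 \<le> (\<Sum>l=1..K. \<Sum>i\<le>I. \<bar>grad M (u s l) i\<bar>)\<^sup>2" by (intro power_mono) auto
      then show "\<bar>(gh s z)\<^sup>2\<bar> \<le> (\<Sum>l=1..K. \<Sum>i\<le>I. \<bar>grad M (u s l) i\<bar>)\<^sup>2" by simp
    qed
  qed
  have "(\<integral>z. (gh s z)\<^sup>2 \<partial>mq T) = (\<integral>t. dissipation s (lvl t) \<partial>lm T)"
    unfolding mq_integral_iterated(1)[OF gi] using grad_sq(1) by (simp add: gh_def)
  also have "\<dots> = prim T (\<lambda>t. dissipation s (lvl t)) (real K * dt)"
    unfolding K_dt using borel_measurable_integrable[OF step_time(1)] by (intro prim_end[symmetric]) simp
  also have "\<dots> = dt * (\<Sum>l=1..K. dissipation s l)" by (rule step_time(2)) simp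
  also have "\<dots> \<le> CE" using total_dissipation[of s] by (simp add: sum_distrib_left)
  finally show "(\<integral>z. (gh s z)\<^sup>2 \<partial>mq T) \<le> Ctot" using Cu_le by simp
  fix t assume t: "0 < t" "t < T"
  then have l: "1 \<le> lvl t" "lvl t \<le> K" using lvl_le by auto
  show "AE x in lm 1. \<bar>ub s (x, t)\<bar> \<le> Ctot" unfolding ub_def fst_conv snd_conv
  proof (rule cstep_bound)
    fix j assume "1 \<le> j" "j \<le> I"
    then show "\<bar>u s (lvl t) j\<bar> \<le> Ctot" using u_range[OF l, of j s] Cu_le by simp
  qed
  show "AE x in lm 1. \<bar>Qh (x, t)\<bar> \<le> Ctot" unfolding Qh_def fst_conv snd_conv
    by (rule dstep_bound) (use dPsi_bound(2)[OF l] Cu_le in \<open>auto intro: order_trans\<close>)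
  show "integrable (lm 1) (\<lambda>x. (gh s (x, t))\<^sup>2)" unfolding gh_def using grad_sq(2) by simp
  show "AE x in lm 1. \<bar>uh s (x, t) - ub s (x, t)\<bar> \<le> Cdel * (h + dt) * \<bar>gh s (x, t)\<bar>"
    using pwaff_cstep_AE[of "u s (lvl t)"]
  proof eventually_elim
    fix x assume "\<bar>pwaff M (u s (lvl t)) x - cstep M (u s (lvl t)) x\<bar> \<le> h * \<bar>dstep M (grad M (u s (lvl t))) x\<bar>"
    also have "\<dots> \<le> Cdel * (h + dt) * \<bar>dstep M (grad M (u s (lvl t))) x\<bar>"
      using hle[OF nn(3)] by (intro mult_right_mono) auto
    finally show "\<bar>uh s (x, t) - ub s (x, t)\<bar> \<le> Cdel * (h + dt) * \<bar>gh s (x, t)\<bar>" by (simp add: uh_def ub_def gh_def)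
  qed
  have ch: "prim 1 (\<lambda>y. 3 * ub SpP (y, t) - ub SpN (y, t) + rho_hl d) x = prim 1 (cstep M (charge (lvl t))) x" for x
    unfolding ub_def fst_conv snd_conv
    by (rule prim_cong_AE) (use charge_cstep[of "lvl t"] in \<open>auto elim: eventually_mono\<close>)
  note cb = charge_bound'[OF l]
  show "AE x in lm 1. \<bar>Qh (x, t) - dPsi M \<Psi> (lvl t) 0 + prim 1 (\<lambda>y. 3 * ub SpP (y, t) - ub SpN (y, t) + rho_hl d) x / (lam d)\<^sup>2\<bar> \<le> Cdel * (h + dt)"
    unfolding ch
  proof (rule AE_dual_cell)
    fix j x assume j: "j \<le> I" "node M j < x" "x < node M (j + 1)" and x: "0 < x" "x < 1"
    note D = dual_props[OF j(1)]
    let ?p = "prim 1 (cstep M (charge (lvl t)))"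
    have "\<bar>x - face M j\<bar> \<le> h" using D j by (auto simp: dual_h_def abs_le_iff)
    then have "Crho * \<bar>x - face M j\<bar> \<le> Crho * h" using Crho_pos by (intro mult_left_mono) auto
    moreover have "\<bar>?p x - ?p (face M j)\<bar> \<le> Crho * \<bar>x - face M j\<bar>"
    proof (cases "x \<le> face M j")
      case True
      have "\<bar>?p (face M j) - ?p x\<bar> \<le> Crho * (face M j - x)"
        by (rule prim_lipschitz[OF _ cb]) (use x True face_range[OF j(1)] in auto)
      then show ?thesis using True by (simp add: abs_minus_commute)
    next
      case False
      have "\<bar>?p x - ?p (face M j)\<bar> \<le> Crho * (x - face M j)"
        by (rule prim_lipschitz[OF _ cb]) (use x False face_range[OF j(1)] in auto)
      then show ?thesis using False by simp
    qed
    ultimately have "\<bar>?p x - ?p (face M j)\<bar> / (lam d)\<^sup>2 \<le> Crho * h / (lam d)\<^sup>2" by (intro divide_right_mono) auto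
    moreover have "Qh (x, t) - dPsi M \<Psi> (lvl t) 0 + ?p x / (lam d)\<^sup>2 = (?p x - ?p (face M j)) / (lam d)\<^sup>2"
      unfolding Qh_def fst_conv snd_conv dstep_at[OF j] dPsi_formula[OF l j(1)] by (simp add: diff_divide_distrib)
    ultimately have "\<bar>Qh (x, t) - dPsi M \<Psi> (lvl t) 0 + ?p x / (lam d)\<^sup>2\<bar> \<le> Cj * h" by (simp add: Cj_def)
    then show "\<bar>Qh (x, t) - dPsi M \<Psi> (lvl t) 0 + ?p x / (lam d)\<^sup>2\<bar> \<le> Cdel * (h + dt)"
      using hle[OF Cdel_parts(2)] by linarith
  qed
  show "dPsi M \<Psi> (lvl t) I = dPsi M \<Psi> (lvl t) 0 - prim 1 (\<lambda>y. 3 * ub SpP (y, t) - ub SpN (y, t) + rho_hl d) 1 / (lam d)\<^sup>2"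
    unfolding ch using dPsi_formula[OF l, of I] face_I by simp
  show "Ph (0, t) - alpha0 d * dPsi M \<Psi> (lvl t) 0 = dPsi_pzc0 d"
    using robin0[OF l] by (simp add: Ph_def pwaff_0)
  show "Ph (1, t) + alpha1 d * dPsi M \<Psi> (lvl t) I = V_pot d - dPsi_pzc1 d"
    using robin1[OF l] by (simp add: Ph_def pwaff_1)
  have "AE x in lm 1. \<bar>dstep M (grad M (\<Psi> (lvl t))) x\<bar> \<le> CQ"
    by (rule dstep_bound) (use dPsi_bound(2)[OF l] in \<open>simp add: dPsi_grad\<close>)
  then show "AE x in lm 1. \<bar>Ph (x, t) - Pb (x, t)\<bar> \<le> Cdel * (h + dt)"
    using pwaff_cstep_AE[of "\<Psi> (lvl t)"]
  proof eventually_elim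
    fix x assume g: "\<bar>dstep M (grad M (\<Psi> (lvl t))) x\<bar> \<le> CQ"
      and "\<bar>pwaff M (\<Psi> (lvl t)) x - cstep M (\<Psi> (lvl t)) x\<bar> \<le> h * \<bar>dstep M (grad M (\<Psi> (lvl t))) x\<bar>"
    note this(2)
    also have "h * \<bar>dstep M (grad M (\<Psi> (lvl t))) x\<bar> \<le> h * CQ" using g nn by (intro mult_left_mono) auto
    also have "\<dots> \<le> Cdel * (h + dt)" using hle[OF Cdel_parts(3)] by (simp add: mult.commute)
    finally show "\<bar>Ph (x, t) - Pb (x, t)\<bar> \<le> Cdel * (h + dt)" by (simp add: Ph_def Pb_def)
  qed
  have near: "\<bar>prim T (\<lambda>\<tau>. B01 s (lvl \<tau>)) t - dt * (\<Sum>l=1..lvl t. B01 s l)\<bar> \<le> 2 * CF * dt"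
  proof (rule step_time_near[OF t])
    fix l assume l: "1 \<le> l" "l \<le> K"
    show "\<bar>B01 s l\<bar> \<le> 2 * CF" using flux_bound[OF l, of s] unfolding B01_eq[OF l] by linarith
  qed
  have "dt * (\<Sum>l=1..lvl t. B01 s l) = - (eps_of d s * (prim 1 (\<lambda>y. ub s (y, t)) 1 - prim 1 (u0 s) 1))"
  proof -
    have "(\<Sum>l=1..lvl t. B01 s l) = (\<Sum>l=1..lvl t. flux M u \<Psi> s l I - flux M u \<Psi> s l 0)"
      by (rule sum.cong) (use l in \<open>auto simp: B01_eq\<close>)
    then show ?thesis using mass_balance[OF order_refl l(2), of s] prim_cstep_face[of I "u s (lvl t)"] face_I
      by (simp add: ub_def)
  qed
  then show "\<bar>eps_of d s * (prim 1 (\<lambda>y. ub s (y, t)) 1 - prim 1 (u0 s) 1)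
        + prim T (\<lambda>\<tau>. (beta d s 1 (V_pot d - Ph (1, \<tau>)) * uh s (1, \<tau>) - gamma1 d s (V_pot d - Ph (1, \<tau>)))
            + (beta d s 0 (Ph (0, \<tau>)) * uh s (0, \<tau>) - gamma0 d s (Ph (0, \<tau>)))) t\<bar> \<le> Cdel * (h + dt)"
    using near dtle[OF Cdel_parts(6)] unfolding Ph_def uh_def fst_conv snd_conv B01_def[symmetric] by linarith
  fix x :: real assume x: "0 \<le> x" "x \<le> 1"
  have "0 \<le> pwaff M (u s (lvl t)) x \<and> pwaff M (u s (lvl t)) x \<le> Cu"
    using pwaff_bounds[of 0 "u s (lvl t)" Cu x] u_range[OF l, of _ s] x by auto
  then show "0 \<le> uh s (x, t) \<and> uh s (x, t) \<le> Cu" by (simp add: uh_def)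
  have "- CP \<le> \<Psi> (lvl t) i \<and> \<Psi> (lvl t) i \<le> CP" if "i \<le> I + 1" for i
    using dPsi_bound(3)[OF l that] by (simp add: abs_le_iff)
  then show "\<bar>Ph (x, t)\<bar> \<le> CP"
    using pwaff_bounds[of "- CP" "\<Psi> (lvl t)" CP x] x by (simp add: Ph_def abs_le_iff)
  show "uh s (x, t) = uh s (0, t) + prim 1 (\<lambda>y. gh s (y, t)) x"
    by (simp add: uh_def gh_def pwaff_0) (simp add: pwaff_def)
  show "Ph (x, t) = Ph (0, t) + prim 1 (\<lambda>y. Qh (y, t)) x"
    by (simp add: Ph_def Qh_def pwaff_0) (simp add: pwaff_def dPsi_grad)
  have "\<bar>prim T (\<lambda>\<tau>. G s (lvl \<tau>) x) t - dt * (\<Sum>l=1..lvl t. G s l x)\<bar> \<le> CG * dt"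
    by (rule step_time_near[OF t]) (rule G_bound[OF _ _ x])
  then have "\<bar>eps_of d s * (prim 1 (prim 1 (\<lambda>y. ub s (y, t))) x - prim 1 (prim 1 (u0 s)) x) - prim T (\<lambda>\<tau>. G s (lvl \<tau>) x) t\<bar>
      \<le> (2 * (1 + eps d) * Cu + 3 * CQ * (T + CE)) * h + CG * dt"
    using level_identity[OF l x, of s] unfolding ub_def fst_conv snd_conv by linarith
  also have "\<dots> \<le> Cdel * h + Cdel * dt"
    using nn by (intro add_mono mult_right_mono Cdel_parts)
  also have "\<dots> = Cdel * (h + dt)" by (simp add: distrib_left)
  finally show "\<bar>eps_of d s * (prim 1 (prim 1 (\<lambda>y. ub s (y, t))) x - prim 1 (prim 1 (u0 s)) x)
        - prim T (\<lambda>\<tau>. uh s (x, \<tau>) - uh s (0, \<tau>) + z_of s * prim 1 (\<lambda>y. Qh (y, \<tau>) * ub s (y, \<tau>)) x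
            - x * (beta d s 0 (Ph (0, \<tau>)) * uh s (0, \<tau>) - gamma0 d s (Ph (0, \<tau>)))) t\<bar> \<le> Cdel * (h + dt)"
    unfolding G_def uh_def Ph_def Qh_def ub_def fst_conv snd_conv .
qed

end

section \<open>Equicontinuity of the primitives\<close>

text \<open>Traces and elements of \<open>L2H1\<close> need not be Borel functions. Completeness of
  Lebesgue measure makes an integrand measurable as soon as it agrees almost everywhere with a Borel
  one.\<close>

lemma set_integral_AE_lm:
  fixes f g :: "real \<Rightarrow> real"
  assumes [measurable]: "g \<in> borel_measurable borel" and ae: "AE t in lm S. f t = g t"
  shows "(LINT t:{0<..<S}|lebesgue. f t) = integral\<^sup>L (lm S) g"
    "set_borel_measurable lebesgue {0<..<S} f"
    "integrable (lm S) g \<Longrightarrow> set_integrable lebesgue {0<..<S} f"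
proof -
  have e: "AE t in lborel. indicator {0<..<S} t *\<^sub>R f t = indicator {0<..<S} t *\<^sub>R g t"
    using ae[unfolded AE_lm] by eventually_elim (auto simp: indicator_def)
  have e': "AE t in lebesgue. indicator {0<..<S} t *\<^sub>R g t = indicator {0<..<S} t *\<^sub>R f t"
    using AE_completion[OF e] by (rule eventually_mono) (rule sym)
  have mg: "(\<lambda>t. indicator {0<..<S} t *\<^sub>R g t) \<in> borel_measurable lborel" by measurable
  have mf: "(\<lambda>t. indicator {0<..<S} t *\<^sub>R f t) \<in> borel_measurable lebesgue"
    by (rule borel_measurable_AE[OF measurable_completion[OF mg] e'])
  have "(LINT t:{0<..<S}|lebesgue. f t) = (LINT t:{0<..<S}|lebesgue. g t)"
    unfolding set_lebesgue_integral_def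
    by (rule Bochner_Integration.integral_cong_AE[OF mf measurable_completion[OF mg] AE_completion[OF e]])
  then show "(LINT t:{0<..<S}|lebesgue. f t) = integral\<^sup>L (lm S) g" by (simp add: integral_lm)
  show "set_borel_measurable lebesgue {0<..<S} f" using mf by (simp add: set_borel_measurable_def)
  assume "integrable (lm S) g"
  then have "set_integrable lebesgue {0<..<S} g" by (simp add: integral_lm(2))
  then show "set_integrable lebesgue {0<..<S} f" unfolding set_integrable_def
    by (rule integrable_cong_AE_imp[OF _ mf e'])
qed

lemma set_integral_AE_mq:
  fixes f g :: "real \<times> real \<Rightarrow> real"
  assumes [measurable]: "g \<in> borel_measurable borel" and ae: "AE z in mq S. f z = g z"
  shows "(LINT z:QT S|lebesgue. f z) = integral\<^sup>L (mq S) g"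
    "set_borel_measurable lebesgue (QT S) f"
    "integrable (mq S) g \<Longrightarrow> set_integrable lebesgue (QT S) f"
proof -
  have e: "AE t in lborel. indicator (QT S) t *\<^sub>R f t = indicator (QT S) t *\<^sub>R g t"
    using ae[unfolded AE_mq] by eventually_elim (auto simp: indicator_def)
  have e': "AE t in lebesgue. indicator (QT S) t *\<^sub>R g t = indicator (QT S) t *\<^sub>R f t"
    using AE_completion[OF e] by (rule eventually_mono) (rule sym)
  have mg: "(\<lambda>t. indicator (QT S) t *\<^sub>R g t) \<in> borel_measurable lborel" by measurable
  have mf: "(\<lambda>t. indicator (QT S) t *\<^sub>R f t) \<in> borel_measurable lebesgue"
    by (rule borel_measurable_AE[OF measurable_completion[OF mg] e'])
  have "(LINT t:QT S|lebesgue. f t) = (LINT t:QT S|lebesgue. g t)"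
    unfolding set_lebesgue_integral_def
    by (rule Bochner_Integration.integral_cong_AE[OF mf measurable_completion[OF mg] AE_completion[OF e]])
  then show "(LINT t:QT S|lebesgue. f t) = integral\<^sup>L (mq S) g" by (simp add: integral_mq)
  show "set_borel_measurable lebesgue (QT S) f" using mf by (simp add: set_borel_measurable_def)
  assume "integrable (mq S) g"
  then have "set_integrable lebesgue (QT S) g" by (simp add: integral_mq(2))
  then show "set_integrable lebesgue (QT S) f" unfolding set_integrable_def
    by (rule integrable_cong_AE_imp[OF _ mf e'])
qed

text \<open>Integrated form of \<open>(F^2)' = 2 F F'\<close>. Truncating \<open>f\<close> at
  \<open>x\<close> permits integration by parts over the whole interval, since the truncated
  primitive ends with the value at \<open>x\<close>.\<close>

lemma prim_square:
  assumes f: "integrable (lm T) f"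
  shows "(a + prim T f x)\<^sup>2 = a\<^sup>2 + 2 * (\<integral>y. indicator {..x} y * ((a + prim T f y) * f y) \<partial>lm T)"
    "integrable (lm T) (\<lambda>y. (a + prim T f y) * f y)"
proof -
  have [measurable]: "f \<in> borel_measurable borel" using borel_measurable_integrable[OF f] by simp
  let ?f = "\<lambda>y. indicator {..x} y * f y"
  have i: "integrable (lm T) ?f" by (rule integrable_trunc[OF f])
  have same: "prim T ?f y = prim T f y" if "y \<le> x" for y
    unfolding prim_def by (rule Bochner_Integration.integral_cong) (use that in \<open>auto simp: indicator_def\<close>)
  have "(\<integral>y. ?f y * (a + prim T ?f y) \<partial>lm T) = (a + integral\<^sup>L (lm T) ?f) * (a + integral\<^sup>L (lm T) ?f) - a * a - (\<integral>y. (a + prim T ?f y) * ?f y \<partial>lm T)"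
    by (rule ibp(1)[OF i i]) auto
  moreover have "(\<integral>y. ?f y * (a + prim T ?f y) \<partial>lm T) = (\<integral>y. indicator {..x} y * ((a + prim T f y) * f y) \<partial>lm T)"
    by (rule Bochner_Integration.integral_cong) (use same in \<open>auto simp: indicator_def\<close>)
  moreover have "(\<integral>y. (a + prim T ?f y) * ?f y \<partial>lm T) = (\<integral>y. indicator {..x} y * ((a + prim T f y) * f y) \<partial>lm T)"
    by (rule Bochner_Integration.integral_cong) (use same in \<open>auto simp: indicator_def\<close>)
  moreover have "integral\<^sup>L (lm T) ?f = prim T f x" by (simp add: prim_def)
  ultimately show "(a + prim T f x)\<^sup>2 = a\<^sup>2 + 2 * (\<integral>y. indicator {..x} y * ((a + prim T f y) * f y) \<partial>lm T)"
    by (simp add: power2_eq_square)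
  show "integrable (lm T) (\<lambda>y. (a + prim T f y) * f y)"
  proof -
    have "(\<lambda>y. (a + prim T f y) * f y) = (\<lambda>y. a * f y + f y * prim T f y)" by (auto simp: algebra_simps)
    then show ?thesis using prim_by_parts(2)[OF f f] f by simp
  qed
qed

text \<open>One-dimensional Gagliardo-Nirenberg inequality: \<open>(F x)^2 - (F y)^2\<close> is
  controlled by the integral of \<open>\<bar>F\<bar> * \<bar>f\<bar>\<close>, and averaging over
  \<open>y\<close> removes the second point. If \<open>F\<close> is small in \<open>L2\<close> and
  \<open>f\<close> merely bounded there, the right side is still small.\<close>

lemma sup_square_bound:
  assumes f: "integrable (lm 1) f" and x: "0 \<le> x" "x \<le> 1"
    and F: "\<And>y. 0 \<le> y \<Longrightarrow> y \<le> 1 \<Longrightarrow> F y = F 0 + prim 1 f y"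
    and [measurable]: "F \<in> borel_measurable borel"
    and i: "integrable (lm 1) (\<lambda>y. (F y)\<^sup>2)"
  shows "(F x)\<^sup>2 \<le> (\<integral>y. (F y)\<^sup>2 \<partial>lm 1) + 2 * (\<integral>y. \<bar>F y\<bar> * \<bar>f y\<bar> \<partial>lm 1)" "integrable (lm 1) (\<lambda>y. \<bar>F y\<bar> * \<bar>f y\<bar>)"
proof -
  have [measurable]: "f \<in> borel_measurable borel" using borel_measurable_integrable[OF f] by simp
  let ?P = "\<lambda>y. (F 0 + prim 1 f y) * f y"
  have ip: "integrable (lm 1) (\<lambda>y. \<bar>?P y\<bar>)" using prim_square(2)[OF f] by (rule integrable_abs)
  have ae: "AE y in lm 1. \<bar>?P y\<bar> = \<bar>F y\<bar> * \<bar>f y\<bar>"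
  proof (rule AE_lm_I)
    fix y :: real assume "0 < y" "y < 1"
    then have "F y = F 0 + prim 1 f y" by (intro F) auto
    then show "\<bar>?P y\<bar> = \<bar>F y\<bar> * \<bar>f y\<bar>" by (simp only: abs_mult)
  qed
  show iF: "integrable (lm 1) (\<lambda>y. \<bar>F y\<bar> * \<bar>f y\<bar>)"
    by (rule integrable_cong_AE_imp[OF ip]) (use ae in \<open>auto elim: eventually_mono\<close>)
  have eq: "(\<integral>y. \<bar>?P y\<bar> \<partial>lm 1) = (\<integral>y. \<bar>F y\<bar> * \<bar>f y\<bar> \<partial>lm 1)"
    by (rule Bochner_Integration.integral_cong_AE) (use ae in auto)
  have part: "\<bar>\<integral>y. indicator {a<..b} y * ?P y \<partial>lm 1\<bar> \<le> (\<integral>y. \<bar>F y\<bar> * \<bar>f y\<bar> \<partial>lm 1)" for a b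
  proof -
    have "\<bar>\<integral>y. indicator {a<..b} y * ?P y \<partial>lm 1\<bar> \<le> (\<integral>y. \<bar>indicator {a<..b} y * ?P y\<bar> \<partial>lm 1)" by (rule integral_abs_bound)
    also have "\<dots> \<le> (\<integral>y. \<bar>?P y\<bar> \<partial>lm 1)"
      using integrable_real_mult_indicator[OF _ prim_square(2)[OF f], of "{a<..b}" "F 0"] ip
      by (intro integral_mono) (auto simp: indicator_def mult.commute)
    finally show ?thesis unfolding eq .
  qed
  have diff: "(F x)\<^sup>2 - (F y)\<^sup>2 \<le> 2 * (\<integral>y. \<bar>F y\<bar> * \<bar>f y\<bar> \<partial>lm 1)" if y: "0 < y" "y < 1" for y
  proof -
    have sq: "(F z)\<^sup>2 = (F 0)\<^sup>2 + 2 * prim 1 ?P z" if "0 \<le> z" "z \<le> 1" for z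
      using prim_square(1)[OF f, of "F 0" z] F[OF that] by (simp add: prim_def)
    have "\<bar>prim 1 ?P x - prim 1 ?P y\<bar> \<le> (\<integral>y. \<bar>F y\<bar> * \<bar>f y\<bar> \<partial>lm 1)"
    proof (cases "x \<le> y")
      case True
      then show ?thesis using prim_diff_Ioc[OF prim_square(2)[OF f] True, of "F 0"] part[of x y] by (simp add: abs_minus_commute)
    next
      case False
      then have "y \<le> x" by simp
      then show ?thesis using prim_diff_Ioc[OF prim_square(2)[OF f] \<open>y \<le> x\<close>, of "F 0"] part[of y x] by simp
    qed
    then show ?thesis using sq[OF x] sq[of y] y by linarith
  qed
  have "(F x)\<^sup>2 = (\<integral>y. (F x)\<^sup>2 \<partial>lm 1)" using measure_lm[of 1] by simp
  also have "\<dots> \<le> (\<integral>y. (F y)\<^sup>2 + 2 * (\<integral>y. \<bar>F y\<bar> * \<bar>f y\<bar> \<partial>lm 1) \<partial>lm 1)"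
  proof (rule integral_mono_AE)
    show "AE y in lm 1. (F x)\<^sup>2 \<le> (F y)\<^sup>2 + 2 * (\<integral>y. \<bar>F y\<bar> * \<bar>f y\<bar> \<partial>lm 1)"
      by (rule AE_lm_I) (use diff in fastforce)
  qed (use i in auto)
  also have "\<dots> = (\<integral>y. (F y)\<^sup>2 \<partial>lm 1) + 2 * (\<integral>y. \<bar>F y\<bar> * \<bar>f y\<bar> \<partial>lm 1)"
    using i measure_lm[of 1] by simp
  finally show "(F x)\<^sup>2 \<le> (\<integral>y. (F y)\<^sup>2 \<partial>lm 1) + 2 * (\<integral>y. \<bar>F y\<bar> * \<bar>f y\<bar> \<partial>lm 1)" .
qed

text \<open>Landau-Kolmogorov: compare \<open>g x\<close> with its mean over a window of length \<open>\<eta>\<close> next to \<open>x\<close>.\<close>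

lemma prim_interpolation:
  assumes [measurable]: "g \<in> borel_measurable borel" and ig: "integrable (lm 1) g"
    and lip: "\<And>x y. 0 \<le> x \<Longrightarrow> x \<le> y \<Longrightarrow> y \<le> 1 \<Longrightarrow> \<bar>g y - g x\<bar> \<le> L * (y - x)"
    and D: "\<And>x. 0 \<le> x \<Longrightarrow> x \<le> 1 \<Longrightarrow> \<bar>prim 1 g x\<bar> \<le> D"
    and x: "0 \<le> x" "x \<le> 1" and \<eta>: "0 < \<eta>" "\<eta> \<le> 1/2" and L: "0 \<le> L"
  shows "\<bar>g x\<bar> \<le> 2 * D / \<eta> + L * \<eta>"
proof -
  have main: "\<bar>g x\<bar> \<le> 2 * D / \<eta> + L * \<eta>" if ab: "0 \<le> a" "a \<le> x" "x \<le> a + \<eta>" "a + \<eta> \<le> 1" for a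
  proof -
    let ?J = "{a<..a + \<eta>}"
    have i1: "integrable (lm 1) (\<lambda>y. indicator ?J y * g y)"
      using integrable_real_mult_indicator[OF _ ig, of ?J] by (simp add: mult.commute)
    have i2: "integrable (lm 1) (\<lambda>y. indicator ?J y * c :: real)" for c
      by (rule integrable_bounded_finite[OF finite_measure_lm, where B="\<bar>c\<bar>"]) (auto simp: indicator_def)
    have mJ: "(\<integral>y. indicator ?J y * c \<partial>lm 1) = \<eta> * c" for c
      using integral_lm_Ioc[of a "a + \<eta>" 1] ab \<eta> by simp
    have "\<bar>(prim 1 g (a + \<eta>) - prim 1 g a) - \<eta> * g x\<bar> = \<bar>\<integral>y. indicator ?J y * g y - indicator ?J y * g x \<partial>lm 1\<bar>"
      unfolding Bochner_Integration.integral_diff[OF i1 i2] mJ using prim_diff_Ioc[OF ig, of a "a + \<eta>"] \<eta> by simp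
    also have "\<dots> \<le> (\<integral>y. \<bar>indicator ?J y * g y - indicator ?J y * g x\<bar> \<partial>lm 1)" by (rule integral_abs_bound)
    also have "\<dots> \<le> (\<integral>y. indicator ?J y * (L * \<eta>) \<partial>lm 1)"
    proof (rule integral_mono_AE)
      show "AE y in lm 1. \<bar>indicator ?J y * g y - indicator ?J y * g x\<bar> \<le> indicator ?J y * (L * \<eta>)"
      proof (rule AE_lm_I)
        fix y :: real assume y: "0 < y" "y < 1"
        show "\<bar>indicator ?J y * g y - indicator ?J y * g x\<bar> \<le> indicator ?J y * (L * \<eta>)"
        proof (cases "y \<in> ?J")
          case True
          have "\<bar>g y - g x\<bar> \<le> L * \<bar>y - x\<bar>"
            using lip[of x y] lip[of y x] x y by (cases "x \<le> y") (auto simp: abs_minus_commute)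
          also have "\<dots> \<le> L * \<eta>" using True ab L by (intro mult_left_mono) auto
          finally show ?thesis using True by simp
        qed simp
      qed
    qed (use i1 i2 in auto)
    also have "\<dots> = \<eta> * (L * \<eta>)" by (rule mJ)
    finally have "\<bar>(prim 1 g (a + \<eta>) - prim 1 g a) - \<eta> * g x\<bar> \<le> \<eta> * (L * \<eta>)" .
    moreover have "\<bar>prim 1 g (a + \<eta>)\<bar> \<le> D" "\<bar>prim 1 g a\<bar> \<le> D" using D ab \<eta> by auto
    ultimately have "\<bar>\<eta> * g x\<bar> \<le> 2 * D + \<eta> * (L * \<eta>)" by linarith
    then have "\<eta> * \<bar>g x\<bar> \<le> \<eta> * (2 * D / \<eta> + L * \<eta>)" using \<eta> by (simp add: abs_mult distrib_left)
    then show ?thesis using \<eta> by simp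
  qed
  \<comment> \<open>Since \<open>\<eta> \<le> 1/2\<close>, the window fits on at least one side of
    \<open>x\<close>.\<close>
  show ?thesis
  proof (cases "x + \<eta> \<le> 1")
    case True then show ?thesis using main[of x] x \<eta> by simp
  next
    case False then show ?thesis using main[of "x - \<eta>"] x \<eta> by simp
  qed
qed

lemma AE_seq_0:
  fixes f :: "nat \<Rightarrow> 'a \<Rightarrow> real"
  assumes "\<And>n. integrable M (f n)" "\<And>n x. 0 \<le> f n x" "\<And>n. integral\<^sup>L M (f n) \<le> C * (1/2)^n"
  shows "AE x in M. (\<lambda>n. f n x) \<longlonglongrightarrow> 0"
  using AE_summable[of M f C] assms by (auto elim!: eventually_mono dest: summable_LIMSEQ_zero)

text \<open>The geometric rate makes the errors summable, so that integrated bounds yield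
  convergence at almost every time.\<close>

locale approximating_sequence = corrosion_setting d for d +
  fixes C :: real and \<delta> :: "nat \<Rightarrow> real" and uh gh ub :: "nat \<Rightarrow> species \<Rightarrow> real \<times> real \<Rightarrow> real"
    and Ph Qh Pb :: "nat \<Rightarrow> real \<times> real \<Rightarrow> real" and q0 q1 :: "nat \<Rightarrow> real \<Rightarrow> real"
  assumes approximates: "\<And>m. approximate_solution d C (\<delta> m) (uh m) (gh m) (ub m) (Ph m) (Qh m) (Pb m) (q0 m) (q1 m)"
    and delta_small: "\<And>m. \<delta> m \<le> (1/2)^m"
begin

lemma subsequence:
  assumes "strict_mono r"
  shows "approximating_sequence d C (\<lambda>m. \<delta> (r m)) (\<lambda>m. uh (r m)) (\<lambda>m. gh (r m)) (\<lambda>m. ub (r m))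
    (\<lambda>m. Ph (r m)) (\<lambda>m. Qh (r m)) (\<lambda>m. Pb (r m)) (\<lambda>m. q0 (r m)) (\<lambda>m. q1 (r m))"
proof (intro approximating_sequence.intro approximating_sequence_axioms.intro corrosion_setting_axioms)
  fix m
  show "approximate_solution d C (\<delta> (r m)) (uh (r m)) (gh (r m)) (ub (r m)) (Ph (r m)) (Qh (r m)) (Pb (r m)) (q0 (r m)) (q1 (r m))"
    by (rule approximates)
  have "\<delta> (r m) \<le> (1/2)^(r m)" by (rule delta_small)
  also have "\<dots> \<le> (1/2)^m" using strict_mono_imp_increasing[OF assms, of m] by (intro power_decreasing) auto
  finally show "\<delta> (r m) \<le> (1/2)^m" .
qed

interpretation a: approximate_solution d C "\<delta> m" "uh m" "gh m" "ub m" "Ph m" "Qh m" "Pb m" "q0 m" "q1 m" for m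
  by (rule approximates)

lemmas seq_borel [measurable] = a.borel

lemma delta_0: "\<delta> \<longlonglongrightarrow> 0"
proof (rule tendsto_sandwich[of "\<lambda>_. 0" \<delta> sequentially "\<lambda>m. (1/2)^m"])
  show "(\<lambda>m. (1/2)^m) \<longlonglongrightarrow> (0::real)" by (rule LIMSEQ_realpow_zero) auto
qed (auto simp: a.delta_nonneg delta_small)

lemma C_nonneg: "0 \<le> C"
proof -
  have "0 \<le> (\<integral>z. (gh 0 s z)\<^sup>2 \<partial>mq T)" for s by simp
  then show ?thesis using a.gh_sq(2)[of 0 SpP] by (meson order_trans)
qed

definition "wm m s z = prim 1 (\<lambda>y. ub m s (y, snd z)) (fst z)"

lemma wm_borel [measurable]: "wm m s \<in> borel_measurable borel"
  unfolding wm_def[abs_def] by (rule prim_borel2) measurable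

lemma slices [measurable]:
  "(\<lambda>y. ub m s (y, t)) \<in> borel_measurable borel" "(\<lambda>y. uh m s (y, t)) \<in> borel_measurable borel" "(\<lambda>y. gh m s (y, t)) \<in> borel_measurable borel"
  "(\<lambda>y. Qh m (y, t)) \<in> borel_measurable borel" "(\<lambda>y. Ph m (y, t)) \<in> borel_measurable borel"
  "(\<lambda>y. Pb m (y, t)) \<in> borel_measurable borel" "(\<lambda>y. wm m s (y, t)) \<in> borel_measurable borel"
  by (intro slice_borel; measurable)+

lemma ub_integrable: "0 < t \<Longrightarrow> t < T \<Longrightarrow> integrable (lm 1) (\<lambda>y. ub m s (y, t))"
  by (rule integrable_bounded_finite[OF finite_measure_lm _ a.ub_bound]) auto

lemma gh_integrable: "0 < t \<Longrightarrow> t < T \<Longrightarrow> integrable (lm 1) (\<lambda>y. gh m s (y, t))"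
  by (rule sq_integrable_imp_integrable[OF finite_measure_lm]) (auto intro: a.gh_sq)

lemma wm_lipschitz:
  "0 < t \<Longrightarrow> t < T \<Longrightarrow> 0 \<le> x \<Longrightarrow> x \<le> y \<Longrightarrow> y \<le> 1 \<Longrightarrow> \<bar>wm m s (y, t) - wm m s (x, t)\<bar> \<le> C * (y - x)"
  unfolding wm_def fst_conv snd_conv by (rule prim_lipschitz[OF _ a.ub_bound]) auto

lemma wm_bound: "0 < t \<Longrightarrow> t < T \<Longrightarrow> 0 \<le> x \<Longrightarrow> x \<le> 1 \<Longrightarrow> \<bar>wm m s (x, t)\<bar> \<le> C"
proof -
  assume t: "0 < t" "t < T" and x: "0 \<le> x" "x \<le> 1"
  have "\<bar>wm m s (x, t)\<bar> \<le> C * x"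
    unfolding wm_def fst_conv snd_conv by (rule prim_bound[OF _ a.ub_bound]) (use t x in auto)
  also have "\<dots> \<le> C * 1" using x C_nonneg by (intro mult_left_mono) auto
  finally show ?thesis by simp
qed

lemma wm_integrable: "0 < t \<Longrightarrow> t < T \<Longrightarrow> integrable (lm 1) (\<lambda>y. wm m s (y, t))"
  by (rule integrable_bounded_finite[OF finite_measure_lm, where B=C]) (auto intro!: AE_lm_I wm_bound)

text \<open>Integrand in time of \<open>moment\<close>. It contains no gradient, hence the pointwise
  bound \<open>CH\<close>.\<close>

definition "H m s x \<tau> = uh m s (x, \<tau>) - uh m s (0, \<tau>) + z_of s * prim 1 (\<lambda>y. Qh m (y, \<tau>) * ub m s (y, \<tau>)) x
            - x * (beta d s 0 (Ph m (0, \<tau>)) * uh m s (0, \<tau>) - gamma0 d s (Ph m (0, \<tau>)))"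

definition "CH = Cu + 3 * C\<^sup>2 + CF"

lemma product_bound: "0 < t \<Longrightarrow> t < T \<Longrightarrow> AE x in lm 1. \<bar>Qh m (x, t) * ub m s (x, t)\<bar> \<le> C\<^sup>2"
proof -
  assume t: "0 < t" "t < T"
  from a.Qh_bound[OF t, of m] a.ub_bound[OF t, of m s] show ?thesis
  proof eventually_elim
    fix x assume "\<bar>Qh m (x, t)\<bar> \<le> C" "\<bar>ub m s (x, t)\<bar> \<le> C"
    then show "\<bar>Qh m (x, t) * ub m s (x, t)\<bar> \<le> C\<^sup>2"
      unfolding abs_mult power2_eq_square using C_nonneg by (intro mult_mono) auto
  qed
qed

lemma H_bound:
  assumes t: "0 < t" "t < T" and x: "0 \<le> x" "x \<le> 1"
  shows "\<bar>H m s x t\<bar> \<le> CH"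
proof -
  have 1: "\<bar>uh m s (x, t) - uh m s (0, t)\<bar> \<le> Cu"
    using a.uh_bound[OF t x, of m s] a.uh_bound[OF t, of 0 m s] by auto
  have "\<bar>prim 1 (\<lambda>y. Qh m (y, t) * ub m s (y, t)) x\<bar> \<le> C\<^sup>2 * x"
    by (rule prim_bound[OF _ product_bound]) (use t x in auto)
  also have "\<dots> \<le> C\<^sup>2 * 1" using x by (intro mult_left_mono) auto
  finally have 2: "\<bar>z_of s * prim 1 (\<lambda>y. Qh m (y, t) * ub m s (y, t)) x\<bar> \<le> 3 * C\<^sup>2"
    unfolding abs_mult using z_bound[of s] by (intro mult_mono) auto
  have "\<bar>beta d s 0 (Ph m (0, t)) * uh m s (0, t) - gamma0 d s (Ph m (0, t))\<bar> \<le> CF"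
    by (rule boundary_bound(1)) (use a.uh_bound[OF t, of 0 m s] a.Ph_bound[OF t, of 0 m] in auto)
  then have "\<bar>x * (beta d s 0 (Ph m (0, t)) * uh m s (0, t) - gamma0 d s (Ph m (0, t)))\<bar> \<le> 1 * CF"
    unfolding abs_mult using x by (intro mult_mono) auto
  then show ?thesis unfolding H_def CH_def using 1 2 by linarith
qed

lemma beta_gamma_borel [measurable]: "beta d s i \<in> borel_measurable borel" "gamma0 d s \<in> borel_measurable borel" "gamma1 d s \<in> borel_measurable borel"
  unfolding beta_def[abs_def] gamma0_def[abs_def] gamma1_def[abs_def] by measurable

lemma time_slices [measurable]:
  "(\<lambda>\<tau>. uh m s (x, \<tau>)) \<in> borel_measurable borel" "(\<lambda>\<tau>. Ph m (x, \<tau>)) \<in> borel_measurable borel"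
  "(\<lambda>\<tau>. prim 1 (\<lambda>y. Qh m (y, \<tau>) * ub m s (y, \<tau>)) x) \<in> borel_measurable borel"
proof -
  show "(\<lambda>\<tau>. uh m s (x, \<tau>)) \<in> borel_measurable borel" "(\<lambda>\<tau>. Ph m (x, \<tau>)) \<in> borel_measurable borel"
    by (intro slice_borel; measurable)+
  have "(\<lambda>z. prim 1 (\<lambda>y. (\<lambda>z. Qh m z * ub m s z) (y, snd z)) (fst z)) \<in> borel_measurable borel"
    by (rule prim_borel2) measurable
  from slice_borel(2)[OF this, of x] show "(\<lambda>\<tau>. prim 1 (\<lambda>y. Qh m (y, \<tau>) * ub m s (y, \<tau>)) x) \<in> borel_measurable borel"
    by simp
qed

lemma H_borel [measurable]: "H m s x \<in> borel_measurable borel"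
  unfolding H_def[abs_def] by measurable

lemma CH_nonneg: "0 \<le> CH" unfolding CH_def using Cu_pos CF_pos by simp

text \<open>Up to the factor \<open>eps_of d s\<close>, the second primitive moves by at most
  \<open>CH * \<bar>t - t'\<bar>\<close> plus twice the defect, and the first one is
  \<open>C\<close>-Lipschitz in space; \<open>prim_interpolation\<close> combines both for the
  difference of two time slices.\<close>

lemma wm_time:
  assumes t: "0 < t" "t < T" and t': "0 < t'" "t' < T" and x: "0 \<le> x" "x \<le> 1" and \<eta>: "0 < \<eta>" "\<eta> \<le> 1/2"
  shows "\<bar>wm m s (x, t) - wm m s (x, t')\<bar> \<le> 2 * ((CH * \<bar>t - t'\<bar> + 2 * \<delta> m) / eps_of d s) / \<eta> + 2 * C * \<eta>"
proof -
  let ?g = "\<lambda>y. wm m s (y, t) - wm m s (y, t')"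
  have mom: "\<bar>eps_of d s * (prim 1 (\<lambda>y. wm m s (y, t)) y - prim 1 (prim 1 (u0 s)) y) - prim T (H m s y) t\<bar> \<le> \<delta> m"
    if "0 < t" "t < T" "0 \<le> y" "y \<le> 1" for y t
    using a.moment[OF that, where s=s and m=m] unfolding H_def[abs_def] wm_def[abs_def] by simp
  have D: "\<bar>prim 1 ?g y\<bar> \<le> (CH * \<bar>t - t'\<bar> + 2 * \<delta> m) / eps_of d s" if y: "0 \<le> y" "y \<le> 1" for y
  proof -
    have Hb: "AE \<tau> in lm T. \<bar>H m s y \<tau>\<bar> \<le> CH" by (rule AE_lm_I) (rule H_bound[OF _ _ y])
    have "\<bar>prim T (H m s y) t - prim T (H m s y) t'\<bar> \<le> CH * \<bar>t - t'\<bar>"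
    proof (cases "t' \<le> t")
      case True
      then show ?thesis using prim_lipschitz[OF _ Hb, of t' t] t t' by simp
    next
      case False
      then show ?thesis using prim_lipschitz[OF _ Hb, of t t'] t t' by (simp add: abs_minus_commute)
    qed
    moreover have "prim 1 ?g y = prim 1 (\<lambda>y. wm m s (y, t)) y - prim 1 (\<lambda>y. wm m s (y, t')) y"
      by (rule prim_diff) (use wm_integrable t t' in auto)
    moreover have "\<bar>eps_of d s * A - eps_of d s * B\<bar> = eps_of d s * \<bar>A - B\<bar>" for A B
      using eps_of_range[of s] by (simp add: right_diff_distrib[symmetric] abs_mult)
    moreover have "\<bar>eps_of d s * prim 1 (\<lambda>y. wm m s (y, t)) y - eps_of d s * prim 1 (\<lambda>y. wm m s (y, t')) y\<bar> \<le> \<bar>prim T (H m s y) t - prim T (H m s y) t'\<bar> + 2 * \<delta> m"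
      using mom[OF t y] mom[OF t' y] unfolding right_diff_distrib by linarith
    ultimately have "eps_of d s * \<bar>prim 1 ?g y\<bar> \<le> CH * \<bar>t - t'\<bar> + 2 * \<delta> m" by simp
    then show ?thesis using eps_of_range[of s] by (simp add: pos_le_divide_eq mult.commute)
  qed
  show ?thesis
  proof (rule prim_interpolation[of ?g "2 * C"])
    fix y z :: real assume yz: "0 \<le> y" "y \<le> z" "z \<le> 1"
    have "\<bar>?g z - ?g y\<bar> \<le> \<bar>wm m s (z, t) - wm m s (y, t)\<bar> + \<bar>wm m s (z, t') - wm m s (y, t')\<bar>" by simp
    also have "\<dots> \<le> C * (z - y) + C * (z - y)"
      by (intro add_mono wm_lipschitz) (use t t' yz in auto)
    finally show "\<bar>?g z - ?g y\<bar> \<le> 2 * C * (z - y)" by simp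
  qed (use D x \<eta> C_nonneg wm_integrable t t' in auto)
qed

text \<open>Four contributions of at most \<open>e / 4\<close>: the step in space, the window error
  \<open>2 * C * \<eta>\<close>, the step in time and the defect \<open>\<delta> n\<close>. The
  window is fixed before \<open>D\<close> and \<open>N\<close>, since the last two contributions are
  divided by \<open>\<eta>\<close>.\<close>

lemma wm_equicontinuous:
  assumes e: "0 < e"
  shows "\<exists>D>0. \<exists>N. \<forall>n\<ge>N. \<forall>z\<in>{0..1} \<times> {0<..<T}. \<forall>z'\<in>{0..1} \<times> {0<..<T}. dist z z' < D \<longrightarrow> \<bar>wm n s z - wm n s z'\<bar> < e"
proof -
  have aux: "4 * a + 4 * b \<le> e \<Longrightarrow> 0 \<le> b \<Longrightarrow> a \<le> e / 4" for a b :: real by simp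
  define \<eta> where "\<eta> = min (1/2) (e / (8 * C + 8))"
  have C1: "0 < 8 * C + 8" using C_nonneg by simp
  have \<eta>: "0 < \<eta>" using e C1 by (simp add: \<eta>_def)
  have \<eta>2: "\<eta> \<le> 1/2" unfolding \<eta>_def by (rule min.cobounded1)
  have \<eta>C: "2 * C * \<eta> \<le> e / 4"
  proof -
    have "\<eta> \<le> e / (8 * C + 8)" by (simp add: \<eta>_def)
    then have "\<eta> * (8 * C + 8) \<le> e" using C1 by (simp add: pos_le_divide_eq)
    then show ?thesis using \<eta> by (simp add: algebra_simps)
  qed
  define k where "k = 2 / (eps_of d s * \<eta>)"
  have k: "0 < k" using \<eta> eps_of_range[of s] by (simp add: k_def)
  define D where "D = min (e / (4 * C + 4)) (e / (4 * k * CH + 4))"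
  have kc: "0 < 4 * k * CH + 4" using k CH_nonneg by (simp add: add_nonneg_pos)
  have D: "0 < D" using e kc C_nonneg by (simp add: D_def)
  have "\<exists>N. \<forall>n\<ge>N. norm (\<delta> n - 0) < e / (8 * k)"
    by (rule LIMSEQ_D[OF delta_0]) (use e k in auto)
  then obtain N where N: "\<And>n. N \<le> n \<Longrightarrow> \<bar>\<delta> n\<bar> < e / (8 * k)" by auto
  have "\<bar>wm n s z - wm n s z'\<bar> < e" if n: "N \<le> n" and z: "z \<in> {0..1} \<times> {0<..<T}" "z' \<in> {0..1} \<times> {0<..<T}" and dz: "dist z z' < D" for n z z'
  proof -
    obtain x t x' t' where zz: "z = (x, t)" "z' = (x', t')" by (metis surj_pair)
    have r: "0 \<le> x" "x \<le> 1" "0 < t" "t < T" "0 \<le> x'" "x' \<le> 1" "0 < t'" "t' < T" using z zz by auto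
    have d1: "\<bar>x - x'\<bar> < D" using dz dist_fst_le[of z z'] zz by (simp add: dist_real_def)
    have d2: "\<bar>t - t'\<bar> < D" using dz dist_snd_le[of z z'] zz by (simp add: dist_real_def)
    have "\<bar>wm n s (x, t) - wm n s (x', t)\<bar> \<le> C * \<bar>x - x'\<bar>"
      using wm_lipschitz[of t x x' n s] wm_lipschitz[of t x' x n s] r by (cases "x \<le> x'") (auto simp: abs_minus_commute)
    also have "\<dots> \<le> e / 4"
    proof -
      have "\<bar>x - x'\<bar> * (4 * C + 4) \<le> e"
        using d1 C_nonneg by (simp add: D_def pos_less_divide_eq less_imp_le)
      then have "4 * (C * \<bar>x - x'\<bar>) + 4 * \<bar>x - x'\<bar> \<le> e" by (simp add: algebra_simps)
      then show ?thesis by (rule aux) simp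
    qed
    finally have 1: "\<bar>wm n s (x, t) - wm n s (x', t)\<bar> \<le> e / 4" .
    have "\<bar>wm n s (x', t) - wm n s (x', t')\<bar> \<le> 2 * ((CH * \<bar>t - t'\<bar> + 2 * \<delta> n) / eps_of d s) / \<eta> + 2 * C * \<eta>"
      by (rule wm_time) (use r \<eta> \<eta>2 in auto)
    also have "2 * ((CH * \<bar>t - t'\<bar> + 2 * \<delta> n) / eps_of d s) / \<eta> = k * CH * \<bar>t - t'\<bar> + 2 * k * \<delta> n"
      using \<eta> eps_of_range[of s] by (simp add: k_def field_simps)
    finally have "\<bar>wm n s (x', t) - wm n s (x', t')\<bar> \<le> k * CH * \<bar>t - t'\<bar> + 2 * k * \<delta> n + 2 * C * \<eta>" .
    moreover have "k * CH * \<bar>t - t'\<bar> \<le> e / 4"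
    proof -
      have "\<bar>t - t'\<bar> * (4 * k * CH + 4) \<le> e"
        using d2 kc by (simp add: D_def pos_less_divide_eq less_imp_le)
      then have "4 * (k * CH * \<bar>t - t'\<bar>) + 4 * \<bar>t - t'\<bar> \<le> e" by (simp add: algebra_simps)
      then show ?thesis by (rule aux) simp
    qed
    moreover have "2 * k * \<delta> n < e / 4"
    proof -
      have "\<delta> n < e / (8 * k)" using N[OF n] by simp
      then show ?thesis using k by (simp add: pos_less_divide_eq field_simps)
    qed
    ultimately show ?thesis unfolding zz using 1 \<eta>C by linarith
  qed
  then show ?thesis using D by (intro exI[of _ D] conjI exI[of _ N] allI impI ballI)
qed

end

section \<open>Convergent subsequences\<close>

declare borel_measurable_lm(2) [simp del]

text \<open>Uniform in time, so the limit of the primitives exists at every time in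
  \<open>(0,T)\<close>, not only at almost every one.\<close>

definition prim_Cauchy :: "real \<Rightarrow> (nat \<Rightarrow> species \<Rightarrow> real \<times> real \<Rightarrow> real) \<Rightarrow> bool" where
  "prim_Cauchy T ub \<longleftrightarrow> (\<forall>e>0. \<exists>N. \<forall>m\<ge>N. \<forall>n\<ge>N. \<forall>s t x. 0 < t \<longrightarrow> t < T \<longrightarrow> 0 \<le> x \<longrightarrow> x \<le> 1 \<longrightarrow>
    \<bar>prim 1 (\<lambda>y. ub m s (y, t)) x - prim 1 (\<lambda>y. ub n s (y, t)) x\<bar> < e)"

lemma prim_CauchyD:
  assumes "prim_Cauchy T ub" "0 < e"
  obtains N where "\<And>m n s t x. N \<le> m \<Longrightarrow> N \<le> n \<Longrightarrow> 0 < t \<Longrightarrow> t < T \<Longrightarrow> 0 \<le> x \<Longrightarrow> x \<le> 1 \<Longrightarrow>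
    \<bar>prim 1 (\<lambda>y. ub m s (y, t)) x - prim 1 (\<lambda>y. ub n s (y, t)) x\<bar> < e"
proof -
  from assms(1)[unfolded prim_Cauchy_def, THEN spec, THEN mp, OF assms(2)]
  obtain N where N: "\<forall>m\<ge>N. \<forall>n\<ge>N. \<forall>s t x. 0 < t \<longrightarrow> t < T \<longrightarrow> 0 \<le> x \<longrightarrow> x \<le> 1 \<longrightarrow>
    \<bar>prim 1 (\<lambda>y. ub m s (y, t)) x - prim 1 (\<lambda>y. ub n s (y, t)) x\<bar> < e" ..
  show thesis by (rule that[of N]) (rule N[rule_format])
qed

lemma prim_Cauchy_subseq: 
  assumes "prim_Cauchy T ub" "strict_mono r"
  shows "prim_Cauchy T (\<lambda>m. ub (r m))"
  unfolding prim_Cauchy_def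
proof (intro allI impI)
  fix e :: real assume "0 < e"
  then obtain N where N: "\<And>m n s t x. N \<le> m \<Longrightarrow> N \<le> n \<Longrightarrow> 0 < t \<Longrightarrow> t < T \<Longrightarrow> 0 \<le> x \<Longrightarrow> x \<le> 1 \<Longrightarrow>
    \<bar>prim 1 (\<lambda>y. ub m s (y, t)) x - prim 1 (\<lambda>y. ub n s (y, t)) x\<bar> < e"
    by (rule prim_CauchyD[OF assms(1)]) (rule that)
  have rN: "N \<le> r m" if "N \<le> m" for m using strict_mono_imp_increasing[OF assms(2), of m] that by simp
  then show "\<exists>N. \<forall>m\<ge>N. \<forall>n\<ge>N. \<forall>s t x. 0 < t \<longrightarrow> t < T \<longrightarrow> 0 \<le> x \<longrightarrow> x \<le> 1 \<longrightarrow>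
    \<bar>prim 1 (\<lambda>y. ub (r m) s (y, t)) x - prim 1 (\<lambda>y. ub (r n) s (y, t)) x\<bar> < e"
    using N[OF rN rN] by (intro exI[of _ N] allI impI)
qed

lemma measure_mq: "0 \<le> S \<Longrightarrow> measure (mq S) UNIV = S"
proof -
  assume S: "0 \<le> S"
  have "(\<integral>z. (1::real) \<partial>mq S) = (\<integral>t. (\<integral>x. 1 \<partial>lm 1) \<partial>lm S)" by (rule mq_integral_iterated(1)) simp
  then show ?thesis using S by (simp add: measure_lm)
qed

context approximating_sequence
begin

interpretation a: approximate_solution d C "\<delta> m" "uh m" "gh m" "ub m" "Ph m" "Qh m" "Pb m" "q0 m" "q1 m" for m
  by (rule approximates)

text \<open>Both species are packed into one function with values in the plane, so that a single
  extraction serves both.\<close>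

lemma prim_Cauchy_subsequence: "\<exists>r. strict_mono r \<and> prim_Cauchy T (\<lambda>m. ub (r m))"
proof -
  let ?f = "\<lambda>n z. (wm n SpP z, wm n SpN z)" and ?S = "{0..1::real} \<times> {0<..<T}"
  have ex: "\<exists>r::nat\<Rightarrow>nat. strict_mono r \<and> (\<forall>e>0. \<exists>N. \<forall>m\<ge>N. \<forall>n\<ge>N. \<forall>z\<in>?S. norm (?f (r m) z - ?f (r n) z) < e)"
  proof (rule approximate_Arzela_Ascoli[where B="C + C"])
    have "bounded {0<..<T}" by (rule bounded_subset[OF compact_imp_bounded[OF compact_Icc[of 0 T]]]) auto
    then show "bounded ?S" by (intro bounded_Times compact_imp_bounded[OF compact_Icc])
    fix n z assume "z \<in> ?S"
    then obtain x t where z: "z = (x, t)" "0 \<le> x" "x \<le> 1" "0 < t" "t < T" by auto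
    have "norm (?f n z) \<le> norm (wm n SpP z) + norm (wm n SpN z)" by (rule norm_Pair_le)
    also have "\<dots> \<le> C + C" unfolding z using wm_bound[OF z(4,5,2,3), of n] by (intro add_mono) auto
    finally show "norm (?f n z) \<le> C + C" .
  next
    fix e :: real assume "0 < e"
    then have e2: "0 < e / 2" by simp
    obtain D1 N1 where 1: "0 < D1" "\<And>n z z'. N1 \<le> n \<Longrightarrow> z \<in> ?S \<Longrightarrow> z' \<in> ?S \<Longrightarrow> dist z z' < D1 \<Longrightarrow> \<bar>wm n SpP z - wm n SpP z'\<bar> < e / 2"
      using wm_equicontinuous[OF e2, of SpP] by blast
    obtain D2 N2 where 2: "0 < D2" "\<And>n z z'. N2 \<le> n \<Longrightarrow> z \<in> ?S \<Longrightarrow> z' \<in> ?S \<Longrightarrow> dist z z' < D2 \<Longrightarrow> \<bar>wm n SpN z - wm n SpN z'\<bar> < e / 2"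
      using wm_equicontinuous[OF e2, of SpN] by blast
    have "norm (?f n z - ?f n z') < e" if "max N1 N2 \<le> n" "z \<in> ?S" "z' \<in> ?S" "dist z z' < min D1 D2" for n z z'
    proof -
      have "norm (?f n z - ?f n z') \<le> norm (wm n SpP z - wm n SpP z') + norm (wm n SpN z - wm n SpN z')"
        unfolding diff_Pair by (rule norm_Pair_le)
      also have "\<dots> < e / 2 + e / 2" using 1(2)[of n z z'] 2(2)[of n z z'] that by (intro add_strict_mono) auto
      finally show ?thesis by simp
    qed
    then show "\<exists>D>0. \<exists>N. \<forall>n\<ge>N. \<forall>z\<in>?S. \<forall>z'\<in>?S. dist z z' < D \<longrightarrow> norm (?f n z - ?f n z') < e"
      using 1(1) 2(1) by (intro exI[of _ "min D1 D2"] conjI exI[of _ "max N1 N2"] allI impI ballI) auto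
  qed
  then obtain r :: "nat \<Rightarrow> nat" where r: "strict_mono r" "\<And>e. 0 < e \<Longrightarrow> \<exists>N. \<forall>m\<ge>N. \<forall>n\<ge>N. \<forall>z\<in>?S. norm (?f (r m) z - ?f (r n) z) < e"
    by blast
  have "prim_Cauchy T (\<lambda>m. ub (r m))"
    unfolding prim_Cauchy_def
  proof (intro allI impI)
    fix e :: real assume "0 < e"
    from r(2)[OF this] obtain N where N: "\<And>m n z. N \<le> m \<Longrightarrow> N \<le> n \<Longrightarrow> z \<in> ?S \<Longrightarrow> norm (?f (r m) z - ?f (r n) z) < e" by blast
    have "\<bar>wm (r m) s (x, t) - wm (r n) s (x, t)\<bar> < e" if "N \<le> m" "N \<le> n" "0 < t" "t < T" "0 \<le> x" "x \<le> 1" for m n s t x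
    proof -
      have "norm (?f (r m) (x, t) - ?f (r n) (x, t)) < e" using N[of m n "(x, t)"] that by auto
      moreover have "\<bar>wm (r m) s (x, t) - wm (r n) s (x, t)\<bar> \<le> norm (?f (r m) (x, t) - ?f (r n) (x, t))"
        unfolding real_norm_def[symmetric] diff_Pair by (cases s) (simp_all only: norm_fst_le norm_snd_le)
      ultimately show ?thesis by linarith
    qed
    then show "\<exists>N. \<forall>m\<ge>N. \<forall>n\<ge>N. \<forall>s t x. 0 < t \<longrightarrow> t < T \<longrightarrow> 0 \<le> x \<longrightarrow> x \<le> 1 \<longrightarrow>
      \<bar>prim 1 (\<lambda>y. ub (r m) s (y, t)) x - prim 1 (\<lambda>y. ub (r n) s (y, t)) x\<bar> < e"
      unfolding wm_def fst_conv snd_conv by (intro exI[of _ N] allI impI)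
  qed
  then show ?thesis using r(1) by (intro exI[of _ r] conjI)
qed

section \<open>Strong convergence of the densities, including boundary values\<close>

definition "Du m n s z = uh m s z - uh n s z"
definition "Dg m n s z = gh m s z - gh n s z"

lemma D_borel [measurable]: "Du m n s \<in> borel_measurable borel" "Dg m n s \<in> borel_measurable borel"
  unfolding Du_def[abs_def] Dg_def[abs_def] by measurable

lemma D_slices [measurable]: "(\<lambda>y. Du m n s (y, t)) \<in> borel_measurable borel" "(\<lambda>y. Dg m n s (y, t)) \<in> borel_measurable borel"
  by (intro slice_borel; measurable)+

lemma Du_bound: "0 < t \<Longrightarrow> t < T \<Longrightarrow> 0 \<le> x \<Longrightarrow> x \<le> 1 \<Longrightarrow> \<bar>Du m n s (x, t)\<bar> \<le> Cu"
  using a.uh_bound[of t x m s] a.uh_bound[of t x n s] unfolding Du_def by auto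

lemma Dg_integrable: "0 < t \<Longrightarrow> t < T \<Longrightarrow> integrable (lm 1) (\<lambda>y. Dg m n s (y, t))"
  unfolding Dg_def using gh_integrable by auto

lemma Du_prim:
  assumes "0 < t" "t < T" "0 \<le> x" "x \<le> 1"
  shows "Du m n s (x, t) = Du m n s (0, t) + prim 1 (\<lambda>y. Dg m n s (y, t)) x"
proof -
  have "prim 1 (\<lambda>y. Dg m n s (y, t)) x = prim 1 (\<lambda>y. gh m s (y, t)) x - prim 1 (\<lambda>y. gh n s (y, t)) x"
    unfolding Dg_def by (rule prim_diff) (use gh_integrable assms in auto)
  then show ?thesis unfolding Du_def using a.uh_prim[OF assms, of m s] a.uh_prim[OF assms, of n s] by linarith
qed

lemma Du_sq_integrable: "0 < t \<Longrightarrow> t < T \<Longrightarrow> integrable (lm 1) (\<lambda>y. (Du m n s (y, t))\<^sup>2)"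
proof -
  assume t: "0 < t" "t < T"
  show ?thesis
  proof (rule integrable_bounded_finite[OF finite_measure_lm, where B="Cu\<^sup>2"])
    show "AE x in lm 1. \<bar>(Du m n s (x, t))\<^sup>2\<bar> \<le> Cu\<^sup>2"
    proof (rule AE_lm_I)
      fix x :: real assume "0 < x" "x < 1"
      then have "\<bar>Du m n s (x, t)\<bar> \<le> Cu" using Du_bound[OF t] by auto
      from power_mono[OF this, of 2] show "\<bar>(Du m n s (x, t))\<^sup>2\<bar> \<le> Cu\<^sup>2" by simp
    qed
  qed auto
qed

text \<open>Up to the distance between the two reconstructions, \<open>Du^2\<close> is the product
  of \<open>Du\<close> with the difference \<open>?f\<close> of the piecewise constant densities.
  Integration by parts replaces \<open>?f\<close> by its primitive, which is at most
  \<open>e\<close>, and \<open>Du\<close> by its gradient, which is merely integrable: smallness in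
  a weak norm against boundedness in a strong one.\<close>

lemma slice_estimate:
  assumes t: "0 < t" "t < T" and e: "\<And>x. 0 \<le> x \<Longrightarrow> x \<le> 1 \<Longrightarrow> \<bar>wm m s (x, t) - wm n s (x, t)\<bar> \<le> e"
  shows "(\<integral>y. (Du m n s (y, t))\<^sup>2 \<partial>lm 1) \<le> e * Cu + (e + Cu * (\<delta> m + \<delta> n)) * (\<integral>y. \<bar>gh m s (y, t)\<bar> + \<bar>gh n s (y, t)\<bar> \<partial>lm 1)"
proof -
  let ?D = "\<lambda>y. Du m n s (y, t)" and ?G = "\<lambda>y. Dg m n s (y, t)" and ?f = "\<lambda>y. ub m s (y, t) - ub n s (y, t)"
  let ?g = "\<lambda>y. \<bar>gh m s (y, t)\<bar> + \<bar>gh n s (y, t)\<bar>"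
  have e0: "0 \<le> e" using e[of 0] by linarith
  have f: "integrable (lm 1) ?f" using ub_integrable[OF t] by simp
  have pf: "prim 1 ?f x = wm m s (x, t) - wm n s (x, t)" for x
    unfolding wm_def fst_conv snd_conv by (rule prim_diff) (use ub_integrable[OF t] in auto)
  have G: "integrable (lm 1) ?G" by (rule Dg_integrable[OF t])
  have g: "integrable (lm 1) ?g" using gh_integrable[OF t] by auto
  have DG: "AE x in lm 1. ?D x = Du m n s (0, t) + prim 1 ?G x" by (rule AE_lm_I) (rule Du_prim[OF t], auto)
  note I = ibp[OF f G, where F="\<lambda>x. wm m s (x, t) - wm n s (x, t)" and a=0 and G="?D" and b="Du m n s (0, t)", OF _ DG]
  have I1: "(\<integral>x. ?f x * ?D x \<partial>lm 1) = (0 + integral\<^sup>L (lm 1) ?f) * (Du m n s (0, t) + integral\<^sup>L (lm 1) ?G) - 0 * Du m n s (0, t) - (\<integral>x. (wm m s (x, t) - wm n s (x, t)) * ?G x \<partial>lm 1)"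
    by (rule I(1)) (auto simp: pf)
  have I2: "integrable (lm 1) (\<lambda>x. ?f x * ?D x)" by (rule I(2)) (auto simp: pf)
  have I3: "integrable (lm 1) (\<lambda>x. (wm m s (x, t) - wm n s (x, t)) * ?G x)" by (rule I(3)) (auto simp: pf)
  have "integral\<^sup>L (lm 1) ?f = wm m s (1, t) - wm n s (1, t)" using prim_end[of ?f 1] pf[of 1] by simp
  then have A: "\<bar>integral\<^sup>L (lm 1) ?f\<bar> \<le> e" using e[of 1] by simp
  have "Du m n s (0, t) + integral\<^sup>L (lm 1) ?G = ?D 1" using Du_prim[OF t, of 1 m n s] prim_end[of ?G 1] by simp
  then have B: "\<bar>Du m n s (0, t) + integral\<^sup>L (lm 1) ?G\<bar> \<le> Cu" using Du_bound[OF t, of 1 m n s] by simp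
  have "\<bar>\<integral>x. (wm m s (x, t) - wm n s (x, t)) * ?G x \<partial>lm 1\<bar> \<le> (\<integral>x. \<bar>(wm m s (x, t) - wm n s (x, t)) * ?G x\<bar> \<partial>lm 1)"
    by (rule integral_abs_bound)
  also have "\<dots> \<le> (\<integral>x. e * ?g x \<partial>lm 1)"
  proof (rule integral_mono_AE)
    show "integrable (lm 1) (\<lambda>x. \<bar>(wm m s (x, t) - wm n s (x, t)) * ?G x\<bar>)" using I3 by (rule integrable_abs)
    show "integrable (lm 1) (\<lambda>x. e * ?g x)" using g by (rule integrable_mult_right)
    show "AE x in lm 1. \<bar>(wm m s (x, t) - wm n s (x, t)) * ?G x\<bar> \<le> e * ?g x"
    proof (rule AE_lm_I)
      fix x :: real assume "0 < x" "x < 1"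
      then show "\<bar>(wm m s (x, t) - wm n s (x, t)) * ?G x\<bar> \<le> e * ?g x"
        unfolding abs_mult using e[of x] e0 by (intro mult_mono) (auto simp: Dg_def)
    qed
  qed
  also have "\<dots> = e * (\<integral>x. ?g x \<partial>lm 1)" by (rule integral_mult_right_zero)
  finally have Cc: "\<bar>\<integral>x. (wm m s (x, t) - wm n s (x, t)) * ?G x \<partial>lm 1\<bar> \<le> e * (\<integral>x. ?g x \<partial>lm 1)" .
  have "\<bar>integral\<^sup>L (lm 1) ?f * (Du m n s (0, t) + integral\<^sup>L (lm 1) ?G)\<bar> \<le> e * Cu"
    unfolding abs_mult using A B e0 by (intro mult_mono) auto
  then have fD: "(\<integral>x. ?f x * ?D x \<partial>lm 1) \<le> e * Cu + e * (\<integral>x. ?g x \<partial>lm 1)"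
    using Cc unfolding I1 by (simp add: abs_le_iff)
  have "(\<integral>y. (?D y)\<^sup>2 \<partial>lm 1) \<le> (\<integral>y. ?f y * ?D y + Cu * (\<delta> m + \<delta> n) * ?g y \<partial>lm 1)"
  proof (rule integral_mono_AE)
    show "integrable (lm 1) (\<lambda>y. (?D y)\<^sup>2)" by (rule Du_sq_integrable[OF t])
    show "integrable (lm 1) (\<lambda>y. ?f y * ?D y + Cu * (\<delta> m + \<delta> n) * ?g y)"
      by (rule Bochner_Integration.integrable_add[OF I2]) (rule integrable_mult_right[OF g])
    have x01: "AE x in lm 1. 0 < x \<and> x < 1" by (rule AE_lm_I) simp
    show "AE y in lm 1. (?D y)\<^sup>2 \<le> ?f y * ?D y + Cu * (\<delta> m + \<delta> n) * ?g y"
      using a.uh_ub[OF t, of m s] a.uh_ub[OF t, of n s] x01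
    proof eventually_elim
      fix y assume 1: "\<bar>uh m s (y, t) - ub m s (y, t)\<bar> \<le> \<delta> m * \<bar>gh m s (y, t)\<bar>"
        and 2: "\<bar>uh n s (y, t) - ub n s (y, t)\<bar> \<le> \<delta> n * \<bar>gh n s (y, t)\<bar>" and y: "0 < y \<and> y < 1"
      have "\<delta> m * \<bar>gh m s (y, t)\<bar> \<le> \<delta> m * ?g y" "\<delta> n * \<bar>gh n s (y, t)\<bar> \<le> \<delta> n * ?g y"
        using a.delta_nonneg by (intro mult_left_mono; simp)+
      then have "\<bar>?D y - ?f y\<bar> \<le> (\<delta> m + \<delta> n) * ?g y"
        using 1 2 unfolding Du_def distrib_right[of "\<delta> m"] by linarith
      then have "\<bar>?D y\<bar> * \<bar>?D y - ?f y\<bar> \<le> Cu * ((\<delta> m + \<delta> n) * ?g y)"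
        using Du_bound[OF t, of y m n s] y Cu_pos by (intro mult_mono) auto
      moreover have "?D y * (?D y - ?f y) \<le> \<bar>?D y\<bar> * \<bar>?D y - ?f y\<bar>" by (metis abs_mult abs_ge_self)
      moreover have "(?D y)\<^sup>2 = ?f y * ?D y + ?D y * (?D y - ?f y)" by (simp add: power2_eq_square algebra_simps)
      ultimately show "(?D y)\<^sup>2 \<le> ?f y * ?D y + Cu * (\<delta> m + \<delta> n) * ?g y" by (simp only: mult.assoc)
    qed
  qed
  also have "\<dots> = (\<integral>y. ?f y * ?D y \<partial>lm 1) + Cu * (\<delta> m + \<delta> n) * (\<integral>y. ?g y \<partial>lm 1)"
    unfolding Bochner_Integration.integral_add[OF I2 integrable_mult_right[OF g]] integral_mult_right_zero ..
  also have "\<dots> \<le> e * Cu + (e + Cu * (\<delta> m + \<delta> n)) * (\<integral>y. ?g y \<partial>lm 1)"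
    using fD unfolding distrib_right[of e] by simp
  finally show ?thesis .
qed

lemma gh_mq_integrable: "integrable (mq T) (gh m s)" "integrable (mq T) (\<lambda>z. \<bar>gh m s z\<bar>)"
  "(\<integral>z. \<bar>gh m s z\<bar> \<partial>mq T) \<le> T + C"
proof -
  show i: "integrable (mq T) (gh m s)"
    by (rule sq_integrable_imp_integrable[OF finite_measure_mq _ a.gh_sq(1)]) measurable
  then show i2: "integrable (mq T) (\<lambda>z. \<bar>gh m s z\<bar>)" by (rule integrable_abs)
  have "(\<integral>z. \<bar>gh m s z\<bar> \<partial>mq T) \<le> (\<integral>z. 1 + (gh m s z)\<^sup>2 \<partial>mq T)"
  proof (rule integral_mono[OF i2])
    show "integrable (mq T) (\<lambda>z. 1 + (gh m s z)\<^sup>2)" using a.gh_sq(1) by simp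
    show "\<bar>gh m s z\<bar> \<le> 1 + (gh m s z)\<^sup>2" for z using young_sq[of 1 "gh m s z" 1] by simp
  qed
  also have "\<dots> = T + (\<integral>z. (gh m s z)\<^sup>2 \<partial>mq T)" using a.gh_sq(1)[of m s] measure_mq[of T] T_pos by simp
  finally show "(\<integral>z. \<bar>gh m s z\<bar> \<partial>mq T) \<le> T + C" using a.gh_sq(2)[of m s] by linarith
qed

lemma D_mq:
  "integrable (mq T) (\<lambda>z. (Du m n s z)\<^sup>2)" "integrable (mq T) (\<lambda>z. (Dg m n s z)\<^sup>2)" "(\<integral>z. (Dg m n s z)\<^sup>2 \<partial>mq T) \<le> 4 * C"
  "integrable (mq T) (\<lambda>z. (Du m n s z)\<^sup>2 + 2 * (\<bar>Du m n s z\<bar> * \<bar>Dg m n s z\<bar>))"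
proof -
  show 1: "integrable (mq T) (\<lambda>z. (Du m n s z)\<^sup>2)"
  proof (rule integrable_bounded_finite[OF finite_measure_mq, where B="Cu\<^sup>2"])
    show "AE z in mq T. \<bar>(Du m n s z)\<^sup>2\<bar> \<le> Cu\<^sup>2"
      unfolding AE_mq
    proof (rule AE_I2, rule impI)
      fix z assume "z \<in> QT T"
      then have "\<bar>Du m n s z\<bar> \<le> Cu" using Du_bound[of "snd z" "fst z" m n s] by (auto simp: QT_def)
      from power_mono[OF this, of 2] show "\<bar>(Du m n s z)\<^sup>2\<bar> \<le> Cu\<^sup>2" by simp
    qed
  qed measurable
  show 2: "integrable (mq T) (\<lambda>z. (Dg m n s z)\<^sup>2)"
    unfolding Dg_def by (rule sq_integrable_diff) (use a.gh_sq(1) in auto)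
  have "(\<integral>z. (Dg m n s z)\<^sup>2 \<partial>mq T) \<le> (\<integral>z. 2 * (gh m s z)\<^sup>2 + 2 * (gh n s z)\<^sup>2 \<partial>mq T)"
  proof (rule integral_mono[OF 2])
    show "integrable (mq T) (\<lambda>z. 2 * (gh m s z)\<^sup>2 + 2 * (gh n s z)\<^sup>2)" using a.gh_sq(1) by simp
    show "(Dg m n s z)\<^sup>2 \<le> 2 * (gh m s z)\<^sup>2 + 2 * (gh n s z)\<^sup>2" for z
      using zero_le_power2[of "gh m s z + gh n s z"] unfolding Dg_def power2_diff power2_sum by linarith
  qed
  also have "\<dots> = 2 * (\<integral>z. (gh m s z)\<^sup>2 \<partial>mq T) + 2 * (\<integral>z. (gh n s z)\<^sup>2 \<partial>mq T)" using a.gh_sq(1) by simp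
  finally show "(\<integral>z. (Dg m n s z)\<^sup>2 \<partial>mq T) \<le> 4 * C" using a.gh_sq(2)[of m s] a.gh_sq(2)[of n s] by linarith
  have "integrable (mq T) (\<lambda>z. \<bar>Du m n s z\<bar> * \<bar>Dg m n s z\<bar>)"
    by (rule sq_integrable_mult) (use 1 2 in auto)
  then show "integrable (mq T) (\<lambda>z. (Du m n s z)\<^sup>2 + 2 * (\<bar>Du m n s z\<bar> * \<bar>Dg m n s z\<bar>))" using 1 by simp
qed

text \<open>Time integral of \<open>slice_estimate\<close>. The \<open>L1\<close> norm of each
  gradient is at most \<open>T + C\<close>, which explains the constant \<open>k\<close>.\<close>

lemma Du_Cauchy:
  assumes pc: "prim_Cauchy T ub" and e: "0 < e"
  shows "\<exists>N. \<forall>m\<ge>N. \<forall>n\<ge>N. \<forall>s. (\<integral>z. (Du m n s z)\<^sup>2 \<partial>mq T) \<le> e"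
proof -
  define k where "k = Cu * T + (1 + 2 * Cu) * (2 * (T + C))"
  have k: "0 < k" unfolding k_def using Cu_pos T_pos C_nonneg by (intro add_pos_nonneg mult_pos_pos mult_nonneg_nonneg) auto
  define e' where "e' = e / k"
  have e': "0 < e'" using e k by (simp add: e'_def)
  obtain N1 where N1: "\<And>m n s t x. N1 \<le> m \<Longrightarrow> N1 \<le> n \<Longrightarrow> 0 < t \<Longrightarrow> t < T \<Longrightarrow> 0 \<le> x \<Longrightarrow> x \<le> 1 \<Longrightarrow>
    \<bar>prim 1 (\<lambda>y. ub m s (y, t)) x - prim 1 (\<lambda>y. ub n s (y, t)) x\<bar> < e'"
    by (rule prim_CauchyD[OF pc e']) (rule that)
  have "eventually (\<lambda>n. \<delta> n < e') sequentially" by (rule order_tendstoD(2)[OF delta_0 e'])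
  then obtain N2 where N2: "\<And>n. N2 \<le> n \<Longrightarrow> \<delta> n \<le> e'"
    unfolding eventually_sequentially using less_imp_le by blast
  have "(\<integral>z. (Du m n s z)\<^sup>2 \<partial>mq T) \<le> e" if mn: "max N1 N2 \<le> m" "max N1 N2 \<le> n" for m n s
  proof -
    let ?g = "\<lambda>z. \<bar>gh m s z\<bar> + \<bar>gh n s z\<bar>"
    have ig: "integrable (mq T) ?g" using gh_mq_integrable by auto
    have "\<delta> m + \<delta> n \<le> 2 * e'" using N2[of m] N2[of n] mn by simp
    then have dd: "e' + Cu * (\<delta> m + \<delta> n) \<le> e' * (1 + 2 * Cu)"
      using mult_left_mono[of "\<delta> m + \<delta> n" "2 * e'" Cu] Cu_pos by (simp add: algebra_simps)
    have "(\<integral>z. (Du m n s z)\<^sup>2 \<partial>mq T) = (\<integral>t. (\<integral>x. (Du m n s (x, t))\<^sup>2 \<partial>lm 1) \<partial>lm T)"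
      by (rule mq_integral_iterated(1)[OF D_mq(1)])
    also have "\<dots> \<le> (\<integral>t. e' * Cu + e' * (1 + 2 * Cu) * (\<integral>x. ?g (x, t) \<partial>lm 1) \<partial>lm T)"
    proof (rule integral_mono_AE)
      show "integrable (lm T) (\<lambda>t. \<integral>x. (Du m n s (x, t))\<^sup>2 \<partial>lm 1)" by (rule mq_integral_iterated(3)[OF D_mq(1)])
      show "integrable (lm T) (\<lambda>t. e' * Cu + e' * (1 + 2 * Cu) * (\<integral>x. ?g (x, t) \<partial>lm 1))"
        using mq_integral_iterated(3)[OF ig] by simp
      show "AE t in lm T. (\<integral>x. (Du m n s (x, t))\<^sup>2 \<partial>lm 1) \<le> e' * Cu + e' * (1 + 2 * Cu) * (\<integral>x. ?g (x, t) \<partial>lm 1)"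
      proof (rule AE_lm_I)
        fix t assume t: "0 < t" "t < T"
        have "\<bar>wm m s (x, t) - wm n s (x, t)\<bar> \<le> e'" if "0 \<le> x" "x \<le> 1" for x
          using N1[of m n t x s] mn t that unfolding wm_def fst_conv snd_conv by auto
        from slice_estimate[OF t this] have "(\<integral>x. (Du m n s (x, t))\<^sup>2 \<partial>lm 1) \<le> e' * Cu + (e' + Cu * (\<delta> m + \<delta> n)) * (\<integral>x. ?g (x, t) \<partial>lm 1)"
          by blast
        also have "\<dots> \<le> e' * Cu + e' * (1 + 2 * Cu) * (\<integral>x. ?g (x, t) \<partial>lm 1)"
          by (intro add_left_mono mult_right_mono dd Bochner_Integration.integral_nonneg) auto
        finally show "(\<integral>x. (Du m n s (x, t))\<^sup>2 \<partial>lm 1) \<le> e' * Cu + e' * (1 + 2 * Cu) * (\<integral>x. ?g (x, t) \<partial>lm 1)" .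
      qed
    qed
    also have "\<dots> = T * (e' * Cu) + e' * (1 + 2 * Cu) * integral\<^sup>L (mq T) ?g"
      using mq_integral_iterated(3)[OF ig] mq_integral_iterated(1)[OF ig] measure_lm[of T] T_pos by simp
    also have "\<dots> \<le> T * (e' * Cu) + e' * (1 + 2 * Cu) * (2 * (T + C))"
    proof (intro add_left_mono mult_left_mono)
      have "integral\<^sup>L (mq T) ?g = (\<integral>z. \<bar>gh m s z\<bar> \<partial>mq T) + (\<integral>z. \<bar>gh n s z\<bar> \<partial>mq T)"
        by (rule Bochner_Integration.integral_add) (rule gh_mq_integrable)+
      then show "integral\<^sup>L (mq T) ?g \<le> 2 * (T + C)"
        unfolding mult_2 using add_mono[OF gh_mq_integrable(3)[of m s] gh_mq_integrable(3)[of n s]] by (simp only:)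
      show "0 \<le> e' * (1 + 2 * Cu)" using e' Cu_pos by simp
    qed
    also have "\<dots> = e' * k" unfolding k_def by (simp add: algebra_simps)
    also have "\<dots> = e" using k by (simp add: e'_def)
    finally show ?thesis .
  qed
  then show ?thesis by (intro exI[of _ "max N1 N2"] allI impI)
qed

text \<open>Time integral of the right side of \<open>sup_square_bound\<close>: it dominates the
  integral over time of the squared supremum in space.\<close>

definition "Dsup m n s = (\<integral>z. (Du m n s z)\<^sup>2 + 2 * (\<bar>Du m n s z\<bar> * \<bar>Dg m n s z\<bar>) \<partial>mq T)"

lemma Dsup_Cauchy:
  assumes pc: "prim_Cauchy T ub" and e: "0 < e"
  shows "\<exists>N. \<forall>m\<ge>N. \<forall>n\<ge>N. Dsup m n SpP + Dsup m n SpN \<le> e"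
proof -
  \<comment> \<open>The gradients need not converge; their differences only satisfy the bound
    \<open>4 * C\<close>. Young's weight \<open>\<eta>\<close> makes their share at most
    \<open>e / 4\<close>, and the difference of the densities is then taken small depending on
    \<open>\<eta>\<close>.\<close>
  define \<eta> where "\<eta> = e / (16 * C + 16)"
  have C1: "0 < 16 * C + 16" using C_nonneg by simp
  have \<eta>: "0 < \<eta>" using e C1 by (simp add: \<eta>_def)
  have \<eta>C: "\<eta> * (4 * C) \<le> e / 4"
  proof -
    have "\<eta> * (16 * C + 16) = e" using C1 by (simp add: \<eta>_def)
    then have "4 * (\<eta> * (4 * C)) + 16 * \<eta> = e" by (simp add: algebra_simps)
    then show ?thesis using \<eta> by linarith
  qed
  define e' where "e' = e / 4 / (1 + 1 / \<eta>)"
  have pos: "0 < 1 + 1 / \<eta>" using \<eta> by (simp add: add_pos_pos)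
  have e': "0 < e'" using e pos by (simp add: e'_def)
  obtain N where N: "\<And>m n s. N \<le> m \<Longrightarrow> N \<le> n \<Longrightarrow> (\<integral>z. (Du m n s z)\<^sup>2 \<partial>mq T) \<le> e'"
    using Du_Cauchy[OF pc e'] by blast
  have "Dsup m n s \<le> e / 2" if mn: "N \<le> m" "N \<le> n" for m n s
  proof -
    have "Dsup m n s \<le> (\<integral>z. (1 + 1 / \<eta>) * (Du m n s z)\<^sup>2 + \<eta> * (Dg m n s z)\<^sup>2 \<partial>mq T)"
      unfolding Dsup_def
    proof (rule integral_mono[OF D_mq(4)])
      show "integrable (mq T) (\<lambda>z. (1 + 1 / \<eta>) * (Du m n s z)\<^sup>2 + \<eta> * (Dg m n s z)\<^sup>2)"
        using D_mq(1,2) by simp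
      show "(Du m n s z)\<^sup>2 + 2 * (\<bar>Du m n s z\<bar> * \<bar>Dg m n s z\<bar>) \<le> (1 + 1 / \<eta>) * (Du m n s z)\<^sup>2 + \<eta> * (Dg m n s z)\<^sup>2" for z
        using young_sq[OF \<eta>, of "Du m n s z" "Dg m n s z"] by (simp add: distrib_right)
    qed
    also have "\<dots> = (1 + 1 / \<eta>) * (\<integral>z. (Du m n s z)\<^sup>2 \<partial>mq T) + \<eta> * (\<integral>z. (Dg m n s z)\<^sup>2 \<partial>mq T)"
      using D_mq(1,2) by simp
    also have "\<dots> \<le> (1 + 1 / \<eta>) * e' + \<eta> * (4 * C)"
      using N[OF mn] D_mq(3) \<eta> pos by (intro add_mono mult_left_mono) auto
    also have "(1 + 1 / \<eta>) * e' = e / 4"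
      unfolding e'_def times_divide_eq_right[of _ "e / 4"] by (rule nonzero_mult_div_cancel_left) (use pos in simp)
    finally show ?thesis using \<eta>C by linarith
  qed
  then have "Dsup m n SpP + Dsup m n SpN \<le> e" if "N \<le> m" "N \<le> n" for m n
    using that by (metis add_mono field_sum_of_halves)
  then show ?thesis by (intro exI[of _ N] allI impI)
qed

text \<open>Increments that are summable uniformly in space give convergence at every
  \<open>x\<close>, in particular at both ends, outside one null set of times.\<close>

lemma pointwise_subsequence:
  assumes pc: "prim_Cauchy T ub"
  shows "\<exists>r. strict_mono r \<and> (AE t in lm T. \<forall>s. \<forall>x\<in>{0..1}. convergent (\<lambda>j. uh (r j) s (x, t)))"
proof -
  obtain r where r: "strict_mono r" "\<And>j m n. r j \<le> m \<Longrightarrow> r j \<le> n \<Longrightarrow> Dsup m n SpP + Dsup m n SpN \<le> (1/4)^j"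
    using fast_subsequence[of "\<lambda>m n. Dsup m n SpP + Dsup m n SpN"] Dsup_Cauchy[OF pc] by blast
  let ?A = "\<lambda>j s t. \<integral>x. (Du (r (Suc j)) (r j) s (x, t))\<^sup>2 + 2 * (\<bar>Du (r (Suc j)) (r j) s (x, t)\<bar> * \<bar>Dg (r (Suc j)) (r j) s (x, t)\<bar>) \<partial>lm 1"
  \<comment> \<open>Young with weight \<open>(1/2)^j\<close>: \<open>?f\<close> bounds the unsquared
    supremum of the increment and keeps a summable integral.\<close>
  let ?f = "\<lambda>j t. (?A j SpP t + ?A j SpN t) * 2^j + (1/2)^j"
  have iA: "integrable (lm T) (?A j s)" for j s using mq_integral_iterated(3)[OF D_mq(4)] by simp
  have A0: "0 \<le> ?A j s t" for j s t by (intro Bochner_Integration.integral_nonneg) auto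
  have "AE t in lm T. summable (\<lambda>j. ?f j t)"
  proof (rule AE_summable[where C="1 + T"])
    fix j
    show "integrable (lm T) (?f j)" using iA by simp
    show "0 \<le> ?f j t" for t using A0 by simp
    have "integral\<^sup>L (lm T) (?f j) = (integral\<^sup>L (lm T) (?A j SpP) + integral\<^sup>L (lm T) (?A j SpN)) * 2^j + T * (1/2)^j"
      using iA measure_lm[of T] T_pos by simp
    also have "\<dots> = (Dsup (r (Suc j)) (r j) SpP + Dsup (r (Suc j)) (r j) SpN) * 2^j + T * (1/2)^j"
      unfolding Dsup_def using mq_integral_iterated(1)[OF D_mq(4)] by simp
    also have "(Dsup (r (Suc j)) (r j) SpP + Dsup (r (Suc j)) (r j) SpN) * 2^j + T * (1/2)^j \<le> (1/4)^j * 2^j + T * (1/2)^j"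
      using r(2)[of j "r (Suc j)" "r j"] strict_mono_less_eq[OF r(1), of j "Suc j"] by (intro add_right_mono mult_right_mono) auto
    also have "(1/4)^j * 2^j = (1/2::real)^j" by (simp add: power_mult_distrib[symmetric])
    also have "(1/2)^j + T * (1/2)^j = (1 + T) * (1/2)^j" by (simp add: algebra_simps)
    finally show "integral\<^sup>L (lm T) (?f j) \<le> (1 + T) * (1/2)^j" .
  qed
  moreover have "AE t in lm T. 0 < t \<and> t < T" by (rule AE_lm_I) simp
  ultimately have "AE t in lm T. \<forall>s. \<forall>x\<in>{0..1}. convergent (\<lambda>j. uh (r j) s (x, t))"
  proof eventually_elim
    fix t assume sm: "summable (\<lambda>j. ?f j t)" and t': "0 < t \<and> t < T"
    then have t: "0 < t" "t < T" by auto
    show "\<forall>s. \<forall>x\<in>{0..1}. convergent (\<lambda>j. uh (r j) s (x, t))"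
    proof (intro allI ballI)
      fix s and x :: real assume "x \<in> {0..1}"
      then have x: "0 \<le> x" "x \<le> 1" by auto
      have bd: "\<bar>uh (r (Suc j)) s (x, t) - uh (r j) s (x, t)\<bar> \<le> ?f j t" for j
      proof -
        let ?D = "\<lambda>y. Du (r (Suc j)) (r j) s (y, t)" and ?G = "\<lambda>y. Dg (r (Suc j)) (r j) s (y, t)"
        note S = sup_square_bound[OF Dg_integrable[OF t] x, of ?D, OF Du_prim[OF t] _ Du_sq_integrable[OF t]]
        have "(?D x)\<^sup>2 \<le> (\<integral>y. (?D y)\<^sup>2 \<partial>lm 1) + 2 * (\<integral>y. \<bar>?D y\<bar> * \<bar>?G y\<bar> \<partial>lm 1)" by (rule S(1)) auto
        also have "\<dots> = ?A j s t"
        proof -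
          have "integrable (lm 1) (\<lambda>y. \<bar>?D y\<bar> * \<bar>?G y\<bar>)" by (rule S(2)) auto
          then show ?thesis using Du_sq_integrable[OF t] by simp
        qed
        also have "\<dots> \<le> ?A j SpP t + ?A j SpN t" using A0[of j SpP t] A0[of j SpN t] by (cases s) auto
        finally have 1: "(?D x)\<^sup>2 \<le> ?A j SpP t + ?A j SpN t" .
        have "2 * (\<bar>?D x\<bar> * \<bar>1\<bar>) \<le> (?D x)\<^sup>2 / (1/2)^j + (1/2)^j * 1\<^sup>2" by (rule young_sq) simp
        then have "\<bar>?D x\<bar> \<le> (?D x)\<^sup>2 * 2^j + (1/2)^j" by (simp add: power_one_over)
        also have "\<dots> \<le> ?f j t" using 1 by (intro add_right_mono mult_right_mono) auto
        finally show ?thesis by (simp only: Du_def)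
      qed
      have "summable (\<lambda>j. \<bar>uh (r (Suc j)) s (x, t) - uh (r j) s (x, t)\<bar>)"
        by (rule summable_comparison_test'[OF sm, of 0]) (use bd in auto)
      then have "summable (\<lambda>j. uh (r (Suc j)) s (x, t) - uh (r j) s (x, t))" by (rule summable_rabs_cancel)
      then have "convergent (\<lambda>n. \<Sum>j<n. uh (r (Suc j)) s (x, t) - uh (r j) s (x, t))" by (simp add: summable_iff_convergent)
      moreover have "(\<Sum>j<n. uh (r (Suc j)) s (x, t) - uh (r j) s (x, t)) = uh (r n) s (x, t) - uh (r 0) s (x, t)" for n
        by (rule sum_lessThan_telescope)
      ultimately have "convergent (\<lambda>n. uh (r n) s (x, t) - uh (r 0) s (x, t))" by simp
      then show "convergent (\<lambda>j. uh (r j) s (x, t))" using convergent_diff_const_right_iff by blast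
    qed
  qed
  then show ?thesis using r(1) by (intro exI[of _ r] conjI)
qed

end

section \<open>The limit functions\<close>

lemma prim_dominated:
  assumes [measurable]: "\<And>n. f n \<in> borel_measurable borel" "g \<in> borel_measurable borel"
    and b: "\<And>n. AE y in lm S. \<bar>f n y\<bar> \<le> B" and l: "AE y in lm S. (\<lambda>n. f n y) \<longlonglongrightarrow> g y"
  shows "(\<lambda>n. prim S (f n) x) \<longlonglongrightarrow> prim S g x"
  unfolding prim_def
proof (rule integral_dominated_convergence[where w="\<lambda>_. B"])
  show "AE y in lm S. (\<lambda>n. indicator {..x} y * f n y) \<longlonglongrightarrow> indicator {..x} y * g y"
    using l by eventually_elim (intro tendsto_mult tendsto_const)
  show "AE y in lm S. norm (indicator {..x} y * f n y) \<le> B" for n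
    using b[of n] by eventually_elim (auto simp: indicator_def)
qed auto

locale convergent_sequence = approximating_sequence +
  assumes pc: "prim_Cauchy T ub"
    and conv_ae: "AE t in lm T. \<forall>s. \<forall>x\<in>{0..1}. convergent (\<lambda>j. uh j s (x, t))"
begin

interpretation a: approximate_solution d C "\<delta> m" "uh m" "gh m" "ub m" "Ph m" "Qh m" "Pb m" "q0 m" "q1 m" for m
  by (rule approximates)

text \<open>\<open>lim\<close> is total, so \<open>U\<close> and \<open>W\<close> are Borel on the
  whole plane; \<open>good\<close> collects the times at which the limit \<open>U\<close> is genuine
  for all \<open>x\<close>. \<open>gap\<close> bounds the \<open>L1\<close> distance between the two
  reconstructions at time \<open>t\<close>.\<close>

definition "U s z = lim (\<lambda>j. uh j s z)"
definition "W s z = lim (\<lambda>j. wm j s z)"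
definition "gap m s t = \<delta> m * (\<integral>y. \<bar>gh m s (y, t)\<bar> \<partial>lm 1)"
definition "good t \<longleftrightarrow> 0 < t \<and> t < T \<and> (\<forall>s. \<forall>x\<in>{0..1}. (\<lambda>j. uh j s (x, t)) \<longlonglongrightarrow> U s (x, t)) \<and> (\<forall>s. (\<lambda>j. gap j s t) \<longlonglongrightarrow> 0)"

lemma U_borel [measurable]: "U s \<in> borel_measurable borel" unfolding U_def[abs_def] by measurable
lemma W_borel [measurable]: "W s \<in> borel_measurable borel" unfolding W_def[abs_def] by measurable

lemma UW_slices [measurable]: "(\<lambda>y. U s (y, t)) \<in> borel_measurable borel" "(\<lambda>\<tau>. U s (x, \<tau>)) \<in> borel_measurable borel"
  "(\<lambda>y. W s (y, t)) \<in> borel_measurable borel" "(\<lambda>\<tau>. W s (x, \<tau>)) \<in> borel_measurable borel"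
  by (intro slice_borel; measurable)+

lemma AE_gap: "AE t in lm T. (\<lambda>j. gap j s t) \<longlonglongrightarrow> 0"
proof (rule AE_seq_0[where C="T + C"])
  fix m
  show "integrable (lm T) (gap m s)" unfolding gap_def using mq_integral_iterated(3)[OF gh_mq_integrable(2)] by simp
  show "0 \<le> gap m s t" for t unfolding gap_def using a.delta_nonneg
    by (intro mult_nonneg_nonneg Bochner_Integration.integral_nonneg) auto
  have "integral\<^sup>L (lm T) (gap m s) = \<delta> m * (\<integral>z. \<bar>gh m s z\<bar> \<partial>mq T)"
    unfolding gap_def using mq_integral_iterated(1)[OF gh_mq_integrable(2)] by simp
  also have "\<dots> \<le> (1/2)^m * (T + C)"
    using a.delta_nonneg delta_small gh_mq_integrable(3) by (intro mult_mono Bochner_Integration.integral_nonneg) auto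
  finally show "integral\<^sup>L (lm T) (gap m s) \<le> (T + C) * (1/2)^m" by (simp add: mult.commute)
qed

lemma AE_good: "AE t in lm T. good t"
proof -
  have "AE t in lm T. 0 < t \<and> t < T" by (rule AE_lm_I) simp
  then show ?thesis using conv_ae AE_gap[of SpP] AE_gap[of SpN]
  proof eventually_elim
    fix t assume "0 < t \<and> t < T" and c: "\<forall>s. \<forall>x\<in>{0..1}. convergent (\<lambda>j. uh j s (x, t))"
      and g: "(\<lambda>j. gap j SpP t) \<longlonglongrightarrow> 0" "(\<lambda>j. gap j SpN t) \<longlonglongrightarrow> 0"
    moreover have "(\<lambda>j. gap j s t) \<longlonglongrightarrow> 0" for s using g by (cases s) auto
    moreover have "(\<lambda>j. uh j s (x, t)) \<longlonglongrightarrow> U s (x, t)" if "x \<in> {0..1}" for s x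
      unfolding U_def using c that by (simp add: convergent_LIMSEQ_iff)
    ultimately show "good t" unfolding good_def by blast
  qed
qed

lemma goodD:
  assumes "good t"
  shows "0 < t" "t < T" "0 \<le> x \<Longrightarrow> x \<le> 1 \<Longrightarrow> (\<lambda>j. uh j s (x, t)) \<longlonglongrightarrow> U s (x, t)" "(\<lambda>j. gap j s t) \<longlonglongrightarrow> 0"
  using assms unfolding good_def by auto

lemma U_range: "good t \<Longrightarrow> 0 \<le> x \<Longrightarrow> x \<le> 1 \<Longrightarrow> 0 \<le> U s (x, t) \<and> U s (x, t) \<le> Cu"
proof -
  assume g: "good t" and x: "0 \<le> x" "x \<le> 1"
  note t = goodD(1,2)[OF g] and l = goodD(3)[OF g x, of s]
  have "0 \<le> U s (x, t)" by (rule LIMSEQ_le_const[OF l]) (use a.uh_bound[OF t x] in auto)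
  moreover have "U s (x, t) \<le> Cu" by (rule LIMSEQ_le_const2[OF l]) (use a.uh_bound[OF t x] in auto)
  ultimately show ?thesis by simp
qed

lemma U_abs: "good t \<Longrightarrow> 0 \<le> x \<Longrightarrow> x \<le> 1 \<Longrightarrow> \<bar>U s (x, t)\<bar> \<le> Cu"
  using U_range[of t x s] by auto

lemma U_integrable: "good t \<Longrightarrow> integrable (lm 1) (\<lambda>y. U s (y, t))"
  by (rule integrable_bounded_finite[OF finite_measure_lm, where B=Cu]) (auto intro!: AE_lm_I U_abs)

lemma W_limit: "0 < t \<Longrightarrow> t < T \<Longrightarrow> 0 \<le> x \<Longrightarrow> x \<le> 1 \<Longrightarrow> (\<lambda>j. wm j s (x, t)) \<longlonglongrightarrow> W s (x, t)"
proof -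
  assume h: "0 < t" "t < T" "0 \<le> x" "x \<le> 1"
  have "Cauchy (\<lambda>j. wm j s (x, t))"
    unfolding Cauchy_iff
  proof (intro allI impI)
    fix e :: real assume "0 < e"
    then obtain N where N: "\<And>m n s t x. N \<le> m \<Longrightarrow> N \<le> n \<Longrightarrow> 0 < t \<Longrightarrow> t < T \<Longrightarrow> 0 \<le> x \<Longrightarrow> x \<le> 1 \<Longrightarrow>
      \<bar>prim 1 (\<lambda>y. ub m s (y, t)) x - prim 1 (\<lambda>y. ub n s (y, t)) x\<bar> < e"
      by (rule prim_CauchyD[OF pc]) (rule that)
    then show "\<exists>M. \<forall>m\<ge>M. \<forall>n\<ge>M. norm (wm m s (x, t) - wm n s (x, t)) < e"
      unfolding wm_def fst_conv snd_conv real_norm_def using h by (intro exI[of _ N] allI impI)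
  qed
  then show ?thesis unfolding W_def by (simp add: Cauchy_convergent_iff convergent_LIMSEQ_iff)
qed

lemma W_bound: "0 < t \<Longrightarrow> t < T \<Longrightarrow> 0 \<le> x \<Longrightarrow> x \<le> 1 \<Longrightarrow> \<bar>W s (x, t)\<bar> \<le> C"
  by (rule LIMSEQ_le_const2[OF tendsto_rabs[OF W_limit]]) (auto intro: wm_bound)

lemma gap_bound:
  assumes t: "0 < t" "t < T"
  shows "(\<integral>y. \<bar>ub m s (y, t) - uh m s (y, t)\<bar> \<partial>lm 1) \<le> gap m s t" "integrable (lm 1) (\<lambda>y. \<bar>ub m s (y, t) - uh m s (y, t)\<bar>)"
    "integrable (lm 1) (\<lambda>y. uh m s (y, t))"
proof -
  show u: "integrable (lm 1) (\<lambda>y. uh m s (y, t))"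
    by (rule integrable_bounded_finite[OF finite_measure_lm, where B=Cu]) (use a.uh_bound[OF t] in \<open>auto intro!: AE_lm_I\<close>)
  show i: "integrable (lm 1) (\<lambda>y. \<bar>ub m s (y, t) - uh m s (y, t)\<bar>)"
    by (intro integrable_abs Bochner_Integration.integrable_diff u ub_integrable t)
  have "(\<integral>y. \<bar>ub m s (y, t) - uh m s (y, t)\<bar> \<partial>lm 1) \<le> (\<integral>y. \<delta> m * \<bar>gh m s (y, t)\<bar> \<partial>lm 1)"
  proof (rule integral_mono_AE[OF i])
    show "integrable (lm 1) (\<lambda>y. \<delta> m * \<bar>gh m s (y, t)\<bar>)" using gh_integrable[OF t] by auto
    show "AE y in lm 1. \<bar>ub m s (y, t) - uh m s (y, t)\<bar> \<le> \<delta> m * \<bar>gh m s (y, t)\<bar>"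
      using a.uh_ub[OF t] by eventually_elim (simp only: abs_minus_commute)
  qed
  then show "(\<integral>y. \<bar>ub m s (y, t) - uh m s (y, t)\<bar> \<partial>lm 1) \<le> gap m s t" by (simp add: gap_def)
qed

lemma prim_gap:
  assumes t: "0 < t" "t < T" and [measurable]: "k \<in> borel_measurable borel" and B: "AE y in lm 1. \<bar>k y\<bar> \<le> B" and B0: "0 \<le> B"
  shows "\<bar>prim 1 (\<lambda>y. k y * ub m s (y, t)) x - prim 1 (\<lambda>y. k y * uh m s (y, t)) x\<bar> \<le> B * gap m s t"
proof -
  note G = gap_bound[OF t, of m s]
  have dom: "integrable (lm 1) (\<lambda>y. k y * f y)" if "integrable (lm 1) f" for f
  proof (rule Bochner_Integration.integrable_bound[of _ "\<lambda>y. B * f y"])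
    have [measurable]: "f \<in> borel_measurable borel" using borel_measurable_integrable[OF that] by simp
    show "(\<lambda>y. k y * f y) \<in> borel_measurable (lm 1)" by measurable
    show "AE y in lm 1. norm (k y * f y) \<le> norm (B * f y)"
      using B by eventually_elim (auto simp: abs_mult intro!: mult_right_mono)
  qed (use that in simp)
  have i: "integrable (lm 1) (\<lambda>y. k y * (ub m s (y, t) - uh m s (y, t)))"
    by (rule dom) (intro Bochner_Integration.integrable_diff G(3) ub_integrable t)
  have "prim 1 (\<lambda>y. k y * ub m s (y, t)) x - prim 1 (\<lambda>y. k y * uh m s (y, t)) x = prim 1 (\<lambda>y. k y * (ub m s (y, t) - uh m s (y, t))) x"
    unfolding right_diff_distrib by (rule prim_diff[symmetric]) (intro dom G(3) ub_integrable t)+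
  then have "\<bar>prim 1 (\<lambda>y. k y * ub m s (y, t)) x - prim 1 (\<lambda>y. k y * uh m s (y, t)) x\<bar> \<le> (\<integral>y. \<bar>k y * (ub m s (y, t) - uh m s (y, t))\<bar> \<partial>lm 1)"
    using prim_le_integral[OF i] by simp
  also have "\<dots> \<le> (\<integral>y. B * \<bar>ub m s (y, t) - uh m s (y, t)\<bar> \<partial>lm 1)"
  proof (rule integral_mono_AE)
    show "AE y in lm 1. \<bar>k y * (ub m s (y, t) - uh m s (y, t))\<bar> \<le> B * \<bar>ub m s (y, t) - uh m s (y, t)\<bar>"
      using B by eventually_elim (auto simp: abs_mult intro!: mult_right_mono)
  qed (use i G(2) in \<open>auto intro: integrable_abs\<close>)
  also have "\<dots> = B * (\<integral>y. \<bar>ub m s (y, t) - uh m s (y, t)\<bar> \<partial>lm 1)" by (rule integral_mult_right_zero)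
  also have "\<dots> \<le> B * gap m s t" using G(1) B0 by (rule mult_left_mono)
  finally show ?thesis .
qed

text \<open>The piecewise constant densities are replaced by the affine ones at the cost of
  \<open>B * gap\<close>, because pointwise convergence at good times is known for the
  latter.\<close>

lemma prim_ub_limit:
  assumes g: "good t" and [measurable]: "\<And>m. k m \<in> borel_measurable borel" "k' \<in> borel_measurable borel"
    and B: "\<And>m. AE y in lm 1. \<bar>k m y\<bar> \<le> B" and B0: "0 \<le> B" and l: "AE y in lm 1. (\<lambda>m. k m y) \<longlonglongrightarrow> k' y"
  shows "(\<lambda>m. prim 1 (\<lambda>y. k m y * ub m s (y, t)) x) \<longlonglongrightarrow> prim 1 (\<lambda>y. k' y * U s (y, t)) x"
proof -
  note t = goodD(1,2)[OF g]
  have x01: "AE y in lm 1. 0 < y \<and> y < 1" by (rule AE_lm_I) simp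
  have l1: "(\<lambda>m. prim 1 (\<lambda>y. k m y * uh m s (y, t)) x) \<longlonglongrightarrow> prim 1 (\<lambda>y. k' y * U s (y, t)) x"
  proof (rule prim_dominated[where B="B * Cu"])
    show "AE y in lm 1. \<bar>k n y * uh n s (y, t)\<bar> \<le> B * Cu" for n
      using B[of n] x01
    proof eventually_elim
      fix y assume "\<bar>k n y\<bar> \<le> B" "0 < y \<and> y < 1"
      moreover have "0 \<le> B" using \<open>\<bar>k n y\<bar> \<le> B\<close> by linarith
      ultimately show "\<bar>k n y * uh n s (y, t)\<bar> \<le> B * Cu"
        unfolding abs_mult using a.uh_bound[OF t, of y n s] by (intro mult_mono) auto
    qed
    show "AE y in lm 1. (\<lambda>n. k n y * uh n s (y, t)) \<longlonglongrightarrow> k' y * U s (y, t)"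
      using l x01 by eventually_elim (intro tendsto_mult goodD(3)[OF g]; simp)
  qed measurable
  have l2: "(\<lambda>m. prim 1 (\<lambda>y. k m y * ub m s (y, t)) x - prim 1 (\<lambda>y. k m y * uh m s (y, t)) x) \<longlonglongrightarrow> 0"
  proof (rule Lim_null_comparison)
    show "\<forall>\<^sub>F m in sequentially. norm (prim 1 (\<lambda>y. k m y * ub m s (y, t)) x - prim 1 (\<lambda>y. k m y * uh m s (y, t)) x) \<le> B * gap m s t"
      unfolding real_norm_def by (intro always_eventually allI prim_gap[OF t _ B B0]) measurable
    show "(\<lambda>m. B * gap m s t) \<longlonglongrightarrow> 0" using tendsto_mult_right_zero[OF goodD(4)[OF g]] .
  qed
  show ?thesis using tendsto_add[OF l2 l1] by simp
qed

lemma W_prim: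
  assumes g: "good t" and x: "0 \<le> x" "x \<le> 1"
  shows "W s (x, t) = prim 1 (\<lambda>y. U s (y, t)) x"
proof -
  have "(\<lambda>m. prim 1 (\<lambda>y. 1 * ub m s (y, t)) x) \<longlonglongrightarrow> prim 1 (\<lambda>y. 1 * U s (y, t)) x"
    by (rule prim_ub_limit[OF g, where B=1]) auto
  moreover have "(\<lambda>m. prim 1 (\<lambda>y. 1 * ub m s (y, t)) x) \<longlonglongrightarrow> W s (x, t)"
    using W_limit[OF goodD(1,2)[OF g] x, of s] by (simp add: wm_def)
  ultimately show ?thesis using LIMSEQ_unique by fastforce
qed

section \<open>Limit of the potential\<close>

definition "Sm m z = (3 * wm m SpP z - wm m SpN z + rho_hl d * fst z) / (lam d)\<^sup>2"
definition "S z = (3 * W SpP z - W SpN z + rho_hl d * fst z) / (lam d)\<^sup>2"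
text \<open>The slope at 0 that solves the limit Robin conditions when the slope in the interior is
  \<open>q - S\<close>; the coefficient \<open>1 + alpha0 + alpha1\<close> is the one of the
  discrete estimate.\<close>

definition "q t = (V_pot d - dPsi_pzc1 d - dPsi_pzc0 d + alpha1 d * S (1, t) + prim 1 (\<lambda>y. S (y, t)) 1) / (1 + alpha0 d + alpha1 d)"
definition "Q z = q (snd z) - S z"
definition "\<Phi> z = dPsi_pzc0 d + alpha0 d * q (snd z) + prim 1 (\<lambda>y. Q (y, snd z)) (fst z)"
definition "CS = (4 * C + \<bar>rho_hl d\<bar>) / (lam d)\<^sup>2"

lemma fst_snd_borel [measurable]: "fst \<in> borel_measurable (borel :: (real \<times> real) measure)" "snd \<in> borel_measurable (borel :: (real \<times> real) measure)"
  by (simp_all add: borel_prod[symmetric])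

lemma S_borel [measurable]: "S \<in> borel_measurable borel" "Sm m \<in> borel_measurable borel"
  unfolding S_def[abs_def] Sm_def[abs_def] by measurable

lemma q_borel [measurable]: "q \<in> borel_measurable borel"
proof -
  have [measurable]: "(\<lambda>t. prim 1 (\<lambda>y. S (y, t)) 1) \<in> borel_measurable borel"
    using slice_borel(2)[OF prim_borel2(1)[OF S_borel(1)], of 1 1] by simp
  have [measurable]: "(\<lambda>t. S (1, t)) \<in> borel_measurable borel" by (rule slice_borel) measurable
  show ?thesis unfolding q_def[abs_def] by measurable
qed

lemma Q_borel [measurable]: "Q \<in> borel_measurable borel"
  unfolding Q_def[abs_def] by measurable

lemma \<Phi>_borel [measurable]: "\<Phi> \<in> borel_measurable borel"
proof -
  have [measurable]: "(\<lambda>z. prim 1 (\<lambda>y. Q (y, snd z)) (fst z)) \<in> borel_measurable (borel :: (real\<times>real) measure)"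
    by (rule prim_borel2) measurable
  show ?thesis unfolding \<Phi>_def[abs_def] by measurable
qed

lemma Q_slices [measurable]: "(\<lambda>y. Q (y, t)) \<in> borel_measurable borel" "(\<lambda>\<tau>. Q (x, \<tau>)) \<in> borel_measurable borel"
  "(\<lambda>y. \<Phi> (y, t)) \<in> borel_measurable borel" "(\<lambda>\<tau>. \<Phi> (x, \<tau>)) \<in> borel_measurable borel" 
  "(\<lambda>y. S (y, t)) \<in> borel_measurable borel" "(\<lambda>y. Sm m (y, t)) \<in> borel_measurable borel"
  by (intro slice_borel; measurable)+

lemma Sm_limit: "0 < t \<Longrightarrow> t < T \<Longrightarrow> 0 \<le> x \<Longrightarrow> x \<le> 1 \<Longrightarrow> (\<lambda>m. Sm m (x, t)) \<longlonglongrightarrow> S (x, t)"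
  unfolding S_def Sm_def using lam_pos by (intro tendsto_intros W_limit) auto

lemma Sm_bound: "0 < t \<Longrightarrow> t < T \<Longrightarrow> 0 \<le> x \<Longrightarrow> x \<le> 1 \<Longrightarrow> \<bar>Sm m (x, t)\<bar> \<le> CS"
proof -
  assume h: "0 < t" "t < T" "0 \<le> x" "x \<le> 1"
  have "\<bar>rho_hl d * x\<bar> \<le> \<bar>rho_hl d\<bar> * 1" unfolding abs_mult using h by (intro mult_left_mono) auto
  then have "\<bar>3 * wm m SpP (x, t) - wm m SpN (x, t) + rho_hl d * x\<bar> \<le> 4 * C + \<bar>rho_hl d\<bar>"
    using wm_bound[OF h, of m SpP] wm_bound[OF h, of m SpN] by linarith
  then show ?thesis unfolding Sm_def CS_def fst_conv abs_divide by (simp add: divide_right_mono)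
qed

lemma Sm_prim:
  assumes t: "0 < t" "t < T" and x: "0 \<le> x" "x \<le> 1"
  shows "prim 1 (\<lambda>y. 3 * ub m SpP (y, t) - ub m SpN (y, t) + rho_hl d) x / (lam d)\<^sup>2 = Sm m (x, t)"
proof -
  have "prim 1 (\<lambda>y. (3 * ub m SpP (y, t) - ub m SpN (y, t)) + rho_hl d) x
    = prim 1 (\<lambda>y. 3 * ub m SpP (y, t) - ub m SpN (y, t)) x + prim 1 (\<lambda>y. rho_hl d) x"
    by (rule prim_add) (use ub_integrable[OF t] in auto)
  also have "prim 1 (\<lambda>y. 3 * ub m SpP (y, t) - ub m SpN (y, t)) x = prim 1 (\<lambda>y. 3 * ub m SpP (y, t)) x - prim 1 (\<lambda>y. ub m SpN (y, t)) x"
    by (rule prim_diff) (use ub_integrable[OF t] in auto)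
  finally show ?thesis unfolding Sm_def wm_def prim_cmult prim_const[OF x] fst_conv snd_conv by simp
qed

lemma Qh_close: "0 < t \<Longrightarrow> t < T \<Longrightarrow> AE x in lm 1. \<bar>Qh m (x, t) - q0 m t + Sm m (x, t)\<bar> \<le> \<delta> m"
proof -
  assume t: "0 < t" "t < T"
  have "AE y in lm 1. 0 < y \<and> y < 1" by (rule AE_lm_I) simp
  with a.Qh_q0[OF t, of m] show ?thesis
    by eventually_elim (use Sm_prim[OF t] in auto)
qed

lemma Sm_integrable: "0 < t \<Longrightarrow> t < T \<Longrightarrow> integrable (lm 1) (\<lambda>y. Sm m (y, t))"
  by (rule integrable_bounded_finite[OF finite_measure_lm, where B=CS]) (auto intro!: AE_lm_I Sm_bound)

lemma Qh_integrable: "0 < t \<Longrightarrow> t < T \<Longrightarrow> integrable (lm 1) (\<lambda>y. Qh m (y, t))"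
  by (rule integrable_bounded_finite[OF finite_measure_lm _ a.Qh_bound]) auto

lemma alpha_sum: "0 < 1 + alpha0 d + alpha1 d" using alpha0_pos alpha1_pos by simp

lemma prim_Sm_limit: "0 < t \<Longrightarrow> t < T \<Longrightarrow> (\<lambda>m. prim 1 (\<lambda>y. Sm m (y, t)) x) \<longlonglongrightarrow> prim 1 (\<lambda>y. S (y, t)) x"
  by (rule prim_dominated[where B=CS]) (auto intro!: AE_lm_I Sm_bound Sm_limit)

text \<open>The discrete slope at 0 solves the same linear equation, with \<open>Sm\<close> in place
  of \<open>S\<close> and an error of size \<open>\<delta> m\<close>. Solving for it explicitly
  replaces a compactness argument for the potential.\<close>

lemma q0_limit: "0 < t \<Longrightarrow> t < T \<Longrightarrow> (\<lambda>m. q0 m t) \<longlonglongrightarrow> q t"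
proof -
  assume t: "0 < t" "t < T"
  define err where "err m = prim 1 (\<lambda>y. Qh m (y, t) - q0 m t + Sm m (y, t)) 1" for m
  have "\<bar>err m\<bar> \<le> \<delta> m * 1" for m unfolding err_def
    by (rule prim_bound[OF _ Qh_close[OF t]]) auto
  then have err: "err \<longlonglongrightarrow> 0" by (intro Lim_null_comparison[OF _ delta_0]) auto
  have e: "prim 1 (\<lambda>y. Qh m (y, t)) 1 = q0 m t - prim 1 (\<lambda>y. Sm m (y, t)) 1 + err m" for m
  proof -
    have "err m = prim 1 (\<lambda>y. Qh m (y, t) - q0 m t) 1 + prim 1 (\<lambda>y. Sm m (y, t)) 1"
      unfolding err_def by (rule prim_add) (use Qh_integrable[OF t] Sm_integrable[OF t] in auto)
    also have "prim 1 (\<lambda>y. Qh m (y, t) - q0 m t) 1 = prim 1 (\<lambda>y. Qh m (y, t)) 1 - prim 1 (\<lambda>y. q0 m t) 1"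
      by (rule prim_diff) (use Qh_integrable[OF t] in auto)
    finally show ?thesis by (simp add: prim_const)
  qed
  have "q0 m t = (V_pot d - dPsi_pzc1 d - dPsi_pzc0 d + alpha1 d * Sm m (1, t) + prim 1 (\<lambda>y. Sm m (y, t)) 1 - err m) / (1 + alpha0 d + alpha1 d)" for m
  proof -
    have "q1 m t = q0 m t - Sm m (1, t)" using a.q1_q0[OF t, of m] Sm_prim[OF t, of 1 m] by simp
    then have "alpha1 d * q1 m t = alpha1 d * q0 m t - alpha1 d * Sm m (1, t)" by (simp add: right_diff_distrib)
    then have "q0 m t * (1 + alpha0 d + alpha1 d) = V_pot d - dPsi_pzc1 d - dPsi_pzc0 d + alpha1 d * Sm m (1, t) + prim 1 (\<lambda>y. Sm m (y, t)) 1 - err m"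
      using a.Ph_0[OF t, of m] a.Ph_1[OF t, of m] a.Ph_prim[OF t, of 1 m] e[of m] by (simp add: algebra_simps)
    then show ?thesis using alpha_sum by (simp add: eq_divide_eq)
  qed
  moreover have "(\<lambda>m. (V_pot d - dPsi_pzc1 d - dPsi_pzc0 d + alpha1 d * Sm m (1, t) + prim 1 (\<lambda>y. Sm m (y, t)) 1 - err m) / (1 + alpha0 d + alpha1 d)) \<longlonglongrightarrow>
     (V_pot d - dPsi_pzc1 d - dPsi_pzc0 d + alpha1 d * S (1, t) + prim 1 (\<lambda>y. S (y, t)) 1 - 0) / (1 + alpha0 d + alpha1 d)"
    using alpha_sum by (intro tendsto_intros Sm_limit[OF t] prim_Sm_limit[OF t] err) auto
  ultimately show ?thesis unfolding q_def by simp
qed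

lemma Qh_limit: "0 < t \<Longrightarrow> t < T \<Longrightarrow> AE x in lm 1. (\<lambda>m. Qh m (x, t)) \<longlonglongrightarrow> Q (x, t)"
proof -
  assume t: "0 < t" "t < T"
  have "AE x in lm 1. \<forall>m. \<bar>Qh m (x, t) - q0 m t + Sm m (x, t)\<bar> \<le> \<delta> m"
    unfolding AE_all_countable using Qh_close[OF t] by blast
  moreover have "AE y in lm 1. 0 < y \<and> y < 1" by (rule AE_lm_I) simp
  ultimately show ?thesis
  proof eventually_elim
    fix x assume c: "\<forall>m. \<bar>Qh m (x, t) - q0 m t + Sm m (x, t)\<bar> \<le> \<delta> m" and x: "0 < x \<and> x < 1"
    have "(\<lambda>m. Qh m (x, t) - q0 m t + Sm m (x, t)) \<longlonglongrightarrow> 0"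
      by (rule Lim_null_comparison[OF _ delta_0]) (use c in auto)
    then have "(\<lambda>m. (Qh m (x, t) - q0 m t + Sm m (x, t)) + (q0 m t - Sm m (x, t))) \<longlonglongrightarrow> 0 + (q t - S (x, t))"
      by (intro tendsto_add tendsto_diff q0_limit[OF t] Sm_limit[OF t]) (use x in auto)
    then show "(\<lambda>m. Qh m (x, t)) \<longlonglongrightarrow> Q (x, t)" by (simp add: Q_def)
  qed
qed

lemma Q_bound: "0 < t \<Longrightarrow> t < T \<Longrightarrow> AE x in lm 1. \<bar>Q (x, t)\<bar> \<le> C"
proof -
  assume t: "0 < t" "t < T"
  have "AE x in lm 1. \<forall>m. \<bar>Qh m (x, t)\<bar> \<le> C" unfolding AE_all_countable using a.Qh_bound[OF t] by blast
  with Qh_limit[OF t] show ?thesis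
  proof eventually_elim
    fix x assume l: "(\<lambda>m. Qh m (x, t)) \<longlonglongrightarrow> Q (x, t)" and b: "\<forall>m. \<bar>Qh m (x, t)\<bar> \<le> C"
    show "\<bar>Q (x, t)\<bar> \<le> C" by (rule LIMSEQ_le_const2[OF tendsto_rabs[OF l]]) (use b in auto)
  qed
qed

lemma Q_integrable: "0 < t \<Longrightarrow> t < T \<Longrightarrow> integrable (lm 1) (\<lambda>y. Q (y, t))"
  by (rule integrable_bounded_finite[OF finite_measure_lm _ Q_bound]) auto

lemma Ph_limit: "0 < t \<Longrightarrow> t < T \<Longrightarrow> 0 \<le> x \<Longrightarrow> x \<le> 1 \<Longrightarrow> (\<lambda>m. Ph m (x, t)) \<longlonglongrightarrow> \<Phi> (x, t)"
proof -
  assume t: "0 < t" "t < T" and x: "0 \<le> x" "x \<le> 1"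
  have "(\<lambda>m. prim 1 (\<lambda>y. Qh m (y, t)) x) \<longlonglongrightarrow> prim 1 (\<lambda>y. Q (y, t)) x"
    by (rule prim_dominated[OF _ _ a.Qh_bound[OF t] Qh_limit[OF t]]) measurable
  then have "(\<lambda>m. dPsi_pzc0 d + alpha0 d * q0 m t + prim 1 (\<lambda>y. Qh m (y, t)) x) \<longlonglongrightarrow> \<Phi> (x, t)"
    unfolding \<Phi>_def fst_conv snd_conv by (intro tendsto_intros q0_limit[OF t])
  moreover have "Ph m (x, t) = dPsi_pzc0 d + alpha0 d * q0 m t + prim 1 (\<lambda>y. Qh m (y, t)) x" for m
    using a.Ph_prim[OF t x, of m] a.Ph_0[OF t, of m] by simp
  ultimately show ?thesis by simp
qed

lemma \<Phi>_bound: "0 < t \<Longrightarrow> t < T \<Longrightarrow> 0 \<le> x \<Longrightarrow> x \<le> 1 \<Longrightarrow> \<bar>\<Phi> (x, t)\<bar> \<le> CP"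
  by (rule LIMSEQ_le_const2[OF tendsto_rabs[OF Ph_limit]]) (auto intro: a.Ph_bound)

lemma \<Phi>_prim: "\<Phi> (x, t) = \<Phi> (0, t) + prim 1 (\<lambda>y. Q (y, t)) x"
  by (simp add: \<Phi>_def prim_0)

lemma \<Phi>_0: "\<Phi> (0, t) = dPsi_pzc0 d + alpha0 d * q t"
  by (simp add: \<Phi>_def prim_0)

lemma \<Phi>_1: "0 < t \<Longrightarrow> t < T \<Longrightarrow> \<Phi> (1, t) = V_pot d - dPsi_pzc1 d - alpha1 d * (q t - S (1, t))"
proof -
  assume t: "0 < t" "t < T"
  have "(\<lambda>m. V_pot d - dPsi_pzc1 d - alpha1 d * (q0 m t - Sm m (1, t))) \<longlonglongrightarrow> V_pot d - dPsi_pzc1 d - alpha1 d * (q t - S (1, t))"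
    by (intro tendsto_intros q0_limit[OF t] Sm_limit[OF t]) auto
  moreover have "V_pot d - dPsi_pzc1 d - alpha1 d * (q0 m t - Sm m (1, t)) = Ph m (1, t)" for m
    using a.Ph_1[OF t, of m] a.q1_q0[OF t, of m] Sm_prim[OF t, of 1 m] by simp
  ultimately show ?thesis using Ph_limit[OF t, of 1] LIMSEQ_unique by fastforce
qed

section \<open>Limit of the integrated conservation laws\<close>

definition "B0 s \<tau> = beta d s 0 (\<Phi> (0, \<tau>)) * U s (0, \<tau>) - gamma0 d s (\<Phi> (0, \<tau>))"
definition "B1 s \<tau> = beta d s 1 (V_pot d - \<Phi> (1, \<tau>)) * U s (1, \<tau>) - gamma1 d s (V_pot d - \<Phi> (1, \<tau>))"

lemma B_borel [measurable]: "B0 s \<in> borel_measurable borel" "B1 s \<in> borel_measurable borel"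
  unfolding B0_def[abs_def] B1_def[abs_def] by measurable

lemma B_bound: "good t \<Longrightarrow> \<bar>B0 s t\<bar> \<le> CF" "good t \<Longrightarrow> \<bar>B1 s t\<bar> \<le> CF"
proof -
  assume g: "good t"
  note t = goodD(1,2)[OF g]
  show "\<bar>B0 s t\<bar> \<le> CF" unfolding B0_def
    by (rule boundary_bound(1)) (use U_range[OF g, of 0 s] \<Phi>_bound[OF t, of 0] in auto)
  show "\<bar>B1 s t\<bar> \<le> CF" unfolding B1_def
    by (rule boundary_bound(2)) (use U_range[OF g, of 1 s] \<Phi>_bound[OF t, of 1] in auto)
qed

lemma boundary_limit:
  assumes g: "good t"
  shows "(\<lambda>m. beta d s 0 (Ph m (0, t)) * uh m s (0, t) - gamma0 d s (Ph m (0, t))) \<longlonglongrightarrow> B0 s t"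
    "(\<lambda>m. beta d s 1 (V_pot d - Ph m (1, t)) * uh m s (1, t) - gamma1 d s (V_pot d - Ph m (1, t))) \<longlonglongrightarrow> B1 s t"
  unfolding B0_def B1_def beta_def gamma0_def gamma1_def
  by (intro tendsto_intros Ph_limit goodD[OF g]; simp)+

text \<open>All integrands are uniformly bounded, so dominated convergence in time asks for
  convergence at good times only, while the left side converges at every \<open>t\<close>.\<close>

theorem moment_limit:
  assumes t: "0 < t" "t < T" and x: "0 \<le> x" "x \<le> 1"
  shows "eps_of d s * (prim 1 (\<lambda>y. W s (y, t)) x - prim 1 (prim 1 (u0 s)) x) =
    prim T (\<lambda>\<tau>. U s (x, \<tau>) - U s (0, \<tau>) + z_of s * prim 1 (\<lambda>y. Q (y, \<tau>) * U s (y, \<tau>)) x - x * B0 s \<tau>) t"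
proof -
  let ?H = "\<lambda>\<tau>. U s (x, \<tau>) - U s (0, \<tau>) + z_of s * prim 1 (\<lambda>y. Q (y, \<tau>) * U s (y, \<tau>)) x - x * B0 s \<tau>"
  have [measurable]: "(\<lambda>\<tau>. prim 1 (\<lambda>y. Q (y, \<tau>) * U s (y, \<tau>)) x) \<in> borel_measurable borel"
  proof -
    have "(\<lambda>z. prim 1 (\<lambda>y. (\<lambda>z. Q z * U s z) (y, snd z)) (fst z)) \<in> borel_measurable borel"
      by (rule prim_borel2) measurable
    from slice_borel(2)[OF this, of x] show ?thesis by simp
  qed
  have "(\<lambda>m. prim T (H m s x) t) \<longlonglongrightarrow> prim T ?H t"
  proof (rule prim_dominated[where B=CH])
    show "AE \<tau> in lm T. \<bar>H m s x \<tau>\<bar> \<le> CH" for m by (rule AE_lm_I) (rule H_bound[OF _ _ x])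
    show "AE \<tau> in lm T. (\<lambda>m. H m s x \<tau>) \<longlonglongrightarrow> ?H \<tau>"
      using AE_good
    proof eventually_elim
      fix \<tau> assume g: "good \<tau>"
      note \<tau> = goodD(1,2)[OF g]
      have "(\<lambda>m. prim 1 (\<lambda>y. Qh m (y, \<tau>) * ub m s (y, \<tau>)) x) \<longlonglongrightarrow> prim 1 (\<lambda>y. Q (y, \<tau>) * U s (y, \<tau>)) x"
        by (rule prim_ub_limit[OF g _ _ a.Qh_bound[OF \<tau>] C_nonneg Qh_limit[OF \<tau>]]) measurable
      then show "(\<lambda>m. H m s x \<tau>) \<longlonglongrightarrow> ?H \<tau>" unfolding H_def
        by (intro tendsto_intros boundary_limit[OF g] goodD(3)[OF g] x) auto
    qed
  qed measurable
  moreover have "(\<lambda>m. prim 1 (\<lambda>y. wm m s (y, t)) x) \<longlonglongrightarrow> prim 1 (\<lambda>y. W s (y, t)) x"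
    by (rule prim_dominated[where B=C]) (auto intro!: AE_lm_I wm_bound t W_limit)
  ultimately have "(\<lambda>m. eps_of d s * (prim 1 (\<lambda>y. wm m s (y, t)) x - prim 1 (prim 1 (u0 s)) x) - prim T (H m s x) t) \<longlonglongrightarrow>
      eps_of d s * (prim 1 (\<lambda>y. W s (y, t)) x - prim 1 (prim 1 (u0 s)) x) - prim T ?H t"
    by (intro tendsto_intros)
  moreover have "(\<lambda>m. eps_of d s * (prim 1 (\<lambda>y. wm m s (y, t)) x - prim 1 (prim 1 (u0 s)) x) - prim T (H m s x) t) \<longlonglongrightarrow> 0"
  proof (rule Lim_null_comparison[OF _ delta_0])
    show "\<forall>\<^sub>F m in sequentially. norm (eps_of d s * (prim 1 (\<lambda>y. wm m s (y, t)) x - prim 1 (prim 1 (u0 s)) x) - prim T (H m s x) t) \<le> \<delta> m"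
      unfolding real_norm_def H_def[abs_def] wm_def fst_conv snd_conv by (intro always_eventually allI a.moment[OF t x])
  qed
  ultimately show ?thesis using LIMSEQ_unique by fastforce
qed

theorem mass_limit:
  assumes t: "0 < t" "t < T"
  shows "eps_of d s * (W s (1, t) - prim 1 (u0 s) 1) + prim T (\<lambda>\<tau>. B1 s \<tau> + B0 s \<tau>) t = 0"
proof -
  let ?b = "\<lambda>m \<tau>. (beta d s 1 (V_pot d - Ph m (1, \<tau>)) * uh m s (1, \<tau>) - gamma1 d s (V_pot d - Ph m (1, \<tau>)))
            + (beta d s 0 (Ph m (0, \<tau>)) * uh m s (0, \<tau>) - gamma0 d s (Ph m (0, \<tau>)))"
  have "(\<lambda>m. prim T (?b m) t) \<longlonglongrightarrow> prim T (\<lambda>\<tau>. B1 s \<tau> + B0 s \<tau>) t"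
  proof (rule prim_dominated[where B="CF + CF"])
    show "AE \<tau> in lm T. \<bar>?b m \<tau>\<bar> \<le> CF + CF" for m
    proof (rule AE_lm_I)
      fix \<tau> assume \<tau>: "0 < \<tau>" "\<tau> < T"
      show "\<bar>?b m \<tau>\<bar> \<le> CF + CF"
        by (rule order_trans[OF abs_triangle_ineq add_mono[OF boundary_bound(2) boundary_bound(1)]])
           (use a.uh_bound[OF \<tau>, of 0 m s] a.uh_bound[OF \<tau>, of 1 m s] a.Ph_bound[OF \<tau>, of 0 m] a.Ph_bound[OF \<tau>, of 1 m] in auto)
    qed
    show "AE \<tau> in lm T. (\<lambda>m. ?b m \<tau>) \<longlonglongrightarrow> B1 s \<tau> + B0 s \<tau>"
      using AE_good by eventually_elim (intro tendsto_add boundary_limit)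
  qed measurable
  then have "(\<lambda>m. eps_of d s * (wm m s (1, t) - prim 1 (u0 s) 1) + prim T (?b m) t) \<longlonglongrightarrow>
      eps_of d s * (W s (1, t) - prim 1 (u0 s) 1) + prim T (\<lambda>\<tau>. B1 s \<tau> + B0 s \<tau>) t"
    by (intro tendsto_intros W_limit[OF t]) auto
  moreover have "(\<lambda>m. eps_of d s * (wm m s (1, t) - prim 1 (u0 s) 1) + prim T (?b m) t) \<longlonglongrightarrow> 0"
  proof (rule Lim_null_comparison[OF _ delta_0])
    show "\<forall>\<^sub>F m in sequentially. norm (eps_of d s * (wm m s (1, t) - prim 1 (u0 s) 1) + prim T (?b m) t) \<le> \<delta> m"
      unfolding real_norm_def wm_def fst_conv snd_conv by (intro always_eventually allI a.mass[OF t])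
  qed
  ultimately show ?thesis using LIMSEQ_unique by fastforce
qed

text \<open>\<open>g\<close> is the derivative of a convex combination \<open>f\<close> of the \<open>uh j s\<close> with \<open>j \<ge> n\<close>, where
  only this consequence of convexity is kept: \<open>f\<close> lies in every ball that contains all these
  functions.\<close>

definition convex_limit :: "species \<Rightarrow> nat \<Rightarrow> (real \<times> real \<Rightarrow> real) \<Rightarrow> bool" where
  "convex_limit s n g \<longleftrightarrow> g \<in> borel_measurable borel \<and> integrable (mq T) (\<lambda>z. (g z)\<^sup>2) \<and> (\<integral>z. (g z)\<^sup>2 \<partial>mq T) \<le> C \<and>
    (\<forall>t. 0 < t \<longrightarrow> t < T \<longrightarrow> integrable (lm 1) (\<lambda>x. (g (x, t))\<^sup>2)) \<and>
    (\<exists>f. \<forall>t x. 0 < t \<longrightarrow> t < T \<longrightarrow> 0 \<le> x \<longrightarrow> x \<le> 1 \<longrightarrow> f (x, t) = f (0, t) + prim 1 (\<lambda>y. g (y, t)) x \<and>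
      (\<forall>e l. (\<forall>j\<ge>n. \<bar>uh j s (x, t) - l\<bar> \<le> e) \<longrightarrow> \<bar>f (x, t) - l\<bar> \<le> e))"

lemma convex_limitI:
  assumes "g \<in> borel_measurable borel" "integrable (mq T) (\<lambda>z. (g z)\<^sup>2)" "(\<integral>z. (g z)\<^sup>2 \<partial>mq T) \<le> C"
    "\<And>t. 0 < t \<Longrightarrow> t < T \<Longrightarrow> integrable (lm 1) (\<lambda>x. (g (x, t))\<^sup>2)"
    "\<forall>t x. 0 < t \<longrightarrow> t < T \<longrightarrow> 0 \<le> x \<longrightarrow> x \<le> 1 \<longrightarrow> f (x, t) = f (0, t) + prim 1 (\<lambda>y. g (y, t)) x \<and>
      (\<forall>e l. (\<forall>j\<ge>n. \<bar>uh j s (x, t) - l\<bar> \<le> e) \<longrightarrow> \<bar>f (x, t) - l\<bar> \<le> e)"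
  shows "convex_limit s n g"
proof -
  have 4: "\<forall>t. 0 < t \<longrightarrow> t < T \<longrightarrow> integrable (lm 1) (\<lambda>x. (g (x, t))\<^sup>2)" by (intro allI impI assms(4))
  show ?thesis unfolding convex_limit_def by (intro conjI exI[of _ f] assms(1,2,3,5) 4)
qed

lemma convex_limitD:
  assumes "convex_limit s n g"
  shows "g \<in> borel_measurable borel" "integrable (mq T) (\<lambda>z. (g z)\<^sup>2)" "(\<integral>z. (g z)\<^sup>2 \<partial>mq T) \<le> C"
    "0 < t \<Longrightarrow> t < T \<Longrightarrow> integrable (lm 1) (\<lambda>x. (g (x, t))\<^sup>2)"
    "\<exists>f. \<forall>t x. 0 < t \<longrightarrow> t < T \<longrightarrow> 0 \<le> x \<longrightarrow> x \<le> 1 \<longrightarrow> f (x, t) = f (0, t) + prim 1 (\<lambda>y. g (y, t)) x \<and>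
      (\<forall>e l. (\<forall>j\<ge>n. \<bar>uh j s (x, t) - l\<bar> \<le> e) \<longrightarrow> \<bar>f (x, t) - l\<bar> \<le> e)"
proof -
  note c = assms[unfolded convex_limit_def]
  show "g \<in> borel_measurable borel" by (rule c[THEN conjunct1])
  show "integrable (mq T) (\<lambda>z. (g z)\<^sup>2)" by (rule c[THEN conjunct2, THEN conjunct1])
  show "(\<integral>z. (g z)\<^sup>2 \<partial>mq T) \<le> C" by (rule c[THEN conjunct2, THEN conjunct2, THEN conjunct1])
  show "0 < t \<Longrightarrow> t < T \<Longrightarrow> integrable (lm 1) (\<lambda>x. (g (x, t))\<^sup>2)"
    by (rule c[THEN conjunct2, THEN conjunct2, THEN conjunct2, THEN conjunct1, THEN spec, THEN mp, THEN mp])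
  show "\<exists>f. \<forall>t x. 0 < t \<longrightarrow> t < T \<longrightarrow> 0 \<le> x \<longrightarrow> x \<le> 1 \<longrightarrow> f (x, t) = f (0, t) + prim 1 (\<lambda>y. g (y, t)) x \<and>
      (\<forall>e l. (\<forall>j\<ge>n. \<bar>uh j s (x, t) - l\<bar> \<le> e) \<longrightarrow> \<bar>f (x, t) - l\<bar> \<le> e)"
    by (rule c[THEN conjunct2, THEN conjunct2, THEN conjunct2, THEN conjunct2])
qed

lemma convex_limit_base: "convex_limit s n (gh n s)"
proof -
  have F: "\<forall>t x. 0 < t \<longrightarrow> t < T \<longrightarrow> 0 \<le> x \<longrightarrow> x \<le> 1 \<longrightarrow> uh n s (x, t) = uh n s (0, t) + prim 1 (\<lambda>y. gh n s (y, t)) x \<and>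
      (\<forall>e l. (\<forall>j\<ge>n. \<bar>uh j s (x, t) - l\<bar> \<le> e) \<longrightarrow> \<bar>uh n s (x, t) - l\<bar> \<le> e)"
    by (intro allI impI conjI a.uh_prim) auto
  show ?thesis by (rule convex_limitI[OF seq_borel(2) a.gh_sq(1) a.gh_sq(2) a.gh_sq(3) F])
qed

lemma convex_limit_mid:
  assumes "convex_limit s n g" "convex_limit s n g'"
  shows "convex_limit s n (\<lambda>z. (g z + g' z) / 2)"
proof -
  obtain f where Ff': "\<forall>t x. 0 < t \<longrightarrow> t < T \<longrightarrow> 0 \<le> x \<longrightarrow> x \<le> 1 \<longrightarrow> f (x, t) = f (0, t) + prim 1 (\<lambda>y. g (y, t)) x \<and>
      (\<forall>e l. (\<forall>j\<ge>n. \<bar>uh j s (x, t) - l\<bar> \<le> e) \<longrightarrow> \<bar>f (x, t) - l\<bar> \<le> e)"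
    using convex_limitD(5)[OF assms(1)] ..
  note f = Ff'[THEN spec, THEN spec, THEN mp, THEN mp, THEN mp, THEN mp, THEN conjunct1] Ff'[THEN spec, THEN spec, THEN mp, THEN mp, THEN mp, THEN mp, THEN conjunct2, THEN spec, THEN spec, THEN mp]
  obtain f' where Ffp': "\<forall>t x. 0 < t \<longrightarrow> t < T \<longrightarrow> 0 \<le> x \<longrightarrow> x \<le> 1 \<longrightarrow> f' (x, t) = f' (0, t) + prim 1 (\<lambda>y. g' (y, t)) x \<and>
      (\<forall>e l. (\<forall>j\<ge>n. \<bar>uh j s (x, t) - l\<bar> \<le> e) \<longrightarrow> \<bar>f' (x, t) - l\<bar> \<le> e)"
    using convex_limitD(5)[OF assms(2)] ..
  note f' = Ffp'[THEN spec, THEN spec, THEN mp, THEN mp, THEN mp, THEN mp, THEN conjunct1] Ffp'[THEN spec, THEN spec, THEN mp, THEN mp, THEN mp, THEN mp, THEN conjunct2, THEN spec, THEN spec, THEN mp]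
  have m [measurable]: "g \<in> borel_measurable borel" "g' \<in> borel_measurable borel"
    and i: "integrable (mq T) (\<lambda>z. (g z)\<^sup>2)" "integrable (mq T) (\<lambda>z. (g' z)\<^sup>2)"
    and b: "(\<integral>z. (g z)\<^sup>2 \<partial>mq T) \<le> C" "(\<integral>z. (g' z)\<^sup>2 \<partial>mq T) \<le> C"
    and sl: "\<And>t. 0 < t \<Longrightarrow> t < T \<Longrightarrow> integrable (lm 1) (\<lambda>x. (g (x, t))\<^sup>2)" "\<And>t. 0 < t \<Longrightarrow> t < T \<Longrightarrow> integrable (lm 1) (\<lambda>x. (g' (x, t))\<^sup>2)"
    using convex_limitD[OF assms(1)] convex_limitD[OF assms(2)] by simp_all
  have ms [measurable]: "(\<lambda>x. g (x, t)) \<in> borel_measurable borel" "(\<lambda>x. g' (x, t)) \<in> borel_measurable borel" for t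
    using slice_borel m by blast+
  have im: "integrable (mq T) (\<lambda>z. ((g z + g' z) / 2)\<^sup>2)"
    unfolding power_divide using sq_integrable_diff(2)[of g "mq T" g'] i by simp
  have "(\<integral>z. ((g z + g' z) / 2)\<^sup>2 \<partial>mq T) \<le> (\<integral>z. (g z)\<^sup>2 / 2 + (g' z)\<^sup>2 / 2 \<partial>mq T)"
  proof (rule integral_mono[OF im])
    show "integrable (mq T) (\<lambda>z. (g z)\<^sup>2 / 2 + (g' z)\<^sup>2 / 2)" using i by simp
    show "((g z + g' z) / 2)\<^sup>2 \<le> (g z)\<^sup>2 / 2 + (g' z)\<^sup>2 / 2" for z
      using zero_le_power2[of "g z - g' z"] unfolding power_divide power2_sum power2_diff by simp
  qed
  also have "\<dots> = (\<integral>z. (g z)\<^sup>2 \<partial>mq T) / 2 + (\<integral>z. (g' z)\<^sup>2 \<partial>mq T) / 2" using i by simp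
  finally have bm: "(\<integral>z. ((g z + g' z) / 2)\<^sup>2 \<partial>mq T) \<le> C" using b by linarith
  have slm: "integrable (lm 1) (\<lambda>x. ((g (x, t) + g' (x, t)) / 2)\<^sup>2)" if "0 < t" "t < T" for t
    unfolding power_divide using sq_integrable_diff(2)[of "\<lambda>x. g (x, t)" "lm 1" "\<lambda>x. g' (x, t)"] sl that by simp
  have pm: "prim 1 (\<lambda>y. (g (y, t) + g' (y, t)) / 2) x = (prim 1 (\<lambda>y. g (y, t)) x + prim 1 (\<lambda>y. g' (y, t)) x) / 2" if "0 < t" "t < T" for t x
  proof -
    have "integrable (lm 1) (\<lambda>y. g (y, t))" "integrable (lm 1) (\<lambda>y. g' (y, t))"
      by (rule sq_integrable_imp_integrable[OF finite_measure_lm]; use sl that in simp)+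
    from prim_add[OF this] show ?thesis using prim_cmult[of 1 "1/2" "\<lambda>y. g (y, t) + g' (y, t)" x] by simp
  qed
  have F: "\<forall>t x. 0 < t \<longrightarrow> t < T \<longrightarrow> 0 \<le> x \<longrightarrow> x \<le> 1 \<longrightarrow> (f (x, t) + f' (x, t)) / 2 = (f (0, t) + f' (0, t)) / 2 + prim 1 (\<lambda>y. (g (y, t) + g' (y, t)) / 2) x \<and>
      (\<forall>e l. (\<forall>j\<ge>n. \<bar>uh j s (x, t) - l\<bar> \<le> e) \<longrightarrow> \<bar>(f (x, t) + f' (x, t)) / 2 - l\<bar> \<le> e)"
  proof (intro allI impI conjI)
    fix t x :: real assume t: "0 < t" "t < T" and x: "0 \<le> x" "x \<le> 1"
    show "(f (x, t) + f' (x, t)) / 2 = (f (0, t) + f' (0, t)) / 2 + prim 1 (\<lambda>y. (g (y, t) + g' (y, t)) / 2) x"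
      unfolding pm[OF t] f(1)[OF t x] f'(1)[OF t x] by (simp add: field_simps)
    fix e l assume j: "\<forall>j\<ge>n. \<bar>uh j s (x, t) - l\<bar> \<le> e"
    show "\<bar>(f (x, t) + f' (x, t)) / 2 - l\<bar> \<le> e"
      using f(2)[OF t x j] f'(2)[OF t x j] by (simp add: abs_le_iff field_simps)
  qed
  have mm: "(\<lambda>z. (g z + g' z) / 2) \<in> borel_measurable borel" by measurable
  show ?thesis by (rule convex_limitI[where f="\<lambda>z. (f z + f' z) / 2", OF mm im bm slm F])
qed

text \<open>Bounds on all members from \<open>n\<close> on include those from \<open>m\<close> on,
  so the classes shrink as the index grows.\<close>

lemma convex_limit_anti: "n \<le> m \<Longrightarrow> convex_limit s m g \<Longrightarrow> convex_limit s n g"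
proof -
  assume nm: "n \<le> m" and c: "convex_limit s m g"
  obtain f where Ff': "\<forall>t x. 0 < t \<longrightarrow> t < T \<longrightarrow> 0 \<le> x \<longrightarrow> x \<le> 1 \<longrightarrow> f (x, t) = f (0, t) + prim 1 (\<lambda>y. g (y, t)) x \<and>
      (\<forall>e l. (\<forall>j\<ge>m. \<bar>uh j s (x, t) - l\<bar> \<le> e) \<longrightarrow> \<bar>f (x, t) - l\<bar> \<le> e)"
    using convex_limitD(5)[OF c] ..
  note f = Ff'[THEN spec, THEN spec, THEN mp, THEN mp, THEN mp, THEN mp, THEN conjunct1] Ff'[THEN spec, THEN spec, THEN mp, THEN mp, THEN mp, THEN mp, THEN conjunct2, THEN spec, THEN spec, THEN mp]
  have "\<forall>t x. 0 < t \<longrightarrow> t < T \<longrightarrow> 0 \<le> x \<longrightarrow> x \<le> 1 \<longrightarrow> f (x, t) = f (0, t) + prim 1 (\<lambda>y. g (y, t)) x \<and>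
      (\<forall>e l. (\<forall>j\<ge>n. \<bar>uh j s (x, t) - l\<bar> \<le> e) \<longrightarrow> \<bar>f (x, t) - l\<bar> \<le> e)"
  proof (intro allI impI conjI)
    fix t x :: real assume t: "0 < t" "t < T" "0 \<le> x" "x \<le> 1"
    show "f (x, t) = f (0, t) + prim 1 (\<lambda>y. g (y, t)) x" by (rule f(1)[OF t])
    fix e l assume "\<forall>j\<ge>n. \<bar>uh j s (x, t) - l\<bar> \<le> e"
    then have "\<forall>j\<ge>m. \<bar>uh j s (x, t) - l\<bar> \<le> e" using nm by simp
    then show "\<bar>f (x, t) - l\<bar> \<le> e" by (rule f(2)[OF t])
  qed
  from convex_limitI[OF convex_limitD(1,2,3)[OF c] convex_limitD(4)[OF c] this] show ?thesis .
qed

text \<open>Near-minimisers over the classes \<open>convex_limit s n\<close> are Cauchy in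
  \<open>L2\<close>, and \<open>v\<close> is their limit. The functions attached to them still
  converge pointwise to \<open>U\<close>, so the identity between function and gradient passes to
  the limit.\<close>

theorem space_derivative:
  "\<exists>v. v \<in> borel_measurable borel \<and> integrable (mq T) (\<lambda>z. (v z)\<^sup>2) \<and>
    (AE t in lm T. good t \<and> integrable (lm 1) (\<lambda>x. (v (x, t))\<^sup>2) \<and>
      (\<forall>x\<in>{0..1}. U s (x, t) = U s (0, t) + prim 1 (\<lambda>y. v (y, t)) x))"
proof -
  have "\<exists>g. (\<forall>n. convex_limit s n (g n)) \<and> (\<forall>e>0. \<exists>N. \<forall>m\<ge>N. \<forall>n\<ge>N. (\<integral>z. (g m z - g n z)\<^sup>2 \<partial>mq T) \<le> e)"
  proof (rule midpoint_convex_Cauchy[where C=C])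
    show "convex_limit s n g \<Longrightarrow> g \<in> borel_measurable (mq T)" for n g using convex_limitD(1) by simp
    show "convex_limit s n g \<Longrightarrow> integrable (mq T) (\<lambda>z. (g z)\<^sup>2)" for n g by (rule convex_limitD(2))
    show "convex_limit s n g \<Longrightarrow> (\<integral>z. (g z)\<^sup>2 \<partial>mq T) \<le> C" for n g by (rule convex_limitD(3))
    show "convex_limit s n f \<Longrightarrow> convex_limit s n g \<Longrightarrow> convex_limit s n (\<lambda>z. (f z + g z) / 2)" for n f g by (rule convex_limit_mid)
    show "n \<le> m \<Longrightarrow> convex_limit s m f \<Longrightarrow> convex_limit s n f" for n m f by (rule convex_limit_anti)
    show "\<exists>f. convex_limit s n f" for n using convex_limit_base by (intro exI)
  qed
  then obtain g where gg: "(\<forall>n. convex_limit s n (g n)) \<and> (\<forall>e>0. \<exists>N. \<forall>m\<ge>N. \<forall>n\<ge>N. (\<integral>z. (g m z - g n z)\<^sup>2 \<partial>mq T) \<le> e)" ..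
  note g = gg[THEN conjunct1, THEN spec] and gC = gg[THEN conjunct2, THEN spec, THEN mp]
  have gm [measurable]: "g n \<in> borel_measurable borel" and gi: "integrable (mq T) (\<lambda>z. (g n z)\<^sup>2)" for n
    using convex_limitD(1,2)[OF g[of n]] by simp_all
  have gs: "integrable (lm 1) (\<lambda>x. (g n (x, t))\<^sup>2)" if "0 < t" "t < T" for n t
    by (rule convex_limitD(4)[OF g[of n] that])
  have "\<exists>f. \<forall>t x. 0 < t \<longrightarrow> t < T \<longrightarrow> 0 \<le> x \<longrightarrow> x \<le> 1 \<longrightarrow> f (x, t) = f (0, t) + prim 1 (\<lambda>y. g n (y, t)) x \<and>
      (\<forall>e l. (\<forall>j\<ge>n. \<bar>uh j s (x, t) - l\<bar> \<le> e) \<longrightarrow> \<bar>f (x, t) - l\<bar> \<le> e)" for n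
    by (rule convex_limitD(5)[OF g[of n]])
  then obtain f where Ff: "\<And>n. \<forall>t x. 0 < t \<longrightarrow> t < T \<longrightarrow> 0 \<le> x \<longrightarrow> x \<le> 1 \<longrightarrow> f n (x, t) = f n (0, t) + prim 1 (\<lambda>y. g n (y, t)) x \<and>
      (\<forall>e l. (\<forall>j\<ge>n. \<bar>uh j s (x, t) - l\<bar> \<le> e) \<longrightarrow> \<bar>f n (x, t) - l\<bar> \<le> e)"
    by (rule exE[OF choice[OF allI]]) (rule that, erule spec)
  note f = Ff[THEN spec, THEN spec, THEN mp, THEN mp, THEN mp, THEN mp, THEN conjunct1] Ff[THEN spec, THEN spec, THEN mp, THEN mp, THEN mp, THEN mp, THEN conjunct2, THEN spec, THEN spec, THEN mp]
  have gmm: "g n \<in> borel_measurable (mq T)" for n using gm[of n] by simp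
  have "\<exists>v r. v \<in> borel_measurable (mq T) \<and> integrable (mq T) (\<lambda>z. (v z)\<^sup>2) \<and> strict_mono r \<and>
    (AE z in mq T. (\<lambda>j. g (r j) z) \<longlonglongrightarrow> v z) \<and> (\<lambda>n. \<integral>z. (g n z - v z)\<^sup>2 \<partial>mq T) \<longlonglongrightarrow> 0"
    by (rule L2_complete[OF finite_measure_mq gmm gi gC])
  then obtain v where v: "v \<in> borel_measurable (mq T)" "integrable (mq T) (\<lambda>z. (v z)\<^sup>2)" "(\<lambda>n. \<integral>z. (g n z - v z)\<^sup>2 \<partial>mq T) \<longlonglongrightarrow> 0"
    by (elim exE conjE) (rule that)
  have vm [measurable]: "v \<in> borel_measurable borel" using v(1) by simp
  have vs [measurable]: "(\<lambda>x. v (x, t)) \<in> borel_measurable borel" "(\<lambda>x. g n (x, t)) \<in> borel_measurable borel" for t n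
    by (rule slice_borel(1)[OF vm]) (rule slice_borel(1)[OF gm])
  have id: "integrable (mq T) (\<lambda>z. (g n z - v z)\<^sup>2)" for n
    by (rule sq_integrable_diff) (use gi v in auto)
  \<comment> \<open>Convergence on the cylinder is transferred to almost every time slice along a
    further subsequence.\<close>
  have "\<exists>r. strict_mono r \<and> (AE t in lm T. (\<lambda>n. \<integral>x. (g (r n) (x, t) - v (x, t))\<^sup>2 \<partial>lm 1) \<longlonglongrightarrow> 0)"
  proof (rule tendsto_L1_AE_subseq)
    show "integrable (lm T) (\<lambda>t. \<integral>x. (g n (x, t) - v (x, t))\<^sup>2 \<partial>lm 1)" for n by (rule mq_integral_iterated(3)[OF id])
    show "(\<lambda>n. \<integral>t. norm (\<integral>x. (g n (x, t) - v (x, t))\<^sup>2 \<partial>lm 1) \<partial>lm T) \<longlonglongrightarrow> 0"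
      using v(3) unfolding mq_integral_iterated(1)[OF id] by simp
  qed
  then obtain r :: "nat \<Rightarrow> nat" where r: "strict_mono r" "AE t in lm T. (\<lambda>n. \<integral>x. (g (r n) (x, t) - v (x, t))\<^sup>2 \<partial>lm 1) \<longlonglongrightarrow> 0"
    by (elim exE conjE) (rule that)
  have "AE t in lm T. integrable (lm 1) (\<lambda>x. (v (x, t))\<^sup>2)" by (rule mq_integral_iterated(5)[OF v(2)])
  with r(2) AE_good have "AE t in lm T. good t \<and> integrable (lm 1) (\<lambda>x. (v (x, t))\<^sup>2) \<and>
      (\<forall>x\<in>{0..1}. U s (x, t) = U s (0, t) + prim 1 (\<lambda>y. v (y, t)) x)"
  proof eventually_elim
    fix t assume l: "(\<lambda>n. \<integral>x. (g (r n) (x, t) - v (x, t))\<^sup>2 \<partial>lm 1) \<longlonglongrightarrow> 0" and gd: "good t"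
      and vi: "integrable (lm 1) (\<lambda>x. (v (x, t))\<^sup>2)"
    note t = goodD(1,2)[OF gd]
    \<comment> \<open>Every ball around the limit contains all \<open>uh j s (x,t)\<close> with
      large \<open>j\<close> and therefore also \<open>f n (x,t)\<close> for large
      \<open>n\<close>.\<close>
    have fl: "(\<lambda>n. f n (x, t)) \<longlonglongrightarrow> U s (x, t)" if x: "0 \<le> x" "x \<le> 1" for x
    proof (rule LIMSEQ_I)
      fix e :: real assume "0 < e"
      then obtain N where N: "\<forall>n\<ge>N. norm (uh n s (x, t) - U s (x, t)) < e / 2"
        using LIMSEQ_D[OF goodD(3)[OF gd x, of s], of "e / 2"] by auto
      have "norm (f n (x, t) - U s (x, t)) < e" if "N \<le> n" for n
      proof -
        have "\<forall>j\<ge>n. \<bar>uh j s (x, t) - U s (x, t)\<bar> \<le> e / 2" using N that by (auto simp: less_imp_le)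
        from f(2)[OF t x this] show ?thesis using \<open>0 < e\<close> by simp
      qed
      then show "\<exists>no. \<forall>n\<ge>no. norm (f n (x, t) - U s (x, t)) < e" by (intro exI[of _ N] allI impI)
    qed
    have rl: "filterlim r sequentially sequentially" using r(1) by (rule filterlim_subseq)
    have iv: "integrable (lm 1) (\<lambda>x. v (x, t))" by (rule sq_integrable_imp_integrable[OF finite_measure_lm]) (use vi in auto)
    have ig: "integrable (lm 1) (\<lambda>x. g n (x, t))" for n by (rule sq_integrable_imp_integrable[OF finite_measure_lm]) (use gs[OF t] in auto)
    have isq: "integrable (lm 1) (\<lambda>x. (g n (x, t) - v (x, t))\<^sup>2)" for n
      by (rule sq_integrable_diff) (use gs[OF t] vi in auto)
    have pl: "(\<lambda>n. prim 1 (\<lambda>y. g (r n) (y, t)) x) \<longlonglongrightarrow> prim 1 (\<lambda>y. v (y, t)) x" for x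
    proof (rule LIMSEQ_I)
      fix e :: real assume e: "0 < e"
      then obtain N where N: "\<forall>n\<ge>N. norm ((\<integral>x. (g (r n) (x, t) - v (x, t))\<^sup>2 \<partial>lm 1) - 0) < e * e"
        using LIMSEQ_D[OF l, of "e * e"] by auto
      have "norm (prim 1 (\<lambda>y. g (r n) (y, t)) x - prim 1 (\<lambda>y. v (y, t)) x) < e" if "N \<le> n" for n
      proof -
        let ?w = "\<lambda>y. g (r n) (y, t) - v (y, t)"
        have iw: "integrable (lm 1) ?w" using ig iv by simp
        have "\<bar>prim 1 ?w x\<bar> \<le> (\<integral>y. \<bar>?w y\<bar> \<partial>lm 1)" by (rule prim_le_integral[OF iw])
        also have "\<dots> \<le> (\<integral>y. (?w y)\<^sup>2 * (1 / (2 * e)) + e / 2 \<partial>lm 1)"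
        proof (rule integral_mono)
          show "integrable (lm 1) (\<lambda>y. \<bar>?w y\<bar>)" using iw by (rule integrable_abs)
          show "integrable (lm 1) (\<lambda>y. (?w y)\<^sup>2 * (1 / (2 * e)) + e / 2)" using isq by simp
          show "\<bar>?w y\<bar> \<le> (?w y)\<^sup>2 * (1 / (2 * e)) + e / 2" for y
            using young_sq[OF e, of "?w y" 1] e by (simp add: field_simps)
        qed
        also have "\<dots> = (\<integral>y. (?w y)\<^sup>2 \<partial>lm 1) * (1 / (2 * e)) + e / 2" using isq measure_lm[of 1] by simp
        also have "\<dots> < e * e * (1 / (2 * e)) + e / 2"
          using N that e by (intro add_strict_right_mono mult_strict_right_mono) auto
        also have "\<dots> = e" using e by simp
        finally show ?thesis using prim_diff[OF ig iv] by simp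
      qed
      then show "\<exists>no. \<forall>n\<ge>no. norm (prim 1 (\<lambda>y. g (r n) (y, t)) x - prim 1 (\<lambda>y. v (y, t)) x) < e" by (intro exI[of _ N] allI impI)
    qed
    have "U s (x, t) = U s (0, t) + prim 1 (\<lambda>y. v (y, t)) x" if x: "x \<in> {0..1}" for x
    proof (rule LIMSEQ_unique)
      have x: "0 \<le> x" "x \<le> 1" using x by auto
      show "(\<lambda>n. f (r n) (x, t)) \<longlonglongrightarrow> U s (x, t)" by (rule filterlim_compose[OF fl[OF x] rl])
      have "(\<lambda>n. f (r n) (0, t) + prim 1 (\<lambda>y. g (r n) (y, t)) x) \<longlonglongrightarrow> U s (0, t) + prim 1 (\<lambda>y. v (y, t)) x"
        by (intro tendsto_add pl filterlim_compose[OF fl rl]) auto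
      then show "(\<lambda>n. f (r n) (x, t)) \<longlonglongrightarrow> U s (0, t) + prim 1 (\<lambda>y. v (y, t)) x"
        using f(1)[OF t x] by simp
    qed
    then have "\<forall>x\<in>{0..1}. U s (x, t) = U s (0, t) + prim 1 (\<lambda>y. v (y, t)) x"
      by (rule ballI)
    then show "good t \<and> integrable (lm 1) (\<lambda>x. (v (x, t))\<^sup>2) \<and> (\<forall>x\<in>{0..1}. U s (x, t) = U s (0, t) + prim 1 (\<lambda>y. v (y, t)) x)"
      by (intro conjI gd vi)
  qed
  then show ?thesis by (intro exI[of _ v] conjI vm v(2))
qed

end

section \<open>Traces, weak derivatives and test functions\<close>

lemma integrable_mult_bounded:
  fixes f g :: "'a \<Rightarrow> real"
  assumes f: "integrable M f" and g: "g \<in> borel_measurable M" and B: "AE z in M. \<bar>g z\<bar> \<le> B"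
  shows "integrable M (\<lambda>z. f z * g z)" "integrable M (\<lambda>z. g z * f z)"
proof -
  have fm: "f \<in> borel_measurable M" using f by (rule borel_measurable_integrable)
  show i: "integrable M (\<lambda>z. f z * g z)"
  proof (rule Bochner_Integration.integrable_bound[of M "\<lambda>z. B * f z"])
    show "integrable M (\<lambda>z. B * f z)" using f by simp
    show "(\<lambda>z. f z * g z) \<in> borel_measurable M" using fm g by (rule borel_measurable_times)
    show "AE z in M. norm (f z * g z) \<le> norm (B * f z)"
      using B
    proof eventually_elim
      fix z assume b: "\<bar>g z\<bar> \<le> B"
      then have "\<bar>f z\<bar> * \<bar>g z\<bar> \<le> \<bar>f z\<bar> * \<bar>B\<bar>" by (intro mult_left_mono) auto
      then show "norm (f z * g z) \<le> norm (B * f z)" by (simp add: abs_mult mult.commute)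
    qed
  qed
  show "integrable M (\<lambda>z. g z * f z)" using i by (simp only: mult.commute)
qed

text \<open>Two continuous representatives agree almost everywhere, and the set where they agree is
  closed; it thus contains the open interval and its end points. This makes the definite description
  in \<open>trace01\<close> denote.\<close>

lemma trace01_eq:
  assumes g: "continuous_on {0..1} g" and fg: "AE x in lm 1. f x = g x" and p: "p \<in> {0..1}"
  shows "trace01 f p = g p"
  unfolding trace01_def
proof (rule the_equality)
  have "AE x in lebesgue. x \<in> {0<..<1} \<longrightarrow> g x = f x"
    using fg unfolding AE_lm_lebesgue by eventually_elim simp
  then show "\<exists>k. continuous_on {0..1} k \<and> (AE x in lebesgue. x \<in> {0<..<1} \<longrightarrow> k x = f x) \<and> k p = g p"
    using g by (intro exI[of _ g] conjI refl)
next
  fix c assume "\<exists>k. continuous_on {0..1} k \<and> (AE x in lebesgue. x \<in> {0<..<1} \<longrightarrow> k x = f x) \<and> k p = c"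
  then obtain k where k: "continuous_on {0..1} k" "AE x in lebesgue. x \<in> {0<..<1} \<longrightarrow> k x = f x" "k p = c"
    by (elim exE conjE) (rule that)
  let ?C = "{x \<in> {0..1}. k x - g x = 0}"
  have C: "closed ?C"
    by (intro continuous_closed_preimage_constant continuous_on_diff k g) simp
  have "{0<..<1} \<subseteq> ?C"
  proof
    fix x :: real assume x: "x \<in> {0<..<1}"
    show "x \<in> ?C"
    proof (rule mem_closed_if_AE_lebesgue_open[OF _ C _ x])
      show "AE x\<in>{0<..<1} in lebesgue. x \<in> ?C"
        using k(2) fg[unfolded AE_lm_lebesgue] by eventually_elim auto
    qed simp
  qed
  then have "closure {0<..<1} \<subseteq> ?C" using C by (rule closure_minimal)
  then show "c = g p" using p k(3) by auto
qed

lemma L2_on_lm: "f \<in> borel_measurable borel \<Longrightarrow> integrable (lm 1) (\<lambda>x. (f x)\<^sup>2) \<Longrightarrow> L2_on {0<..<1} f"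
  unfolding L2_on_def by (auto intro!: set_integral_AE_lm(2)[of f] set_integral_AE_lm(3)[of "\<lambda>x. (f x)\<^sup>2"])

lemma L2_on_mq:
  assumes [measurable]: "g \<in> borel_measurable borel" and ae: "AE z in mq S. f z = g z" and i: "integrable (mq S) (\<lambda>x. (g x)\<^sup>2)"
  shows "L2_on (QT S) f"
proof -
  have "AE z in mq S. (f z)\<^sup>2 = (g z)\<^sup>2" using ae by eventually_elim simp
  then show ?thesis unfolding L2_on_def
    by (intro conjI set_integral_AE_mq(2)[OF _ ae] set_integral_AE_mq(3)[OF _ _ i]) measurable
qed

text \<open>Entry from the Lebesgue setting of the definitions into the Borel setting of the
  proof.\<close>

lemma L2_on_Borel:
  assumes "L2_on (QT S) f"
  obtains g where "g \<in> borel_measurable borel" "AE z in mq S. f z = g z" "integrable (mq S) (\<lambda>x. (g x)\<^sup>2)"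
proof -
  have "(\<lambda>z. indicator (QT S) z *\<^sub>R f z) \<in> borel_measurable (completion lborel)"
    using assms unfolding L2_on_def set_borel_measurable_def by simp
  from completion_ex_borel_measurable_real[OF this]
  obtain g where g: "g \<in> borel_measurable lborel" "AE z in lborel. indicator (QT S) z *\<^sub>R f z = g z" by (elim bexE) (rule that)
  have gb [measurable]: "g \<in> borel_measurable borel" using g(1) by simp
  have ae: "AE z in mq S. f z = g z" unfolding AE_mq
    using g(2) by eventually_elim auto
  have "set_integrable lebesgue (QT S) (\<lambda>z. (f z)\<^sup>2) \<longleftrightarrow> set_integrable lebesgue (QT S) (\<lambda>z. (g z)\<^sup>2)"
    unfolding set_integrable_def
  proof (rule integrable_cong_AE)
    have m: "(\<lambda>z. indicator (QT S) z *\<^sub>R f z) \<in> borel_measurable lebesgue"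
      using assms unfolding L2_on_def set_borel_measurable_def by simp
    have e: "indicator (QT S) z *\<^sub>R (f z)\<^sup>2 = (indicator (QT S) z *\<^sub>R f z)\<^sup>2" for z
      by (auto simp: indicator_def)
    show "(\<lambda>z. indicator (QT S) z *\<^sub>R (f z)\<^sup>2) \<in> borel_measurable lebesgue"
      unfolding e by (rule borel_measurable_power[OF m])
    show "(\<lambda>z. indicator (QT S) z *\<^sub>R (g z)\<^sup>2) \<in> borel_measurable lebesgue"
      by (rule measurable_completion) measurable
    show "AE z in lebesgue. indicator (QT S) z *\<^sub>R (f z)\<^sup>2 = indicator (QT S) z *\<^sub>R (g z)\<^sup>2"
      using ae[unfolded AE_mq_lebesgue] by eventually_elim (auto simp: indicator_def)
  qed
  then have "integrable (mq S) (\<lambda>z. (g z)\<^sup>2)" using assms unfolding L2_on_def by (subst integral_mq(2)[symmetric]) auto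
  with that[OF gb ae] show thesis .
qed

lemma H1_deriv_prim:
  assumes [measurable]: "f \<in> borel_measurable borel" "g \<in> borel_measurable borel"
    and f2: "integrable (lm 1) (\<lambda>x. (f x)\<^sup>2)" and g2: "integrable (lm 1) (\<lambda>x. (g x)\<^sup>2)"
    and ae: "AE x in lm 1. f x = c + prim 1 g x"
  shows "H1_deriv f g"
  unfolding H1_deriv_def weak_deriv01_def
proof (intro conjI allI impI)
  show "L2_on {0<..<1} f" "L2_on {0<..<1} g" by (auto intro: L2_on_lm f2 g2)
  fix \<phi> assume "test_fun01 \<phi>"
  note P = test_fun01_props[OF this]
  have ig: "integrable (lm 1) g" by (rule sq_integrable_imp_integrable[OF finite_measure_lm _ g2]) simp
  have a: "AE x in lm 1. \<phi> x = 0 + prim 1 (deriv \<phi>) x" by (rule AE_lm_I) (use P(6) in auto)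
  have [measurable]: "deriv \<phi> \<in> borel_measurable borel" "\<phi> \<in> borel_measurable borel" by (rule P)+
  have "(\<integral>x. deriv \<phi> x * f x \<partial>lm 1) = - (\<integral>x. \<phi> x * g x \<partial>lm 1)"
    using ibp(1)[OF P(7) ig a ae] by (simp add: P(9))
  then show "(LINT x:{0<..<1}|lebesgue. f x * deriv \<phi> x) = - (LINT x:{0<..<1}|lebesgue. g x * \<phi> x)"
    by (simp add: integral_lm mult.commute)
qed

lemma L2H1_deriv_prim:
  assumes [measurable]: "u \<in> borel_measurable borel" "v \<in> borel_measurable borel"
    and u2: "integrable (mq S) (\<lambda>z. (u z)\<^sup>2)" and v2: "integrable (mq S) (\<lambda>z. (v z)\<^sup>2)"
    and ae: "AE t in lm S. AE x in lm 1. u (x, t) = c t + prim 1 (\<lambda>y. v (y, t)) x"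
  shows "L2H1_deriv S u v"
proof -
  have "AE t in lm S. H1_deriv (\<lambda>x. u (x, t)) (\<lambda>x. v (x, t))"
    using ae mq_integral_iterated(5)[OF u2] mq_integral_iterated(5)[OF v2]
  proof eventually_elim
    fix t assume h: "AE x in lm 1. u (x, t) = c t + prim 1 (\<lambda>y. v (y, t)) x"
      "integrable (lm 1) (\<lambda>x. (u (x, t))\<^sup>2)" "integrable (lm 1) (\<lambda>x. (v (x, t))\<^sup>2)"
    show "H1_deriv (\<lambda>x. u (x, t)) (\<lambda>x. v (x, t))"
      by (rule H1_deriv_prim[OF slice_borel(1) slice_borel(1) h(2,3,1)]) measurable
  qed
  then show ?thesis unfolding L2H1_deriv_def AE_lm_lebesgue
    by (intro conjI L2_on_mq[of u] L2_on_mq[of v] u2 v2) auto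
qed

text \<open>The Poisson equation has to hold for every test function in \<open>L2H1\<close>, given
  only through weak derivatives. \<open>du_Bois_Reymond\<close> on almost every time slice makes it
  absolutely continuous up to null sets and gives access to its traces.\<close>

lemma L2H1_derivE:
  assumes "L2H1_deriv S u u'"
  obtains w w' c where "w \<in> borel_measurable borel" "w' \<in> borel_measurable borel"
    "AE z in mq S. u z = w z" "AE z in mq S. u' z = w' z"
    "integrable (mq S) (\<lambda>z. (w z)\<^sup>2)" "integrable (mq S) (\<lambda>z. (w' z)\<^sup>2)"
    "c \<in> borel_measurable borel" "integrable (lm S) c"
    "AE t in lm S. (AE x in lm 1. w (x, t) = c t + prim 1 (\<lambda>y. w' (y, t)) x) \<and>
      integrable (lm 1) (\<lambda>x. w (x, t)) \<and> integrable (lm 1) (\<lambda>x. w' (x, t)) \<and>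
      tr u 0 t = c t \<and> tr u 1 t = c t + (\<integral>x. w' (x, t) \<partial>lm 1)"
proof -
  note D = assms[unfolded L2H1_deriv_def]
  obtain w where w: "w \<in> borel_measurable borel" "AE z in mq S. u z = w z" "integrable (mq S) (\<lambda>x. (w x)\<^sup>2)"
    by (rule L2_on_Borel[OF D[THEN conjunct1]])
  obtain w' where w': "w' \<in> borel_measurable borel" "AE z in mq S. u' z = w' z" "integrable (mq S) (\<lambda>x. (w' x)\<^sup>2)"
    by (rule L2_on_Borel[OF D[THEN conjunct2, THEN conjunct1]])
  note [measurable] = w(1) w'(1)
  have [measurable]: "(\<lambda>x. w (x, t)) \<in> borel_measurable borel" "(\<lambda>x. w' (x, t)) \<in> borel_measurable borel" for t
    by (rule slice_borel(1), fact)+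
  \<comment> \<open>\<open>du_Bois_Reymond\<close> yields a constant for each slice with no control
    in \<open>t\<close>. Written as the mean of \<open>w\<close> minus the primitive of
    \<open>w'\<close>, it is measurable and, by Fubini, integrable.\<close>
  define c where "c t = (\<integral>x. w (x, t) - prim 1 (\<lambda>y. w' (y, t)) x \<partial>lm 1)" for t
  have cb [measurable]: "c \<in> borel_measurable borel"
  proof -
    have "(\<lambda>z. prim 1 (\<lambda>y. w' (y, snd z)) (fst z)) \<in> borel_measurable borel" by (rule prim_borel2) measurable
    then have m: "(\<lambda>z. w z - prim 1 (\<lambda>y. w' (y, snd z)) (fst z)) \<in> borel_measurable borel" by measurable
    have "c t = prim 1 (\<lambda>x. w (x, t) - prim 1 (\<lambda>y. w' (y, t)) x) 1" for t
      unfolding c_def by (subst prim_end) measurable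
    then show ?thesis using slice_borel(2)[OF prim_borel2(1)[OF m], of 1] by (simp cong: measurable_cong)
  qed
  have iw: "integrable (mq S) w" "integrable (mq S) w'"
    by (rule sq_integrable_imp_integrable[OF finite_measure_mq _ w(3)], simp add: w,
        rule sq_integrable_imp_integrable[OF finite_measure_mq _ w'(3)], simp add: w')
  have sl: "AE t in lm S. integrable (lm 1) (\<lambda>x. w (x, t))" "AE t in lm S. integrable (lm 1) (\<lambda>x. w' (x, t))"
    by (rule mq_integral_iterated(5)[OF iw(1)]) (rule mq_integral_iterated(5)[OF iw(2)])
  have ci: "integrable (lm S) c"
  proof (rule Bochner_Integration.integrable_bound)
    show "integrable (lm S) (\<lambda>t. (\<integral>x. \<bar>w (x, t)\<bar> \<partial>lm 1) + (\<integral>x. \<bar>w' (x, t)\<bar> \<partial>lm 1))"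
      by (intro Bochner_Integration.integrable_add mq_integral_iterated(3) integrable_abs iw)
    show "AE t in lm S. norm (c t) \<le> norm ((\<integral>x. \<bar>w (x, t)\<bar> \<partial>lm 1) + (\<integral>x. \<bar>w' (x, t)\<bar> \<partial>lm 1))"
      using sl
    proof eventually_elim
      fix t assume i: "integrable (lm 1) (\<lambda>x. w (x, t))" "integrable (lm 1) (\<lambda>x. w' (x, t))"
      let ?I = "\<integral>x. \<bar>w (x, t)\<bar> \<partial>lm 1" and ?J = "\<integral>x. \<bar>w' (x, t)\<bar> \<partial>lm 1"
      have pb: "\<bar>prim 1 (\<lambda>y. w' (y, t)) x\<bar> \<le> ?J" for x by (rule prim_le_integral[OF i(2)])
      have ip: "integrable (lm 1) (prim 1 (\<lambda>y. w' (y, t)))"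
        by (rule integrable_bounded_finite[OF finite_measure_lm, where B="?J"]) (simp, rule AE_I2, rule pb)
      have "c t = (\<integral>x. w (x, t) \<partial>lm 1) - (\<integral>x. prim 1 (\<lambda>y. w' (y, t)) x \<partial>lm 1)"
        unfolding c_def by (rule Bochner_Integration.integral_diff[OF i(1) ip])
      moreover have "\<bar>\<integral>x. w (x, t) \<partial>lm 1\<bar> \<le> ?I" by (rule integral_abs_bound)
      moreover have "\<bar>\<integral>x. prim 1 (\<lambda>y. w' (y, t)) x \<partial>lm 1\<bar> \<le> ?J"
      proof -
        have "\<bar>\<integral>x. prim 1 (\<lambda>y. w' (y, t)) x \<partial>lm 1\<bar> \<le> (\<integral>x. \<bar>prim 1 (\<lambda>y. w' (y, t)) x\<bar> \<partial>lm 1)" by (rule integral_abs_bound)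
        also have "\<dots> \<le> (\<integral>x. ?J \<partial>lm 1)" by (rule integral_mono[OF integrable_abs[OF ip]]) (simp, rule pb)
        also have "\<dots> = ?J" using measure_lm[of 1] by simp
        finally show ?thesis .
      qed
      ultimately have "\<bar>c t\<bar> \<le> ?I + ?J" by (simp only: abs_diff_le_iff) (linarith)
      then show "norm (c t) \<le> norm (?I + ?J)" unfolding real_norm_def by (rule order_trans[OF _ abs_ge_self])
    qed
  qed simp
  have H: "AE t in lm S. H1_deriv (\<lambda>x. u (x, t)) (\<lambda>x. u' (x, t))"
    unfolding AE_lm_lebesgue by (rule D[THEN conjunct2, THEN conjunct2])
  have "AE t in lm S. (AE x in lm 1. w (x, t) = c t + prim 1 (\<lambda>y. w' (y, t)) x) \<and>
      integrable (lm 1) (\<lambda>x. w (x, t)) \<and> integrable (lm 1) (\<lambda>x. w' (x, t)) \<and>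
      tr u 0 t = c t \<and> tr u 1 t = c t + (\<integral>x. w' (x, t) \<partial>lm 1)"
    using H sl AE_mq_slice[OF w(2)] AE_mq_slice[OF w'(2)]
  proof eventually_elim
    fix t assume h: "H1_deriv (\<lambda>x. u (x, t)) (\<lambda>x. u' (x, t))" and i: "integrable (lm 1) (\<lambda>x. w (x, t))" "integrable (lm 1) (\<lambda>x. w' (x, t))"
      and e: "AE x in lm 1. u (x, t) = w (x, t)" "AE x in lm 1. u' (x, t) = w' (x, t)"
    have "\<exists>c. AE x in lm 1. w (x, t) = c + prim 1 (\<lambda>y. w' (y, t)) x"
    proof (rule du_Bois_Reymond[OF i])
      fix \<phi> assume p: "test_fun01 \<phi>"
      note [measurable] = test_fun01_props(1,8)[OF p]
      have a: "AE x in lm 1. u (x, t) * deriv \<phi> x = w (x, t) * deriv \<phi> x" using e(1) by eventually_elim simp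
      have b: "AE x in lm 1. u' (x, t) * \<phi> x = w' (x, t) * \<phi> x" using e(2) by eventually_elim simp
      have "(LINT x:{0<..<1}|lebesgue. u (x, t) * deriv \<phi> x) = - (LINT x:{0<..<1}|lebesgue. u' (x, t) * \<phi> x)"
        using h p unfolding H1_deriv_def weak_deriv01_def by simp
      then show "(\<integral>x. w (x, t) * deriv \<phi> x \<partial>lm 1) = - (\<integral>x. w' (x, t) * \<phi> x \<partial>lm 1)"
        by (subst (asm) set_integral_AE_lm(1)[OF _ a], measurable) (subst (asm) set_integral_AE_lm(1)[OF _ b], measurable)
    qed
    then obtain k where k: "AE x in lm 1. w (x, t) = k + prim 1 (\<lambda>y. w' (y, t)) x" ..
    have "c t = (\<integral>x. k \<partial>lm 1)" unfolding c_def
    proof (rule integral_cong_AE)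
      show "AE x in lm 1. w (x, t) - prim 1 (\<lambda>y. w' (y, t)) x = k" using k by eventually_elim simp
    qed measurable
    then have ck: "c t = k" using measure_lm[of 1] by simp
    have ae: "AE x in lm 1. u (x, t) = c t + prim 1 (\<lambda>y. w' (y, t)) x" using e(1) k unfolding ck by eventually_elim simp
    have co: "continuous_on {0..1} (\<lambda>x. c t + prim 1 (\<lambda>y. w' (y, t)) x)"
      by (intro continuous_intros continuous_on_subset[OF prim_continuous[OF i(2)]]) simp
    have "tr u 0 t = c t" using trace01_eq[OF co ae, of 0] by (simp add: prim_0)
    moreover have "tr u 1 t = c t + (\<integral>x. w' (x, t) \<partial>lm 1)" using trace01_eq[OF co ae, of 1] by (simp add: prim_end)
    ultimately show "(AE x in lm 1. w (x, t) = c t + prim 1 (\<lambda>y. w' (y, t)) x) \<and>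
      integrable (lm 1) (\<lambda>x. w (x, t)) \<and> integrable (lm 1) (\<lambda>x. w' (x, t)) \<and>
      tr u 0 t = c t \<and> tr u 1 t = c t + (\<integral>x. w' (x, t) \<partial>lm 1)"
      using k unfolding ck by (intro conjI i)
  qed
  then show thesis by (rule that[OF w(1) w'(1) w(2) w'(2) w(3) w'(3) cb ci])
qed

section \<open>Smooth test functions on the cylinder\<close>

lemma smooth_fun_partial: "smooth_fun f \<Longrightarrow> b \<in> Basis \<Longrightarrow> smooth_fun (\<lambda>z. frechet_derivative f (at z) b)"
  unfolding smooth_fun_def
proof (rule allI)
  fix k assume "\<forall>k. Ck k f" and b: "b \<in> Basis"
  then have "Ck (Suc k) f" by (rule_tac spec)
  then show "Ck k (\<lambda>z. frechet_derivative f (at z) b)" using b by simp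
qed

lemma smooth_fun_partial_derivative:
  fixes f :: "real \<times> real \<Rightarrow> real"
  assumes "smooth_fun f"
  shows "((\<lambda>x. f (x, t)) has_real_derivative frechet_derivative f (at (x, t)) (1, 0)) (at x)"
    "((\<lambda>t. f (x, t)) has_real_derivative frechet_derivative f (at (x, t)) (0, 1)) (at t)"
proof -
  have "Ck (Suc 0) f" using assms unfolding smooth_fun_def by (rule spec)
  then have "f differentiable (at (x, t))" by simp
  then have D: "(f has_derivative frechet_derivative f (at (x, t))) (at (x, t))" by (simp add: frechet_derivative_works)
  note lin = has_derivative_linear[OF D]
  have "((\<lambda>x. f (x, t)) has_derivative (\<lambda>h. frechet_derivative f (at (x, t)) (h, 0))) (at x)"
    by (rule has_derivative_compose[of "\<lambda>x. (x, t)" "\<lambda>h. (h, 0)" x UNIV f, OF _ D]) (auto intro!: derivative_eq_intros)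
  moreover have "(\<lambda>h. frechet_derivative f (at (x, t)) (h, 0)) = (*) (frechet_derivative f (at (x, t)) (1, 0))"
  proof
    fix h
    have "frechet_derivative f (at (x, t)) (h *\<^sub>R (1, 0)) = h *\<^sub>R frechet_derivative f (at (x, t)) (1, 0)" by (rule linear_cmul[OF lin])
    then show "frechet_derivative f (at (x, t)) (h, 0) = frechet_derivative f (at (x, t)) (1, 0) * h" by (simp add: mult.commute)
  qed
  ultimately show "((\<lambda>x. f (x, t)) has_real_derivative frechet_derivative f (at (x, t)) (1, 0)) (at x)"
    by (simp add: has_field_derivative_def)
  have "((\<lambda>t. f (x, t)) has_derivative (\<lambda>h. frechet_derivative f (at (x, t)) (0, h))) (at t)"
    by (rule has_derivative_compose[of "\<lambda>t. (x, t)" "\<lambda>h. (0, h)" t UNIV f, OF _ D]) (auto intro!: derivative_eq_intros)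
  moreover have "(\<lambda>h. frechet_derivative f (at (x, t)) (0, h)) = (*) (frechet_derivative f (at (x, t)) (0, 1))"
  proof
    fix h
    have "frechet_derivative f (at (x, t)) (h *\<^sub>R (0, 1)) = h *\<^sub>R frechet_derivative f (at (x, t)) (0, 1)" by (rule linear_cmul[OF lin])
    then show "frechet_derivative f (at (x, t)) (0, h) = frechet_derivative f (at (x, t)) (0, 1) * h" by (simp add: mult.commute)
  qed
  ultimately show "((\<lambda>t. f (x, t)) has_real_derivative frechet_derivative f (at (x, t)) (0, 1)) (at t)"
    by (simp add: has_field_derivative_def)
qed

lemma smooth_fun_prim:
  fixes f :: "real \<times> real \<Rightarrow> real"
  assumes sm: "smooth_fun f"
  shows "0 \<le> x \<Longrightarrow> x \<le> S \<Longrightarrow> f (x, t) = f (0, t) + prim S (\<lambda>y. frechet_derivative f (at (y, t)) (1, 0)) x"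
    "0 \<le> t \<Longrightarrow> t \<le> S \<Longrightarrow> f (x, t) = f (x, 0) + prim S (\<lambda>\<tau>. frechet_derivative f (at (x, \<tau>)) (0, 1)) t"
proof -
  have s1: "smooth_fun (\<lambda>z. frechet_derivative f (at z) (1, 0))" and s2: "smooth_fun (\<lambda>z. frechet_derivative f (at z) (0, 1))"
    by (auto intro!: smooth_fun_partial[OF sm] simp: Basis_prod_def)
  have c1: "continuous_on UNIV (\<lambda>y. frechet_derivative f (at (y, t)) (1, 0))"
    by (rule continuous_on_compose2[OF smooth_continuous[OF s1]]) (auto intro!: continuous_intros)
  have c2: "continuous_on UNIV (\<lambda>\<tau>. frechet_derivative f (at (x, \<tau>)) (0, 1))"
    by (rule continuous_on_compose2[OF smooth_continuous[OF s2]]) (auto intro!: continuous_intros)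
  show "f (x, t) = f (0, t) + prim S (\<lambda>y. frechet_derivative f (at (y, t)) (1, 0)) x" if "0 \<le> x" "x \<le> S"
    by (rule prim_FTC[of _ S "\<lambda>x. f (x, t)"]) (use that c1 continuous_on_subset[OF c1] smooth_fun_partial_derivative(1)[OF sm] in \<open>auto intro: borel_measurable_continuous_onI\<close>)
  show "f (x, t) = f (x, 0) + prim S (\<lambda>\<tau>. frechet_derivative f (at (x, \<tau>)) (0, 1)) t" if "0 \<le> t" "t \<le> S"
    by (rule prim_FTC[of _ S "\<lambda>t. f (x, t)"]) (use that c2 continuous_on_subset[OF c2] smooth_fun_partial_derivative(2)[OF sm] in \<open>auto intro: borel_measurable_continuous_onI\<close>)
qed

lemma smooth_fun_bounded:
  fixes f :: "real \<times> real \<Rightarrow> real"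
  assumes "smooth_fun f"
  obtains B where "\<And>x t. 0 \<le> x \<Longrightarrow> x \<le> 1 \<Longrightarrow> 0 \<le> t \<Longrightarrow> t \<le> S \<Longrightarrow> \<bar>f (x, t)\<bar> \<le> B"
proof -
  have "compact (f ` ({0..1} \<times> {0..S}))"
    by (intro compact_continuous_image continuous_on_subset[OF smooth_continuous[OF assms]] compact_Times compact_Icc) simp
  then obtain B where "\<forall>z\<in>f ` ({0..1} \<times> {0..S}). norm z \<le> B" using compact_imp_bounded bounded_iff by metis
  then show thesis by (intro that[of B]) auto
qed

text \<open>The support condition concerns times below \<open>S\<close> only. If
  \<open>\<phi>\<close> were nonzero at the final time, points approaching from below would lie in
  the support, whose closure would then reach time \<open>S\<close>.\<close>

lemma test_fun_QT_end:
  assumes p: "test_fun_QT S \<phi>" and S: "0 < S" and x: "0 \<le> x" "x \<le> 1"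
  shows "\<phi> (x, S) = 0"
proof (rule ccontr)
  assume n: "\<phi> (x, S) \<noteq> 0"
  let ?S = "closure {z \<in> {0..1} \<times> {0..<S}. \<phi> z \<noteq> 0}"
  have sm: "smooth_fun \<phi>" and sub: "?S \<subseteq> {0..1} \<times> {0..<S}" using p unfolding test_fun_QT_def Let_def by auto
  define y where "y n = (x, S - S * inverse (real (Suc n)))" for n
  have yl: "y \<longlonglongrightarrow> (x, S - S * 0)" unfolding y_def
    by (intro tendsto_Pair tendsto_diff tendsto_mult tendsto_const LIMSEQ_inverse_real_of_nat)
  then have "(\<lambda>n. \<phi> (y n)) \<longlonglongrightarrow> \<phi> (x, S - S * 0)"
    using smooth_continuous[OF sm] by (auto simp: continuous_on_eq_continuous_at intro: isCont_tendsto_compose)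
  then have "\<forall>\<^sub>F n in sequentially. \<phi> (y n) \<noteq> 0" using n by (intro tendsto_imp_eventually_ne) auto
  moreover have "y n \<in> {0..1} \<times> {0..<S}" for n
  proof -
    have "S * inverse (real (Suc n)) \<le> S * 1" using S by (intro mult_left_mono) (auto simp: inverse_le_1_iff)
    moreover have "0 < S * inverse (real (Suc n))" using S by simp
    ultimately show ?thesis using x by (simp add: y_def)
  qed
  ultimately have "\<forall>\<^sub>F n in sequentially. y n \<in> ?S"
    by (auto elim!: eventually_mono intro!: closure_subset[THEN subsetD])
  then have "(x, S - S * 0) \<in> ?S" using yl by (intro Lim_in_closed_set[of ?S y sequentially]) auto
  then show False using sub by auto
qed

section \<open>The limit equations\<close>

lemma AE_mq_swap:
  assumes m: "{z. P (fst z) (snd z)} \<in> sets borel" and ae: "AE t in lm T. AE x in lm S. P x t"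
  shows "AE x in lm S. AE t in lm T. P x t"
proof -
  have "AE t in lm T. AE x in lm S. P (fst (x, t)) (snd (x, t))" using ae by simp
  from lmp.AE_pair[OF AE_mq_I[OF m this]] show ?thesis by simp
qed

lemma AE_mq_le:
  fixes f :: "real \<times> real \<Rightarrow> real"
  assumes [measurable]: "f \<in> borel_measurable borel" and ae: "AE t in lm S. AE x in lm 1. \<bar>f (x, t)\<bar> \<le> B"
  shows "AE z in mq S. \<bar>f z\<bar> \<le> B"
proof (rule AE_mq_I[OF _ ae])
  have "{z \<in> space borel. \<bar>f z\<bar> \<le> B} \<in> sets borel" by measurable
  then show "{z. \<bar>f z\<bar> \<le> B} \<in> sets borel" by simp
qed

lemma mq_integrable_trunc:
  assumes f: "integrable (lm S \<Otimes>\<^sub>M lm T) (f :: real \<times> real \<Rightarrow> real)"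
  shows "integrable (lm S \<Otimes>\<^sub>M lm T) (\<lambda>z. indicator {..x} (fst z) * (indicator {..t} (snd z) * f z))"
    "integrable (lm S \<Otimes>\<^sub>M lm T) (\<lambda>z. indicator {..t} (snd z) * f z)"
proof -
  have m: "fst \<in> borel_measurable (borel :: (real \<times> real) measure)" "snd \<in> borel_measurable (borel :: (real \<times> real) measure)"
    by (simp_all add: borel_prod[symmetric])
  note [measurable] = m
  show i: "integrable (lm S \<Otimes>\<^sub>M lm T) (\<lambda>z. indicator {..t} (snd z) * f z)"
    by (rule integrable_mult_bounded(2)[OF f, where B=1]) (simp, auto simp: indicator_def)
  show "integrable (lm S \<Otimes>\<^sub>M lm T) (\<lambda>z. indicator {..x} (fst z) * (indicator {..t} (snd z) * f z))"
    by (rule integrable_mult_bounded(2)[OF i, where B=1]) (simp, auto simp: indicator_def)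
qed

lemma prim_swap:
  assumes f: "integrable (lm S \<Otimes>\<^sub>M lm T) (f :: real \<times> real \<Rightarrow> real)"
  shows "prim T (\<lambda>\<tau>. prim S (\<lambda>y. f (y, \<tau>)) x) t = prim S (\<lambda>y. prim T (\<lambda>\<tau>. f (y, \<tau>)) t) x"
    "integrable (lm S) (\<lambda>y. prim T (\<lambda>\<tau>. f (y, \<tau>)) t)"
proof -
  note M = mq_integral_iterated[OF mq_integrable_trunc(1)[OF f, of x t]]
  have "prim T (\<lambda>\<tau>. prim S (\<lambda>y. f (y, \<tau>)) x) t = (\<integral>\<tau>. \<integral>y. indicator {..x} y * (indicator {..t} \<tau> * f (y, \<tau>)) \<partial>lm S \<partial>lm T)"
    unfolding prim_def by (subst integral_mult_right_zero[symmetric]) (simp only: mult.left_commute)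
  also have "\<dots> = (\<integral>y. \<integral>\<tau>. indicator {..x} y * (indicator {..t} \<tau> * f (y, \<tau>)) \<partial>lm T \<partial>lm S)"
    using M(1,2) by (simp only: fst_conv snd_conv)
  also have "\<dots> = prim S (\<lambda>y. prim T (\<lambda>\<tau>. f (y, \<tau>)) t) x"
    unfolding prim_def by (subst integral_mult_right_zero) (rule refl)
  finally show "prim T (\<lambda>\<tau>. prim S (\<lambda>y. f (y, \<tau>)) x) t = prim S (\<lambda>y. prim T (\<lambda>\<tau>. f (y, \<tau>)) t) x" .
  show "integrable (lm S) (\<lambda>y. prim T (\<lambda>\<tau>. f (y, \<tau>)) t)"
    using mq_integral_iterated(4)[OF mq_integrable_trunc(2)[OF f, of t]] unfolding prim_def by (simp only: snd_conv)
qed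

lemma smooth_fun_integrable:
  fixes f :: "real \<times> real \<Rightarrow> real"
  assumes sm: "smooth_fun f"
  shows "integrable (mq S) f" "0 \<le> t \<Longrightarrow> integrable (lm 1) (\<lambda>x. f (x, t))" "0 \<le> x \<Longrightarrow> x \<le> 1 \<Longrightarrow> integrable (lm S) (\<lambda>t. f (x, t))"
proof -
  note [measurable] = smooth_borel[OF sm] slice_borel[OF smooth_borel[OF sm]]
  obtain B where B: "\<And>x t. 0 \<le> x \<Longrightarrow> x \<le> 1 \<Longrightarrow> 0 \<le> t \<Longrightarrow> t \<le> S \<Longrightarrow> \<bar>f (x, t)\<bar> \<le> B" by (rule smooth_fun_bounded[OF sm, where S=S]) (rule that)
  show "integrable (mq S) f"
    by (rule integrable_bounded_finite[OF finite_measure_mq, where B=B]) (auto simp: AE_mq QT_def intro!: B AE_I2)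
  show "integrable (lm S) (\<lambda>t. f (x, t))" if "0 \<le> x" "x \<le> 1"
    by (rule integrable_bounded_finite[OF finite_measure_lm, where B=B]) (use that in \<open>auto intro!: AE_lm_I B\<close>)
  show "integrable (lm 1) (\<lambda>x. f (x, t))" if t: "0 \<le> t"
  proof -
    obtain B where B: "\<And>x \<tau>. 0 \<le> x \<Longrightarrow> x \<le> 1 \<Longrightarrow> 0 \<le> \<tau> \<Longrightarrow> \<tau> \<le> t \<Longrightarrow> \<bar>f (x, \<tau>)\<bar> \<le> B" by (rule smooth_fun_bounded[OF sm, where S=t]) (rule that)
    show ?thesis by (rule integrable_bounded_finite[OF finite_measure_lm, where B=B]) (use t in \<open>auto intro!: AE_lm_I B\<close>)
  qed
qed

text \<open>An integrated form of Schwarz's theorem: mixed partial derivatives never have to be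
  exchanged pointwise.\<close>

lemma test_fun_QT_mixed:
  fixes \<phi> :: "real \<times> real \<Rightarrow> real"
  assumes p: "test_fun_QT S \<phi>" and S: "0 < S"
  defines "fx \<equiv> \<lambda>z. frechet_derivative \<phi> (at z) (1, 0)" and "ft \<equiv> \<lambda>z. frechet_derivative \<phi> (at z) (0, 1)"
  defines "ftx \<equiv> \<lambda>z. frechet_derivative ft (at z) (1, 0)"
  shows "smooth_fun \<phi>" "smooth_fun fx" "smooth_fun ft" "smooth_fun ftx"
    "AE y in lm 1. (AE t in lm S. fx (y, t) = fx (y, 0) + prim S (\<lambda>t. ftx (y, t)) t)"
    "AE y in lm 1. fx (y, 0) + integral\<^sup>L (lm S) (\<lambda>t. ftx (y, t)) = 0"
proof -
  have B: "(1, 0) \<in> (Basis :: (real \<times> real) set)" "(0, 1) \<in> (Basis :: (real \<times> real) set)" by (auto simp: Basis_prod_def)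
  show sm: "smooth_fun \<phi>" using p unfolding test_fun_QT_def by simp
  show sx: "smooth_fun fx" and st: "smooth_fun ft" unfolding fx_def ft_def by (rule smooth_fun_partial[OF sm B(1)]) (rule smooth_fun_partial[OF sm B(2)])
  show stx: "smooth_fun ftx" unfolding ftx_def by (rule smooth_fun_partial[OF st B(1)])
  have fold: "frechet_derivative \<phi> (at z) (1, 0) = fx z" "frechet_derivative \<phi> (at z) (0, 1) = ft z" "frechet_derivative ft (at z) (1, 0) = ftx z" for z
    by (simp_all only: fx_def ft_def ftx_def)
  note px = smooth_fun_prim(1)[OF sm, unfolded fold(1)] and pt = smooth_fun_prim(2)[OF sm, unfolded fold(2)]
    and ptx = smooth_fun_prim(1)[OF st, unfolded fold(3)]
  note itx = smooth_fun_integrable(1)[OF stx, of S] and ix = smooth_fun_integrable(2)[OF sx] and it = smooth_fun_integrable(3)[OF st, of _ S]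
  note [measurable] = slice_borel[OF smooth_borel[OF stx]] slice_borel[OF smooth_borel[OF st]] smooth_borel[OF sx] smooth_borel[OF stx]
  \<comment> \<open>Integrated over \<open>[0,x]\<close>, both expressions give the increment of
    \<open>\<phi>\<close> over the rectangle \<open>[0,x] x [0,t]\<close>; a function with vanishing
    primitive is 0 almost everywhere.\<close>
  have key: "AE y in lm 1. fx (y, t) - fx (y, 0) - prim S (\<lambda>t. ftx (y, t)) t = 0" if t: "0 \<le> t" "t \<le> S" for t
  proof (rule prim_zero_imp_AE_zero)
    have i1: "integrable (lm 1) (\<lambda>y. fx (y, t) - fx (y, 0))" by (intro Bochner_Integration.integrable_diff ix t order_refl)
    show "integrable (lm 1) (\<lambda>y. fx (y, t) - fx (y, 0) - prim S (\<lambda>t. ftx (y, t)) t)"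
      by (intro Bochner_Integration.integrable_diff[OF i1] prim_swap(2) itx)
    fix x :: real assume x: "0 < x" "x \<le> 1"
    have "prim 1 (\<lambda>y. fx (y, t) - fx (y, 0) - prim S (\<lambda>t. ftx (y, t)) t) x
      = prim 1 (\<lambda>y. fx (y, t) - fx (y, 0)) x - prim 1 (\<lambda>y. prim S (\<lambda>t. ftx (y, t)) t) x"
      by (rule prim_diff[OF i1 prim_swap(2)[OF itx]])
    also have "prim 1 (\<lambda>y. fx (y, t) - fx (y, 0)) x = prim 1 (\<lambda>y. fx (y, t)) x - prim 1 (\<lambda>y. fx (y, 0)) x"
      by (rule prim_diff) (intro ix t order_refl)+
    also have "prim 1 (\<lambda>y. prim S (\<lambda>t. ftx (y, t)) t) x = prim S (\<lambda>\<tau>. prim 1 (\<lambda>y. ftx (y, \<tau>)) x) t"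
      by (rule prim_swap(1)[OF itx, symmetric])
    also have "(\<lambda>\<tau>. prim 1 (\<lambda>y. ftx (y, \<tau>)) x) = (\<lambda>\<tau>. ft (x, \<tau>) - ft (0, \<tau>))"
    proof
      fix \<tau> show "prim 1 (\<lambda>y. ftx (y, \<tau>)) x = ft (x, \<tau>) - ft (0, \<tau>)" using ptx[of x 1 \<tau>] x by simp
    qed
    also have "prim S (\<lambda>\<tau>. ft (x, \<tau>) - ft (0, \<tau>)) t = prim S (\<lambda>\<tau>. ft (x, \<tau>)) t - prim S (\<lambda>\<tau>. ft (0, \<tau>)) t"
      by (rule prim_diff) (use it x in auto)
    finally show "prim 1 (\<lambda>y. fx (y, t) - fx (y, 0) - prim S (\<lambda>t. ftx (y, t)) t) x = 0"
      using px[of x 1 t] px[of x 1 0] pt[of t S x] pt[of t S 0] x t by linarith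
  qed
  show "AE y in lm 1. (AE t in lm S. fx (y, t) = fx (y, 0) + prim S (\<lambda>t. ftx (y, t)) t)"
  proof (rule AE_mq_swap)
    have "AE y in lm 1. fx (y, t) = fx (y, 0) + prim S (\<lambda>t. ftx (y, t)) t" if "0 \<le> t" "t \<le> S" for t
      using key[OF that] by eventually_elim simp
    then show "AE t in lm S. AE y in lm 1. fx (y, t) = fx (y, 0) + prim S (\<lambda>t. ftx (y, t)) t"
      by - (rule AE_lm_I, simp)
    have [measurable]: "(\<lambda>z. prim S (\<lambda>t. ftx (fst z, t)) (snd z)) \<in> borel_measurable borel" by (rule prim_borel2) measurable
    have [measurable]: "fst \<in> borel_measurable (borel :: (real \<times> real) measure)" by (simp add: borel_prod[symmetric])
    have [measurable]: "(\<lambda>z :: real \<times> real. fx (fst z, 0)) \<in> borel_measurable borel"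
      by (rule measurable_compose[OF \<open>fst \<in> borel_measurable borel\<close> slice_borel(1)]) measurable
    have "{z \<in> space borel. fx z = fx (fst z, 0) + prim S (\<lambda>t. ftx (fst z, t)) (snd z)} \<in> sets borel" by measurable
    then show "{z. fx (fst z, snd z) = fx (fst z, 0) + prim S (\<lambda>t. ftx (fst z, t)) (snd z)} \<in> sets borel" by simp
  qed
  \<comment> \<open>\<open>\<phi>\<close> vanishes at time \<open>S\<close> for every
    \<open>x\<close>, hence so does the primitive of its space derivative.\<close>
  have "AE y in lm 1. fx (y, S) = 0"
  proof (rule prim_zero_imp_AE_zero)
    show "integrable (lm 1) (\<lambda>y. fx (y, S))" using ix S by simp
    fix x :: real assume x: "0 < x" "x \<le> 1"
    show "prim 1 (\<lambda>y. fx (y, S)) x = 0" using px[of x 1 S] x test_fun_QT_end[OF p S, of x] test_fun_QT_end[OF p S, of 0] by simp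
  qed
  then show "AE y in lm 1. fx (y, 0) + integral\<^sup>L (lm S) (\<lambda>t. ftx (y, t)) = 0"
    using key[of S]
  proof -
    assume a: "AE y in lm 1. fx (y, S) = 0"
    have b: "AE y in lm 1. fx (y, S) - fx (y, 0) - prim S (\<lambda>t. ftx (y, t)) S = 0" using S by (intro key) auto
    from a b show ?thesis
    proof eventually_elim
      fix y assume "fx (y, S) = 0" "fx (y, S) - fx (y, 0) - prim S (\<lambda>t. ftx (y, t)) S = 0"
      moreover have "prim S (\<lambda>t. ftx (y, t)) S = integral\<^sup>L (lm S) (\<lambda>t. ftx (y, t))" by (rule prim_end) measurable
      ultimately show "fx (y, 0) + integral\<^sup>L (lm S) (\<lambda>t. ftx (y, t)) = 0" by linarith
    qed
  qed
qed

section \<open>Weak form of the conservation laws\<close>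

context convergent_sequence
begin

interpretation a: approximate_solution d C "\<delta> m" "uh m" "gh m" "ub m" "Ph m" "Qh m" "Pb m" "q0 m" "q1 m" for m
  by (rule approximates)

definition v :: "species \<Rightarrow> real \<times> real \<Rightarrow> real" where
  "v s = (SOME v. v \<in> borel_measurable borel \<and> integrable (mq T) (\<lambda>z. (v z)\<^sup>2) \<and>
    (AE t in lm T. good t \<and> integrable (lm 1) (\<lambda>x. (v (x, t))\<^sup>2) \<and>
      (\<forall>x\<in>{0..1}. U s (x, t) = U s (0, t) + prim 1 (\<lambda>y. v (y, t)) x)))"

lemma v_borel [measurable]: "v s \<in> borel_measurable borel"
  and v_sq: "integrable (mq T) (\<lambda>z. (v s z)\<^sup>2)"
  and v_good: "AE t in lm T. good t \<and> integrable (lm 1) (\<lambda>x. (v s (x, t))\<^sup>2) \<and>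
      (\<forall>x\<in>{0..1}. U s (x, t) = U s (0, t) + prim 1 (\<lambda>y. v s (y, t)) x)"
  using someI_ex[OF space_derivative[of s], folded v_def] by - (elim conjE, assumption)+

lemma v_slices [measurable]: "(\<lambda>y. v s (y, t)) \<in> borel_measurable borel" "(\<lambda>\<tau>. v s (x, \<tau>)) \<in> borel_measurable borel"
  by (rule slice_borel(1)[OF v_borel]) (rule slice_borel(2)[OF v_borel])

lemma v_integrable: "integrable (mq T) (v s)"
  by (rule sq_integrable_imp_integrable[OF finite_measure_mq _ v_sq]) simp

lemma v_slice_integrable: "integrable (lm 1) (\<lambda>x. (v s (x, t))\<^sup>2) \<Longrightarrow> integrable (lm 1) (\<lambda>x. v s (x, t))"
  by (rule sq_integrable_imp_integrable[OF finite_measure_lm]) simp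

lemma mq_bounds:
  "AE z in mq T. \<bar>U s z\<bar> \<le> Cu" "AE z in mq T. \<bar>W s z\<bar> \<le> C" "AE z in mq T. \<bar>Q z\<bar> \<le> C" "AE z in mq T. \<bar>\<Phi> z\<bar> \<le> CP"
  "AE z in mq T. \<bar>B0 s (snd z)\<bar> \<le> CF"
proof -
  have t: "AE t in lm T. 0 < t \<and> t < T" by (rule AE_lm_I) simp
  show "AE z in mq T. \<bar>U s z\<bar> \<le> Cu"
    by (rule AE_mq_le) (simp, use AE_good in eventually_elim, auto intro!: AE_lm_I U_abs)
  show "AE z in mq T. \<bar>W s z\<bar> \<le> C"
    by (rule AE_mq_le) (simp, use t in eventually_elim, auto intro!: AE_lm_I W_bound)
  show "AE z in mq T. \<bar>Q z\<bar> \<le> C"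
    by (rule AE_mq_le) (simp, use t in eventually_elim, rule Q_bound, auto)
  show "AE z in mq T. \<bar>\<Phi> z\<bar> \<le> CP"
    by (rule AE_mq_le) (simp, use t in eventually_elim, auto intro!: AE_lm_I \<Phi>_bound)
  have b: "(\<lambda>z :: real \<times> real. B0 s (snd z)) \<in> borel_measurable borel" by measurable
  show "AE z in mq T. \<bar>B0 s (snd z)\<bar> \<le> CF"
    by (rule AE_mq_le[OF b]) (use AE_good in eventually_elim, auto intro!: AE_lm_I B_bound)
qed

text \<open>Space derivative of the integrand in \<open>moment_limit\<close>, that is, minus the
  limit flux relative to its value at the left end.\<close>

definition "J s z = v s z + z_of s * (Q z * U s z) - B0 s (snd z)"

lemma U_mq_integrable: "integrable (mq T) (U s)"
  by (rule integrable_bounded_finite[OF finite_measure_mq _ mq_bounds(1)]) simp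

lemma W_mq_integrable: "integrable (mq T) (W s)"
  by (rule integrable_bounded_finite[OF finite_measure_mq _ mq_bounds(2)]) simp

lemma QU_integrable: "integrable (mq T) (\<lambda>z. z_of s * (Q z * U s z))"
  by (intro integrable_mult_right integrable_mult_bounded(2)[OF U_mq_integrable _ mq_bounds(3)]) simp

lemma B0_mq_integrable: "integrable (mq T) (\<lambda>z. B0 s (snd z))"
  by (rule integrable_bounded_finite[OF finite_measure_mq _ mq_bounds(5)]) simp

lemma AE_B_bound: "AE t in lm T. \<bar>B0 s t\<bar> \<le> CF" "AE t in lm T. \<bar>B1 s t\<bar> \<le> CF"
  by (use AE_good in eventually_elim, rule B_bound, assumption)+

lemma B_integrable: "integrable (lm T) (B0 s)" "integrable (lm T) (B1 s)"
  by (rule integrable_bounded_finite[OF finite_measure_lm _ AE_B_bound(1)], simp,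
      rule integrable_bounded_finite[OF finite_measure_lm _ AE_B_bound(2)], simp)

lemma smooth_B_integrable:
  fixes \<phi> :: "real \<times> real \<Rightarrow> real"
  assumes "smooth_fun \<phi>" "0 \<le> x" "x \<le> 1"
  shows "integrable (lm T) (\<lambda>t. \<phi> (x, t) * B0 s t)" "integrable (lm T) (\<lambda>t. \<phi> (x, t) * B1 s t)"
  by (rule integrable_mult_bounded(1)[OF smooth_fun_integrable(3)[OF assms] _ AE_B_bound(1)], simp,
      rule integrable_mult_bounded(1)[OF smooth_fun_integrable(3)[OF assms] _ AE_B_bound(2)], simp)

lemma J_borel [measurable]: "J s \<in> borel_measurable borel"
  unfolding J_def[abs_def] by measurable

lemma J_integrable: "integrable (mq T) (J s)"
  unfolding J_def[abs_def] by (intro Bochner_Integration.integrable_diff Bochner_Integration.integrable_add v_integrable QU_integrable B0_mq_integrable)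

text \<open>\<open>moment_limit\<close> differentiated in space, in the sense that both sides have
  the same primitive. The quantifiers are exchanged to almost every \<open>y\<close>, then almost
  every \<open>t\<close>, because integration by parts in time is carried out along fixed
  \<open>y\<close>.\<close>

lemma W_time:
  "AE y in lm 1. AE t in lm T. eps_of d s * W s (y, t) = eps_of d s * prim 1 (u0 s) y + prim T (\<lambda>\<tau>. J s (y, \<tau>)) t"
proof (rule AE_mq_swap)
  have [measurable]: "fst \<in> borel_measurable (borel :: (real \<times> real) measure)" by (rule fst_snd_borel)
  have [measurable]: "(\<lambda>z. prim T (\<lambda>\<tau>. J s (fst z, \<tau>)) (snd z)) \<in> borel_measurable borel" by (rule prim_borel2) measurable
  have [measurable]: "(\<lambda>z :: real \<times> real. prim 1 (u0 s) (fst z)) \<in> borel_measurable borel"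
    by (rule measurable_compose[OF fst_snd_borel(1) prim_borel[OF u0_borel]])
  have "{z \<in> space borel. eps_of d s * W s z = eps_of d s * prim 1 (u0 s) (fst z) + prim T (\<lambda>\<tau>. J s (fst z, \<tau>)) (snd z)} \<in> sets borel" by measurable
  then show "{z. eps_of d s * W s (fst z, snd z) = eps_of d s * prim 1 (u0 s) (fst z) + prim T (\<lambda>\<tau>. J s (fst z, \<tau>)) (snd z)} \<in> sets borel"
    by simp
next
  show "AE t in lm T. AE y in lm 1. eps_of d s * W s (y, t) = eps_of d s * prim 1 (u0 s) y + prim T (\<lambda>\<tau>. J s (y, \<tau>)) t"
  proof (rule AE_lm_I)
    fix t assume t: "0 < t" "t < T"
    have iW: "integrable (lm 1) (\<lambda>y. W s (y, t))"
      by (rule integrable_bounded_finite[OF finite_measure_lm, where B=C]) (auto intro!: AE_lm_I W_bound t)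
    have iu: "integrable (lm 1) (prim 1 (u0 s))"
      by (rule integrable_bounded_finite[OF finite_measure_lm]) (simp, rule AE_I2, rule prim_le_integral[OF u0_integrable])
    have i: "integrable (lm 1) (\<lambda>y. eps_of d s * (W s (y, t) - prim 1 (u0 s) y))"
      by (intro integrable_mult_right Bochner_Integration.integrable_diff iW iu)
    have "AE y in lm 1. eps_of d s * (W s (y, t) - prim 1 (u0 s) y) - prim T (\<lambda>\<tau>. J s (y, \<tau>)) t = 0"
    proof (rule prim_zero_imp_AE_zero)
      show "integrable (lm 1) (\<lambda>y. eps_of d s * (W s (y, t) - prim 1 (u0 s) y) - prim T (\<lambda>\<tau>. J s (y, \<tau>)) t)"
        by (intro Bochner_Integration.integrable_diff[OF i] prim_swap(2) J_integrable)
      fix x :: real assume x: "0 < x" "x \<le> 1"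
      have x0: "0 \<le> x" using x by simp
      let ?H = "\<lambda>\<tau>. U s (x, \<tau>) - U s (0, \<tau>) + z_of s * prim 1 (\<lambda>y. Q (y, \<tau>) * U s (y, \<tau>)) x - x * B0 s \<tau>"
      have mH: "?H \<in> borel_measurable borel"
      proof -
        have "(\<lambda>z. prim 1 (\<lambda>y. (\<lambda>z. Q z * U s z) (y, snd z)) (fst z)) \<in> borel_measurable borel"
          by (rule prim_borel2) measurable
        from slice_borel(2)[OF this, of x] have [measurable]: "(\<lambda>\<tau>. prim 1 (\<lambda>y. Q (y, \<tau>) * U s (y, \<tau>)) x) \<in> borel_measurable borel" by simp
        show ?thesis by measurable
      qed
      have mJ: "(\<lambda>\<tau>. prim 1 (\<lambda>y. J s (y, \<tau>)) x) \<in> borel_measurable borel"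
        using slice_borel(2)[OF prim_borel2(1)[OF J_borel[of s], of 1], of x] by simp
      \<comment> \<open>At times where \<open>U\<close> is a primitive of \<open>v\<close>, the
        integrand \<open>?H\<close> is the primitive of \<open>J\<close>.\<close>
      have e: "prim T ?H t = prim T (\<lambda>\<tau>. prim 1 (\<lambda>y. J s (y, \<tau>)) x) t"
      proof (rule prim_cong_AE[OF mH mJ])
        show "AE \<tau> in lm T. ?H \<tau> = prim 1 (\<lambda>y. J s (y, \<tau>)) x"
          using v_good[of s]
        proof eventually_elim
          fix \<tau> assume h: "good \<tau> \<and> integrable (lm 1) (\<lambda>x. (v s (x, \<tau>))\<^sup>2) \<and> (\<forall>x\<in>{0..1}. U s (x, \<tau>) = U s (0, \<tau>) + prim 1 (\<lambda>y. v s (y, \<tau>)) x)"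
          note g = h[THEN conjunct1] and iv = v_slice_integrable[OF h[THEN conjunct2, THEN conjunct1]]
          have Ux: "U s (x, \<tau>) = U s (0, \<tau>) + prim 1 (\<lambda>y. v s (y, \<tau>)) x" using h[THEN conjunct2, THEN conjunct2, THEN bspec, of x] x by simp
          have iq: "integrable (lm 1) (\<lambda>y. Q (y, \<tau>) * U s (y, \<tau>))"
            by (rule integrable_mult_bounded(2)[OF U_integrable[OF g] _ Q_bound[OF goodD(1,2)[OF g]]]) simp
          have "prim 1 (\<lambda>y. J s (y, \<tau>)) x = prim 1 (\<lambda>y. v s (y, \<tau>) + z_of s * (Q (y, \<tau>) * U s (y, \<tau>))) x - prim 1 (\<lambda>y. B0 s \<tau>) x"
            unfolding J_def snd_conv by (rule prim_diff) (auto intro!: iv iq integrable_mult_right finite_measure.integrable_const finite_measure_lm)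
          also have "prim 1 (\<lambda>y. v s (y, \<tau>) + z_of s * (Q (y, \<tau>) * U s (y, \<tau>))) x = prim 1 (\<lambda>y. v s (y, \<tau>)) x + prim 1 (\<lambda>y. z_of s * (Q (y, \<tau>) * U s (y, \<tau>))) x"
            by (rule prim_add[OF iv]) (intro integrable_mult_right iq)
          also have "prim 1 (\<lambda>y. B0 s \<tau>) x = B0 s \<tau> * x" by (rule prim_const[OF x0 x(2)])
          finally show "?H \<tau> = prim 1 (\<lambda>y. J s (y, \<tau>)) x" unfolding prim_cmult using Ux by (simp add: mult.commute)
        qed
      qed
      have "prim 1 (\<lambda>y. eps_of d s * (W s (y, t) - prim 1 (u0 s) y) - prim T (\<lambda>\<tau>. J s (y, \<tau>)) t) x
        = prim 1 (\<lambda>y. eps_of d s * (W s (y, t) - prim 1 (u0 s) y)) x - prim 1 (\<lambda>y. prim T (\<lambda>\<tau>. J s (y, \<tau>)) t) x"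
        by (rule prim_diff[OF i prim_swap(2)[OF J_integrable]])
      also have "prim 1 (\<lambda>y. eps_of d s * (W s (y, t) - prim 1 (u0 s) y)) x = eps_of d s * (prim 1 (\<lambda>y. W s (y, t)) x - prim 1 (prim 1 (u0 s)) x)"
        unfolding prim_cmult by (subst prim_diff[OF iW iu]) (rule refl)
      also have "prim 1 (\<lambda>y. prim T (\<lambda>\<tau>. J s (y, \<tau>)) t) x = prim T ?H t" unfolding e by (rule prim_swap(1)[OF J_integrable, symmetric])
      finally show "prim 1 (\<lambda>y. eps_of d s * (W s (y, t) - prim 1 (u0 s) y) - prim T (\<lambda>\<tau>. J s (y, \<tau>)) t) x = 0"
        using moment_limit[OF t x0 x(2), of s] by simp
    qed
    then show "AE y in lm 1. eps_of d s * W s (y, t) = eps_of d s * prim 1 (u0 s) y + prim T (\<lambda>\<tau>. J s (y, \<tau>)) t"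
      by eventually_elim (simp add: right_diff_distrib)
  qed
qed

text \<open>Time regularity is available for \<open>W\<close>, not for \<open>U\<close>. Hence one
  integration by parts in space, with \<open>U\<close> as derivative of \<open>W\<close>, and one in
  time, with \<open>J\<close> as derivative of \<open>eps_of d s * W\<close>; the mixed derivative
  \<open>ftx\<close> appears in between and disappears again.\<close>

lemma integral_U_test:
  assumes p: "test_fun_QT T \<phi>"
  defines "fx \<equiv> \<lambda>z. frechet_derivative \<phi> (at z) (1, 0)" and "ft \<equiv> \<lambda>z. frechet_derivative \<phi> (at z) (0, 1)"
  shows "eps_of d s * (\<integral>z. U s z * ft z \<partial>mq T) =
    (\<integral>t. \<phi> (1, t) * B1 s t \<partial>lm T) + (\<integral>t. \<phi> (0, t) * B0 s t \<partial>lm T)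
    - eps_of d s * (\<integral>x. \<phi> (x, 0) * u0 s x \<partial>lm 1) + (\<integral>z. fx z * (v s z + z_of s * (Q z * U s z)) \<partial>mq T)"
proof -
  define e where "e = eps_of d s"
  define ftx where "ftx = (\<lambda>z. frechet_derivative ft (at z) (1, 0))"
  have fold: "frechet_derivative \<phi> (at z) (1, 0) = fx z" "frechet_derivative \<phi> (at z) (0, 1) = ft z" "frechet_derivative ft (at z) (1, 0) = ftx z" for z
    by (simp_all only: fx_def ft_def ftx_def)
  note X = test_fun_QT_mixed[OF p T_pos, unfolded fold]
  have sm: "smooth_fun \<phi>" "smooth_fun fx" "smooth_fun ft" "smooth_fun ftx" by (rule X)+
  note px = smooth_fun_prim(1)[OF sm(1), unfolded fold(1)] and pt = smooth_fun_prim(2)[OF sm(1), unfolded fold(2)]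
    and ptx = smooth_fun_prim(1)[OF sm(3), unfolded fold(3)]
  note sI = smooth_fun_integrable
  have mb: "f \<in> borel_measurable borel" "(\<lambda>x. f (x, t)) \<in> borel_measurable borel" "(\<lambda>t. f (x, t)) \<in> borel_measurable borel" if "smooth_fun f"
    for f :: "real \<times> real \<Rightarrow> real" and x t using smooth_borel[OF that] slice_borel[OF smooth_borel[OF that]] by auto
  note [measurable] = mb[OF sm(1)] mb[OF sm(2)] mb[OF sm(3)] mb[OF sm(4)]
  have bd: "\<exists>B. AE z in mq T. \<bar>f z\<bar> \<le> B" if f: "smooth_fun f" for f :: "real \<times> real \<Rightarrow> real"
  proof -
    obtain B where B: "\<And>x t. 0 \<le> x \<Longrightarrow> x \<le> 1 \<Longrightarrow> 0 \<le> t \<Longrightarrow> t \<le> T \<Longrightarrow> \<bar>f (x, t)\<bar> \<le> B"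
      by (rule smooth_fun_bounded[OF f, where S=T]) (rule that)
    show ?thesis by (rule exI[of _ B]) (auto simp: AE_mq QT_def intro!: B AE_I2)
  qed
  have imul: "integrable (mq T) (\<lambda>z. f z * g z)" if f: "smooth_fun f" and g: "integrable (mq T) g" for f g :: "real \<times> real \<Rightarrow> real"
  proof -
    obtain B where B: "AE z in mq T. \<bar>f z\<bar> \<le> B" using bd[OF f] ..
    show ?thesis by (rule integrable_mult_bounded(2)[OF g _ B]) (simp add: mb[OF f])
  qed
  define m0 where "m0 = integral\<^sup>L (lm 1) (u0 s)"
  define IA where "IA = (\<integral>t. ft (1, t) * (e * W s (1, t)) \<partial>lm T)"
  define IB where "IB = (\<integral>z. ftx z * (e * W s z) \<partial>mq T)"
  define I1 where "I1 = (\<integral>t. \<phi> (1, t) * B1 s t \<partial>lm T)"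
  define I10 where "I10 = (\<integral>t. \<phi> (1, t) * B0 s t \<partial>lm T)"
  define I0 where "I0 = (\<integral>t. \<phi> (0, t) * B0 s t \<partial>lm T)"
  define Iu where "Iu = (\<integral>x. \<phi> (x, 0) * u0 s x \<partial>lm 1)"
  define IJ where "IJ = (\<integral>z. fx z * J s z \<partial>mq T)"
  have iB: "integrable (mq T) (\<lambda>z. ftx z * (e * W s z))" by (intro imul sm integrable_mult_right W_mq_integrable)
  have iU: "integrable (mq T) (\<lambda>z. U s z * ft z)" using imul[OF sm(3) U_mq_integrable] by (simp only: mult.commute)
  have iJ: "integrable (mq T) (\<lambda>z. fx z * J s z)" by (intro imul sm J_integrable)

  \<comment> \<open>At \<open>x = 1\<close> the primitive is the total mass, so
    \<open>mass_limit\<close> gives its evolution and brings in the flux at the right end.\<close>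
  have W1: "AE t in lm T. e * W s (1, t) = e * m0 + prim T (\<lambda>\<tau>. - (B1 s \<tau> + B0 s \<tau>)) t"
  proof (rule AE_lm_I)
    fix t assume t: "0 < t" "t < T"
    have "prim T (\<lambda>\<tau>. - (B1 s \<tau> + B0 s \<tau>)) t = - prim T (\<lambda>\<tau>. B1 s \<tau> + B0 s \<tau>) t"
      using prim_cmult[of T "- 1" "\<lambda>\<tau>. B1 s \<tau> + B0 s \<tau>" t] by simp
    moreover have "prim 1 (u0 s) 1 = m0" unfolding m0_def by (rule prim_end) simp
    ultimately show "e * W s (1, t) = e * m0 + prim T (\<lambda>\<tau>. - (B1 s \<tau> + B0 s \<tau>)) t"
      using mass_limit[OF t, of s] by (simp add: e_def right_diff_distrib)
  qed
  have ae1: "AE t in lm T. \<phi> (1, t) = \<phi> (1, 0) + prim T (\<lambda>\<tau>. ft (1, \<tau>)) t"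
    by (rule AE_lm_I) (rule pt; simp)
  have z1: "\<phi> (1, 0) + integral\<^sup>L (lm T) (\<lambda>t. ft (1, t)) = 0"
  proof -
    have "prim T (\<lambda>\<tau>. ft (1, \<tau>)) T = integral\<^sup>L (lm T) (\<lambda>t. ft (1, t))" by (rule prim_end) measurable
    then show ?thesis using pt[of T T 1] test_fun_QT_end[OF p T_pos, of 1] T_pos by simp
  qed
  have iB1: "integrable (lm T) (\<lambda>t. - (B1 s t + B0 s t))" using B_integrable by simp
  have mW: "(\<lambda>t. e * W s (1, t)) \<in> borel_measurable borel" by measurable
  have i3: "integrable (lm T) (\<lambda>t. ft (1, t))" by (rule sI(3)[OF sm(3)]) auto
  note ib1 = ibp[OF i3 iB1 ae1 W1 mb(3)[OF sm(1)] mW]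
  have IA: "IA = - \<phi> (1, 0) * (e * m0) + I1 + I10"
  proof -
    have "(\<integral>t. \<phi> (1, t) * - (B1 s t + B0 s t) \<partial>lm T) = (\<integral>t. - (\<phi> (1, t) * B1 s t + \<phi> (1, t) * B0 s t) \<partial>lm T)"
      by (rule Bochner_Integration.integral_cong) (simp_all add: algebra_simps)
    also have "\<dots> = - (I1 + I10)" unfolding I1_def I10_def
      by (subst integral_minus, subst Bochner_Integration.integral_add) (auto intro!: smooth_B_integrable sm(1))
    finally have k: "(\<integral>t. \<phi> (1, t) * - (B1 s t + B0 s t) \<partial>lm T) = - (I1 + I10)" .
    show ?thesis using ib1(1) unfolding z1 k IA_def by simp
  qed

  \<comment> \<open>Integration by parts in space at each good time. The primitive \<open>W\<close>
    vanishes at \<open>x = 0\<close>, so only the boundary term at 1 remains.\<close>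
  have eU: "e * (\<integral>z. U s z * ft z \<partial>mq T) = IA - IB"
  proof -
    have "e * (\<integral>z. U s z * ft z \<partial>mq T) = (\<integral>t. e * (\<integral>x. U s (x, t) * ft (x, t) \<partial>lm 1) \<partial>lm T)"
      unfolding mq_integral_iterated(1)[OF iU] by simp
    also have "\<dots> = (\<integral>t. ft (1, t) * (e * W s (1, t)) - (\<integral>x. ftx (x, t) * (e * W s (x, t)) \<partial>lm 1) \<partial>lm T)"
    proof (rule integral_cong_AE)
      show "(\<lambda>t. e * (\<integral>x. U s (x, t) * ft (x, t) \<partial>lm 1)) \<in> borel_measurable (lm T)"
        using borel_measurable_integrable[OF mq_integral_iterated(3)[OF iU]] by (rule borel_measurable_times[OF borel_measurable_const])
      have m1: "(\<lambda>t. ft (1, t) * (e * W s (1, t))) \<in> borel_measurable (lm T)" by measurable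
      show "(\<lambda>t. ft (1, t) * (e * W s (1, t)) - (\<integral>x. ftx (x, t) * (e * W s (x, t)) \<partial>lm 1)) \<in> borel_measurable (lm T)"
        by (rule borel_measurable_diff[OF m1 borel_measurable_integrable[OF mq_integral_iterated(3)[OF iB]]])
      show "AE t in lm T. e * (\<integral>x. U s (x, t) * ft (x, t) \<partial>lm 1) = ft (1, t) * (e * W s (1, t)) - (\<integral>x. ftx (x, t) * (e * W s (x, t)) \<partial>lm 1)"
        using AE_good
      proof eventually_elim
        fix t assume g: "good t"
        have t: "0 \<le> t" using goodD(1)[OF g] by simp
        have a1: "AE x in lm 1. W s (x, t) = 0 + prim 1 (\<lambda>y. U s (y, t)) x" by (rule AE_lm_I) (simp add: W_prim[OF g])
        have a2: "AE x in lm 1. ft (x, t) = ft (0, t) + prim 1 (\<lambda>y. ftx (y, t)) x" by (rule AE_lm_I) (rule ptx; simp)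
        have w1: "integral\<^sup>L (lm 1) (\<lambda>x. U s (x, t)) = W s (1, t)"
          using W_prim[OF g, of 1 s] prim_end[of "\<lambda>y. U s (y, t)" 1] by simp
        have f1: "ft (0, t) + integral\<^sup>L (lm 1) (\<lambda>x. ftx (x, t)) = ft (1, t)"
          using ptx[of 1 1 t] prim_end[OF mb(2)[OF sm(4)], of 1 t] by simp
        have "(\<integral>x. U s (x, t) * ft (x, t) \<partial>lm 1) = W s (1, t) * ft (1, t) - (\<integral>x. W s (x, t) * ftx (x, t) \<partial>lm 1)"
          using ibp(1)[OF U_integrable[OF g] sI(2)[OF sm(4) t] a1 a2 UW_slices(3) mb(2)[OF sm(3)]] unfolding w1 f1 by simp
        then have "e * (\<integral>x. U s (x, t) * ft (x, t) \<partial>lm 1) = e * (W s (1, t) * ft (1, t)) - e * (\<integral>x. W s (x, t) * ftx (x, t) \<partial>lm 1)"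
          by (simp only: right_diff_distrib)
        moreover have "e * (\<integral>x. W s (x, t) * ftx (x, t) \<partial>lm 1) = (\<integral>x. ftx (x, t) * (e * W s (x, t)) \<partial>lm 1)"
          by (subst integral_mult_right_zero[symmetric]) (simp only: mult.commute mult.left_commute)
        ultimately show "e * (\<integral>x. U s (x, t) * ft (x, t) \<partial>lm 1) = ft (1, t) * (e * W s (1, t)) - (\<integral>x. ftx (x, t) * (e * W s (x, t)) \<partial>lm 1)"
          by (simp only: mult.commute mult.left_commute)
      qed
    qed
    also have "\<dots> = IA - (\<integral>t. \<integral>x. ftx (x, t) * (e * W s (x, t)) \<partial>lm 1 \<partial>lm T)"
      unfolding IA_def by (rule Bochner_Integration.integral_diff[OF ib1(2) mq_integral_iterated(3)[OF iB]])
    also have "\<dots> = IA - IB" unfolding IB_def mq_integral_iterated(1)[OF iB] ..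
    finally show ?thesis .
  qed

  have ipu: "integrable (lm 1) (\<lambda>y. fx (y, 0) * (e * prim 1 (u0 s) y))"
    by (rule integrable_mult_bounded(1)[OF sI(2)[OF sm(2) order_refl], where B="\<bar>e\<bar> * (\<integral>y. \<bar>u0 s y\<bar> \<partial>lm 1)"])
       (simp, rule AE_I2, unfold abs_mult, intro mult_left_mono prim_le_integral u0_integrable abs_ge_zero)
  \<comment> \<open>Integration by parts in space at time 0, where the datum enters; the term with
    \<open>m0\<close> cancels against the one in \<open>IA\<close>.\<close>
  have p0: "(\<integral>y. fx (y, 0) * (e * prim 1 (u0 s) y) \<partial>lm 1) = e * (\<phi> (1, 0) * m0 - Iu)"
  proof -
    have a1: "AE y in lm 1. \<phi> (y, 0) = \<phi> (0, 0) + prim 1 (\<lambda>y. fx (y, 0)) y" by (rule AE_lm_I) (rule px; simp)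
    have a2: "AE y in lm 1. prim 1 (u0 s) y = 0 + prim 1 (u0 s) y" by simp
    have f1: "\<phi> (0, 0) + integral\<^sup>L (lm 1) (\<lambda>y. fx (y, 0)) = \<phi> (1, 0)"
      using px[of 1 1 0] prim_end[OF mb(2)[OF sm(2)], of 1 0] by simp
    have "(\<integral>y. fx (y, 0) * prim 1 (u0 s) y \<partial>lm 1) = \<phi> (1, 0) * m0 - Iu"
      using ibp(1)[OF sI(2)[OF sm(2) order_refl] u0_integrable a1 a2 mb(2)[OF sm(1)] prim_borel[OF u0_borel]] unfolding f1 m0_def Iu_def by simp
    moreover have "(\<integral>y. fx (y, 0) * (e * prim 1 (u0 s) y) \<partial>lm 1) = e * (\<integral>y. fx (y, 0) * prim 1 (u0 s) y \<partial>lm 1)"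
      by (subst integral_mult_right_zero[symmetric]) (simp only: mult.left_commute)
    ultimately show ?thesis by simp
  qed
  \<comment> \<open>Integration by parts in time for almost every fixed \<open>y\<close>: the final
    value of \<open>fx\<close> is 0, and its initial value meets the primitive of the datum.\<close>
  have IB: "IB = - (e * (\<phi> (1, 0) * m0 - Iu)) - IJ"
  proof -
    have "IB = (\<integral>y. \<integral>t. ftx (y, t) * (e * W s (y, t)) \<partial>lm T \<partial>lm 1)" unfolding IB_def by (rule mq_integral_iterated(2)[OF iB])
    also have "\<dots> = (\<integral>y. - (fx (y, 0) * (e * prim 1 (u0 s) y)) - (\<integral>t. fx (y, t) * J s (y, t) \<partial>lm T) \<partial>lm 1)"
    proof (rule integral_cong_AE)
      show "(\<lambda>y. \<integral>t. ftx (y, t) * (e * W s (y, t)) \<partial>lm T) \<in> borel_measurable (lm 1)"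
        by (rule borel_measurable_integrable[OF mq_integral_iterated(4)[OF iB]])
      show "(\<lambda>y. - (fx (y, 0) * (e * prim 1 (u0 s) y)) - (\<integral>t. fx (y, t) * J s (y, t) \<partial>lm T)) \<in> borel_measurable (lm 1)"
        by (intro borel_measurable_diff borel_measurable_uminus borel_measurable_integrable[OF ipu] borel_measurable_integrable[OF mq_integral_iterated(4)[OF iJ]])
      have i01: "AE y in lm 1. 0 < y \<and> y < 1" by (rule AE_lm_I) simp
      show "AE y in lm 1. (\<integral>t. ftx (y, t) * (e * W s (y, t)) \<partial>lm T) = - (fx (y, 0) * (e * prim 1 (u0 s) y)) - (\<integral>t. fx (y, t) * J s (y, t) \<partial>lm T)"
        using W_time[of s, folded e_def] X(5,6) mq_integral_iterated(6)[OF J_integrable[of s]] i01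
      proof eventually_elim
        fix y assume w: "AE t in lm T. e * W s (y, t) = e * prim 1 (u0 s) y + prim T (\<lambda>\<tau>. J s (y, \<tau>)) t"
          and f: "AE t in lm T. fx (y, t) = fx (y, 0) + prim T (\<lambda>t. ftx (y, t)) t"
          and z: "fx (y, 0) + integral\<^sup>L (lm T) (\<lambda>t. ftx (y, t)) = 0"
          and ij: "integrable (lm T) (\<lambda>t. J s (y, t))" and y: "0 < y \<and> y < 1"
        have if': "integrable (lm T) (\<lambda>t. ftx (y, t))" by (rule sI(3)[OF sm(4)]) (use y in auto)
        have mw: "(\<lambda>t. e * W s (y, t)) \<in> borel_measurable borel" by measurable
        show "(\<integral>t. ftx (y, t) * (e * W s (y, t)) \<partial>lm T) = - (fx (y, 0) * (e * prim 1 (u0 s) y)) - (\<integral>t. fx (y, t) * J s (y, t) \<partial>lm T)"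
          using ibp(1)[OF if' ij f w mb(3)[OF sm(2)] mw] unfolding z by simp
      qed
    qed
    also have "\<dots> = (\<integral>y. - (fx (y, 0) * (e * prim 1 (u0 s) y)) \<partial>lm 1) - (\<integral>y. \<integral>t. fx (y, t) * J s (y, t) \<partial>lm T \<partial>lm 1)"
      by (intro Bochner_Integration.integral_diff Bochner_Integration.integrable_minus ipu mq_integral_iterated(4)[OF iJ])
    also have "(\<integral>y. - (fx (y, 0) * (e * prim 1 (u0 s) y)) \<partial>lm 1) = - (e * (\<phi> (1, 0) * m0 - Iu))" unfolding integral_minus p0 ..
    also have "(\<integral>y. \<integral>t. fx (y, t) * J s (y, t) \<partial>lm T \<partial>lm 1) = IJ" unfolding IJ_def by (rule mq_integral_iterated(2)[OF iJ, symmetric])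
    finally show ?thesis .
  qed
  \<comment> \<open>The part \<open>B0\<close> of \<open>J\<close> is constant in space and
    integrates against \<open>fx\<close> to boundary values: its share at 1 cancels
    \<open>I10\<close>, its share at 0 is the left boundary term.\<close>
  have IJ: "IJ = (\<integral>z. fx z * (v s z + z_of s * (Q z * U s z)) \<partial>mq T) - (I10 - I0)"
  proof -
    have i1: "integrable (mq T) (\<lambda>z. fx z * (v s z + z_of s * (Q z * U s z)))"
      by (intro imul sm Bochner_Integration.integrable_add v_integrable QU_integrable)
    have i2: "integrable (mq T) (\<lambda>z. fx z * B0 s (snd z))" by (intro imul sm B0_mq_integrable)
    have "IJ = (\<integral>z. fx z * (v s z + z_of s * (Q z * U s z)) - fx z * B0 s (snd z) \<partial>mq T)"
      unfolding IJ_def J_def by (simp only: right_diff_distrib)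
    also have "\<dots> = (\<integral>z. fx z * (v s z + z_of s * (Q z * U s z)) \<partial>mq T) - (\<integral>z. fx z * B0 s (snd z) \<partial>mq T)"
      by (rule Bochner_Integration.integral_diff[OF i1 i2])
    also have "(\<integral>z. fx z * B0 s (snd z) \<partial>mq T) = (\<integral>t. \<integral>x. fx (x, t) * B0 s t \<partial>lm 1 \<partial>lm T)"
      using mq_integral_iterated(1)[OF i2] by (simp only: snd_conv)
    also have "\<dots> = (\<integral>t. \<phi> (1, t) * B0 s t - \<phi> (0, t) * B0 s t \<partial>lm T)"
    proof (rule integral_cong_AE)
      show "(\<lambda>t. \<integral>x. fx (x, t) * B0 s t \<partial>lm 1) \<in> borel_measurable (lm T)"
        using borel_measurable_integrable[OF mq_integral_iterated(3)[OF i2]] by (simp only: snd_conv)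
      show "(\<lambda>t. \<phi> (1, t) * B0 s t - \<phi> (0, t) * B0 s t) \<in> borel_measurable (lm T)" by measurable
      have "(\<integral>x. fx (x, t) * B0 s t \<partial>lm 1) = \<phi> (1, t) * B0 s t - \<phi> (0, t) * B0 s t" for t
      proof -
        have "integral\<^sup>L (lm 1) (\<lambda>x. fx (x, t)) = \<phi> (1, t) - \<phi> (0, t)"
          using px[of 1 1 t] prim_end[OF mb(2)[OF sm(2)], of 1 t] by simp
        then show ?thesis by (simp add: left_diff_distrib)
      qed
      then show "AE t in lm T. (\<integral>x. fx (x, t) * B0 s t \<partial>lm 1) = \<phi> (1, t) * B0 s t - \<phi> (0, t) * B0 s t" by simp
    qed
    also have "\<dots> = I10 - I0" unfolding I10_def I0_def
      by (rule Bochner_Integration.integral_diff) (auto intro!: smooth_B_integrable sm(1))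
    finally show ?thesis .
  qed
  have "e * (\<integral>z. U s z * ft z \<partial>mq T) = I1 + I0 - e * Iu + (\<integral>z. fx z * (v s z + z_of s * (Q z * U s z)) \<partial>mq T)"
    unfolding eU IA IB IJ by (simp add: algebra_simps)
  then show ?thesis unfolding e_def I1_def I0_def Iu_def .
qed

end

section \<open>Strong convergence of the reconstructions and traces of the limit\<close>

lemma integrable_bounded_sq:
  fixes f :: "'a \<Rightarrow> real"
  assumes M: "finite_measure M" and f: "f \<in> borel_measurable M" and ae: "AE x in M. \<bar>f x\<bar> \<le> B"
  shows "integrable M (\<lambda>x. (f x)\<^sup>2)"
proof (rule integrable_bounded_finite[OF M borel_measurable_power[OF f]])
  show "AE x in M. \<bar>(f x)\<^sup>2\<bar> \<le> B\<^sup>2" using ae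
    by eventually_elim (auto simp: abs_le_square_iff[symmetric])
qed

text \<open>Dominated convergence in space and again in time matches the form of the available
  information: almost every time, and then almost every point.\<close>

lemma mq_square_limit:
  fixes f :: "nat \<Rightarrow> real \<times> real \<Rightarrow> real"
  assumes f [measurable]: "\<And>m. f m \<in> borel_measurable borel" and g [measurable]: "g \<in> borel_measurable borel"
    and bf: "\<And>m. AE t in lm S. AE x in lm 1. \<bar>f m (x, t)\<bar> \<le> B" and bg: "AE t in lm S. AE x in lm 1. \<bar>g (x, t)\<bar> \<le> B"
    and lim: "AE t in lm S. AE x in lm 1. (\<lambda>m. f m (x, t)) \<longlonglongrightarrow> g (x, t)"
  shows "(\<lambda>m. \<integral>z. (f m z - g z)\<^sup>2 \<partial>mq S) \<longlonglongrightarrow> 0"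
proof -
  have sl [measurable]: "(\<lambda>x. f m (x, t)) \<in> borel_measurable borel" "(\<lambda>x. g (x, t)) \<in> borel_measurable borel" for m t
    by (rule slice_borel(1)[OF f]) (rule slice_borel(1)[OF g])
  have i: "integrable (mq S) (\<lambda>z. (f m z - g z)\<^sup>2)" for m
    using integrable_bounded_sq[OF finite_measure_mq _ AE_mq_le[OF f bf]] integrable_bounded_sq[OF finite_measure_mq _ AE_mq_le[OF g bg]]
    by (intro sq_integrable_diff(1)) simp_all
  have d: "AE x in lm 1. \<bar>(f m (x, t) - g (x, t))\<^sup>2\<bar> \<le> (2 * B)\<^sup>2"
    if "AE x in lm 1. \<bar>f m (x, t)\<bar> \<le> B" "AE x in lm 1. \<bar>g (x, t)\<bar> \<le> B" for m t
    using that
  proof eventually_elim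
    fix x assume "\<bar>f m (x, t)\<bar> \<le> B" "\<bar>g (x, t)\<bar> \<le> B"
    then have "\<bar>f m (x, t) - g (x, t)\<bar> \<le> \<bar>2 * B\<bar>" by linarith
    then show "\<bar>(f m (x, t) - g (x, t))\<^sup>2\<bar> \<le> (2 * B)\<^sup>2" unfolding abs_le_square_iff by simp
  qed
  have "(\<lambda>m. \<integral>t. (\<integral>x. (f m (x, t) - g (x, t))\<^sup>2 \<partial>lm 1) \<partial>lm S) \<longlonglongrightarrow> (\<integral>t. 0 \<partial>lm S)"
  proof (rule integral_dominated_convergence[where w="\<lambda>_. (2 * B)\<^sup>2"])
    show "(\<lambda>t. \<integral>x. (f m (x, t) - g (x, t))\<^sup>2 \<partial>lm 1) \<in> borel_measurable (lm S)" for m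
      by (rule borel_measurable_integrable[OF mq_integral_iterated(3)[OF i]])
    show "integrable (lm S) (\<lambda>_. (2 * B)\<^sup>2)" by simp
    show "AE t in lm S. norm (\<integral>x. (f m (x, t) - g (x, t))\<^sup>2 \<partial>lm 1) \<le> (2 * B)\<^sup>2" for m
      using bf[of m] bg
    proof eventually_elim
      fix t assume b: "AE x in lm 1. \<bar>f m (x, t)\<bar> \<le> B" "AE x in lm 1. \<bar>g (x, t)\<bar> \<le> B"
      have "norm (\<integral>x. (f m (x, t) - g (x, t))\<^sup>2 \<partial>lm 1) \<le> (\<integral>x. \<bar>(f m (x, t) - g (x, t))\<^sup>2\<bar> \<partial>lm 1)"
        unfolding real_norm_def by (rule integral_abs_bound)
      also have "\<dots> \<le> (\<integral>x. (2 * B)\<^sup>2 \<partial>lm 1)"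
        by (rule integral_mono_AE[OF integrable_abs[OF integrable_bounded_finite[OF finite_measure_lm _ d[OF b]]] _ d[OF b]]) simp_all
      also have "\<dots> = (2 * B)\<^sup>2" using measure_lm[of 1] by simp
      finally show "norm (\<integral>x. (f m (x, t) - g (x, t))\<^sup>2 \<partial>lm 1) \<le> (2 * B)\<^sup>2" .
    qed
    have "AE t in lm S. \<forall>m. AE x in lm 1. \<bar>f m (x, t)\<bar> \<le> B" unfolding AE_all_countable using bf by (rule allI)
    then show "AE t in lm S. (\<lambda>m. \<integral>x. (f m (x, t) - g (x, t))\<^sup>2 \<partial>lm 1) \<longlonglongrightarrow> 0"
      using bg lim
    proof eventually_elim
      fix t assume b: "\<forall>m. AE x in lm 1. \<bar>f m (x, t)\<bar> \<le> B" "AE x in lm 1. \<bar>g (x, t)\<bar> \<le> B"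
        and l: "AE x in lm 1. (\<lambda>m. f m (x, t)) \<longlonglongrightarrow> g (x, t)"
      have "(\<lambda>m. \<integral>x. (f m (x, t) - g (x, t))\<^sup>2 \<partial>lm 1) \<longlonglongrightarrow> (\<integral>x. 0 \<partial>lm 1)"
      proof (rule integral_dominated_convergence[where w="\<lambda>_. (2 * B)\<^sup>2"])
        show "AE x in lm 1. (\<lambda>m. (f m (x, t) - g (x, t))\<^sup>2) \<longlonglongrightarrow> 0"
          using l
        proof eventually_elim
          fix x assume "(\<lambda>m. f m (x, t)) \<longlonglongrightarrow> g (x, t)"
          then have "(\<lambda>m. (f m (x, t) - g (x, t))\<^sup>2) \<longlonglongrightarrow> (g (x, t) - g (x, t))\<^sup>2" by (intro tendsto_intros)
          then show "(\<lambda>m. (f m (x, t) - g (x, t))\<^sup>2) \<longlonglongrightarrow> 0" by simp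
        qed
        show "AE x in lm 1. norm ((f m (x, t) - g (x, t))\<^sup>2) \<le> (2 * B)\<^sup>2" for m
          unfolding real_norm_def by (rule d[OF b(1)[THEN spec] b(2)])
      qed simp_all
      then show "(\<lambda>m. \<integral>x. (f m (x, t) - g (x, t))\<^sup>2 \<partial>lm 1) \<longlonglongrightarrow> 0" by simp
    qed
  qed simp
  then show ?thesis unfolding mq_integral_iterated(1)[OF i] by simp
qed

lemma tendsto_L2I:
  assumes [measurable]: "\<And>m. f m \<in> borel_measurable borel" "g \<in> borel_measurable borel"
    and ae: "\<And>m. AE z in mq S. F m z = f m z"
    and i: "\<And>m. integrable (mq S) (\<lambda>z. (f m z)\<^sup>2)" "integrable (mq S) (\<lambda>z. (g z)\<^sup>2)"
    and lim: "(\<lambda>m. \<integral>z. (f m z - g z)\<^sup>2 \<partial>mq S) \<longlonglongrightarrow> 0"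
  shows "tendsto_L2 S F g"
proof -
  have "(LINT z:QT S|lebesgue. (F m z - g z)\<^sup>2) = (\<integral>z. (f m z - g z)\<^sup>2 \<partial>mq S)" for m
  proof (rule set_integral_AE_mq(1))
    show "AE z in mq S. (F m z - g z)\<^sup>2 = (f m z - g z)\<^sup>2" using ae[of m] by eventually_elim simp
  qed measurable
  moreover have "(\<lambda>m. sqrt (\<integral>z. (f m z - g z)\<^sup>2 \<partial>mq S)) \<longlonglongrightarrow> 0"
    using tendsto_real_sqrt[OF lim] by simp
  moreover have "L2_on (QT S) (F m)" for m by (rule L2_on_mq[OF _ ae i(1)]) simp
  moreover have "L2_on (QT S) g" by (rule L2_on_mq[of g, OF _ _ i(2)]) simp_all
  ultimately show ?thesis unfolding tendsto_L2_def by simp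
qed

context convergent_sequence
begin

interpretation a: approximate_solution d C "\<delta> m" "uh m" "gh m" "ub m" "Ph m" "Qh m" "Pb m" "q0 m" "q1 m" for m
  by (rule approximates)

lemma AE_inside: "AE t in lm T. 0 < t \<and> t < T"
  by (rule AE_lm_I) simp

lemma squares_integrable:
  "integrable (mq T) (\<lambda>z. (U s z)\<^sup>2)" "integrable (mq T) (\<lambda>z. (\<Phi> z)\<^sup>2)" "integrable (mq T) (\<lambda>z. (Q z)\<^sup>2)"
  by (rule integrable_bounded_sq[OF finite_measure_mq _ mq_bounds(1)], simp,
      rule integrable_bounded_sq[OF finite_measure_mq _ mq_bounds(4)], simp,
      rule integrable_bounded_sq[OF finite_measure_mq _ mq_bounds(3)], simp)

text \<open>The distance to the affine reconstruction is at most
  \<open>\<delta> m * \<bar>gh m s\<bar>\<close>, which tends to 0 almost everywhere because its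
  integrals are summable.\<close>

lemma limit_ub:
  assumes F: "\<And>m. AE z in mq T. F m z = ub m s z"
  shows "tendsto_L2 T F (U s)"
proof -
  have gd: "AE z in mq T. (\<lambda>m. \<delta> m * \<bar>gh m s z\<bar>) \<longlonglongrightarrow> 0"
  proof (rule AE_seq_0[where C="T + C"])
    show "integrable (mq T) (\<lambda>z. \<delta> m * \<bar>gh m s z\<bar>)" for m by (intro integrable_mult_right gh_mq_integrable(2))
    show "0 \<le> \<delta> m * \<bar>gh m s z\<bar>" for m z using a.delta_nonneg by simp
    have "(\<integral>z. \<delta> m * \<bar>gh m s z\<bar> \<partial>mq T) \<le> (1/2)^m * (T + C)" for m
      unfolding integral_mult_right_zero
      using a.delta_nonneg delta_small gh_mq_integrable(3) by (intro mult_mono Bochner_Integration.integral_nonneg) auto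
    then show "(\<integral>z. \<delta> m * \<bar>gh m s z\<bar> \<partial>mq T) \<le> (T + C) * (1/2)^m" for m by (simp only: mult.commute)
  qed
  have b1: "AE t in lm T. AE x in lm 1. \<bar>ub m s (x, t)\<bar> \<le> C + Cu" for m
    using AE_inside
  proof eventually_elim
    fix t assume t: "0 < t \<and> t < T"
    show "AE x in lm 1. \<bar>ub m s (x, t)\<bar> \<le> C + Cu" using a.ub_bound[OF t[THEN conjunct1] t[THEN conjunct2], of m s]
      by eventually_elim (use Cu_pos in linarith)
  qed
  have b2: "AE t in lm T. AE x in lm 1. \<bar>U s (x, t)\<bar> \<le> C + Cu"
    using AE_mq_slice[OF mq_bounds(1)[of s]]
  proof eventually_elim
    fix t assume "AE x in lm 1. \<bar>U s (x, t)\<bar> \<le> Cu"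
    then show "AE x in lm 1. \<bar>U s (x, t)\<bar> \<le> C + Cu" by eventually_elim (use C_nonneg in linarith)
  qed
  have "(\<lambda>m. \<integral>z. (ub m s z - U s z)\<^sup>2 \<partial>mq T) \<longlonglongrightarrow> 0"
  proof (rule mq_square_limit[OF _ _ b1 b2])
    show "AE t in lm T. AE x in lm 1. (\<lambda>m. ub m s (x, t)) \<longlonglongrightarrow> U s (x, t)"
      using AE_good AE_mq_slice[OF gd]
    proof eventually_elim
      fix t assume g: "good t" and l: "AE x in lm 1. (\<lambda>m. \<delta> m * \<bar>gh m s (x, t)\<bar>) \<longlonglongrightarrow> 0"
      have "AE x in lm 1. \<forall>m. \<bar>uh m s (x, t) - ub m s (x, t)\<bar> \<le> \<delta> m * \<bar>gh m s (x, t)\<bar>"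
        unfolding AE_all_countable by (intro allI a.uh_ub goodD[OF g])
      moreover have "AE x in lm 1. 0 < x \<and> x < 1" by (rule AE_lm_I) simp
      ultimately show "AE x in lm 1. (\<lambda>m. ub m s (x, t)) \<longlonglongrightarrow> U s (x, t)"
        using l
      proof eventually_elim
        fix x assume c: "\<forall>m. \<bar>uh m s (x, t) - ub m s (x, t)\<bar> \<le> \<delta> m * \<bar>gh m s (x, t)\<bar>" and x: "0 < x \<and> x < 1"
          and l: "(\<lambda>m. \<delta> m * \<bar>gh m s (x, t)\<bar>) \<longlonglongrightarrow> 0"
        have "(\<lambda>m. uh m s (x, t) - ub m s (x, t)) \<longlonglongrightarrow> 0"
          by (rule Lim_null_comparison[OF _ l]) (use c in auto)
        then have "(\<lambda>m. uh m s (x, t) - (uh m s (x, t) - ub m s (x, t))) \<longlonglongrightarrow> U s (x, t) - 0"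
          by (intro tendsto_diff goodD(3)[OF g]) (use x in auto)
        then show "(\<lambda>m. ub m s (x, t)) \<longlonglongrightarrow> U s (x, t)" by simp
      qed
    qed
  qed (simp_all add: a.borel)
  then show ?thesis
    by (intro tendsto_L2I[OF a.borel(3) U_borel F _ squares_integrable(1)] integrable_bounded_sq[OF finite_measure_mq _ AE_mq_le[OF a.borel(3) b1]]) (simp_all add: a.borel)
qed

lemma limit_Pb:
  assumes F: "\<And>m. AE z in mq T. F m z = Pb m z"
  shows "tendsto_L2 T F \<Phi>"
proof -
  have dl: "\<delta> m \<le> 1" for m using delta_small[of m] power_le_one[of "1/2::real" m] by simp
  have b1: "AE t in lm T. AE x in lm 1. \<bar>Pb m (x, t)\<bar> \<le> CP + 1" for m
    using AE_inside
  proof eventually_elim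
    fix t assume t: "0 < t \<and> t < T"
    have "AE x in lm 1. 0 < x \<and> x < 1" by (rule AE_lm_I) simp
    then show "AE x in lm 1. \<bar>Pb m (x, t)\<bar> \<le> CP + 1" using a.Ph_Pb[OF t[THEN conjunct1] t[THEN conjunct2], of m]
    proof eventually_elim
      fix x assume x: "0 < x \<and> x < 1" and "\<bar>Ph m (x, t) - Pb m (x, t)\<bar> \<le> \<delta> m"
      moreover have "\<bar>Ph m (x, t)\<bar> \<le> CP" by (rule a.Ph_bound) (use t x in auto)
      ultimately show "\<bar>Pb m (x, t)\<bar> \<le> CP + 1" using dl[of m] by linarith
    qed
  qed
  have b2: "AE t in lm T. AE x in lm 1. \<bar>\<Phi> (x, t)\<bar> \<le> CP + 1"
    using AE_mq_slice[OF mq_bounds(4)]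
  proof eventually_elim
    fix t assume "AE x in lm 1. \<bar>\<Phi> (x, t)\<bar> \<le> CP"
    then show "AE x in lm 1. \<bar>\<Phi> (x, t)\<bar> \<le> CP + 1" by eventually_elim linarith
  qed
  have "(\<lambda>m. \<integral>z. (Pb m z - \<Phi> z)\<^sup>2 \<partial>mq T) \<longlonglongrightarrow> 0"
  proof (rule mq_square_limit[OF _ _ b1 b2])
    show "AE t in lm T. AE x in lm 1. (\<lambda>m. Pb m (x, t)) \<longlonglongrightarrow> \<Phi> (x, t)"
      using AE_inside
    proof eventually_elim
      fix t assume "0 < t \<and> t < T"
      then have t: "0 < t" "t < T" by simp_all
      have "AE x in lm 1. \<forall>m. \<bar>Ph m (x, t) - Pb m (x, t)\<bar> \<le> \<delta> m"
        unfolding AE_all_countable by (intro allI a.Ph_Pb t)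
      moreover have "AE x in lm 1. 0 < x \<and> x < 1" by (rule AE_lm_I) simp
      ultimately show "AE x in lm 1. (\<lambda>m. Pb m (x, t)) \<longlonglongrightarrow> \<Phi> (x, t)"
      proof eventually_elim
        fix x assume c: "\<forall>m. \<bar>Ph m (x, t) - Pb m (x, t)\<bar> \<le> \<delta> m" and x: "0 < x \<and> x < 1"
        have "(\<lambda>m. Ph m (x, t) - Pb m (x, t)) \<longlonglongrightarrow> 0"
          by (rule Lim_null_comparison[OF _ delta_0]) (use c in auto)
        then have "(\<lambda>m. Ph m (x, t) - (Ph m (x, t) - Pb m (x, t))) \<longlonglongrightarrow> \<Phi> (x, t) - 0"
          by (intro tendsto_diff Ph_limit t) (use x in auto)
        then show "(\<lambda>m. Pb m (x, t)) \<longlonglongrightarrow> \<Phi> (x, t)" by simp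
      qed
    qed
  qed (simp_all add: a.borel)
  then show ?thesis
    by (intro tendsto_L2I[OF a.borel(6) \<Phi>_borel F _ squares_integrable(2)] integrable_bounded_sq[OF finite_measure_mq _ AE_mq_le[OF a.borel(6) b1]]) (simp_all add: a.borel)
qed

lemma limit_L2H1: "L2H1_deriv T (U s) (v s)" "L2H1_deriv T \<Phi> Q"
proof -
  show "L2H1_deriv T (U s) (v s)"
  proof (rule L2H1_deriv_prim[where c="\<lambda>t. U s (0, t)"])
    show "AE t in lm T. AE x in lm 1. U s (x, t) = U s (0, t) + prim 1 (\<lambda>y. v s (y, t)) x"
      using v_good[of s]
    proof eventually_elim
      fix t assume h: "good t \<and> integrable (lm 1) (\<lambda>x. (v s (x, t))\<^sup>2) \<and> (\<forall>x\<in>{0..1}. U s (x, t) = U s (0, t) + prim 1 (\<lambda>y. v s (y, t)) x)"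
      show "AE x in lm 1. U s (x, t) = U s (0, t) + prim 1 (\<lambda>y. v s (y, t)) x"
        by (rule AE_lm_I) (rule h[THEN conjunct2, THEN conjunct2, THEN bspec], simp)
    qed
  qed (simp_all add: squares_integrable v_sq)
  show "L2H1_deriv T \<Phi> Q"
  proof (rule L2H1_deriv_prim[where c="\<lambda>t. \<Phi> (0, t)"])
    show "AE t in lm T. AE x in lm 1. \<Phi> (x, t) = \<Phi> (0, t) + prim 1 (\<lambda>y. Q (y, t)) x"
      by (intro AE_I2 \<Phi>_prim)
  qed (simp_all add: squares_integrable)
qed

text \<open>At times where \<open>U\<close> is a primitive of \<open>v\<close> it is its own
  continuous representative on \<open>[0,1]\<close>.\<close>

lemma trace_U: "AE t in lm T. \<forall>p\<in>{0, 1}. tr (U s) p t = U s (p, t)"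
  using v_good[of s]
proof eventually_elim
  fix t assume h: "good t \<and> integrable (lm 1) (\<lambda>x. (v s (x, t))\<^sup>2) \<and> (\<forall>x\<in>{0..1}. U s (x, t) = U s (0, t) + prim 1 (\<lambda>y. v s (y, t)) x)"
  note e = h[THEN conjunct2, THEN conjunct2, THEN bspec] and i = v_slice_integrable[OF h[THEN conjunct2, THEN conjunct1]]
  have "continuous_on {0..1} (\<lambda>x. U s (0, t) + prim 1 (\<lambda>y. v s (y, t)) x)"
    by (intro continuous_intros continuous_on_subset[OF prim_continuous[OF i]]) simp
  moreover have "AE x in lm 1. U s (x, t) = U s (0, t) + prim 1 (\<lambda>y. v s (y, t)) x"
    by (rule AE_lm_I) (rule e, simp)
  ultimately have "tr (U s) p t = U s (0, t) + prim 1 (\<lambda>y. v s (y, t)) p" if "p \<in> {0..1}" for p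
    using that by (rule trace01_eq)
  then show "\<forall>p\<in>{0, 1}. tr (U s) p t = U s (p, t)" using e[symmetric] by simp
qed

lemma trace_\<Phi>: "0 < t \<Longrightarrow> t < T \<Longrightarrow> p \<in> {0, 1} \<Longrightarrow> tr \<Phi> p t = \<Phi> (p, t)"
proof -
  assume t: "0 < t" "t < T" and p: "p \<in> {0, 1}"
  have c: "continuous_on {0..1} (\<lambda>x. \<Phi> (0, t) + prim 1 (\<lambda>y. Q (y, t)) x)"
    by (intro continuous_intros continuous_on_subset[OF prim_continuous[OF Q_integrable[OF t]]]) simp
  have "tr \<Phi> p t = \<Phi> (0, t) + prim 1 (\<lambda>y. Q (y, t)) p"
    by (rule trace01_eq[OF c]) (intro AE_I2 \<Phi>_prim, use p in auto)
  then show ?thesis using \<Phi>_prim[of p t] by (rule trans[OF _ sym])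
qed

lemma limit_Linf: "Linf_on (QT T) (U s)" "Linf_on (QT T) \<Phi>"
  unfolding Linf_on_def
  by (intro conjI set_integral_AE_mq(2)[OF U_borel[of s]] exI[of _ Cu] mq_bounds(1)[unfolded AE_mq_lebesgue]; simp)
     (intro conjI set_integral_AE_mq(2)[OF \<Phi>_borel] exI[of _ CP] mq_bounds(4)[unfolded AE_mq_lebesgue]; simp)

lemma limit_equation:
  assumes p: "test_fun_QT T \<phi>"
  shows "- eps_of d s * (LINT z:QT T|lebesgue. U s z * frechet_derivative \<phi> (at z) (0, 1))
        - eps_of d s * (LINT x:{0<..<1}|lebesgue. u_init d s x * \<phi> (x, 0))
        - (LINT z:QT T|lebesgue. (- v s z - z_of s * U s z * Q z) * frechet_derivative \<phi> (at z) (1, 0))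
        + (LINT t:{0<..<T}|lebesgue.
             (beta d s 1 (V_pot d - tr \<Phi> 1 t) * tr (U s) 1 t - gamma1 d s (V_pot d - tr \<Phi> 1 t)) * \<phi> (1, t)
           + (beta d s 0 (tr \<Phi> 0 t) * tr (U s) 0 t - gamma0 d s (tr \<Phi> 0 t)) * \<phi> (0, t)) = 0"
proof -
  note sm = test_fun_QT_mixed(1-3)[OF p T_pos]
  note [measurable] = smooth_borel[OF sm(1)] smooth_borel[OF sm(2)] smooth_borel[OF sm(3)] slice_borel[OF smooth_borel[OF sm(1)]]
  have 1: "(LINT z:QT T|lebesgue. U s z * frechet_derivative \<phi> (at z) (0, 1)) = (\<integral>z. U s z * frechet_derivative \<phi> (at z) (0, 1) \<partial>mq T)"
    by (rule integral_mq(1)) measurable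
  have 2: "(LINT x:{0<..<1}|lebesgue. u_init d s x * \<phi> (x, 0)) = (\<integral>x. \<phi> (x, 0) * u0 s x \<partial>lm 1)"
  proof (rule set_integral_AE_lm(1))
    have "AE x in lm 1. u_init d s x = u0 s x" unfolding AE_lm by (rule u0(2))
    then show "AE x in lm 1. u_init d s x * \<phi> (x, 0) = \<phi> (x, 0) * u0 s x" by eventually_elim simp
  qed measurable
  have 3: "(LINT z:QT T|lebesgue. (- v s z - z_of s * U s z * Q z) * frechet_derivative \<phi> (at z) (1, 0))
    = - (\<integral>z. frechet_derivative \<phi> (at z) (1, 0) * (v s z + z_of s * (Q z * U s z)) \<partial>mq T)"
  proof -
    have "(LINT z:QT T|lebesgue. (- v s z - z_of s * U s z * Q z) * frechet_derivative \<phi> (at z) (1, 0))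
      = (\<integral>z. (- v s z - z_of s * U s z * Q z) * frechet_derivative \<phi> (at z) (1, 0) \<partial>mq T)"
      by (rule integral_mq(1)) measurable
    also have "\<dots> = (\<integral>z. - (frechet_derivative \<phi> (at z) (1, 0) * (v s z + z_of s * (Q z * U s z))) \<partial>mq T)"
      by (rule Bochner_Integration.integral_cong) (simp_all add: algebra_simps)
    finally show ?thesis by (simp only: integral_minus)
  qed
  have 4: "(LINT t:{0<..<T}|lebesgue.
             (beta d s 1 (V_pot d - tr \<Phi> 1 t) * tr (U s) 1 t - gamma1 d s (V_pot d - tr \<Phi> 1 t)) * \<phi> (1, t)
           + (beta d s 0 (tr \<Phi> 0 t) * tr (U s) 0 t - gamma0 d s (tr \<Phi> 0 t)) * \<phi> (0, t))
      = (\<integral>t. \<phi> (1, t) * B1 s t + \<phi> (0, t) * B0 s t \<partial>lm T)"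
  proof (rule set_integral_AE_lm(1))
    show "AE t in lm T. (beta d s 1 (V_pot d - tr \<Phi> 1 t) * tr (U s) 1 t - gamma1 d s (V_pot d - tr \<Phi> 1 t)) * \<phi> (1, t)
           + (beta d s 0 (tr \<Phi> 0 t) * tr (U s) 0 t - gamma0 d s (tr \<Phi> 0 t)) * \<phi> (0, t) = \<phi> (1, t) * B1 s t + \<phi> (0, t) * B0 s t"
      using trace_U[of s] AE_inside
    proof eventually_elim
      fix t assume u: "\<forall>p\<in>{0, 1}. tr (U s) p t = U s (p, t)" and t: "0 < t \<and> t < T"
      have e: "tr \<Phi> 0 t = \<Phi> (0, t)" "tr \<Phi> 1 t = \<Phi> (1, t)" "tr (U s) 0 t = U s (0, t)" "tr (U s) 1 t = U s (1, t)"
        using trace_\<Phi>[of t] t u by simp_all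
      show "(beta d s 1 (V_pot d - tr \<Phi> 1 t) * tr (U s) 1 t - gamma1 d s (V_pot d - tr \<Phi> 1 t)) * \<phi> (1, t)
           + (beta d s 0 (tr \<Phi> 0 t) * tr (U s) 0 t - gamma0 d s (tr \<Phi> 0 t)) * \<phi> (0, t) = \<phi> (1, t) * B1 s t + \<phi> (0, t) * B0 s t"
        unfolding e B0_def B1_def by (simp only: mult.commute)
    qed
  qed measurable
  have 5: "(\<integral>t. \<phi> (1, t) * B1 s t + \<phi> (0, t) * B0 s t \<partial>lm T) = (\<integral>t. \<phi> (1, t) * B1 s t \<partial>lm T) + (\<integral>t. \<phi> (0, t) * B0 s t \<partial>lm T)"
    by (rule Bochner_Integration.integral_add) (auto intro!: smooth_B_integrable sm(1))
  show ?thesis unfolding 1 2 3 4 5 using integral_U_test[OF p, of s] by linarith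
qed

text \<open>At almost every time this is one integration by parts of \<open>\<lambda>^2 Q\<close>,
  whose derivative is minus the charge, against \<open>w\<close>. The Robin conditions identify the
  boundary coefficients: \<open>k1\<close> is \<open>\<lambda>^2 Q\<close> at 1, and
  \<open>k0\<close> is \<open>\<lambda>^2 q\<close>.\<close>

lemma limit_Poisson:
  assumes L: "L2H1_deriv T \<phi> \<phi>'"
  shows "(lam d)\<^sup>2 * (LINT z:QT T|lebesgue. Q z * \<phi>' z)
        - (LINT t:{0<..<T}|lebesgue. (lam d)\<^sup>2 / alpha1 d * (V_pot d - tr \<Phi> 1 t - dPsi_pzc1 d) * tr \<phi> 1 t)
        + (LINT t:{0<..<T}|lebesgue. (lam d)\<^sup>2 / alpha0 d * (tr \<Phi> 0 t - dPsi_pzc0 d) * tr \<phi> 0 t)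
        = (LINT z:QT T|lebesgue. (3 * U SpP z - U SpN z + rho_hl d) * \<phi> z)"
proof -
  obtain w w' c where w [measurable]: "w \<in> borel_measurable borel" and w' [measurable]: "w' \<in> borel_measurable borel"
    and ew: "AE z in mq T. \<phi> z = w z" "AE z in mq T. \<phi>' z = w' z"
    and w2: "integrable (mq T) (\<lambda>z. (w z)\<^sup>2)" "integrable (mq T) (\<lambda>z. (w' z)\<^sup>2)"
    and c [measurable]: "c \<in> borel_measurable borel" and ci: "integrable (lm T) c"
    and sl: "AE t in lm T. (AE x in lm 1. w (x, t) = c t + prim 1 (\<lambda>y. w' (y, t)) x) \<and>
      integrable (lm 1) (\<lambda>x. w (x, t)) \<and> integrable (lm 1) (\<lambda>x. w' (x, t)) \<and>
      tr \<phi> 0 t = c t \<and> tr \<phi> 1 t = c t + (\<integral>x. w' (x, t) \<partial>lm 1)"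
    by (rule L2H1_derivE[OF L]) (rule that)
  have iw: "integrable (mq T) w" by (rule sq_integrable_imp_integrable[OF finite_measure_mq _ w2(1)]) simp
  have iw': "integrable (mq T) w'" by (rule sq_integrable_imp_integrable[OF finite_measure_mq _ w2(2)]) simp
  let ?\<rho> = "\<lambda>z. 3 * U SpP z - U SpN z + rho_hl d"
  have \<rho>b: "AE z in mq T. \<bar>?\<rho> z\<bar> \<le> 4 * Cu + \<bar>rho_hl d\<bar>"
    using mq_bounds(1)[of SpP] mq_bounds(1)[of SpN] by eventually_elim linarith
  have m\<rho>: "?\<rho> \<in> borel_measurable borel" by measurable
  have iq: "integrable (mq T) (\<lambda>z. Q z * w' z)" by (rule integrable_mult_bounded(2)[OF iw' _ mq_bounds(3)]) simp
  have i\<rho>: "integrable (mq T) (\<lambda>z. ?\<rho> z * w z)" by (rule integrable_mult_bounded(2)[OF iw _ \<rho>b]) simp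
  define k1 where "k1 t = (lam d)\<^sup>2 / alpha1 d * (V_pot d - \<Phi> (1, t) - dPsi_pzc1 d)" for t
  define k0 where "k0 t = (lam d)\<^sup>2 / alpha0 d * (\<Phi> (0, t) - dPsi_pzc0 d)" for t
  have [measurable]: "k1 \<in> borel_measurable borel" "k0 \<in> borel_measurable borel" unfolding k1_def[abs_def] k0_def[abs_def] by measurable
  have m: "(\<lambda>t. \<integral>x. w' (x, t) \<partial>lm 1) \<in> borel_measurable borel"
    using borel_measurable_integrable[OF mq_integral_iterated(3)[OF iw']] by simp
  define c1 where "c1 t = c t + (\<integral>x. w' (x, t) \<partial>lm 1)" for t
  have [measurable]: "c1 \<in> borel_measurable borel" unfolding c1_def[abs_def] using m by measurable
  have ic1: "integrable (lm T) c1" unfolding c1_def[abs_def] by (intro Bochner_Integration.integrable_add ci mq_integral_iterated(3)[OF iw'])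
  have ik1: "integrable (lm T) (\<lambda>t. k1 t * c1 t)"
  proof (rule integrable_mult_bounded(2)[OF ic1])
    show "AE t in lm T. \<bar>k1 t\<bar> \<le> (lam d)\<^sup>2 / alpha1 d * (\<bar>V_pot d\<bar> + CP + \<bar>dPsi_pzc1 d\<bar>)"
      using AE_inside
    proof eventually_elim
      fix t assume t: "0 < t \<and> t < T"
      have "\<bar>V_pot d - \<Phi> (1, t) - dPsi_pzc1 d\<bar> \<le> \<bar>V_pot d\<bar> + CP + \<bar>dPsi_pzc1 d\<bar>"
        using \<Phi>_bound[of t 1] t by linarith
      then show "\<bar>k1 t\<bar> \<le> (lam d)\<^sup>2 / alpha1 d * (\<bar>V_pot d\<bar> + CP + \<bar>dPsi_pzc1 d\<bar>)"
        unfolding k1_def abs_mult using alpha1_pos by (simp add: divide_right_mono mult_left_mono)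
    qed
  qed simp
  have ik0: "integrable (lm T) (\<lambda>t. k0 t * c t)"
  proof (rule integrable_mult_bounded(2)[OF ci])
    show "AE t in lm T. \<bar>k0 t\<bar> \<le> (lam d)\<^sup>2 / alpha0 d * (CP + \<bar>dPsi_pzc0 d\<bar>)"
      using AE_inside
    proof eventually_elim
      fix t assume t: "0 < t \<and> t < T"
      have "\<bar>\<Phi> (0, t) - dPsi_pzc0 d\<bar> \<le> CP + \<bar>dPsi_pzc0 d\<bar>"
        using \<Phi>_bound[of t 0] t by linarith
      then show "\<bar>k0 t\<bar> \<le> (lam d)\<^sup>2 / alpha0 d * (CP + \<bar>dPsi_pzc0 d\<bar>)"
        unfolding k0_def abs_mult using alpha0_pos by (simp add: divide_right_mono mult_left_mono)
    qed
  qed simp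
  have 1: "(LINT z:QT T|lebesgue. Q z * \<phi>' z) = (\<integral>t. \<integral>x. Q (x, t) * w' (x, t) \<partial>lm 1 \<partial>lm T)"
  proof -
    have "AE z in mq T. Q z * \<phi>' z = Q z * w' z" using ew(2) by eventually_elim simp
    then have "(LINT z:QT T|lebesgue. Q z * \<phi>' z) = (\<integral>z. Q z * w' z \<partial>mq T)" by (intro set_integral_AE_mq(1)) measurable
    then show ?thesis by (simp only: mq_integral_iterated(1)[OF iq])
  qed
  have 2: "(LINT t:{0<..<T}|lebesgue. (lam d)\<^sup>2 / alpha1 d * (V_pot d - tr \<Phi> 1 t - dPsi_pzc1 d) * tr \<phi> 1 t) = (\<integral>t. k1 t * c1 t \<partial>lm T)"
  proof (rule set_integral_AE_lm(1))
    show "AE t in lm T. (lam d)\<^sup>2 / alpha1 d * (V_pot d - tr \<Phi> 1 t - dPsi_pzc1 d) * tr \<phi> 1 t = k1 t * c1 t"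
      using sl AE_inside
    proof eventually_elim
      fix t assume h: "(AE x in lm 1. w (x, t) = c t + prim 1 (\<lambda>y. w' (y, t)) x) \<and>
        integrable (lm 1) (\<lambda>x. w (x, t)) \<and> integrable (lm 1) (\<lambda>x. w' (x, t)) \<and> tr \<phi> 0 t = c t \<and> tr \<phi> 1 t = c t + (\<integral>x. w' (x, t) \<partial>lm 1)"
        and t: "0 < t \<and> t < T"
      have e: "tr \<phi> 1 t = c1 t" using h unfolding c1_def by (elim conjE)
      have e': "tr \<Phi> 1 t = \<Phi> (1, t)" by (rule trace_\<Phi>) (use t in auto)
      show "(lam d)\<^sup>2 / alpha1 d * (V_pot d - tr \<Phi> 1 t - dPsi_pzc1 d) * tr \<phi> 1 t = k1 t * c1 t"
        unfolding e e' k1_def ..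
    qed
  qed measurable
  have 3: "(LINT t:{0<..<T}|lebesgue. (lam d)\<^sup>2 / alpha0 d * (tr \<Phi> 0 t - dPsi_pzc0 d) * tr \<phi> 0 t) = (\<integral>t. k0 t * c t \<partial>lm T)"
  proof (rule set_integral_AE_lm(1))
    show "AE t in lm T. (lam d)\<^sup>2 / alpha0 d * (tr \<Phi> 0 t - dPsi_pzc0 d) * tr \<phi> 0 t = k0 t * c t"
      using sl AE_inside
    proof eventually_elim
      fix t assume h: "(AE x in lm 1. w (x, t) = c t + prim 1 (\<lambda>y. w' (y, t)) x) \<and>
        integrable (lm 1) (\<lambda>x. w (x, t)) \<and> integrable (lm 1) (\<lambda>x. w' (x, t)) \<and> tr \<phi> 0 t = c t \<and> tr \<phi> 1 t = c t + (\<integral>x. w' (x, t) \<partial>lm 1)"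
        and t: "0 < t \<and> t < T"
      have e: "tr \<phi> 0 t = c t" using h by (elim conjE)
      have e': "tr \<Phi> 0 t = \<Phi> (0, t)" by (rule trace_\<Phi>) (use t in auto)
      show "(lam d)\<^sup>2 / alpha0 d * (tr \<Phi> 0 t - dPsi_pzc0 d) * tr \<phi> 0 t = k0 t * c t"
        unfolding e e' k0_def ..
    qed
  qed measurable
  have 4: "(LINT z:QT T|lebesgue. ?\<rho> z * \<phi> z) = (\<integral>t. \<integral>x. ?\<rho> (x, t) * w (x, t) \<partial>lm 1 \<partial>lm T)"
  proof -
    have "AE z in mq T. ?\<rho> z * \<phi> z = ?\<rho> z * w z" using ew(1) by eventually_elim simp
    then have "(LINT z:QT T|lebesgue. ?\<rho> z * \<phi> z) = (\<integral>z. ?\<rho> z * w z \<partial>mq T)" by (intro set_integral_AE_mq(1)) measurable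
    then show ?thesis by (simp only: mq_integral_iterated(1)[OF i\<rho>])
  qed
  have "(lam d)\<^sup>2 * (\<integral>t. \<integral>x. Q (x, t) * w' (x, t) \<partial>lm 1 \<partial>lm T) - (\<integral>t. k1 t * c1 t \<partial>lm T) + (\<integral>t. k0 t * c t \<partial>lm T)
    = (\<integral>t. (lam d)\<^sup>2 * (\<integral>x. Q (x, t) * w' (x, t) \<partial>lm 1) - k1 t * c1 t + k0 t * c t \<partial>lm T)"
  proof -
    note iQ = integrable_mult_right[OF mq_integral_iterated(3)[OF iq], of "(lam d)\<^sup>2"]
    show ?thesis
      by (subst Bochner_Integration.integral_add[OF Bochner_Integration.integrable_diff[OF iQ ik1] ik0],
          subst Bochner_Integration.integral_diff[OF iQ ik1], subst integral_mult_right_zero, rule refl)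
  qed
  also have "\<dots> = (\<integral>t. \<integral>x. ?\<rho> (x, t) * w (x, t) \<partial>lm 1 \<partial>lm T)"
  proof (rule integral_cong_AE)
    show "(\<lambda>t. (lam d)\<^sup>2 * (\<integral>x. Q (x, t) * w' (x, t) \<partial>lm 1) - k1 t * c1 t + k0 t * c t) \<in> borel_measurable (lm T)"
      by (intro borel_measurable_add borel_measurable_diff borel_measurable_integrable[OF ik1] borel_measurable_integrable[OF ik0]
          borel_measurable_times[OF borel_measurable_const] borel_measurable_integrable[OF mq_integral_iterated(3)[OF iq]])
    show "(\<lambda>t. \<integral>x. ?\<rho> (x, t) * w (x, t) \<partial>lm 1) \<in> borel_measurable (lm T)"
      by (rule borel_measurable_integrable[OF mq_integral_iterated(3)[OF i\<rho>]])
    show "AE t in lm T. (lam d)\<^sup>2 * (\<integral>x. Q (x, t) * w' (x, t) \<partial>lm 1) - k1 t * c1 t + k0 t * c t = (\<integral>x. ?\<rho> (x, t) * w (x, t) \<partial>lm 1)"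
      using sl AE_good
    proof eventually_elim
      fix t assume h: "(AE x in lm 1. w (x, t) = c t + prim 1 (\<lambda>y. w' (y, t)) x) \<and>
        integrable (lm 1) (\<lambda>x. w (x, t)) \<and> integrable (lm 1) (\<lambda>x. w' (x, t)) \<and> tr \<phi> 0 t = c t \<and> tr \<phi> 1 t = c t + (\<integral>x. w' (x, t) \<partial>lm 1)"
        and g: "good t"
      note t = goodD(1,2)[OF g]
      note a1 = h[THEN conjunct1] and i' = h[THEN conjunct2, THEN conjunct2, THEN conjunct1]
      let ?l = "(lam d)\<^sup>2"
      have l: "?l \<noteq> 0" using lam_pos by simp
      have ir: "integrable (lm 1) (\<lambda>x. ?\<rho> (x, t))"
        by (intro Bochner_Integration.integrable_add Bochner_Integration.integrable_diff integrable_mult_right U_integrable[OF g]) simp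
      have Spr: "?l * S (x, t) = prim 1 (\<lambda>y. ?\<rho> (y, t)) x" if x: "0 \<le> x" "x \<le> 1" for x
      proof -
        have i3: "integrable (lm 1) (\<lambda>y. 3 * U SpP (y, t))" by (intro integrable_mult_right U_integrable[OF g])
        have "prim 1 (\<lambda>y. ?\<rho> (y, t)) x = prim 1 (\<lambda>y. 3 * U SpP (y, t) - U SpN (y, t)) x + prim 1 (\<lambda>y. rho_hl d) x"
          by (rule prim_add) (intro Bochner_Integration.integrable_diff i3 U_integrable[OF g], simp)
        also have "prim 1 (\<lambda>y. 3 * U SpP (y, t) - U SpN (y, t)) x = 3 * prim 1 (\<lambda>y. U SpP (y, t)) x - prim 1 (\<lambda>y. U SpN (y, t)) x"
          by (subst prim_diff[OF i3 U_integrable[OF g]], subst prim_cmult, rule refl)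
        also have "prim 1 (\<lambda>y. rho_hl d) x = rho_hl d * x" by (rule prim_const[OF x])
        finally show ?thesis using l W_prim[OF g x] by (simp add: S_def)
      qed
      \<comment> \<open>Poisson equation in integrated form: \<open>\<lambda>^2 Q\<close> starts
        from \<open>\<lambda>^2 q\<close> and loses the charge accumulated up to
        \<open>x\<close>.\<close>
      have aq: "AE x in lm 1. ?l * Q (x, t) = ?l * q t + prim 1 (\<lambda>y. (- 1) * ?\<rho> (y, t)) x"
      proof (rule AE_lm_I)
        fix x :: real assume x: "0 < x" "x < 1"
        have e: "prim 1 (\<lambda>y. ?\<rho> (y, t)) x = ?l * S (x, t)" by (rule Spr[symmetric]) (use x in auto)
        show "?l * Q (x, t) = ?l * q t + prim 1 (\<lambda>y. (- 1) * ?\<rho> (y, t)) x"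
          unfolding prim_cmult e Q_def snd_conv by (simp add: right_diff_distrib)
      qed
      have q1: "?l * q t + integral\<^sup>L (lm 1) (\<lambda>x. (- 1) * ?\<rho> (x, t)) = ?l * Q (1, t)"
      proof -
        have e: "integral\<^sup>L (lm 1) (\<lambda>x. ?\<rho> (x, t)) = ?l * S (1, t)"
          using Spr[of 1] prim_end[of "\<lambda>y. ?\<rho> (y, t)" 1] by simp
        show ?thesis unfolding integral_mult_right_zero e Q_def snd_conv by (simp add: right_diff_distrib)
      qed
      have mq: "(\<lambda>x. ?l * Q (x, t)) \<in> borel_measurable borel" by measurable
      have "(\<integral>x. (- 1) * ?\<rho> (x, t) * w (x, t) \<partial>lm 1) = (?l * Q (1, t)) * c1 t - ?l * q t * c t - (\<integral>x. ?l * Q (x, t) * w' (x, t) \<partial>lm 1)"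
        using ibp(1)[OF integrable_mult_right[OF ir, of "- 1"] i' aq a1 mq slice_borel(1)[OF w]] unfolding q1 c1_def .
      moreover have "(\<integral>x. (- 1) * ?\<rho> (x, t) * w (x, t) \<partial>lm 1) = - (\<integral>x. ?\<rho> (x, t) * w (x, t) \<partial>lm 1)"
        unfolding integral_minus[symmetric] by (rule Bochner_Integration.integral_cong) (simp_all add: algebra_simps)
      moreover have "(\<integral>x. ?l * Q (x, t) * w' (x, t) \<partial>lm 1) = ?l * (\<integral>x. Q (x, t) * w' (x, t) \<partial>lm 1)"
        by (subst integral_mult_right_zero[symmetric]) (simp only: mult.assoc)
      moreover have "k1 t = ?l * Q (1, t)" unfolding k1_def \<Phi>_1[OF t] using alpha1_pos by (simp add: Q_def field_simps)
      moreover have "k0 t = ?l * q t" unfolding k0_def \<Phi>_0 using alpha0_pos by simp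
      ultimately show "?l * (\<integral>x. Q (x, t) * w' (x, t) \<partial>lm 1) - k1 t * c1 t + k0 t * c t = (\<integral>x. ?\<rho> (x, t) * w (x, t) \<partial>lm 1)"
        by (simp only:)
    qed
  qed
  finally show ?thesis unfolding 1 2 3 4 .
qed

theorem limit_weak_solution: "weak_solution d U \<Phi>"
  unfolding weak_solution_def
  by (intro exI[of _ v] exI[of _ Q] conjI allI impI limit_L2H1 limit_Linf limit_equation limit_Poisson)

end

section \<open>Convergence of the scheme\<close>

theorem theorem1p1:
  fixes d :: corrosion_data
    and M :: "nat \<Rightarrow> mesh" and K :: "nat \<Rightarrow> nat"
    and u :: "nat \<Rightarrow> species \<Rightarrow> nat \<Rightarrow> nat \<Rightarrow> real" and \<Psi> :: "nat \<Rightarrow> nat \<Rightarrow> nat \<Rightarrow> real"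
  assumes "t_end d > 0" and "lam d > 0" and "eps d > 0" and "alpha0 d > 0" and "alpha1 d > 0"
    and "\<And>s. u_max d s > 0"
    and "\<And>s i. i \<in> {0, 1} \<Longrightarrow> m_c d s i > 0 \<and> k_c d s i > 0"
    and "\<And>s i. i \<in> {0, 1} \<Longrightarrow> a_c d s i \<in> {0..1} \<and> b_c d s i \<in> {0..1}"
    and "a_c d SpP 0 > 0" and "a_c d SpN 0 > 0" and "b_c d SpP 1 > 0" and "b_c d SpN 1 > 0"
    and "\<And>s. Linf_on {0<..<1} (u_init d s)"
    and "\<And>s. AE x in lebesgue. x \<in> {0<..<1} \<longrightarrow> 0 \<le> u_init d s x \<and> u_init d s x \<le> u_max d s"
    and "3 * u_max d SpP - u_max d SpN + rho_hl d = 0"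
    and "- (1 / (3 * a_c d SpP 0)) * (1 + ln (alpha0 d * a_c d SpP 0 * k_c d SpP 0)) \<le> dPsi_pzc0 d"
    and "dPsi_pzc0 d \<le> 1 / a_c d SpN 0 * (1 + ln (alpha0 d * a_c d SpN 0 * k_c d SpN 0))"
    and "- (1 / b_c d SpN 1) * (1 + ln (alpha1 d * b_c d SpN 1 * m_c d SpN 1)) \<le> dPsi_pzc1 d"
    and "dPsi_pzc1 d \<le> 1 / (3 * b_c d SpP 1) * (1 + ln (alpha1 d * b_c d SpP 1 * m_c d SpP 1))"
    and "\<And>m. is_mesh (M m)" and "\<And>m. K m \<ge> 1"
    and "(\<lambda>m. mesh_size (M m)) \<longlonglongrightarrow> 0" and "(\<lambda>m. t_end d / real (K m)) \<longlonglongrightarrow> 0"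
    and "\<And>m. scheme_solution d (M m) (K m) (u m) (\<Psi> m)"
    and "\<And>m. bounded_unknowns d (M m) (K m) (u m)"
  shows "\<exists>U \<Phi> r. (\<forall>s. L2H1 (t_end d) (U s)) \<and> L2H1 (t_end d) \<Phi> \<and> strict_mono (r :: nat \<Rightarrow> nat) \<and>
    (\<forall>s. tendsto_L2 (t_end d) (\<lambda>m. approx (t_end d) (M (r m)) (K (r m)) (u (r m) s)) (U s)) \<and>
    tendsto_L2 (t_end d) (\<lambda>m. approx (t_end d) (M (r m)) (K (r m)) (\<Psi> (r m))) \<Phi> \<and>
    weak_solution d U \<Phi>"
proof -
  interpret corrosion_setting d using assms by unfold_locales
  interpret s: corrosion_scheme d "M m" "K m" "u m" "\<Psi> m" for m
    using assms by unfold_locales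
  define \<delta> where "\<delta> m = Cdel * (mesh_size (M m) + s.dt m)" for m
  have "\<delta> \<longlonglongrightarrow> Cdel * (0 + 0)" unfolding \<delta>_def s.dt_def
    by (intro tendsto_intros assms)
  then have "\<delta> \<longlonglongrightarrow> 0" by simp
  \<comment> \<open>The cost depends on its first argument only, so \<open>fast_subsequence\<close>
    merely accelerates a null sequence here.\<close>
  have "\<exists>r. strict_mono r \<and> (\<forall>j. \<forall>m\<ge>r j. \<forall>n\<ge>r j. \<delta> m \<le> (1/4)^j)"
  proof (rule fast_subsequence)
    fix e :: real assume "0 < e"
    then have "\<forall>\<^sub>F m in sequentially. \<delta> m < e" using \<open>\<delta> \<longlonglongrightarrow> 0\<close> by (rule order_tendstoD(2)[rotated])
    then show "\<exists>N. \<forall>m\<ge>N. \<forall>n\<ge>N. \<delta> m \<le> e" unfolding eventually_sequentially by (auto intro: less_imp_le)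
  qed
  then obtain r0 where r0: "strict_mono r0" "\<And>m. \<delta> (r0 m) \<le> (1/4)^m" by auto
  have "approximating_sequence d Ctot (\<lambda>m. \<delta> (r0 m)) (\<lambda>m. s.uh (r0 m)) (\<lambda>m. s.gh (r0 m)) (\<lambda>m. s.ub (r0 m))
    (\<lambda>m. s.Ph (r0 m)) (\<lambda>m. s.Qh (r0 m)) (\<lambda>m. s.Pb (r0 m)) (\<lambda>m t. dPsi (M (r0 m)) (\<Psi> (r0 m)) (s.lvl (r0 m) t) 0)
    (\<lambda>m t. dPsi (M (r0 m)) (\<Psi> (r0 m)) (s.lvl (r0 m) t) (n_cells (M (r0 m))))"
  proof (intro approximating_sequence.intro approximating_sequence_axioms.intro corrosion_setting_axioms)
    fix m
    show "approximate_solution d Ctot (\<delta> (r0 m)) (s.uh (r0 m)) (s.gh (r0 m)) (s.ub (r0 m)) (s.Ph (r0 m)) (s.Qh (r0 m)) (s.Pb (r0 m))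
      (\<lambda>t. dPsi (M (r0 m)) (\<Psi> (r0 m)) (s.lvl (r0 m) t) 0) (\<lambda>t. dPsi (M (r0 m)) (\<Psi> (r0 m)) (s.lvl (r0 m) t) (n_cells (M (r0 m))))"
      unfolding \<delta>_def by (rule s.scheme_approximate_solution)
    have "(1/4::real)^m \<le> (1/2)^m" by (intro power_mono) auto
    then show "\<delta> (r0 m) \<le> (1/2)^m" using r0(2)[of m] by simp
  qed
  note S0 = this
  \<comment> \<open>Three nested extractions: fast decay of the errors, uniform convergence of the
    primitives, pointwise convergence of the affine reconstructions. Each earlier property is
    inherited by the later subsequences.\<close>
  obtain r1 where r1: "strict_mono r1" "prim_Cauchy T (\<lambda>m. s.ub (r0 (r1 m)))"
    using approximating_sequence.prim_Cauchy_subsequence[OF S0] by (elim exE conjE) (rule that)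
  note S1 = approximating_sequence.subsequence[OF S0 r1(1)]
  obtain r2 where r2: "strict_mono r2" "AE t in lm T. \<forall>s. \<forall>x\<in>{0..1}. convergent (\<lambda>j. s.uh (r0 (r1 (r2 j))) s (x, t))"
    using approximating_sequence.pointwise_subsequence[OF S1 r1(2)] by (elim exE conjE) (rule that)
  note S2 = approximating_sequence.subsequence[OF S1 r2(1)]
  define r where "r m = r0 (r1 (r2 m))" for m
  have r: "strict_mono r" using r0(1) r1(1) r2(1) unfolding r_def strict_mono_def by simp
  interpret L: convergent_sequence d Ctot "\<lambda>m. \<delta> (r m)" "\<lambda>m. s.uh (r m)" "\<lambda>m. s.gh (r m)" "\<lambda>m. s.ub (r m)"
    "\<lambda>m. s.Ph (r m)" "\<lambda>m. s.Qh (r m)" "\<lambda>m. s.Pb (r m)" "\<lambda>m t. dPsi (M (r m)) (\<Psi> (r m)) (s.lvl (r m) t) 0"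
    "\<lambda>m t. dPsi (M (r m)) (\<Psi> (r m)) (s.lvl (r m) t) (n_cells (M (r m)))"
    unfolding r_def using S2 prim_Cauchy_subseq[OF r1(2) r2(1)] r2(2)
    by (intro convergent_sequence.intro convergent_sequence_axioms.intro)
  \<comment> \<open>\<open>approx\<close> is 0 outside its time interval, so the identification is
    made on the cylinder, which is all that \<open>mq T\<close> sees.\<close>
  have a: "AE z in mq T. approx T (M m) (K m) (u m s) z = s.ub m s z"
    "AE z in mq T. approx T (M m) (K m) (\<Psi> m) z = s.Pb m z" for m s
    unfolding AE_mq by (auto simp: QT_def s.approx_eq s.ub_def s.Pb_def intro!: AE_I2)
  show ?thesis
    using L.limit_L2H1 by (intro exI[of _ L.U] exI[of _ L.\<Phi>] exI[of _ r] conjI allI r L.limit_ub L.limit_Pb a L.limit_weak_solution)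
      (auto simp: L2H1_def)
qed

end
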